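(* Let $\mu$ be a real number with $\mu>\frac{1}{|D|}$, and let $$\mathcal{N}^\mu=\{\omega\in L^\infty(D)\mid \omega=\mu I_A,\ A\text{ a measurable set in } D,\ \mu|A|=1\}.$$ Then there exist $\omega^\mu\in\mathcal{N}^\mu$ and $x^\mu\in D$ such that $(\omega^\mu,x^\mu)$ is a weak solution to the stationary vortex-wave system, i.e. $$\int_D\omega^\mu\, J\nabla\big(G*\omega^\mu+G(x^\mu,\cdot)\big)\cdot\nabla\phi\,dy=0\quad\text{for all }\phi\in C_c^\infty(D),\qquad \nabla (G*\omega^\mu)(x^\mu)-\nabla H(x^\mu)=0.$$ Moreover, $\omega^\mu$ has the form $$\omega^\mu=\mu I_{\{G*\omega^\mu+G(x^\mu,\cdot)>b^\mu\}}$$ for some $b^\mu>0$.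
   Context: $D\subset\mathbb{R}^2$ is a bounded, simply-connected domain with smooth boundary. $|A|$ is two-dimensional Lebesgue measure, $I_A$ the characteristic function of $A$, and $J(a,b)=(b,-a)$. $G$ is the Green's function of $-\Delta$ in $D$ with zero Dirichlet boundary condition, written $G(x,y)=\frac{1}{2\pi}\ln\frac{1}{|x-y|}-h(x,y)$, where $h$ is its regular part. The Kirchhoff-Routh function is $H(x)=\frac12 h(x,x)$, $x\in D$. For $\omega\in L^\infty(D)$, $G*\omega(x)=\int_D G(x,y)\omega(y)\,dy$. Elements of $L^\infty(D)$ are identified when equal a.e. *)

theory Defs
  imports "HOL-Analysis.Analysis"
begin

section \<open>Classical smoothness, gradient, Laplacian\<close>

definition partial :: "'a::euclidean_space \<Rightarrow> ('a \<Rightarrow> real) \<Rightarrow> 'a \<Rightarrow> real" where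
  "partial i f x = frechet_derivative f (at x) i"

text \<open>Intended for open \<open>S\<close>; the derivatives are taken in the full neighbourhood of a point.\<close>

fun Ck_on :: "nat \<Rightarrow> 'a::euclidean_space set \<Rightarrow> ('a \<Rightarrow> real) \<Rightarrow> bool" where
  "Ck_on 0 S f \<longleftrightarrow> continuous_on S f"
| "Ck_on (Suc k) S f \<longleftrightarrow>
     (\<forall>x\<in>S. f differentiable (at x)) \<and> (\<forall>i\<in>Basis. Ck_on k S (partial i f))"

definition smooth_on :: "'a::euclidean_space set \<Rightarrow> ('a \<Rightarrow> real) \<Rightarrow> bool" where
  "smooth_on S f \<longleftrightarrow> (\<forall>k. Ck_on k S f)"

text \<open>Meaningful only where \<open>f\<close> is differentiable.\<close>

definition grad :: "('a::euclidean_space \<Rightarrow> real) \<Rightarrow> 'a \<Rightarrow> 'a" where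
  "grad f x = (THE g. GDERIV f x :> g)"

definition laplacian :: "('a::euclidean_space \<Rightarrow> real) \<Rightarrow> 'a \<Rightarrow> real" where
  "laplacian f x = (\<Sum>i\<in>Basis. partial i (partial i f) x)"

definition harmonic_on :: "'a::euclidean_space set \<Rightarrow> ('a \<Rightarrow> real) \<Rightarrow> bool" where
  "harmonic_on S f \<longleftrightarrow> Ck_on 2 S f \<and> (\<forall>x\<in>S. laplacian f x = 0)"

definition test_function_on :: "'a::euclidean_space set \<Rightarrow> ('a \<Rightarrow> real) \<Rightarrow> bool" where
  "test_function_on D \<phi> \<longleftrightarrow>
     smooth_on UNIV \<phi> \<and> compact (closure {x. \<phi> x \<noteq> 0}) \<and> closure {x. \<phi> x \<noteq> 0} \<subseteq> D"

section \<open>Domains\<close>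

text \<open>Near each boundary point, the domain is a sublevel set of a smooth function
  without critical points, so it lies locally on one side of its boundary.\<close>

definition smooth_boundary :: "'a::euclidean_space set \<Rightarrow> bool" where
  "smooth_boundary D \<longleftrightarrow>
     (\<forall>p\<in>frontier D. \<exists>U \<psi>. open U \<and> p \<in> U \<and> smooth_on U \<psi> \<and>
        (\<forall>x\<in>U. grad \<psi> x \<noteq> 0) \<and> D \<inter> U = {x\<in>U. \<psi> x < 0})"

definition smooth_simply_connected_domain :: "(real^2) set \<Rightarrow> bool" where
  "smooth_simply_connected_domain D \<longleftrightarrow>
     open D \<and> connected D \<and> D \<noteq> {} \<and> bounded D \<and> simply_connected D \<and> smooth_boundary D"

section \<open>Green's function, its regular part, and the Kirchhoff-Routh function\<close>

text \<open>\<open>G\<close> is the Green's function of the negative Laplacian in \<open>D\<close> with zero Dirichlet data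
  and \<open>h\<close> is its regular part. Harmonicity of \<open>h x\<close> in all of \<open>D\<close>, including at the
  pole \<open>x\<close>, expresses that the negative Laplacian of \<open>G x\<close> is the Dirac mass at \<open>x\<close>, and
  it determines \<open>h x x\<close>. The values \<open>G x x\<close> and the values outside \<open>D\<close> are left
  unconstrained and play no role.\<close>

definition greens_function ::
  "(real^2) set \<Rightarrow> (real^2 \<Rightarrow> real^2 \<Rightarrow> real) \<Rightarrow> (real^2 \<Rightarrow> real^2 \<Rightarrow> real) \<Rightarrow> bool" where
  "greens_function D G h \<longleftrightarrow>
     (\<forall>x\<in>D.
        (\<forall>y\<in>D - {x}. G x y = 1 / (2 * pi) * ln (1 / norm (x - y)) - h x y) \<and>
        harmonic_on D (h x) \<and>
        (\<forall>z\<in>frontier D. (G x \<longlongrightarrow> 0) (at z within D)))"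

definition kirchhoff_routh :: "(real^2 \<Rightarrow> real^2 \<Rightarrow> real) \<Rightarrow> real^2 \<Rightarrow> real" where
  "kirchhoff_routh h x = 1 / 2 * h x x"

definition green_potential ::
  "(real^2) set \<Rightarrow> (real^2 \<Rightarrow> real^2 \<Rightarrow> real) \<Rightarrow> (real^2 \<Rightarrow> real) \<Rightarrow> real^2 \<Rightarrow> real" where
  "green_potential D G \<omega> x = (LINT y:D|lebesgue. G x y * \<omega> y)"

definition stream ::
  "(real^2) set \<Rightarrow> (real^2 \<Rightarrow> real^2 \<Rightarrow> real) \<Rightarrow> (real^2 \<Rightarrow> real) \<Rightarrow> real^2 \<Rightarrow> real^2 \<Rightarrow> real" where
  "stream D G \<omega> x y = green_potential D G \<omega> y + G x y"

section \<open>Vorticity classes and the stationary vortex-wave system\<close>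

text \<open>Elements of \<open>L\<^sup>\<infinity>(D)\<close> are represented by functions; equality in \<open>L\<^sup>\<infinity>(D)\<close> is
  equality almost everywhere in \<open>D\<close>.\<close>

definition Linfty :: "(real^2) set \<Rightarrow> (real^2 \<Rightarrow> real) set" where
  "Linfty D = {\<omega>. \<omega> \<in> borel_measurable (lebesgue_on D) \<and>
                   (\<exists>C. AE y in lebesgue_on D. \<bar>\<omega> y\<bar> \<le> C)}"

definition vortex_patches :: "(real^2) set \<Rightarrow> real \<Rightarrow> (real^2 \<Rightarrow> real) set" where
  "vortex_patches D \<mu> =
     {\<omega>\<in>Linfty D. \<exists>A. A \<in> sets lebesgue \<and> A \<subseteq> D \<and>
        (AE y in lebesgue_on D. \<omega> y = \<mu> * indicator A y) \<and> \<mu> * measure lebesgue A = 1}"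

definition rotJ :: "real^2 \<Rightarrow> real^2" where
  "rotJ v = vector [v $ 2, - (v $ 1)]"

text \<open>Since \<open>grad\<close> and the Lebesgue integral are total functions, the differentiability and
  integrability that the two equations presuppose are stated explicitly. The stream function
  is singular at \<open>x\<close>, which is a null set for the integral.\<close>

definition weak_vortex_wave_solution ::
  "(real^2) set \<Rightarrow> (real^2 \<Rightarrow> real^2 \<Rightarrow> real) \<Rightarrow> (real^2 \<Rightarrow> real^2 \<Rightarrow> real) \<Rightarrow>
   (real^2 \<Rightarrow> real) \<Rightarrow> real^2 \<Rightarrow> bool" where
  "weak_vortex_wave_solution D G h \<omega> x \<longleftrightarrow>
     (\<forall>y\<in>D - {x}. stream D G \<omega> x differentiable (at y)) \<and>
     (\<forall>\<phi>. test_function_on D \<phi> \<longrightarrow>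
        set_integrable lebesgue D
          (\<lambda>y. \<omega> y * (rotJ (grad (stream D G \<omega> x) y) \<bullet> grad \<phi> y)) \<and>
        (LINT y:D|lebesgue. \<omega> y * (rotJ (grad (stream D G \<omega> x) y) \<bullet> grad \<phi> y)) = 0) \<and>
     green_potential D G \<omega> differentiable (at x) \<and>
     kirchhoff_routh h differentiable (at x) \<and>
     grad (green_potential D G \<omega>) x - grad (kirchhoff_routh h) x = 0"

end

theory Submission
  imports Defs "HOL-Complex_Analysis.Complex_Analysis"
begin

text \<open>A solution is found by maximising
  \<open>E(\<omega>, x) = 1/2 \<integral> \<omega> (G * \<omega>) + (G * \<omega>)(x) - H(x)\<close>
over \<open>x \<in> D\<close> and over the convex class of densities \<open>0 \<le> \<omega> \<le> \<mu>\<close> with \<open>\<integral> \<omega> = 1\<close>,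
which contains the patches and is closed under the limits that occur.

Green's function. \<open>D\<close> is simply connected, so it has a Riemann map \<open>f\<close> onto the disc, and the weak
maximum principle identifies \<open>h(x, y)\<close> with \<open>1/(2 pi) ln |g\<^sub>x(y)|\<close> for the nonvanishing holomorphic
function \<open>g\<^sub>x(y) = (f(y) - f(x)) / ((y - x) (1 - cnj (f x) f(y)))\<close> (\<open>h_eq_disc_regular\<close>). The symmetry
of \<open>G\<close>, its positivity and the differentiability of \<open>H\<close> can be read off this formula, and Cauchy's
inequality makes all estimates on \<open>h(\<cdot>, y)\<close> uniform in \<open>y\<close> (\<open>h_local_holomorphic\<close>). A comparison
function built from a square root of \<open>z - p\<close> shows \<open>H(x) \<rightarrow> \<infinity>\<close> as \<open>x\<close> tends to a boundary point \<open>p\<close>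
(\<open>h_diag_blowup\<close>).

Existence of a maximiser (\<open>maximizer_exists\<close>). The blow-up of \<open>H\<close> keeps the points of a maximising
sequence away from the boundary. Potentials of admissible densities are locally Lipschitz with uniform
constants, so a subsequence of them converges pointwise; averages of the densities with almost minimal
\<open>L\<^sup>2\<close> norm converge by the parallelogram law, and the limit density has the limit potential
(\<open>admissible_compact\<close>). This replaces weak compactness.

The form of the maximiser (\<open>optimal_patch\<close>). Linearising \<open>E\<close> in \<open>\<omega>\<close> shows that \<open>\<omega>\<close> maximises
\<open>v \<mapsto> \<integral> v \<psi>\<close> where \<open>\<psi> = G * \<omega> + G(x, \<cdot>)\<close>, hence \<open>\<omega> = \<mu>\<close> where \<open>\<psi> > b\<close> and \<open>\<omega> = 0\<close> where \<open>\<psi> < b\<close>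
for some level \<open>b\<close> (\<open>bathtub\<close>). It remains to see that \<open>\<omega> = 0\<close> almost everywhere on the level set
\<open>{\<psi> = b}\<close>. Instead of second derivatives of \<open>\<psi>\<close>, the five-point discrete Laplacian is used. On a
logarithmic potential it acts as convolution with rescalings of the integrable kernel
\<open>ln |1 - y\<^sup>-\<^sup>4|\<close>, whose integral is positive, so it converges in \<open>L\<^sup>1\<close> to a positive multiple of the
density. On the other hand almost every point of the level set has, along a sequence of step
sizes, all its stencil neighbours in the level set, where the discrete Laplacian of the constant \<open>b\<close>
vanishes (\<open>density_zero_on_level_set\<close>). Finally \<open>b > 0\<close>, because \<open>\<psi> > 0\<close> and \<open>\<mu> |D| > 1\<close>.

The equations. Maximality in \<open>x\<close> gives \<open>\<nabla>(G * \<omega>)(x) = \<nabla>H(x)\<close>. Since \<open>\<omega>\<close> is a function of \<open>\<psi>\<close>, the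
field \<open>\<omega> J\<nabla>\<psi>\<close> is formally \<open>J\<nabla>(F(\<psi>))\<close> and so divergence free. This is made rigorous with functions
\<open>F\<close> that are constant for large arguments, which removes the singularity at \<open>x\<close>, and whose derivatives
converge pointwise to the indicator of \<open>(b, \<infinity>)\<close> (\<open>plateau_integral_zero\<close>, \<open>weak_equation\<close>).\<close>

section \<open>Integration in the plane\<close>

lemma cball_measurable [measurable]: "cball (c::'a::euclidean_space) R \<in> sets borel"
  by simp

lemma ball_measurable [measurable]: "ball (c::'a::euclidean_space) R \<in> sets borel"
  by simp

text \<open>The change of variables for a linear isometry follows from the invariance of the measure of boxes,
since Lebesgue-Borel measure is determined by its values there.\<close>

lemma distr_lborel_orthogonal:
  fixes T :: "real^2 \<Rightarrow> real^2"
  assumes "orthogonal_transformation T"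
  shows "distr lborel borel T = lborel"
proof -
  have lin: "linear T" using assms by (rule orthogonal_transformation_linear)
  have cont: "continuous_on UNIV T" using lin linear_continuous_on linear_conv_bounded_linear by blast
  have m [measurable]: "T \<in> borel_measurable borel" using cont by (rule borel_measurable_continuous_onI)
  have bij: "bij T" using assms by (rule orthogonal_transformation_bij)
  have inv: "orthogonal_transformation (inv T)" using assms by (rule orthogonal_transformation_inv)
  show ?thesis
  proof (rule lborel_eqI[symmetric])
    fix l u :: "real^2"
    assume le: "\<And>b. b \<in> Basis \<Longrightarrow> l \<bullet> b \<le> u \<bullet> b"
    have img: "T -` box l u = inv T ` box l u" by (rule bij_vimage_eq_inv_image[OF bij])
    have box: "T -` box l u \<in> sets borel"
      using measurable_sets[OF m, of "box l u"] by simp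
    have "box l u \<in> lmeasurable" by simp
    then have lm: "T -` box l u \<in> lmeasurable" and ms: "measure lebesgue (T -` box l u) = measure lebesgue (box l u)"
      unfolding img using measurable_orthogonal_image[OF inv] measure_orthogonal_image[OF inv] by auto
    have "emeasure (distr lborel borel T) (box l u) = emeasure lborel (T -` box l u)"
      by (subst emeasure_distr) auto
    also have "\<dots> = emeasure lebesgue (T -` box l u)" using box by simp
    also have "\<dots> = ennreal (measure lebesgue (box l u))"
      using lm ms by (simp add: emeasure_eq_measure2)
    also have "measure lebesgue (box l u) = (\<Prod>b\<in>Basis. (u - l) \<bullet> b)"
      using le by simp
    finally show "emeasure (distr lborel borel T) (box l u) = ennreal (\<Prod>b\<in>Basis. (u - l) \<bullet> b)" .
  qed simp
qed

lemma
  fixes f :: "'a::euclidean_space \<Rightarrow> 'b::{banach,second_countable_topology}"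
  assumes c: "c \<noteq> 0"
  shows integral_lborel_affine: "(LINT y|lborel. f y) = \<bar>c\<bar>^DIM('a) *\<^sub>R (LINT y|lborel. f (t + c *\<^sub>R y))"
    and integrable_lborel_affine_iff: "integrable lborel (\<lambda>y. f (t + c *\<^sub>R y)) \<longleftrightarrow> integrable lborel f"
proof -
  have imp: "integrable lborel (\<lambda>y. f (t + c *\<^sub>R y))" if "integrable lborel f" "c \<noteq> 0" for f :: "'a \<Rightarrow> 'b" and c t
  proof -
    have f [measurable]: "f \<in> borel_measurable borel" using that by auto
    have "integrable (density (distr lborel borel (\<lambda>x. t + c *\<^sub>R x)) (\<lambda>_. \<bar>c\<bar>^DIM('a))) f"
      using that lborel_affine[of c t] by simp
    then have "integrable (distr lborel borel (\<lambda>x. t + c *\<^sub>R x)) (\<lambda>x. \<bar>c\<bar>^DIM('a) *\<^sub>R f x)"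
      by (subst (asm) integrable_density) auto
    then have "integrable lborel (\<lambda>x. \<bar>c\<bar>^DIM('a) *\<^sub>R f (t + c *\<^sub>R x))"
      by (subst (asm) integrable_distr_eq) auto
    from integrable_scaleR_right[OF this, of "inverse (\<bar>c\<bar>^DIM('a))"] that(2) show ?thesis by simp
  qed
  show *: "integrable lborel (\<lambda>y. f (t + c *\<^sub>R y)) \<longleftrightarrow> integrable lborel f" (is "?L \<longleftrightarrow> ?R")
  proof
    assume ?L
    from imp[OF this, of "1/c" "- (1/c) *\<^sub>R t"] c
    show ?R by (simp add: algebra_simps)
  qed (use imp c in auto)
  show "(LINT y|lborel. f y) = \<bar>c\<bar>^DIM('a) *\<^sub>R (LINT y|lborel. f (t + c *\<^sub>R y))"
  proof (cases "integrable lborel f")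
    case True
    have f [measurable]: "f \<in> borel_measurable borel" using True by auto
    have "(LINT y|lborel. f y) = (LINT y|density (distr lborel borel (\<lambda>x. t + c *\<^sub>R x)) (\<lambda>_. \<bar>c\<bar>^DIM('a)). f y)"
      using lborel_affine[OF c, of t] by simp
    also have "\<dots> = (LINT y|distr lborel borel (\<lambda>x. t + c *\<^sub>R x). \<bar>c\<bar>^DIM('a) *\<^sub>R f y)"
      by (subst integral_density) auto
    also have "\<dots> = (LINT y|lborel. \<bar>c\<bar>^DIM('a) *\<^sub>R f (t + c *\<^sub>R y))"
      by (subst integral_distr) auto
    finally show ?thesis by simp
  next
    case False
    then show ?thesis using * by (simp add: not_integrable_integral_eq)
  qed
qed

lemma
  fixes f :: "'a::euclidean_space \<Rightarrow> 'b::{banach,second_countable_topology}"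
  shows integral_shift: "(LINT y|lborel. f (y + w)) = (LINT y|lborel. f y)"
    and integrable_shift_iff: "integrable lborel (\<lambda>y. f (y + w)) \<longleftrightarrow> integrable lborel f"
  using integral_lborel_affine[of 1 f w] integrable_lborel_affine_iff[of 1 f w] by (simp_all add: add.commute)

lemma
  fixes f :: "'a::euclidean_space \<Rightarrow> 'b::{banach,second_countable_topology}"
  shows integrable_reflect_iff: "integrable lborel (\<lambda>y. f (z - y)) \<longleftrightarrow> integrable lborel f"
    and integral_reflect: "(LINT y|lborel. f (z - y)) = (LINT y|lborel. f y)"
  using integrable_lborel_affine_iff[of "-1" f z] integral_lborel_affine[of "-1" f z] by simp_all

lemma dyadic_bracket:
  fixes t :: real
  assumes "0 < t" "t \<le> 1"
  obtains k where "(1/2)^(Suc k) < t" "t \<le> (1/2)^k"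
proof -
  obtain n where n: "(1/2)^n < t" using real_arch_pow_inv[OF assms(1), of "1/2"] by auto
  define m where "m = (LEAST n. (1/2::real)^n < t)"
  have m: "(1/2)^m < t" unfolding m_def by (rule LeastI[of "\<lambda>n. (1/2::real)^n < t", OF n])
  have "m \<noteq> 0" using m assms by (intro notI) auto
  then obtain k where k: "m = Suc k" by (cases m) auto
  have "\<not> (1/2)^k < t" using not_less_Least[of k "\<lambda>n. (1/2::real)^n < t"] k m_def by simp
  with m k show ?thesis by (intro that[of k]) auto
qed

text \<open>Dominating \<open>f\<close> by a sum of constants on concentric discs yields integrability of radial singularities
and of radial decay without polar coordinates.\<close>

lemma integrable_shells:
  fixes f :: "real^2 \<Rightarrow> real"
  assumes [measurable]: "f \<in> borel_measurable borel"
    and bd: "\<And>y. f y \<noteq> 0 \<Longrightarrow> \<exists>k. norm y \<le> r k \<and> \<bar>f y\<bar> \<le> a k"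
    and r: "\<And>k. r k \<ge> 0" and a: "\<And>k. a k \<ge> 0" and s: "summable (\<lambda>k. a k * (r k)\<^sup>2)"
  shows "integrable lborel f"
proof (rule integrableI_bounded)
  have "(\<integral>\<^sup>+ y. ennreal (norm (f y)) \<partial>lborel) \<le> (\<integral>\<^sup>+ y. (\<Sum>k. ennreal (a k) * indicator (cball (0::real^2) (r k)) y) \<partial>lborel)"
  proof (rule nn_integral_mono)
    fix y :: "real^2"
    show "ennreal (norm (f y)) \<le> (\<Sum>k. ennreal (a k) * indicator (cball 0 (r k)) y)"
    proof (cases "f y = 0")
      case False
    then obtain k where k: "norm y \<le> r k" "\<bar>f y\<bar> \<le> a k" using bd by blast
    have "ennreal (norm (f y)) \<le> ennreal (a k) * indicator (cball 0 (r k)) y" using k by (simp add: ennreal_leI)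
    also have "\<dots> \<le> (\<Sum>k. ennreal (a k) * indicator (cball 0 (r k)) y)"
      using sum_le_suminf[of "\<lambda>k. ennreal (a k) * indicator (cball 0 (r k)) y" "{k}"]
      by (simp del: sum_mult_indicator)
    finally show ?thesis .
    qed simp
  qed
  also have "\<dots> = (\<Sum>k. (\<integral>\<^sup>+ y. ennreal (a k) * indicator (cball (0::real^2) (r k)) y \<partial>lborel))"
    by (rule nn_integral_suminf) measurable
  also have "\<dots> = (\<Sum>k. ennreal (pi * (a k * (r k)\<^sup>2)))"
  proof (rule suminf_cong)
    fix k
    have "(\<integral>\<^sup>+ y. ennreal (a k) * indicator (cball (0::real^2) (r k)) y \<partial>lborel) = ennreal (a k) * emeasure lborel (cball (0::real^2) (r k))"
      by (rule nn_integral_cmult_indicator) auto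
    also have "emeasure lborel (cball (0::real^2) (r k)) = ennreal (pi * (r k)\<^sup>2)"
      using r[of k] by (simp add: emeasure_cball unit_ball_vol_2)
    finally show "(\<integral>\<^sup>+ y. ennreal (a k) * indicator (cball (0::real^2) (r k)) y \<partial>lborel) = ennreal (pi * (a k * (r k)\<^sup>2))"
      using a[of k] by (simp add: ennreal_mult'[symmetric] mult_ac)
  qed
  also have "\<dots> < \<infinity>"
    using a summable_mult[OF s, of pi] by (subst suminf_ennreal2) auto
  finally show "(\<integral>\<^sup>+ y. ennreal (norm (f y)) \<partial>lborel) < \<infinity>" .
qed simp

lemma integrable_inverse_norm_ball:
  fixes R :: real
  shows "integrable lborel (\<lambda>y::real^2. indicator (cball 0 R) y / norm y)"
proof (cases "R > 0")
  case R: True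
  show ?thesis
  proof (rule integrable_shells[where r="\<lambda>k. R * (1/2)^k" and a="\<lambda>k. 2^(Suc k) / R"])
    show "(\<lambda>y::real^2. indicator (cball 0 R) y / norm y) \<in> borel_measurable borel" by measurable
    show "summable (\<lambda>k. 2 ^ Suc k / R * (R * (1 / 2) ^ k)\<^sup>2)"
    proof -
      have "(\<lambda>k. 2 ^ Suc k / R * (R * (1 / 2) ^ k)\<^sup>2) = (\<lambda>k. 2 * R * (1/2)^k)"
        using R by (auto simp: fun_eq_iff power2_eq_square field_simps power_mult_distrib power_divide)
      then show ?thesis by (simp add: summable_geometric)
    qed
    fix y :: "real^2"
    assume "indicator (cball 0 R) y / norm y \<noteq> 0"
    then have y: "y \<in> cball 0 R" "y \<noteq> 0" by (auto simp: indicator_def split: if_splits)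
    then obtain k where k: "(1/2)^(Suc k) < norm y / R" "norm y / R \<le> (1/2)^k"
      using dyadic_bracket[of "norm y / R"] R by auto
    have "1 / norm y \<le> 2^(Suc k) / R"
      using k y R by (simp add: field_simps power_divide)
    then show "\<exists>k. norm y \<le> R * (1/2)^k \<and> \<bar>indicator (cball 0 R) y / norm y\<bar> \<le> 2^(Suc k) / R"
      using k y R by (intro exI[of _ k]) (auto simp: field_simps)
  qed (use R in simp_all)
next
  case False
  have "y = 0" if "norm y \<le> R" for y :: "real^2" using that norm_ge_zero[of y] False by (metis linorder_not_less norm_eq_zero order.trans order_antisym)
  then have "(\<lambda>y::real^2. indicator (cball 0 R) y / norm y) = (\<lambda>_. 0)"
    by (auto simp: fun_eq_iff indicator_def)
  then show ?thesis by simp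
qed


lemma integrable_inverse_norm_4:
  "integrable lborel (\<lambda>y::real^2. indicator (- ball 0 1) y / (norm y)^4)"
proof (rule integrable_shells[where r="\<lambda>k. 2^(Suc k)" and a="\<lambda>k. (1/2)^(4*k)"])
  have "(\<lambda>k. (1/2)^(4*k) * (2 ^ Suc k)\<^sup>2) = (\<lambda>k. 4 * (1/4::real)^k)"
  proof
    fix k :: nat
    have "(1/2::real)^(4*k) = (1/4)^k * (1/4)^k" by (simp add: power_mult power_mult_distrib[symmetric] power2_eq_square power4_eq_xxxx)
    moreover have "(2 ^ Suc k)\<^sup>2 = (4::real) * 4^k" by (simp add: power_mult_distrib power2_eq_square flip: power_mult_distrib)
    ultimately show "(1/2::real)^(4*k) * (2 ^ Suc k)\<^sup>2 = 4 * (1/4)^k" by (simp add: power_divide)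
  qed
  then show "summable (\<lambda>k. (1/2)^(4*k) * (2 ^ Suc k :: real)\<^sup>2)" by simp
  fix y :: "real^2"
  assume "indicator (- ball 0 1) y / (norm y)^4 \<noteq> 0"
  then have y: "norm y \<ge> 1" by (auto simp: indicator_def split: if_splits)
  have "norm y > 0" using y by linarith
  then have "0 < 1 / norm y" "1 / norm y \<le> 1" using y by (simp_all add: divide_le_eq)
  then obtain k where k: "(1/2)^(Suc k) < 1 / norm y" "1 / norm y \<le> (1/2)^k"
    by (rule dyadic_bracket)
  have "(1 / norm y)^4 \<le> ((1/2)^k)^4" using k y by (intro power_mono) auto
  then have "\<bar>indicator (- ball 0 1) y / (norm y)^4\<bar> \<le> (1/2)^(4*k)"
    using y by (simp add: power_one_over power_mult[symmetric] mult.commute)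
  then show "\<exists>k. norm y \<le> 2^(Suc k) \<and> \<bar>indicator (- ball 0 1) y / (norm y)^4\<bar> \<le> (1/2)^(4*k)"
  proof (intro exI[of _ k] conjI)
    show "norm y \<le> 2^(Suc k)" using k(1) \<open>norm y > 0\<close>
      by (simp add: power_one_over divide_less_eq less_divide_eq split: if_splits)
  qed
qed simp_all

lemma abs_ln_le: "t \<ge> 0 \<Longrightarrow> \<bar>ln t\<bar> \<le> t + 1 / (t::real)"
proof (cases "t = 0")
  case False
  assume "t \<ge> 0"
  then have t: "t > 0" using False by simp
  have "ln t \<le> t - 1" by (rule ln_le_minus_one[OF t])
  moreover have "ln (1/t) \<le> 1/t - 1" using t by (intro ln_le_minus_one) simp
  moreover have "1/t > 0" using t by simp
  moreover have "ln (1/t) = - ln t" using t by (simp add: ln_div)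
  ultimately show ?thesis using t by arith
qed simp

lemma integrable_indicator_bounded:
  fixes c :: "'a::euclidean_space" and K :: real
  shows "integrable lborel (\<lambda>y. indicator (cball c R) y * K)"
  by (intro integrable_mult_left) (auto intro!: integrable_real_indicator emeasure_bounded_finite)

lemma integrable_ln_norm_ball:
  "integrable lborel (\<lambda>y::real^2. indicator (cball 0 R) y * ln (norm y))"
proof (rule Bochner_Integration.integrable_bound)
  show "integrable lborel (\<lambda>y::real^2. indicator (cball 0 R) y * R + indicator (cball 0 R) y / norm y)"
    by (intro Bochner_Integration.integrable_add integrable_indicator_bounded integrable_inverse_norm_ball)
  show "AE y in lborel. norm (indicator (cball 0 R) y * ln (norm y)) \<le> norm (indicator (cball 0 R) y * R + indicator (cball 0 R) y / norm (y::real^2))"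
  proof (rule AE_I2)
    fix y :: "real^2"
    show "norm (indicator (cball 0 R) y * ln (norm y)) \<le> norm (indicator (cball 0 R) y * R + indicator (cball 0 R) y / norm y)"
      using abs_ln_le[of "norm y"] by (auto simp: indicator_def)
  qed
  show "(\<lambda>y::real^2. indicator (cball 0 R) y * ln (norm y)) \<in> borel_measurable lborel" by measurable
qed

text \<open>For the indicator of \<open>A\<close>, an open set \<open>U \<supseteq> A\<close> of almost the same measure contains \<open>y + v n\<close> eventually
for each \<open>y \<in> A\<close>, so little of \<open>A\<close> is moved out of \<open>A\<close>; as translation preserves measure, equally
little is moved in. The general case follows by the induction principle for integrable functions.\<close>

lemma L1_translation_continuous:
  fixes f :: "'a::euclidean_space \<Rightarrow> real"
  assumes "integrable lborel f" "v \<longlonglongrightarrow> 0"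
  shows "(\<lambda>n. LINT y|lborel. \<bar>f (y + v n) - f y\<bar>) \<longlonglongrightarrow> 0"
  using assms(1)
proof (induction rule: integrable_induct)
  note shift = integral_shift[where 'a='a and 'b=real] integrable_shift_iff[where 'a='a and 'b=real]
  {
    case (base A c)
    have A [measurable]: "A \<in> sets borel" and fin: "emeasure lborel A < \<infinity>" using base by auto
    have iA [intro, simp]: "integrable lborel (\<lambda>y. indicator A y :: real)" using A fin by auto
    have iB [simp]: "integrable lborel (\<lambda>y. indicator A (y + w) :: real)" for w using shift(2)[of "indicator A" w] by simp
    let ?b = "\<lambda>n. LINT y|lborel. indicator A y * (1 - indicator A (y + v n) :: real)"
    have b0: "?b \<longlonglongrightarrow> 0"
    proof (rule LIMSEQ_I)
      fix e :: real assume e: "e > 0"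
      obtain U where U: "open U" "A \<subseteq> U" "emeasure lborel (U - A) < ennreal (e/2)"
        using outer_regular_lborel[of A "e/2"] e by auto
      have [measurable]: "U \<in> sets borel" using U by auto
      have UA: "U - A \<in> sets lborel" "emeasure lborel (U - A) < \<infinity>" using U(3) by (auto intro: less_trans)
      have iUA: "integrable lborel (\<lambda>y. indicator (U - A) y :: real)" using UA by auto
      have mUA: "(LINT y|lborel. indicator (U - A) y :: real) < e/2"
        using U(3) UA e emeasure_eq_ennreal_measure[of lborel "U - A"] by (simp add: ennreal_less_iff less_top)
      have "(\<lambda>n. LINT y|lborel. indicator A y * (1 - indicator U (y + v n)) :: real) \<longlonglongrightarrow> integral\<^sup>L lborel (\<lambda>y::'a. 0::real)"
      proof (rule integral_dominated_convergence[where w="indicator A"])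
        show "AE y in lborel. (\<lambda>n. indicator A y * (1 - indicator U (y + v n)) :: real) \<longlonglongrightarrow> 0"
        proof (rule AE_I2)
          fix y :: 'a
          show "(\<lambda>n. indicator A y * (1 - indicator U (y + v n)) :: real) \<longlonglongrightarrow> 0"
          proof (cases "y \<in> A")
            case True
            have "(\<lambda>n. y + v n) \<longlonglongrightarrow> y" using tendsto_add[OF tendsto_const assms(2), of y] by simp
            then have "eventually (\<lambda>n. y + v n \<in> U) sequentially"
              using topological_tendstoD[OF _ U(1)] U(2) True by blast
            then have "\<forall>\<^sub>F n in sequentially. indicator A y * (1 - indicator U (y + v n)) = (0::real)"
              by (rule eventually_mono) simp
            then show ?thesis by (rule tendsto_eventually)
          qed simp
        qed
        show "AE y in lborel. norm (indicator A y * (1 - indicator U (y + v n)) :: real) \<le> indicator A y" for n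
          by (auto simp: indicator_def)
      qed auto
      then have "\<forall>\<^sub>F n in sequentially. (LINT y|lborel. indicator A y * (1 - indicator U (y + v n)) :: real) < e/2"
        using e by (intro order_tendstoD) auto
      moreover have "?b n \<ge> 0 \<and> ?b n \<le> (LINT y|lborel. indicator A y * (1 - indicator U (y + v n)) :: real) + (LINT y|lborel. indicator (U - A) y :: real)" for n
      proof -
        have 1: "integrable lborel (\<lambda>y. indicator A y * (1 - indicator U (y + v n)) :: real)"
          by (rule Bochner_Integration.integrable_bound[OF iA]) (auto simp: indicator_def)
        have 2: "integrable lborel (\<lambda>y. indicator (U - A) (y + v n) :: real)" using shift(2)[of "indicator (U-A)" "v n"] iUA by simp
        have 3: "integrable lborel (\<lambda>y. indicator A y * (1 - indicator A (y + v n)) :: real)"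
          by (rule Bochner_Integration.integrable_bound[OF iA]) (auto simp: indicator_def)
        have "?b n \<le> (LINT y|lborel. indicator A y * (1 - indicator U (y + v n)) + (indicator (U - A) (y + v n) :: real))"
          by (rule integral_mono[OF 3 Bochner_Integration.integrable_add[OF 1 2]]) (auto simp: indicator_def)
        also have "\<dots> = (LINT y|lborel. indicator A y * (1 - indicator U (y + v n)) :: real) + (LINT y|lborel. indicator (U - A) (y + v n) :: real)"
          by (rule Bochner_Integration.integral_add[OF 1 2])
        also have "(LINT y|lborel. indicator (U - A) (y + v n) :: real) = (LINT y|lborel. indicator (U - A) y)"
          using shift(1)[of "indicator (U-A)" "v n"] by simp
        finally show ?thesis by (auto intro!: Bochner_Integration.integral_nonneg simp: indicator_def)
      qed
      ultimately have "\<forall>\<^sub>F n in sequentially. norm (?b n - 0) < e"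
        using mUA by (auto elim!: eventually_mono) (smt (verit) field_sum_of_halves)
      then show "\<exists>no. \<forall>n\<ge>no. norm (?b n - 0) < e" by (simp only: eventually_sequentially)
    qed
    have "(LINT y|lborel. \<bar>indicator A (y + v n) *\<^sub>R c - indicator A y *\<^sub>R c\<bar>) = 2 * \<bar>c\<bar> * ?b n" for n
    proof -
      have 3: "integrable lborel (\<lambda>y. indicator A y * (1 - indicator A (y + v n)) :: real)"
          by (rule Bochner_Integration.integrable_bound[OF iA]) (auto simp: indicator_def)
      have "(LINT y|lborel. \<bar>indicator A (y + v n) *\<^sub>R c - indicator A y *\<^sub>R c\<bar>)
        = (LINT y|lborel. 2 * \<bar>c\<bar> * (indicator A y * (1 - indicator A (y + v n))) + \<bar>c\<bar> * (indicator A (y + v n) - indicator A y))"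
        by (intro Bochner_Integration.integral_cong) (auto simp: indicator_def)
      also have "\<dots> = 2 * \<bar>c\<bar> * ?b n + \<bar>c\<bar> * ((LINT y|lborel. indicator A (y + v n)) - (LINT y|lborel. indicator A y))"
        using 3 by (subst Bochner_Integration.integral_add) auto
      also have "(LINT y|lborel. indicator A (y + v n)) = (LINT y|lborel. indicator A y :: real)"
        using shift(1)[of "indicator A" "v n"] by simp
      finally show ?thesis by simp
    qed
    then show ?case using tendsto_mult_left[OF b0, of "2 * \<bar>c\<bar>"] by simp
  next
    case (add f g)
    have sf [simp]: "integrable lborel (\<lambda>y. f (y + w))" "integrable lborel (\<lambda>y. g (y + w))" for w using shift(2) add by auto
    note [simp] = add.hyps
    show ?case
    proof (rule tendsto_sandwich[OF _ _ tendsto_const])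
      show "(\<lambda>n. (LINT y|lborel. \<bar>f (y + v n) - f y\<bar>) + (LINT y|lborel. \<bar>g (y + v n) - g y\<bar>)) \<longlonglongrightarrow> 0"
        using tendsto_add[OF add.IH] by simp
      have "(LINT y|lborel. \<bar>f (y + v n) + g (y + v n) - (f y + g y)\<bar>) \<le> (LINT y|lborel. \<bar>f (y + v n) - f y\<bar>) + (LINT y|lborel. \<bar>g (y + v n) - g y\<bar>)" for n
      proof -
        have "(LINT y|lborel. \<bar>f (y + v n) + g (y + v n) - (f y + g y)\<bar>) \<le> (LINT y|lborel. \<bar>f (y + v n) - f y\<bar> + \<bar>g (y + v n) - g y\<bar>)"
          by (intro integral_mono) auto
        then show ?thesis by simp
      qed
      then show "\<forall>\<^sub>F n in sequentially. (LINT y|lborel. \<bar>f (y + v n) + g (y + v n) - (f y + g y)\<bar>) \<le> (LINT y|lborel. \<bar>f (y + v n) - f y\<bar>) + (LINT y|lborel. \<bar>g (y + v n) - g y\<bar>)"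
        by simp
    qed (auto intro!: Bochner_Integration.integral_nonneg)
  next
    case (lim f s)
    note [simp] = lim.hyps(1,4)
    have [measurable]: "f \<in> borel_measurable borel" "s i \<in> borel_measurable borel" for i
      using borel_measurable_integrable[OF lim.hyps(4)] borel_measurable_integrable[OF lim.hyps(1)] by simp_all
    have sf [simp]: "integrable lborel (\<lambda>y. f (y + w))" "integrable lborel (\<lambda>y. s i (y + w))" for w i using shift(2) lim by auto
    have c: "(\<lambda>i. LINT y|lborel. \<bar>f y - s i y\<bar>) \<longlonglongrightarrow> integral\<^sup>L lborel (\<lambda>y::'a. 0::real)"
    proof (rule integral_dominated_convergence[where w="\<lambda>y. 3 * \<bar>f y\<bar>"])
      show "AE y in lborel. (\<lambda>i. \<bar>f y - s i y\<bar>) \<longlonglongrightarrow> 0"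
      proof (rule AE_I2)
        fix y :: 'a
        have "(\<lambda>i. \<bar>f y - s i y\<bar>) \<longlonglongrightarrow> \<bar>f y - f y\<bar>" using lim.hyps(2)[of y] by (intro tendsto_intros) auto
        then show "(\<lambda>i. \<bar>f y - s i y\<bar>) \<longlonglongrightarrow> 0" by simp
      qed
      show "AE y in lborel. norm \<bar>f y - s i y\<bar> \<le> 3 * \<bar>f y\<bar>" for i
      proof (rule AE_I2)
        fix y :: 'a
        show "norm \<bar>f y - s i y\<bar> \<le> 3 * \<bar>f y\<bar>" using lim.hyps(3)[of y i] by auto
      qed
    qed auto
    show ?case
    proof (rule LIMSEQ_I)
      fix e :: real assume e: "e > 0"
      obtain i where i: "(LINT y|lborel. \<bar>f y - s i y\<bar>) < e/3"
        using order_tendstoD(2)[OF c, of "e/3"] e by (auto simp: eventually_sequentially)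
      have "\<forall>\<^sub>F n in sequentially. (LINT y|lborel. \<bar>s i (y + v n) - s i y\<bar>) < e/3"
        using order_tendstoD(2)[OF lim.IH, of "e/3"] e by auto
      moreover have "(LINT y|lborel. \<bar>f (y + v n) - f y\<bar>) \<le> 2 * (LINT y|lborel. \<bar>f y - s i y\<bar>) + (LINT y|lborel. \<bar>s i (y + v n) - s i y\<bar>)" for n
      proof -
        have "(LINT y|lborel. \<bar>f (y + v n) - f y\<bar>) \<le> (LINT y|lborel. (\<bar>f (y + v n) - s i (y + v n)\<bar> + \<bar>f y - s i y\<bar>) + \<bar>s i (y + v n) - s i y\<bar>)"
          by (intro integral_mono) auto
        also have "\<dots> = (LINT y|lborel. \<bar>f (y + v n) - s i (y + v n)\<bar>) + (LINT y|lborel. \<bar>f y - s i y\<bar>) + (LINT y|lborel. \<bar>s i (y + v n) - s i y\<bar>)"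
          by simp
        also have "(LINT y|lborel. \<bar>f (y + v n) - s i (y + v n)\<bar>) = (LINT y|lborel. \<bar>f y - s i y\<bar>)"
          using shift(1)[of "\<lambda>y. \<bar>f y - s i y\<bar>" "v n"] .
        finally show ?thesis by simp
      qed
      moreover have "0 \<le> (LINT y|lborel. \<bar>f (y + v n) - f y\<bar>)" for n by simp
      ultimately have "\<forall>\<^sub>F n in sequentially. norm ((LINT y|lborel. \<bar>f (y + v n) - f y\<bar>) - 0) < e"
        using i by (auto elim!: eventually_mono) (smt (verit) field_sum_of_halves)
      then show "\<exists>no. \<forall>n\<ge>no. norm ((LINT y|lborel. \<bar>f (y + v n) - f y\<bar>) - 0) < e" by (simp only: eventually_sequentially)
    qed
  }
qed

section \<open>The kernel of the five-point stencil\<close>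

definition cplx :: "real^2 \<Rightarrow> complex" where "cplx v = Complex (v $ 1) (v $ 2)"
definition plane :: "complex \<Rightarrow> real^2" where "plane z = vector [Re z, Im z]"

lemma cplx_plane [simp]: "cplx (plane z) = z" and plane_cplx [simp]: "plane (cplx v) = v"
  by (simp_all add: cplx_def plane_def complex_eq_iff vec_eq_iff forall_2)

lemma cplx_eq_iff [simp]: "cplx v = cplx w \<longleftrightarrow> v = w" by (metis plane_cplx)

lemma cplx_add: "cplx (v + w) = cplx v + cplx w" and cplx_diff: "cplx (v - w) = cplx v - cplx w"
  and cplx_scaleR: "cplx (t *\<^sub>R v) = t *\<^sub>R cplx v" and cplx_zero [simp]: "cplx 0 = 0"
  by (simp_all add: cplx_def complex_eq_iff)

lemma norm_cplx [simp]: "cmod (cplx v) = norm v"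
  by (simp add: cplx_def cmod_def norm_vec_def L2_set_def sum_2)

lemma norm_plane [simp]: "norm (plane z) = cmod z" by (metis cplx_plane norm_cplx)

lemma cplx_mem_ball [simp]: "cplx y \<in> ball (cplx x) r \<longleftrightarrow> y \<in> ball x r"
  using norm_cplx[of "x - y"] by (simp add: dist_norm cplx_diff del: norm_cplx)

lemma cplx_eq_0_iff [simp]: "cplx v = 0 \<longleftrightarrow> v = 0" using cplx_eq_iff[of v 0] by simp

lemma bounded_linear_cplx: "bounded_linear cplx"
  by (rule bounded_linear_intro[where K=1]) (auto simp: cplx_add cplx_scaleR)

lemma bounded_linear_plane: "bounded_linear plane"
proof (rule bounded_linear_intro[where K=1])
  show "plane (x + y) = plane x + plane y" for x y by (metis cplx_add cplx_plane plane_cplx)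
  show "plane (t *\<^sub>R x) = t *\<^sub>R plane x" for t x by (metis cplx_scaleR cplx_plane plane_cplx)
qed auto

lemma continuous_on_cplx [continuous_intros]: "continuous_on S g \<Longrightarrow> continuous_on S (\<lambda>x. cplx (g x))"
  using bounded_linear.continuous_on[OF bounded_linear_cplx] .

lemma continuous_on_plane [continuous_intros]: "continuous_on S g \<Longrightarrow> continuous_on S (\<lambda>x. plane (g x))"
  using bounded_linear.continuous_on[OF bounded_linear_plane] .

lemma cplx_measurable [measurable]: "cplx \<in> borel_measurable borel"
  by (intro borel_measurable_continuous_onI continuous_intros)

lemma plane_measurable [measurable]: "plane \<in> borel_measurable borel"
  by (intro borel_measurable_continuous_onI continuous_intros)

definition rotation :: "real \<Rightarrow> real^2 \<Rightarrow> real^2" where "rotation t v = plane (cis t * cplx v)"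

lemma cplx_rotation [simp]: "cplx (rotation t v) = cis t * cplx v" by (simp add: rotation_def)

lemma norm_rotation [simp]: "norm (rotation t v) = norm v" by (simp add: rotation_def norm_mult)

lemma orthogonal_rotation: "orthogonal_transformation (rotation t)"
proof -
  have "linear (rotation t)"
    unfolding rotation_def
    using bounded_linear.linear[OF bounded_linear_compose[OF bounded_linear_plane
      bounded_linear_compose[OF bounded_linear_mult_right bounded_linear_cplx]]] .
  then show ?thesis by (simp add: orthogonal_transformation)
qed

lemma abs_ln_norm_1_minus:
  assumes "cmod w \<le> \<rho>" "\<rho> < 1"
  shows "\<bar>ln (cmod (1 - w))\<bar> \<le> cmod w / (1 - \<rho>)"
proof -
  define t where "t = cmod (1 - w)"
  have t1: "t \<le> 1 + cmod w" unfolding t_def using norm_triangle_ineq4[of 1 w] by simp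
  have t2: "1 - cmod w \<le> t" unfolding t_def using norm_triangle_ineq2[of 1 w] by simp
  have t0: "t > 0" "t \<ge> 1 - \<rho>" using t2 assms by auto
  have "0 \<le> \<rho>" using assms(1) norm_ge_zero[of w] by linarith
  then have r: "cmod w \<le> cmod w / (1 - \<rho>)" using assms
    by (simp add: le_divide_eq algebra_simps)
  have "ln t \<le> cmod w / (1 - \<rho>)" using ln_le_minus_one[OF t0(1)] t1 r by linarith
  moreover have "- ln t \<le> cmod w / (1 - \<rho>)"
  proof -
    have "- ln t = ln (1 / t)" using t0 by (simp add: ln_div)
    also have "\<dots> \<le> 1 / t - 1" using t0 by (intro ln_le_minus_one) simp
    also have "\<dots> = (1 - t) / t" using t0 by (simp add: field_simps)
    also have "\<dots> \<le> cmod w / t" using t0 t2 by (intro divide_right_mono) auto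
    also have "\<dots> \<le> cmod w / (1 - \<rho>)" using t0 assms by (intro divide_left_mono) auto
    finally show ?thesis .
  qed
  ultimately show ?thesis unfolding t_def[symmetric] by linarith
qed

text \<open>This is the mean value property of \<open>ln |1 - w\<^sup>4|\<close> at \<open>w = 0\<close>, integrated over a rotation invariant
set. If \<open>a n\<close> is the integral with exponent \<open>n\<close>, rotating by an \<open>n\<close>-th root of \<open>-1\<close> and adding turns
\<open>(1 - w\<^sup>n) (1 + w\<^sup>n)\<close> into \<open>1 - w\<^sup>2\<^sup>n\<close>, so \<open>a (2 * n) = 2 * a n\<close>, while \<open>a n\<close> stays bounded. Both
\<open>u = y\<close> inside the unit disc and \<open>u = 1/y\<close> outside it are of interest.\<close>

lemma integral_ln_norm_1_minus_power_eq_0: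
  fixes u :: "real^2 \<Rightarrow> complex"
  assumes [measurable]: "u \<in> borel_measurable borel" "S \<in> sets borel"
    and rho: "\<And>y. y \<in> S \<Longrightarrow> cmod (u y) \<le> \<rho>" "\<rho> < 1"
    and int: "integrable lborel (\<lambda>y. indicator S y * cmod (u y)^4)"
    and S: "\<And>t y. rotation t y \<in> S \<longleftrightarrow> y \<in> S"
    and u: "\<And>n. n > 0 \<Longrightarrow> \<exists>t. \<forall>y. u (rotation t y)^n = - (u y^n)"
  shows "(LINT y|lborel. indicator S y * ln (cmod (1 - u y^4))) = 0"
proof -
  define a where "a n = (LINT y|lborel. indicator S y * ln (cmod (1 - u y^n)))" for n
  define B where "B = (LINT y|lborel. indicator S y * cmod (u y)^4)"
  have pt: "\<bar>indicator S y * ln (cmod (1 - u y^n))\<bar> \<le> 1 / (1 - \<rho>) * (indicator S y * cmod (u y)^4)" if "n \<ge> 4" for n y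
  proof (cases "y \<in> S")
    case True
    have r0: "0 \<le> \<rho>" using rho(1)[OF True] norm_ge_zero[of "u y"] by linarith
    have "cmod (u y^n) = cmod (u y)^n" by (simp add: norm_power)
    also have "\<dots> \<le> cmod (u y)^4" using that rho(1)[OF True] rho(2) by (intro power_decreasing) auto
    finally have 1: "cmod (u y^n) \<le> cmod (u y)^4" .
    have 2: "cmod (u y)^4 \<le> \<rho>" using power_decreasing[of 1 4 "cmod (u y)"] rho(1)[OF True] rho(2) by auto
    show ?thesis using abs_ln_norm_1_minus[of "u y^n" \<rho>] 1 2 rho(2) True divide_right_mono[OF 1, of "1 - \<rho>"] by auto
  qed simp
  have intn: "integrable lborel (\<lambda>y. indicator S y * ln (cmod (1 - u y^n)))" if "n \<ge> 4" for n
    by (rule Bochner_Integration.integrable_bound[OF integrable_mult_right[OF int, of "1 / (1 - \<rho>)"]])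
       (measurable, rule AE_I2, unfold real_norm_def, rule order_trans[OF pt[OF that] abs_ge_self])
  have bound: "\<bar>a n\<bar> \<le> 1 / (1 - \<rho>) * B" if "n \<ge> 4" for n
  proof -
    have "\<bar>a n\<bar> \<le> (LINT y|lborel. \<bar>indicator S y * ln (cmod (1 - u y^n))\<bar>)"
      unfolding a_def by (rule integral_abs_bound)
    also have "\<dots> \<le> (LINT y|lborel. 1 / (1 - \<rho>) * (indicator S y * cmod (u y)^4))"
      by (rule integral_mono) (use pt[OF that] int intn[OF that] in auto)
    also have "\<dots> = 1 / (1 - \<rho>) * B" unfolding B_def by simp
    finally show ?thesis .
  qed
  have double: "a (2 * n) = 2 * a n" if n: "n \<ge> 4" for n
  proof -
    obtain t where t: "\<And>y. u (rotation t y)^n = - (u y^n)" using u[of n] n by auto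
    have rm [measurable]: "rotation t \<in> borel_measurable borel" unfolding rotation_def by measurable
    have eq: "distr lborel borel (rotation t) = lborel" by (rule distr_lborel_orthogonal[OF orthogonal_rotation])
    have 1: "(LINT y|lborel. indicator S y * ln (cmod (1 + u y^n))) = a n"
    proof -
      have "a n = (LINT y|distr lborel borel (rotation t). indicator S y * ln (cmod (1 - u y^n)))" unfolding a_def eq ..
      also have "\<dots> = (LINT y|lborel. indicator S (rotation t y) * ln (cmod (1 - u (rotation t y)^n)))"
        by (rule integral_distr) measurable
      also have "\<dots> = (LINT y|lborel. indicator S y * ln (cmod (1 + u y^n)))"
        using S by (auto simp: t indicator_def)
      finally show ?thesis by simp
    qed
    have 2: "integrable lborel (\<lambda>y. indicator S y * ln (cmod (1 + u y^n)))"
    proof -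
      have "integrable (distr lborel borel (rotation t)) (\<lambda>y. indicator S y * ln (cmod (1 - u y^n)))" unfolding eq by (rule intn[OF n])
      then have "integrable lborel (\<lambda>y. indicator S (rotation t y) * ln (cmod (1 - u (rotation t y)^n)))"
        by (subst (asm) integrable_distr_eq) measurable
      then show ?thesis using S by (simp add: t indicator_def)
    qed
    have "a (2 * n) = (LINT y|lborel. indicator S y * ln (cmod (1 - u y^n)) + indicator S y * ln (cmod (1 + u y^n)))"
      unfolding a_def
    proof (rule Bochner_Integration.integral_cong[OF refl])
      fix y
      show "indicator S y * ln (cmod (1 - u y^(2*n))) = indicator S y * ln (cmod (1 - u y^n)) + indicator S y * ln (cmod (1 + u y^n))"
      proof (cases "y \<in> S")
        case True
        have "cmod (u y)^n < 1" using rho(1)[OF True] rho(2) n by (intro power_less_one_iff[THEN iffD2]) auto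
        then have l: "cmod (u y^n) < 1" by (simp add: norm_power)
        then have "1 - u y^n \<noteq> 0" "1 + u y^n \<noteq> 0"
          by (auto simp: add_eq_0_iff)
        moreover have "1 - u y^(2*n) = (1 - u y^n) * (1 + u y^n)" by (simp add: algebra_simps power_mult power2_eq_square mult_2 power_add)
        ultimately show ?thesis using True by (simp add: norm_mult ln_mult)
      qed simp
    qed
    also have "\<dots> = a n + a n"
      using 1 by (subst Bochner_Integration.integral_add[OF intn[OF n] 2]) (simp add: a_def)
    finally show ?thesis by simp
  qed
  have pw: "a (4 * 2^k) = 2^k * a 4" for k
  proof (induction k)
    case (Suc k)
    have "a (4 * 2^Suc k) = a (2 * (4 * 2^k))" by (simp add: mult_ac)
    also have "\<dots> = 2 * a (4 * 2^k)" by (rule double) simp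
    finally show ?case using Suc by simp
  qed simp
  have "a 4 = 0"
  proof (rule ccontr)
    assume nz: "a 4 \<noteq> 0"
    obtain k where k: "(1 / (1 - \<rho>) * B) / \<bar>a 4\<bar> < 2^k" using real_arch_pow[of 2] by auto
    have "2^k * \<bar>a 4\<bar> \<le> 1 / (1 - \<rho>) * B" using bound[of "4 * 2^k"] pw[of k] by (simp add: abs_mult)
    moreover have "1 / (1 - \<rho>) * B < 2^k * \<bar>a 4\<bar>" 
    proof -
      have "\<bar>a 4\<bar> > 0" using nz by simp
      from k[unfolded pos_divide_less_eq[OF this]] show ?thesis .
    qed
    ultimately show False by linarith
  qed
  then show ?thesis unfolding a_def .
qed

text \<open>Up to a null set this is \<open>\<Sum>\<^sub>j ln |y - \<i>\<^sup>j| - 4 ln |y|\<close>, the discrete Laplacian of the logarithm with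
unit step, because \<open>y\<^sup>4 - 1\<close> has the roots \<open>\<i>\<^sup>j\<close>. The closed form shows the decay \<open>|y|\<^sup>-\<^sup>4\<close>.\<close>

definition stencil_kernel :: "real^2 \<Rightarrow> real" where "stencil_kernel y = ln (cmod (1 - inverse (cplx y)^4))"

lemma stencil_kernel_measurable [measurable]: "stencil_kernel \<in> borel_measurable borel"
  unfolding stencil_kernel_def by measurable

lemma AE_neq_point: "AE y in lborel. y \<noteq> (p::'a::euclidean_space)"
  by (rule AE_I'[of "{p}"]) auto

lemma stencil_kernel_eq_sum:
  assumes "y \<noteq> 0" "\<And>j. j < 4 \<Longrightarrow> y \<noteq> plane (\<i>^j)"
  shows "stencil_kernel y = (\<Sum>j<4. ln (norm (y - plane (\<i>^j)))) - 4 * ln (norm y)"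
proof -
  define z where "z = cplx y"
  have z0: "z \<noteq> 0" using assms by (simp add: z_def)
  have nz: "z - \<i>^j \<noteq> 0" if "j < 4" for j using assms(2)[OF that] unfolding z_def by (metis cplx_plane eq_iff_diff_eq_0 plane_cplx)
  have "1 - inverse z^4 = (z^4 - 1) / z^4" using z0 by (simp add: field_simps)
  also have "z^4 - 1 = (\<Prod>j<4. z - \<i>^j)"
    by (simp add: eval_nat_numeral lessThan_Suc algebra_simps)
  finally have "cmod (1 - inverse z^4) = (\<Prod>j<4. cmod (z - \<i>^j)) / cmod z^4"
    by (simp add: norm_divide norm_power prod_norm)
  moreover have "ln ((\<Prod>j<4. cmod (z - \<i>^j)) / cmod z^4) = (\<Sum>j<4. ln (cmod (z - \<i>^j))) - 4 * ln (cmod z)"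
  proof -
    have 1: "ln (\<Prod>j<4. cmod (z - \<i>^j)) = (\<Sum>j<4. ln (cmod (z - \<i>^j)))"
      using nz by (intro ln_prod) auto
    have 2: "(\<Prod>j<4. cmod (z - \<i>^j)) > 0" using nz by (intro prod_pos) auto
    have 3: "cmod z^4 > 0" using z0 by simp
    have lnd: "ln (P / Q) = ln P - ln Q" if "P > 0" "Q > 0" for P Q :: real using that by (simp add: ln_div)
    have "ln ((\<Prod>j<4. cmod (z - \<i>^j)) / cmod z^4) = ln (\<Prod>j<4. cmod (z - \<i>^j)) - ln (cmod z^4)"
      using lnd[OF 2 3] .
    also have "ln (cmod z^4) = 4 * ln (cmod z)" using z0 by (subst ln_realpow) auto
    finally show ?thesis unfolding 1 .
  qed
  moreover have "cmod (z - \<i>^j) = norm (y - plane (\<i>^j))" for j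
    unfolding z_def using norm_cplx[of "y - plane (\<i>^j)"] by (simp add: cplx_diff)
  ultimately show ?thesis by (simp add: stencil_kernel_def z_def)
qed

lemma AE_stencil_kernel_eq_sum:
  "AE y in lborel. stencil_kernel y = (\<Sum>j<4. ln (norm (y - plane (\<i>^j)))) - 4 * ln (norm y)"
proof -
  have "AE y in lborel. \<forall>p\<in>insert 0 ((\<lambda>j. plane (\<i>^j)) ` {..<4}). y \<noteq> p"
    by (intro AE_finite_allI) (auto intro: AE_neq_point)
  then show ?thesis by eventually_elim (rule stencil_kernel_eq_sum, auto)
qed

lemma integrable_ln_norm_shift:
  "integrable lborel (\<lambda>y::real^2. indicator (cball c R) y * ln (norm (y - p)))"
proof -
  have "integrable lborel (\<lambda>y::real^2. indicator (cball 0 (R + norm (c - p))) y * ln (norm y))"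
    by (rule integrable_ln_norm_ball)
  then have "integrable lborel (\<lambda>y::real^2. indicator (cball 0 (R + norm (c - p))) (- p + 1 *\<^sub>R y) * ln (norm (- p + 1 *\<^sub>R y)))"
    by (subst integrable_lborel_affine_iff) auto
  then have "integrable lborel (\<lambda>y::real^2. indicator (cball c R) y * (indicator (cball 0 (R + norm (c - p))) (y - p) * ln (norm (y - p))))"
    using integrable_mult_indicator[of "cball c R" lborel "\<lambda>y::real^2. indicator (cball 0 (R + norm (c - p))) (y - p) * ln (norm (y - p))"]
    by (simp only: real_scaleR_def scaleR_one sets_lborel cball_measurable uminus_add_conv_diff simp_thms)
  also have "(\<lambda>y. indicator (cball c R) y * (indicator (cball 0 (R + norm (c - p))) (y - p) * ln (norm (y - p)))) = (\<lambda>y. indicator (cball c R) y * ln (norm (y - p)))"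
  proof
    fix y
    have "norm (y - p) \<le> norm (c - y) + norm (c - p)"
      using norm_triangle_ineq[of "y - c" "c - p"] by (simp add: norm_minus_commute)
    then show "indicator (cball c R) y * (indicator (cball 0 (R + norm (c - p))) (y - p) * ln (norm (y - p))) = indicator (cball c R) y * ln (norm (y - p))"
      by (auto simp: indicator_def dist_norm norm_minus_commute)
  qed
  finally show ?thesis .
qed

lemma integrable_stencil_kernel: "integrable lborel stencil_kernel"
proof -
  have 1: "integrable lborel (\<lambda>y. indicator (cball 0 2) y * stencil_kernel y)"
  proof (subst integrable_cong_AE)
    show "AE y in lborel. indicator (cball 0 2) y * stencil_kernel y = (\<Sum>j<4. indicator (cball 0 2) y * ln (norm (y - plane (\<i>^j)))) - 4 * (indicator (cball 0 2) y * ln (norm (y - 0)))"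
      using AE_stencil_kernel_eq_sum 
    proof (rule eventually_mono)
      fix y :: "real^2" assume e: "stencil_kernel y = (\<Sum>j<4. ln (norm (y - plane (\<i>^j)))) - 4 * ln (norm y)"
      show "indicator (cball 0 2) y * stencil_kernel y = (\<Sum>j<4. indicator (cball 0 2) y * ln (norm (y - plane (\<i>^j)))) - 4 * (indicator (cball 0 2) y * ln (norm (y - 0)))"
        unfolding sum_distrib_left[symmetric] e by (simp add: right_diff_distrib)
    qed
    show "integrable lborel (\<lambda>y. (\<Sum>j<4. indicator (cball 0 2) y * ln (norm (y - plane (\<i>^j)))) - 4 * (indicator (cball 0 2) y * ln (norm (y - 0))))"
      by (intro Bochner_Integration.integrable_diff Bochner_Integration.integrable_sum integrable_mult_right integrable_ln_norm_shift)
  qed measurable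
  have 2: "integrable lborel (\<lambda>y. indicator (- cball 0 2) y * stencil_kernel y)"
  proof (rule Bochner_Integration.integrable_bound)
    show "integrable lborel (\<lambda>y::real^2. 2 * (indicator (- ball 0 1) y / (norm y)^4))"
      by (intro integrable_mult_right integrable_inverse_norm_4)
    show "AE y in lborel. norm (indicator (- cball 0 2) y * stencil_kernel y) \<le> norm (2 * (indicator (- ball 0 1) y / norm y ^ 4))"
    proof (rule AE_I2)
      fix y :: "real^2"
      show "norm (indicator (- cball 0 2) y * stencil_kernel y) \<le> norm (2 * (indicator (- ball 0 1) y / norm y ^ 4))"
      proof (cases "y \<in> cball 0 2")
        case False
        then have y: "norm y > 2" by simp
        have e: "cmod (inverse (cplx y)^4) = 1 / norm y^4" by (simp add: norm_power norm_inverse power_inverse divide_inverse)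
        have "norm y ^ 4 \<ge> 2^4" using y by (intro power_mono) auto
        then have "cmod (inverse (cplx y)^4) \<le> 1/2" unfolding e using y by (simp add: divide_le_eq)
        from abs_ln_norm_1_minus[OF this] show ?thesis using y False by (simp add: stencil_kernel_def e)
      qed simp
    qed
  qed measurable
  have "stencil_kernel = (\<lambda>y. indicator (cball 0 2) y * stencil_kernel y + indicator (- cball 0 2) y * stencil_kernel y)"
    by (auto simp: fun_eq_iff indicator_def)
  then show ?thesis using Bochner_Integration.integrable_add[OF 1 2] by simp
qed


lemma AE_norm_neq: "AE y in lborel. norm (y::'a::euclidean_space) \<noteq> r"
proof -
  have "sphere (0::'a) r \<in> null_sets lebesgue" using negligible_sphere[of 0 r] by (simp add: negligible_iff_null_sets)
  then have "sphere (0::'a) r \<in> null_sets lborel" by (subst (asm) null_sets_completion_iff) auto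
  then show ?thesis by (rule AE_I') auto
qed

lemma cplx_power_rotation:
  assumes "n > 0"
  shows "\<exists>t. \<forall>y. cplx (rotation t y)^n = - (cplx y^n)" "\<exists>t. \<forall>y. inverse (cplx (rotation t y))^n = - (inverse (cplx y)^n)"
proof -
  have "cis (pi / n)^n = - 1" using assms Complex.DeMoivre[of "pi / n" n] by simp
  then have 1: "\<forall>y. cplx (rotation (pi / n) y)^n = - (cplx y^n)"
    by (simp add: power_mult_distrib)
  moreover have "\<forall>y. inverse (cplx (rotation (pi / n) y))^n = - (inverse (cplx y)^n)"
    using 1 unfolding power_inverse by (simp del: cplx_rotation)
  ultimately show "\<exists>t. \<forall>y. cplx (rotation t y)^n = - (cplx y^n)" "\<exists>t. \<forall>y. inverse (cplx (rotation t y))^n = - (inverse (cplx y)^n)" by blast+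
qed

lemma stencil_kernel_integral_outer: "(LINT y|lborel. indicator (- cball 0 1) y * stencil_kernel y) = 0"
proof -
  have z: "(LINT y|lborel. indicator (- cball 0 (1 + inverse (Suc m))) y * stencil_kernel y) = 0" for m
    unfolding stencil_kernel_def
  proof (rule integral_ln_norm_1_minus_power_eq_0[where \<rho>="inverse (1 + inverse (Suc m))"])
    show "integrable lborel (\<lambda>y. indicator (- cball 0 (1 + inverse (real (Suc m)))) y * cmod (inverse (cplx y)) ^ 4)"
    proof (rule Bochner_Integration.integrable_bound[OF integrable_inverse_norm_4])
      show "AE y in lborel. norm (indicator (- cball 0 (1 + inverse (real (Suc m)))) y * cmod (inverse (cplx y)) ^ 4) \<le> norm (indicator (- ball 0 1) y / norm y ^ 4)"
      proof (rule AE_I2)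
        fix y :: "real^2"
        have "inverse (real (Suc m)) > 0" by simp
        then have "norm y \<le> 1 \<Longrightarrow> norm y \<le> 1 + inverse (real (Suc m))" by linarith
        then show "norm (indicator (- cball 0 (1 + inverse (real (Suc m)))) y * cmod (inverse (cplx y)) ^ 4) \<le> norm (indicator (- ball 0 1) y / norm y ^ 4)"
          by (auto simp: indicator_def norm_inverse power_inverse divide_inverse)
      qed
    qed measurable
    show "cmod (inverse (cplx y)) \<le> inverse (1 + inverse (real (Suc m)))" if "y \<in> - cball 0 (1 + inverse (real (Suc m)))" for y
    proof -
      have "0 < 1 + inverse (real (Suc m))" by (simp add: add_pos_pos)
      moreover have "1 + inverse (real (Suc m)) \<le> norm y" using that by simp
      ultimately show ?thesis by (simp only: norm_inverse norm_cplx le_imp_inverse_le)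
    qed
    show "inverse (1 + inverse (real (Suc m))) < 1"
      by (rule inverse_less_1_iff[THEN iffD2]) simp
    show "\<exists>t. \<forall>y. inverse (cplx (rotation t y)) ^ n = - (inverse (cplx y) ^ n)" if "n > 0" for n
      using cplx_power_rotation(2)[OF that] .
    show "(\<lambda>y. inverse (cplx y)) \<in> borel_measurable borel" by measurable
    show "- cball (0::real^2) (1 + inverse (real (Suc m))) \<in> sets borel" by (intro borel_comp cball_measurable)
  qed simp
  have "(\<lambda>m. LINT y|lborel. indicator (- cball 0 (1 + inverse (Suc m))) y * stencil_kernel y) \<longlonglongrightarrow> (LINT y|lborel. indicator (- cball 0 1) y * stencil_kernel y)"
  proof (rule integral_dominated_convergence[where w="\<lambda>y. \<bar>stencil_kernel y\<bar>"])
    show "AE y in lborel. (\<lambda>m. indicator (- cball 0 (1 + inverse (real (Suc m)))) y * stencil_kernel y) \<longlonglongrightarrow> indicator (- cball 0 1) y * stencil_kernel y"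
    proof (rule AE_I2)
      fix y :: "real^2"
      have "\<forall>\<^sub>F m in sequentially. indicator (- cball 0 (1 + inverse (real (Suc m)))) y * stencil_kernel y = indicator (- cball 0 1) y * stencil_kernel y"
      proof (cases "norm y > 1")
        case True
        have "\<forall>\<^sub>F m in sequentially. inverse (real (Suc m)) < norm y - 1"
          using True by (intro order_tendstoD[OF LIMSEQ_inverse_real_of_nat]) simp
        then show ?thesis by eventually_elim (use True in auto)
      next
        case False
        then have "norm y \<le> 1 + inverse (real (Suc m))" for m by (simp add: add_increasing2)
        then show ?thesis using False by simp
      qed
      then show "(\<lambda>m. indicator (- cball 0 (1 + inverse (real (Suc m)))) y * stencil_kernel y) \<longlonglongrightarrow> indicator (- cball 0 1) y * stencil_kernel y"
        by (rule tendsto_eventually)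
    qed
  qed (auto simp: indicator_def intro!: integrable_abs integrable_stencil_kernel)
  then show ?thesis unfolding z by (simp add: LIMSEQ_const_iff)
qed

lemma stencil_kernel_inner:
  assumes "norm y < 1" "y \<noteq> 0"
  shows "stencil_kernel y = ln (cmod (1 - cplx y^4)) - 4 * ln (norm y)"
proof -
  have "1 - inverse (cplx y)^4 = - ((1 - cplx y^4) / cplx y^4)" using assms by (simp add: field_simps)
  then have e: "cmod (1 - inverse (cplx y)^4) = cmod (1 - cplx y^4) / norm y^4" by (simp add: norm_divide norm_power)
  have "cmod (cplx y^4) < 1" using assms by (simp add: norm_power power_less_one_iff)
  then have "1 - cplx y^4 \<noteq> 0" by auto
  then have "cmod (1 - cplx y^4) > 0" by simp
  then show ?thesis using assms unfolding stencil_kernel_def e by (simp add: ln_div ln_realpow)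
qed

lemma stencil_kernel_integral_inner:
  "integrable lborel (\<lambda>y. indicator (ball 0 1) y * ln (cmod (1 - cplx y^4)))"
  "(LINT y|lborel. indicator (ball 0 1) y * ln (cmod (1 - cplx y^4))) = 0"
proof -
  have "integrable lborel (\<lambda>y. indicator (ball 0 1) y * (stencil_kernel y + 4 * (indicator (cball 0 1) y * ln (norm y))))"
    using integrable_mult_indicator[of "ball 0 1" lborel "\<lambda>y. stencil_kernel y + 4 * (indicator (cball 0 1) y * ln (norm y))"]
      integrable_stencil_kernel integrable_ln_norm_ball[of 1] by simp
  then show int: "integrable lborel (\<lambda>y. indicator (ball 0 1) y * ln (cmod (1 - cplx y^4)))"
  proof (rule integrable_cong_AE_imp)
    show "AE y in lborel. indicator (ball 0 1) y * (stencil_kernel y + 4 * (indicator (cball 0 1) y * ln (norm y))) = indicator (ball 0 1) y * ln (cmod (1 - cplx y^4))"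
      using AE_neq_point[of 0] by eventually_elim (auto simp: indicator_def stencil_kernel_inner)
  qed measurable
  have z: "(LINT y|lborel. indicator (ball 0 (1 - inverse (Suc m))) y * ln (cmod (1 - cplx y^4))) = 0" for m
  proof (rule integral_ln_norm_1_minus_power_eq_0[where \<rho>="1 - inverse (Suc m)"])
    show "integrable lborel (\<lambda>y. indicator (ball 0 (1 - inverse (real (Suc m)))) y * cmod (cplx y) ^ 4)"
    proof (rule Bochner_Integration.integrable_bound[OF integrable_indicator_bounded[of 0 1 1]])
      show "AE y in lborel. norm (indicator (ball 0 (1 - inverse (real (Suc m)))) y * cmod (cplx y) ^ 4) \<le> norm (indicator (cball 0 1) y * 1 :: real)"
      proof (rule AE_I2)
        fix y :: "real^2"
        show "norm (indicator (ball 0 (1 - inverse (real (Suc m)))) y * cmod (cplx y) ^ 4) \<le> norm (indicator (cball 0 1) y * 1 :: real)"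
        proof (cases "norm y < 1 - inverse (real (Suc m))")
          case True
          moreover have "inverse (real (Suc m)) > 0" by simp
          ultimately have "norm y \<le> 1" by linarith
          then show ?thesis by (auto simp: indicator_def power_le_one)
        qed simp
      qed
    qed measurable
    show "\<exists>t. \<forall>y. cplx (rotation t y) ^ n = - (cplx y ^ n)" if "n > 0" for n
      using cplx_power_rotation(1)[OF that] .
    show "ball (0::real^2) (1 - inverse (real (Suc m))) \<in> sets borel" by simp
  qed auto
  have "(\<lambda>m. LINT y|lborel. indicator (ball 0 (1 - inverse (Suc m))) y * ln (cmod (1 - cplx y^4))) \<longlonglongrightarrow> (LINT y|lborel. indicator (ball 0 1) y * ln (cmod (1 - cplx y^4)))"
  proof (rule integral_dominated_convergence[where w="\<lambda>y. \<bar>indicator (ball 0 1) y * ln (cmod (1 - cplx y^4))\<bar>"])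
    show "AE y in lborel. (\<lambda>m. indicator (ball 0 (1 - inverse (real (Suc m)))) y * ln (cmod (1 - cplx y^4))) \<longlonglongrightarrow> indicator (ball 0 1) y * ln (cmod (1 - cplx y^4))"
    proof (rule AE_I2)
      fix y :: "real^2"
      have "\<forall>\<^sub>F m in sequentially. indicator (ball 0 (1 - inverse (real (Suc m)))) y * ln (cmod (1 - cplx y^4)) = indicator (ball 0 1) y * ln (cmod (1 - cplx y^4))"
      proof (cases "norm y < 1")
        case True
        have "\<forall>\<^sub>F m in sequentially. inverse (real (Suc m)) < 1 - norm y"
          using True by (intro order_tendstoD[OF LIMSEQ_inverse_real_of_nat]) simp
        then show ?thesis by eventually_elim (use True in auto)
      next
        case False
        moreover have "inverse (real (Suc m)) > 0" for m by simp
        ultimately have "\<not> norm y < 1 - inverse (real (Suc m))" for m by (smt (verit))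
        then show ?thesis using False by simp
      qed
      then show "(\<lambda>m. indicator (ball 0 (1 - inverse (real (Suc m)))) y * ln (cmod (1 - cplx y^4))) \<longlonglongrightarrow> indicator (ball 0 1) y * ln (cmod (1 - cplx y^4))"
        by (rule tendsto_eventually)
    qed
    show "AE y in lborel. norm (indicator (ball 0 (1 - inverse (real (Suc m)))) y * ln (cmod (1 - cplx y^4))) \<le> \<bar>indicator (ball 0 1) y * ln (cmod (1 - cplx y^4))\<bar>" for m
    proof (rule AE_I2)
      fix y :: "real^2"
      have "inverse (real (Suc m)) > 0" by simp
      then have "norm y < 1 - inverse (real (Suc m)) \<Longrightarrow> norm y < 1" by linarith
      then show "norm (indicator (ball 0 (1 - inverse (real (Suc m)))) y * ln (cmod (1 - cplx y^4))) \<le> \<bar>indicator (ball 0 1) y * ln (cmod (1 - cplx y^4))\<bar>"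
        by (auto simp: indicator_def)
    qed
  qed (measurable, rule integrable_abs[OF int])
  then show "(LINT y|lborel. indicator (ball 0 1) y * ln (cmod (1 - cplx y^4))) = 0" unfolding z by (simp add: LIMSEQ_const_iff)
qed

text \<open>The part of the kernel outside the unit disc integrates to zero. Inside, the kernel is
\<open>ln |1 - y\<^sup>4| - 4 ln |y|\<close>, whose first term integrates to zero as well, which leaves the positive
function \<open>- 4 ln |y|\<close>.\<close>

lemma stencil_kernel_integral_pos: "(LINT y|lborel. stencil_kernel y) > 0"
proof -
  let ?l = "\<lambda>y::real^2. - 4 * (indicator (cball 0 1) y * ln (norm y))"
  have il: "integrable lborel ?l" by (intro integrable_mult_right integrable_ln_norm_ball)
  have io: "integrable lborel (\<lambda>y. indicator (- cball 0 1) y * stencil_kernel y)"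
    using integrable_mult_indicator[of "- cball 0 1" lborel stencil_kernel] integrable_stencil_kernel by simp
  have "(LINT y|lborel. stencil_kernel y) = (LINT y|lborel. (indicator (- cball 0 1) y * stencil_kernel y + indicator (ball 0 1) y * ln (cmod (1 - cplx y^4))) + ?l y)"
  proof (rule integral_cong_AE)
    show "AE y in lborel. stencil_kernel y = (indicator (- cball 0 1) y * stencil_kernel y + indicator (ball 0 1) y * ln (cmod (1 - cplx y^4))) + ?l y"
      using AE_neq_point[of 0] AE_norm_neq[of 1] by eventually_elim (auto simp: indicator_def stencil_kernel_inner)
  qed measurable
  also have e: "\<dots> = (LINT y|lborel. ?l y)"
    using il io stencil_kernel_integral_inner stencil_kernel_integral_outer
    by (subst Bochner_Integration.integral_add) (auto intro!: Bochner_Integration.integrable_add)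
  finally have "(LINT y|lborel. stencil_kernel y) = (LINT y|lborel. ?l y)" .
  moreover have "(LINT y|lborel. ?l y) \<ge> (LINT y|lborel. indicator (cball (0::real^2) (1/2)) y * (4 * ln 2))"
  proof (rule integral_mono_AE[OF integrable_indicator_bounded il], rule AE_mp[OF AE_neq_point[of 0] AE_I2], rule impI)
    fix y :: "real^2" assume "y \<noteq> 0"
    then show "indicator (cball 0 (1/2)) y * (4 * ln 2) \<le> ?l y"
    proof -
      assume False: "y \<noteq> 0"
      have 1: "ln (norm y) \<le> 0" if "norm y \<le> 1" using False that by simp
      have 2: "ln (norm y) \<le> - ln 2" if "norm y \<le> 1/2"
      proof -
        have "ln (norm y) \<le> ln (1/2)" by (rule ln_mono) (use False that in auto)
        also have "ln (1/2::real) = - ln 2" using ln_div[of 1 "2::real"] by simp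
        finally show ?thesis .
      qed
      consider "norm y \<le> 1/2" | "norm y > 1/2" "norm y \<le> 1" | "norm y > 1" by linarith
      then show ?thesis by cases (use 1 2 in auto)
    qed
  qed
  moreover have "(LINT y|lborel. indicator (cball (0::real^2) (1/2)) y * (4 * ln 2 :: real)) > 0"
    by (simp add: content_cball)
  ultimately show ?thesis by linarith
qed

section \<open>Logarithmic potentials are differentiable\<close>

lemma gradient_difference_quotient_tendsto:
  fixes f :: "'a::euclidean_space \<Rightarrow> real"
  assumes der: "(f has_derivative (\<lambda>v. g \<bullet> v)) (at z)" and h: "h \<longlonglongrightarrow> 0" "\<And>n. h n > 0"
  shows "(\<lambda>n. (f (z + h n *\<^sub>R i) - f z) / h n) \<longlonglongrightarrow> g \<bullet> i"
proof -
  have "((\<lambda>s. f (z + s *\<^sub>R i)) has_derivative (\<lambda>s. g \<bullet> (s *\<^sub>R i))) (at 0)"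
  proof (rule has_derivative_compose[where f="\<lambda>s. z + s *\<^sub>R i" and f'="\<lambda>s. s *\<^sub>R i" and g=f and g'="\<lambda>v. g \<bullet> v" and x=0 and s=UNIV])
    show "((\<lambda>s. z + s *\<^sub>R i) has_derivative (\<lambda>s. s *\<^sub>R i)) (at 0)" by (auto intro!: derivative_eq_intros)
  qed (use der in simp)
  then have "((\<lambda>s. f (z + s *\<^sub>R i)) has_real_derivative (g \<bullet> i)) (at 0)"
    by (simp add: has_field_derivative_def mult.commute[of _ "g \<bullet> i"])
  then have "(\<lambda>s. (f (z + s *\<^sub>R i) - f z) / s) \<midarrow>0\<rightarrow> g \<bullet> i" by (simp add: DERIV_def)
  then show ?thesis
    unfolding tendsto_at_iff_sequentially comp_def using h by (auto simp: less_imp_neq[symmetric])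
qed

lemma gradient_bound_imp_Lipschitz:
  fixes f :: "'a::euclidean_space \<Rightarrow> real"
  assumes S: "convex S" "y \<in> S" "z \<in> S" and der: "\<And>u. u \<in> S \<Longrightarrow> (f has_derivative (\<lambda>v. g u \<bullet> v)) (at u)"
    and L: "\<And>u. u \<in> S \<Longrightarrow> norm (g u) \<le> L"
  shows "\<bar>f y - f z\<bar> \<le> L * norm (y - z)"
proof -
  have "norm (f y - f z) \<le> L * norm (y - z)"
  proof (rule differentiable_bound[OF S(1), where f'="\<lambda>u v. g u \<bullet> v"])
    show "(f has_derivative (\<lambda>v. g u \<bullet> v)) (at u within S)" if "u \<in> S" for u
      using der[OF that] by (rule has_derivative_at_withinI)
    show "onorm (\<lambda>v. g u \<bullet> v) \<le> L" if "u \<in> S" for u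
    proof (rule onorm_bound)
      show "0 \<le> L" using order_trans[OF norm_ge_zero L[OF that]] .
      show "norm (g u \<bullet> v) \<le> L * norm v" for v
        using Cauchy_Schwarz_ineq2[of "g u" v] mult_right_mono[OF L[OF that] norm_ge_zero[of v]] by simp
    qed
  qed (use S in auto)
  then show ?thesis by simp
qed

text \<open>The Lipschitz function \<open>L\<close> dominates the difference quotients and, in the limit, the gradients \<open>g\<close>,
so dominated convergence applies along every sequence tending to \<open>a\<close>.\<close>

lemma has_derivative_integral_Lipschitz_kernel:
  fixes p :: "'a::euclidean_space \<Rightarrow> 'b \<Rightarrow> real" and g :: "'b \<Rightarrow> 'a"
  assumes U: "open U" "a \<in> U"
    and p: "\<And>z. z \<in> U \<Longrightarrow> integrable M (p z)"
    and g: "g \<in> borel_measurable M"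
    and L: "integrable M L"
    and lip: "\<And>y z. y \<in> space M \<Longrightarrow> z \<in> U \<Longrightarrow> \<bar>p z y - p a y\<bar> \<le> L y * norm (z - a)"
    and der: "\<And>y. y \<in> space M \<Longrightarrow> ((\<lambda>z. p z y) has_derivative (\<lambda>v. g y \<bullet> v)) (at a)"
  shows "((\<lambda>z. LINT y|M. p z y) has_derivative (\<lambda>v. (LINT y|M. g y) \<bullet> v)) (at a)" "integrable M g"
proof -
  have gb: "norm (g y) \<le> L y" if y: "y \<in> space M" for y
  proof (rule ccontr)
    assume n: "\<not> norm (g y) \<le> L y"
    obtain r where r: "r > 0" "ball a r \<subseteq> U" using U open_contains_ball by blast
    have L0: "0 \<le> L y"
    proof -
      obtain b :: 'a where b: "b \<in> Basis" using nonempty_Basis by blast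
      have "a + (r/2) *\<^sub>R b \<in> U" using r b by (intro subsetD[OF r(2)]) (simp add: dist_norm)
      from lip[OF y this] have "0 \<le> L y * norm ((r/2) *\<^sub>R b)" by (metis abs_ge_zero add_diff_cancel_left' order_trans)
      then show ?thesis using r b by (simp add: zero_le_mult_iff)
    qed
    have g0: "g y \<noteq> 0" using n L0 by auto
    define e where "e = (norm (g y) - L y) / 2"
    have e: "e > 0" using n by (simp add: e_def)
    have "((\<lambda>z. (p z y - p a y - g y \<bullet> (z - a)) /\<^sub>R norm (z - a)) \<longlongrightarrow> 0) (at a)"
      using der[OF y] by (simp add: has_derivative_at_within)
    from tendstoD[OF this e] have "eventually (\<lambda>z. \<bar>p z y - p a y - g y \<bullet> (z - a)\<bar> < e * norm (z - a)) (at a)"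
    proof (rule eventually_rev_mp, intro eventually_at_filter[THEN iffD2] always_eventually allI impI)
      fix z assume z: "z \<noteq> a" "dist ((p z y - p a y - g y \<bullet> (z - a)) /\<^sub>R norm (z - a)) 0 < e"
      then have "\<bar>p z y - p a y - g y \<bullet> (z - a)\<bar> / norm (z - a) < e" by (simp add: abs_mult divide_inverse mult.commute)
      then show "\<bar>p z y - p a y - g y \<bullet> (z - a)\<bar> < e * norm (z - a)" using z(1) by (simp add: divide_less_eq)
    qed
    then obtain d where d: "d > 0" "\<And>z. z \<noteq> a \<Longrightarrow> dist z a < d \<Longrightarrow> \<bar>p z y - p a y - g y \<bullet> (z - a)\<bar> < e * norm (z - a)"
      by (auto simp: eventually_at)
    define t where "t = min d r / 2"
    have t: "0 < t" "t < d" "t < r" using d r by (auto simp: t_def)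
    define z where "z = a + (t / norm (g y)) *\<^sub>R g y"
    have nz: "norm (z - a) = t" using t g0 by (simp add: z_def)
    have "z \<noteq> a" "dist z a < d" "z \<in> U" using nz t r(2) by (auto simp: dist_norm norm_minus_commute subset_iff)
    note 1 = d(2)[OF this(1,2)] and 2 = lip[OF y \<open>z \<in> U\<close>]
    have "g y \<bullet> (z - a) = t * norm (g y)" using g0 by (simp add: z_def power2_norm_eq_inner[symmetric] power2_eq_square)
    with 1[unfolded nz] 2[unfolded nz] have "t * norm (g y) < L y * t + e * t" by linarith
    then have "t * norm (g y) < t * (L y + e)" by (simp add: algebra_simps)
    then have "norm (g y) < L y + e" using t by simp
    then show False using n by (simp add: e_def field_simps)
  qed
  show ig: "integrable M g"
    by (rule Bochner_Integration.integrable_bound[OF L g]) (use gb in \<open>auto intro!: AE_I2 intro: order_trans[OF _ abs_ge_self]\<close>)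
  show "((\<lambda>z. LINT y|M. p z y) has_derivative (\<lambda>v. (LINT y|M. g y) \<bullet> v)) (at a)"
  proof (rule has_derivativeI)
    show "bounded_linear (\<lambda>v. (LINT y|M. g y) \<bullet> v)" by (rule bounded_linear_inner_right)
    show "((\<lambda>z. ((LINT y|M. p z y) - (LINT y|M. p a y) - (LINT y|M. g y) \<bullet> (z - a)) /\<^sub>R norm (z - a)) \<longlongrightarrow> 0) (at a)"
      unfolding tendsto_at_iff_sequentially comp_def
    proof (intro allI impI)
      fix X :: "nat \<Rightarrow> 'a" assume X: "\<forall>i. X i \<in> UNIV - {a}" "X \<longlonglongrightarrow> a"
      have "eventually (\<lambda>n. X n \<in> U) sequentially" using topological_tendstoD[OF X(2) U] .
      then obtain N where N: "\<And>n. n \<ge> N \<Longrightarrow> X n \<in> U" by (auto simp: eventually_sequentially)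
      define Y where "Y n = X (n + N)" for n
      have YU: "Y n \<in> U" and Yz: "Y n \<noteq> a" for n using N X(1) by (auto simp: Y_def)
      have Y: "Y \<longlonglongrightarrow> a" unfolding Y_def using X(2) by (rule LIMSEQ_ignore_initial_segment)
      define q where "q n y = (p (Y n) y - p a y - g y \<bullet> (Y n - a)) /\<^sub>R norm (Y n - a)" for n y
      have "(\<lambda>n. LINT y|M. q n y) \<longlonglongrightarrow> (LINT y|M. 0)"
      proof (rule integral_dominated_convergence[where w="\<lambda>y. 2 * L y"])
        show "q n \<in> borel_measurable M" for n
          unfolding q_def using p[OF YU] p[OF U(2)] g by measurable
        show "AE y in M. (\<lambda>n. q n y) \<longlonglongrightarrow> 0"
        proof (rule AE_I2)
          fix y assume y: "y \<in> space M"
          have "((\<lambda>z. (p z y - p a y - g y \<bullet> (z - a)) /\<^sub>R norm (z - a)) \<longlongrightarrow> 0) (at a)"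
            using der[OF y] by (simp add: has_derivative_at_within)
          then show "(\<lambda>n. q n y) \<longlonglongrightarrow> 0" unfolding q_def tendsto_at_iff_sequentially comp_def
            using Yz Y by auto
        qed
        show "AE y in M. norm (q n y) \<le> 2 * L y" for n
        proof (rule AE_I2)
          fix y assume y: "y \<in> space M"
          have n0: "norm (Y n - a) > 0" using Yz by simp
          have "\<bar>g y \<bullet> (Y n - a)\<bar> \<le> L y * norm (Y n - a)"
            using Cauchy_Schwarz_ineq2[of "g y" "Y n - a"] mult_right_mono[OF gb[OF y] norm_ge_zero, of "Y n - a"] by linarith
          then have "\<bar>p (Y n) y - p a y - g y \<bullet> (Y n - a)\<bar> \<le> 2 * L y * norm (Y n - a)"
            using lip[OF y YU[of n]] by linarith
          then show "norm (q n y) \<le> 2 * L y" unfolding q_def real_norm_def real_scaleR_def abs_mult abs_inverse abs_norm_cancel using n0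
            by (subst mult.commute, subst divide_inverse[symmetric], subst pos_divide_le_eq) (auto simp: algebra_simps)
        qed
      qed (use L in auto)
      moreover have "(LINT y|M. q n y) = ((LINT y|M. p (Y n) y) - (LINT y|M. p a y) - (LINT y|M. g y) \<bullet> (Y n - a)) /\<^sub>R norm (Y n - a)" for n
      proof -
        have "(LINT y|M. p (Y n) y - p a y - g y \<bullet> (Y n - a)) = (LINT y|M. p (Y n) y) - (LINT y|M. p a y) - (LINT y|M. g y) \<bullet> (Y n - a)"
          using p[OF YU[of n]] p[OF U(2)] ig by simp
        then show ?thesis unfolding q_def by simp
      qed
      ultimately have "(\<lambda>n. ((LINT y|M. p (Y n) y) - (LINT y|M. p a y) - (LINT y|M. g y) \<bullet> (Y n - a)) /\<^sub>R norm (Y n - a)) \<longlonglongrightarrow> 0"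
        by simp
      then show "(\<lambda>n. ((LINT y|M. p (X n) y) - (LINT y|M. p a y) - (LINT y|M. g y) \<bullet> (X n - a)) /\<^sub>R norm (X n - a)) \<longlonglongrightarrow> 0"
        unfolding Y_def by (rule LIMSEQ_offset)
    qed
  qed
qed

definition bounded_density :: "real \<Rightarrow> real \<Rightarrow> (real^2 \<Rightarrow> real) \<Rightarrow> bool" where
  "bounded_density R M \<omega> \<longleftrightarrow> M \<ge> 0 \<and> \<omega> \<in> borel_measurable borel \<and> (\<forall>y. \<bar>\<omega> y\<bar> \<le> M * indicator (cball 0 R) y)"

lemma bounded_densityD:
  assumes "bounded_density R M \<omega>"
  shows "\<omega> \<in> borel_measurable borel" "\<bar>\<omega> y\<bar> \<le> M" "norm y > R \<Longrightarrow> \<omega> y = 0" "\<bar>\<omega> y\<bar> \<le> M * indicator (cball 0 R) y" "M \<ge> 0"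
proof -
  show b: "\<bar>\<omega> y\<bar> \<le> M * indicator (cball 0 R) y" for y using assms by (auto simp: bounded_density_def)
  show M: "M \<ge> 0" using assms by (auto simp: bounded_density_def)
  show "\<bar>\<omega> y\<bar> \<le> M" using b[of y] M by (cases "norm y \<le> R") auto
  show "norm y > R \<Longrightarrow> \<omega> y = 0" using b[of y] by auto
qed (use assms in \<open>auto simp: bounded_density_def\<close>)


definition log_potential :: "(real^2 \<Rightarrow> real) \<Rightarrow> real^2 \<Rightarrow> real" where
  "log_potential \<omega> z = (LINT y|lborel. ln (norm (z - y)) * \<omega> y)"

lemma integrable_kernel_mult_density:
  fixes k :: "real^2 \<Rightarrow> real"
  assumes k [measurable]: "k \<in> borel_measurable borel" and int: "integrable lborel (\<lambda>w. indicator (cball 0 R') w * k w)"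
    and w: "bounded_density R M \<omega>" and R': "R + norm z \<le> R'"
  shows "integrable lborel (\<lambda>y. k (z - y) * \<omega> y)"
    "(LINT y|lborel. \<bar>k (z - y) * \<omega> y\<bar>) \<le> M * (LINT w|lborel. indicator (cball 0 R') w * \<bar>k w\<bar>)"
proof -
  have [measurable]: "\<omega> \<in> borel_measurable borel" using bounded_densityD(1)[OF w] .
  have i1: "integrable lborel (\<lambda>w. \<bar>indicator (cball 0 R') w * k w\<bar>)" using int by (rule integrable_abs)
  have e: "\<bar>indicator (cball 0 R') w * k w\<bar> = indicator (cball 0 R') w * \<bar>k w\<bar>" for w by (simp add: abs_mult)
  have i2: "integrable lborel (\<lambda>y. M * (indicator (cball 0 R') (z - y) * \<bar>k (z - y)\<bar>))"
    using i1 unfolding e by (intro integrable_mult_right) (subst integrable_reflect_iff[where f="\<lambda>w. indicator (cball 0 R') w * \<bar>k w\<bar>"])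
  have b: "\<bar>k (z - y) * \<omega> y\<bar> \<le> M * (indicator (cball 0 R') (z - y) * \<bar>k (z - y)\<bar>)" for y
  proof (cases "norm y \<le> R")
    case True
    have "norm (z - y) \<le> R'" using norm_triangle_ineq4[of z y] R' True by linarith
    then show ?thesis using mult_left_mono[OF bounded_densityD(2)[OF w, of y], of "\<bar>k (z - y)\<bar>"] by (simp add: abs_mult mult.commute)
  next
    case False
    then show ?thesis using bounded_densityD(3,5)[OF w] by (simp add: indicator_def)
  qed
  show i: "integrable lborel (\<lambda>y. k (z - y) * \<omega> y)"
    by (rule Bochner_Integration.integrable_bound[OF i2]) (measurable, rule AE_I2, unfold real_norm_def, rule order_trans[OF b abs_ge_self])
  have "(LINT y|lborel. \<bar>k (z - y) * \<omega> y\<bar>) \<le> (LINT y|lborel. M * (indicator (cball 0 R') (z - y) * \<bar>k (z - y)\<bar>))"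
    by (rule integral_mono[OF integrable_abs[OF i] i2 b])
  also have "\<dots> = M * (LINT w|lborel. indicator (cball 0 R') w * \<bar>k w\<bar>)"
    using integral_reflect[where f="\<lambda>w. indicator (cball 0 R') w * \<bar>k w\<bar>"] by simp
  finally show "(LINT y|lborel. \<bar>k (z - y) * \<omega> y\<bar>) \<le> M * (LINT w|lborel. indicator (cball 0 R') w * \<bar>k w\<bar>)" .
qed

lemma integrable_log_potential:
  assumes "bounded_density R M \<omega>"
  shows "integrable lborel (\<lambda>y. ln (norm (z - y)) * \<omega> y)"
  by (rule integrable_kernel_mult_density(1)[where k="\<lambda>w. ln (norm w)", OF _ integrable_ln_norm_ball assms order_refl]) measurable

text \<open>Smoothing the logarithm at scale \<open>d\<close> makes it Lipschitz. With \<open>d = 0\<close> the gradient is \<open>w / |w|\<^sup>2\<close>, the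
gradient of \<open>ln |w|\<close>.\<close>

definition smooth_ln_grad :: "real \<Rightarrow> real^2 \<Rightarrow> real^2" where "smooth_ln_grad d w = (1 / ((norm w)\<^sup>2 + d\<^sup>2)) *\<^sub>R w"
definition smooth_ln :: "real \<Rightarrow> real^2 \<Rightarrow> real" where "smooth_ln d w = ln ((norm w)\<^sup>2 + d\<^sup>2) / 2"

lemma smooth_ln_has_derivative:
  assumes "d \<noteq> 0" shows "(smooth_ln d has_derivative (\<lambda>v. smooth_ln_grad d w \<bullet> v)) (at w)"
proof -
  have pos: "w \<bullet> w + d\<^sup>2 > 0" using assms by (simp add: add_nonneg_pos)
  have "((\<lambda>w. ln (w \<bullet> w + d\<^sup>2) / 2) has_derivative (\<lambda>v. smooth_ln_grad d w \<bullet> v)) (at w)"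
  proof (rule derivative_eq_intros refl pos zero_neq_numeral[symmetric])+
    have "- ln (w \<bullet> w + d\<^sup>2) * (inverse 2 * 0 * inverse 2) + (w \<bullet> h + h \<bullet> w + 0) * inverse (w \<bullet> w + d\<^sup>2) / 2 = smooth_ln_grad d w \<bullet> h" for h
    proof -
      have "w \<bullet> h + h \<bullet> w = 2 * (w \<bullet> h)" by (simp add: inner_commute)
      moreover have "(2 * a + 0) * inverse P / 2 = (1 / P) * a" for a P :: real by (simp add: inverse_eq_divide)
      ultimately show ?thesis by (simp only: smooth_ln_grad_def power2_norm_eq_inner inner_scaleR_left mult_zero_right mult_zero_left add_0_left)
    qed
    then show "(\<lambda>h. - ln (w \<bullet> w + d\<^sup>2) * (inverse 2 * 0 * inverse 2) + (w \<bullet> h + h \<bullet> w + 0) * inverse (w \<bullet> w + d\<^sup>2) / 2) = (\<bullet>) (smooth_ln_grad d w)"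
      by auto
  qed
  then show ?thesis unfolding smooth_ln_def power2_norm_eq_inner .
qed

lemma norm_smooth_ln_grad:
  assumes "d > 0" shows "norm (smooth_ln_grad d w) \<le> 1 / d" "w \<noteq> 0 \<Longrightarrow> norm (smooth_ln_grad d w) \<le> 1 / norm w"
proof -
  have pos: "(norm w)\<^sup>2 + d\<^sup>2 > 0" using assms by (simp add: add_nonneg_pos)
  have "0 \<le> norm w * d" using assms by simp
  then have "norm w * d \<le> (norm w)\<^sup>2 + d\<^sup>2" using sum_squares_bound[of "norm w" d] by linarith
  then show "norm (smooth_ln_grad d w) \<le> 1 / d" using pos assms by (simp add: smooth_ln_grad_def field_simps)
  show "w \<noteq> 0 \<Longrightarrow> norm (smooth_ln_grad d w) \<le> 1 / norm w" using pos by (simp add: smooth_ln_grad_def field_simps power2_eq_square)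
qed

lemma smooth_ln_Lipschitz:
  assumes "d > 0" shows "\<bar>smooth_ln d w - smooth_ln d w'\<bar> \<le> norm (w - w') / d"
  using gradient_bound_imp_Lipschitz[where S=UNIV and f="smooth_ln d" and g="smooth_ln_grad d" and y=w and z=w' and L="1 / d"]
    smooth_ln_has_derivative[of d] norm_smooth_ln_grad(1)[OF assms] assms by simp

lemma smooth_ln_grad_measurable [measurable]: "smooth_ln_grad d \<in> borel_measurable borel" unfolding smooth_ln_grad_def by measurable
lemma smooth_ln_measurable [measurable]: "smooth_ln d \<in> borel_measurable borel" unfolding smooth_ln_def by measurable

lemma smooth_ln_tendsto:
  assumes "d \<longlonglongrightarrow> 0" "w \<noteq> 0" shows "(\<lambda>n. smooth_ln (d n) w) \<longlonglongrightarrow> ln (norm w)"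
proof -
  have "(\<lambda>n. smooth_ln (d n) w) \<longlonglongrightarrow> ln ((norm w)\<^sup>2 + 0\<^sup>2) / 2"
    unfolding smooth_ln_def using assms by (intro tendsto_intros) auto
  then show ?thesis using assms(2) by (simp add: ln_realpow)
qed

lemma smooth_ln_bound:
  assumes "0 < d" "d \<le> 1" "w \<noteq> 0" "norm w \<le> R"
  shows "\<bar>smooth_ln d w\<bar> \<le> \<bar>ln (norm w)\<bar> + R\<^sup>2"
proof -
  have l: "ln (norm w) \<le> smooth_ln d w"
  proof -
    have "ln ((norm w)\<^sup>2) \<le> ln ((norm w)\<^sup>2 + d\<^sup>2)" using assms by (intro ln_mono) auto
    then show ?thesis using assms by (simp add: smooth_ln_def ln_realpow)
  qed
  have "ln ((norm w)\<^sup>2 + d\<^sup>2) \<le> (norm w)\<^sup>2 + d\<^sup>2 - 1"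
    using assms by (intro ln_le_minus_one) (simp add: add_nonneg_pos)
  also have "\<dots> \<le> R\<^sup>2" using assms power_mono[of "norm w" R 2] power_le_one[of d 2] by auto
  finally have "smooth_ln d w \<le> R\<^sup>2 / 2" by (simp add: smooth_ln_def)
  then show ?thesis using l by (smt (verit) field_sum_of_halves zero_le_power2)
qed

text \<open>Differentiation under the integral applies to the smoothed kernels. Their gradients converge to
\<open>w / |w|\<^sup>2\<close> in \<open>L\<^sup>1\<close> of every disc, hence the gradients of the smoothed potentials converge uniformly near
\<open>z\<close>, and the limit of the potentials is differentiable with the limit gradient.\<close>

lemma log_potential_has_derivative:
  assumes w: "bounded_density R M \<omega>"
  shows "(log_potential \<omega> has_derivative (\<lambda>v. (LINT y|lborel. \<omega> y *\<^sub>R smooth_ln_grad 0 (z - y)) \<bullet> v)) (at z)"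
proof -
  define z0 where "z0 = z"
  define R' where "R' = \<bar>R\<bar> + norm z0 + 1"
  define d where "d n = inverse (real (Suc n))" for n
  have d0: "d \<longlonglongrightarrow> 0" unfolding d_def by (rule LIMSEQ_inverse_real_of_nat)
  have d1: "0 < d n" "d n \<le> 1" for n by (auto simp: d_def inverse_le_1_iff)
  have [measurable]: "\<omega> \<in> borel_measurable borel" using bounded_densityD(1)[OF w] .
  let ?S = "ball z0 1"
  have RS: "R + norm x \<le> R'" if "x \<in> ?S" for x
    using that norm_triangle_ineq2[of x z0] unfolding R'_def by (simp add: dist_norm norm_minus_commute)
  have inv_int: "integrable lborel (\<lambda>w::real^2. indicator (cball 0 R') w * (1 / norm w))"
    using integrable_inverse_norm_ball[of R'] by simp
  have Lint: "integrable lborel (\<lambda>w. indicator (cball 0 R') w * smooth_ln (d n) w)" for n R'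
  proof (rule Bochner_Integration.integrable_bound)
    show "integrable lborel (\<lambda>w::real^2. \<bar>indicator (cball 0 R') w * ln (norm w)\<bar> + indicator (cball 0 R') w * R'\<^sup>2)"
      by (intro Bochner_Integration.integrable_add integrable_abs integrable_ln_norm_ball integrable_indicator_bounded)
    show "AE w in lborel. norm (indicator (cball 0 R') w * smooth_ln (d n) w) \<le> norm (\<bar>indicator (cball 0 R') w * ln (norm w)\<bar> + indicator (cball 0 R') w * R'\<^sup>2)"
      using AE_neq_point[of 0]
    proof (rule eventually_mono)
      fix w :: "real^2" assume "w \<noteq> 0"
      then show "norm (indicator (cball 0 R') w * smooth_ln (d n) w) \<le> norm (\<bar>indicator (cball 0 R') w * ln (norm w)\<bar> + indicator (cball 0 R') w * R'\<^sup>2)"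
        using smooth_ln_bound[OF d1[of n], of w R'] by (cases "norm w \<le> R'") auto
    qed
  qed measurable
  have Lwint: "integrable lborel (\<lambda>y. smooth_ln (d n) (x - y) * \<omega> y)" for n x
    by (rule integrable_kernel_mult_density(1)[OF _ Lint w order_refl]) measurable
  have winth: "integrable lborel \<omega>"
    by (rule Bochner_Integration.integrable_bound[OF integrable_indicator_bounded[of 0 R M]])
       (use bounded_densityD(4)[OF w] in \<open>auto simp: mult.commute intro: order_trans[OF _ abs_ge_self]\<close>)
  define f where "f n x = (LINT y|lborel. smooth_ln (d n) (x - y) * \<omega> y)" for n x
  have Kint: "integrable lborel (\<lambda>y. \<omega> y *\<^sub>R smooth_ln_grad (d n) (x - y))"
   and fder: "(f n has_derivative (\<lambda>v. (LINT y|lborel. \<omega> y *\<^sub>R smooth_ln_grad (d n) (x - y)) \<bullet> v)) (at x)" for n x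
  proof -
      have lip: "\<bar>smooth_ln (d n) (u - y) * \<omega> y - smooth_ln (d n) (x - y) * \<omega> y\<bar> \<le> \<bar>\<omega> y\<bar> / d n * norm (u - x)" for y u
      proof -
        have "\<bar>smooth_ln (d n) (u - y) * \<omega> y - smooth_ln (d n) (x - y) * \<omega> y\<bar> = \<bar>\<omega> y\<bar> * \<bar>smooth_ln (d n) (u - y) - smooth_ln (d n) (x - y)\<bar>"
          by (simp add: abs_mult[symmetric] algebra_simps)
        also have "\<dots> \<le> \<bar>\<omega> y\<bar> * (norm (u - x) / d n)"
          using smooth_ln_Lipschitz[OF d1(1), of n "u - y" "x - y"] by (intro mult_left_mono) auto
        finally show ?thesis by simp
      qed
      have der: "((\<lambda>u. smooth_ln (d n) (u - y) * \<omega> y) has_derivative (\<lambda>v. \<omega> y *\<^sub>R smooth_ln_grad (d n) (x - y) \<bullet> v)) (at x)" for y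
      proof -
        have "((\<lambda>u. smooth_ln (d n) (u - y)) has_derivative (\<lambda>v. smooth_ln_grad (d n) (x - y) \<bullet> v)) (at x)"
        proof (rule has_derivative_compose[where f="\<lambda>u. u - y" and f'="\<lambda>v. v" and g="smooth_ln (d n)" and g'="\<lambda>v. smooth_ln_grad (d n) (x - y) \<bullet> v" and x=x and s=UNIV])
          show "((\<lambda>u. u - y) has_derivative (\<lambda>v. v)) (at x)" by (auto intro!: derivative_eq_intros)
          show "(smooth_ln (d n) has_derivative (\<lambda>v. smooth_ln_grad (d n) (x - y) \<bullet> v)) (at (x - y))"
            using smooth_ln_has_derivative[of "d n" "x - y"] d1(1)[of n] by simp
        qed
        from has_derivative_mult_left[OF this, of "\<omega> y"] show ?thesis by (simp add: mult.commute)
      qed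
    note D = has_derivative_integral_Lipschitz_kernel[where U=UNIV and L="\<lambda>y. \<bar>\<omega> y\<bar> / d n" and a=x and M=lborel
        and p="\<lambda>u y. smooth_ln (d n) (u - y) * \<omega> y" and g="\<lambda>y. \<omega> y *\<^sub>R smooth_ln_grad (d n) (x - y)", OF open_UNIV UNIV_I Lwint _ _ lip der]
    show "integrable lborel (\<lambda>y. \<omega> y *\<^sub>R smooth_ln_grad (d n) (x - y))"
      by (rule D(2)) (use winth in auto)
    show "(f n has_derivative (\<lambda>v. (LINT y|lborel. \<omega> y *\<^sub>R smooth_ln_grad (d n) (x - y)) \<bullet> v)) (at x)"
      unfolding f_def by (rule D(1)) (use winth in auto)
  qed
  have K0: "norm (smooth_ln_grad 0 w) = 1 / norm w" for w by (simp add: smooth_ln_grad_def power2_eq_square)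
  have K0int: "integrable lborel (\<lambda>y. \<omega> y *\<^sub>R smooth_ln_grad 0 (x - y))" if "x \<in> ?S" for x
  proof (rule Bochner_Integration.integrable_bound)
    show "integrable lborel (\<lambda>y. (1 / norm (x - y)) * \<omega> y)"
      by (rule integrable_kernel_mult_density(1)[where k="\<lambda>w. 1 / norm w", OF _ inv_int w RS[OF that]]) measurable
  qed (auto simp: K0 mult.commute)
  (* The L1 distance of the gradient kernels bounds the error of the gradients uniformly near the point. *)
  define eps where "eps n = (LINT w|lborel. indicator (cball 0 R') w * norm (smooth_ln_grad (d n) w - smooth_ln_grad 0 w))" for n
  have Kd: "norm (smooth_ln_grad (d n) w - smooth_ln_grad 0 w) \<le> 2 * (1 / norm w)" for n w
  proof (cases "w = 0")
    case False
    then show ?thesis using norm_triangle_ineq4[of "smooth_ln_grad (d n) w" "smooth_ln_grad 0 w"] norm_smooth_ln_grad(2)[OF d1(1) False, of n] K0[of w] by linarith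
  qed (simp add: smooth_ln_grad_def)
  have Kdint: "integrable lborel (\<lambda>w. indicator (cball 0 R') w * norm (smooth_ln_grad (d n) w - smooth_ln_grad 0 w))" for n
    by (rule Bochner_Integration.integrable_bound[OF integrable_mult_right[OF inv_int, of 2]])
       (use Kd in \<open>auto simp: indicator_def\<close>)
  have "eps \<longlonglongrightarrow> integral\<^sup>L lborel (\<lambda>w::real^2. 0::real)"
    unfolding eps_def
  proof (rule integral_dominated_convergence[where w="\<lambda>w. 2 * (indicator (cball 0 R') w * (1 / norm w))"])
    show "AE w in lborel. (\<lambda>n. indicator (cball 0 R') w * norm (smooth_ln_grad (d n) w - smooth_ln_grad 0 w)) \<longlonglongrightarrow> 0"
      using AE_neq_point[of 0]
    proof (rule eventually_mono)
      fix w :: "real^2" assume "w \<noteq> 0"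
      then have "(\<lambda>n. indicator (cball 0 R') w * norm (smooth_ln_grad (d n) w - smooth_ln_grad 0 w)) \<longlonglongrightarrow> indicator (cball 0 R') w * norm (smooth_ln_grad 0 w - smooth_ln_grad 0 w)"
        unfolding smooth_ln_grad_def using d0 by (intro tendsto_intros) auto
      then show "(\<lambda>n. indicator (cball 0 R') w * norm (smooth_ln_grad (d n) w - smooth_ln_grad 0 w)) \<longlonglongrightarrow> 0" by simp
    qed
    show "AE w in lborel. norm (indicator (cball 0 R') w * norm (smooth_ln_grad (d n) w - smooth_ln_grad 0 w)) \<le> 2 * (indicator (cball 0 R') w * (1 / norm w))" for n
      using Kd by (auto simp: indicator_def)
    show "integrable lborel (\<lambda>w::real^2. 2 * (indicator (cball 0 R') w * (1 / norm w)))"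
      by (rule integrable_mult_right[OF inv_int])
  qed measurable
  then have eps0: "eps \<longlonglongrightarrow> 0" by simp
  have Kdiff: "norm ((LINT y|lborel. \<omega> y *\<^sub>R smooth_ln_grad (d n) (x - y)) - (LINT y|lborel. \<omega> y *\<^sub>R smooth_ln_grad 0 (x - y))) \<le> M * eps n" if x: "x \<in> ?S" for n x
  proof -
    have "(LINT y|lborel. \<omega> y *\<^sub>R smooth_ln_grad (d n) (x - y)) - (LINT y|lborel. \<omega> y *\<^sub>R smooth_ln_grad 0 (x - y)) = (LINT y|lborel. \<omega> y *\<^sub>R (smooth_ln_grad (d n) (x - y) - smooth_ln_grad 0 (x - y)))"
      using Kint K0int[OF x] by (simp add: scaleR_diff_right)
    also have "norm \<dots> \<le> (LINT y|lborel. norm (\<omega> y *\<^sub>R (smooth_ln_grad (d n) (x - y) - smooth_ln_grad 0 (x - y))))"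
      by (rule integral_norm_bound)
    also have "\<dots> = (LINT y|lborel. \<bar>norm (smooth_ln_grad (d n) (x - y) - smooth_ln_grad 0 (x - y)) * \<omega> y\<bar>)"
      by (intro Bochner_Integration.integral_cong) (auto simp: abs_mult)
    also have "\<dots> \<le> M * (LINT w|lborel. indicator (cball 0 R') w * \<bar>norm (smooth_ln_grad (d n) w - smooth_ln_grad 0 w)\<bar>)"
      by (rule integrable_kernel_mult_density(2)[where k="\<lambda>w. norm (smooth_ln_grad (d n) w - smooth_ln_grad 0 w)", OF _ Kdint w RS[OF x]]) measurable
    finally show ?thesis by (simp add: eps_def)
  qed
  have flim: "(\<lambda>n. f n x) \<longlonglongrightarrow> log_potential \<omega> x" for x
    unfolding f_def log_potential_def
  proof (rule integral_dominated_convergence[where w="\<lambda>y. \<bar>ln (norm (x - y)) * \<omega> y\<bar> + (\<bar>R\<bar> + norm x)\<^sup>2 * \<bar>\<omega> y\<bar>"])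
    show "AE y in lborel. (\<lambda>n. smooth_ln (d n) (x - y) * \<omega> y) \<longlonglongrightarrow> ln (norm (x - y)) * \<omega> y"
      using AE_neq_point[of x] by (rule eventually_mono) (intro tendsto_intros smooth_ln_tendsto d0, simp)
    show "AE y in lborel. norm (smooth_ln (d n) (x - y) * \<omega> y) \<le> \<bar>ln (norm (x - y)) * \<omega> y\<bar> + (\<bar>R\<bar> + norm x)\<^sup>2 * \<bar>\<omega> y\<bar>" for n
      using AE_neq_point[of x]
    proof (rule eventually_mono)
      fix y assume y: "y \<noteq> x"
      show "norm (smooth_ln (d n) (x - y) * \<omega> y) \<le> \<bar>ln (norm (x - y)) * \<omega> y\<bar> + (\<bar>R\<bar> + norm x)\<^sup>2 * \<bar>\<omega> y\<bar>"
      proof (cases "norm y \<le> R")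
        case True
        have "norm (x - y) \<le> \<bar>R\<bar> + norm x" using norm_triangle_ineq4[of x y] True by linarith
        then have "\<bar>smooth_ln (d n) (x - y)\<bar> \<le> \<bar>ln (norm (x - y))\<bar> + (\<bar>R\<bar> + norm x)\<^sup>2" using smooth_ln_bound[OF d1] y by auto
        from mult_right_mono[OF this, of "\<bar>\<omega> y\<bar>"] show ?thesis by (simp add: abs_mult algebra_simps)
      next
        case False
        then show ?thesis using bounded_densityD(3)[OF w] by simp
      qed
    qed
    show "integrable lborel (\<lambda>y. \<bar>ln (norm (x - y)) * \<omega> y\<bar> + (\<bar>R\<bar> + norm x)\<^sup>2 * \<bar>\<omega> y\<bar>)"
      by (intro Bochner_Integration.integrable_add integrable_abs integrable_log_potential[OF w] integrable_mult_right winth)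
  qed measurable
  have "\<exists>g. \<forall>x\<in>?S. (\<lambda>n. f n x) \<longlonglongrightarrow> g x \<and> (g has_derivative (\<lambda>v. (LINT y|lborel. \<omega> y *\<^sub>R smooth_ln_grad 0 (x - y)) \<bullet> v)) (at x within ?S)"
  proof (rule has_derivative_sequence)
    show "(f n has_derivative (\<lambda>v. (LINT y|lborel. \<omega> y *\<^sub>R smooth_ln_grad (d n) (x - y)) \<bullet> v)) (at x within ?S)" for n x
      using fder by (rule has_derivative_at_withinI)
    show "\<forall>\<^sub>F n in sequentially. \<forall>x\<in>?S. \<forall>h. norm ((LINT y|lborel. \<omega> y *\<^sub>R smooth_ln_grad (d n) (x - y)) \<bullet> h - (LINT y|lborel. \<omega> y *\<^sub>R smooth_ln_grad 0 (x - y)) \<bullet> h) \<le> e * norm h" if e: "e > 0" for e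
    proof -
      have "(\<lambda>n. M * eps n) \<longlonglongrightarrow> M * 0" by (intro tendsto_intros eps0)
      then have "\<forall>\<^sub>F n in sequentially. M * eps n < e" using e by (intro order_tendstoD) auto
      then show ?thesis
      proof eventually_elim
        case (elim n)
        show ?case
        proof (intro ballI allI)
          fix x h assume x: "x \<in> ?S"
          have "norm (((LINT y|lborel. \<omega> y *\<^sub>R smooth_ln_grad (d n) (x - y)) - (LINT y|lborel. \<omega> y *\<^sub>R smooth_ln_grad 0 (x - y))) \<bullet> h)
            \<le> norm ((LINT y|lborel. \<omega> y *\<^sub>R smooth_ln_grad (d n) (x - y)) - (LINT y|lborel. \<omega> y *\<^sub>R smooth_ln_grad 0 (x - y))) * norm h"
            using Cauchy_Schwarz_ineq2 by simp
          also have "\<dots> \<le> e * norm h" using Kdiff[OF x, of n] elim by (intro mult_right_mono) auto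
          finally show "norm ((LINT y|lborel. \<omega> y *\<^sub>R smooth_ln_grad (d n) (x - y)) \<bullet> h - (LINT y|lborel. \<omega> y *\<^sub>R smooth_ln_grad 0 (x - y)) \<bullet> h) \<le> e * norm h"
            by (simp add: inner_diff_left)
        qed
      qed
    qed
    show "(\<lambda>n. f n z0) \<longlonglongrightarrow> log_potential \<omega> z0" by (rule flim)
  qed auto
  then obtain g where g: "\<And>x. x \<in> ?S \<Longrightarrow> (\<lambda>n. f n x) \<longlonglongrightarrow> g x" "\<And>x. x \<in> ?S \<Longrightarrow> (g has_derivative (\<lambda>v. (LINT y|lborel. \<omega> y *\<^sub>R smooth_ln_grad 0 (x - y)) \<bullet> v)) (at x within ?S)"
    by blast
  have gl: "g x = log_potential \<omega> x" if "x \<in> ?S" for x using LIMSEQ_unique[OF g(1)[OF that] flim] .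
  have "(log_potential \<omega> has_derivative (\<lambda>v. (LINT y|lborel. \<omega> y *\<^sub>R smooth_ln_grad 0 (z0 - y)) \<bullet> v)) (at z0 within ?S)"
    by (rule has_derivative_transform[OF _ _ g(2)]) (auto simp: gl)
  then show ?thesis unfolding z0_def by (simp add: at_within_open[OF _ open_ball])
qed

lemma log_potential_gradient_bound:
  assumes w: "bounded_density R M \<omega>"
  shows "norm (LINT y|lborel. \<omega> y *\<^sub>R smooth_ln_grad 0 (z - y)) \<le> M * (LINT w|lborel. indicator (cball (0::real^2) (R + norm z)) w * (1 / norm w))"
proof -
  have K0: "norm (smooth_ln_grad 0 w) = 1 / norm w" for w by (simp add: smooth_ln_grad_def power2_eq_square)
  have inv_int: "integrable lborel (\<lambda>w::real^2. indicator (cball 0 (R + norm z)) w * (1 / norm w))"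
    using integrable_inverse_norm_ball[of "R + norm z"] by simp
  have "norm (LINT y|lborel. \<omega> y *\<^sub>R smooth_ln_grad 0 (z - y)) \<le> (LINT y|lborel. norm (\<omega> y *\<^sub>R smooth_ln_grad 0 (z - y)))"
    by (rule integral_norm_bound)
  also have "\<dots> = (LINT y|lborel. \<bar>1 / norm (z - y) * \<omega> y\<bar>)"
    by (intro Bochner_Integration.integral_cong) (auto simp: K0 abs_mult)
  also have "\<dots> \<le> M * (LINT w|lborel. indicator (cball (0::real^2) (R + norm z)) w * \<bar>1 / norm w\<bar>)"
    by (rule integrable_kernel_mult_density(2)[where k="\<lambda>w. 1 / norm w", OF _ inv_int w order_refl]) measurable
  finally show ?thesis by simp
qed

section \<open>A density vanishes on level sets of its potential\<close>

definition stencil :: "real \<Rightarrow> (real^2 \<Rightarrow> real) \<Rightarrow> real^2 \<Rightarrow> real" where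
  "stencil h F z = (\<Sum>j<4. F (z + h *\<^sub>R plane (\<i>^j))) - 4 * F z"

lemma density_integrable:
  assumes "bounded_density R M \<omega>" shows "integrable lborel \<omega>"
  by (rule Bochner_Integration.integrable_bound[OF integrable_indicator_bounded[of 0 R M]])
     (use bounded_densityD(1,4)[OF assms] in \<open>auto simp: mult.commute intro: order_trans[OF _ abs_ge_self]\<close>)

text \<open>Substituting \<open>y = z + h u\<close> in the potential makes the stencil act on \<open>ln |h (u - \<i>\<^sup>j)|\<close>; the four terms
\<open>ln h\<close> of the neighbours cancel against the centre.\<close>

lemma stencil_log_potential:
  assumes w: "bounded_density R M \<omega>" and h: "h > 0"
  shows "stencil h (log_potential \<omega>) z / h\<^sup>2 = (LINT u|lborel. \<omega> (z + h *\<^sub>R u) * stencil_kernel u)"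
proof -
  have [measurable]: "\<omega> \<in> borel_measurable borel" using bounded_densityD(1)[OF w] .
  have "stencil h (log_potential \<omega>) z = (LINT y|lborel. (\<Sum>j<4. ln (norm (z + h *\<^sub>R plane (\<i>^j) - y)) * \<omega> y) - 4 * (ln (norm (z - y)) * \<omega> y))"
    unfolding stencil_def log_potential_def using integrable_log_potential[OF w] by simp
  also have "\<dots> = \<bar>h\<bar>^DIM(real^2) *\<^sub>R (LINT u|lborel. (\<Sum>j<4. ln (norm (z + h *\<^sub>R plane (\<i>^j) - (z + h *\<^sub>R u))) * \<omega> (z + h *\<^sub>R u)) - 4 * (ln (norm (z - (z + h *\<^sub>R u))) * \<omega> (z + h *\<^sub>R u)))"
    using h by (intro integral_lborel_affine) auto
  also have "(LINT u|lborel. (\<Sum>j<4. ln (norm (z + h *\<^sub>R plane (\<i>^j) - (z + h *\<^sub>R u))) * \<omega> (z + h *\<^sub>R u)) - 4 * (ln (norm (z - (z + h *\<^sub>R u))) * \<omega> (z + h *\<^sub>R u)))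
    = (LINT u|lborel. \<omega> (z + h *\<^sub>R u) * stencil_kernel u)"
  proof (rule integral_cong_AE)
    have "AE u in lborel. \<forall>p\<in>insert 0 ((\<lambda>j. plane (\<i>^j)) ` {..<4}). u \<noteq> p"
      by (intro AE_finite_allI) (auto intro: AE_neq_point)
    with AE_stencil_kernel_eq_sum show "AE u in lborel. (\<Sum>j<4. ln (norm (z + h *\<^sub>R plane (\<i>^j) - (z + h *\<^sub>R u))) * \<omega> (z + h *\<^sub>R u)) - 4 * (ln (norm (z - (z + h *\<^sub>R u))) * \<omega> (z + h *\<^sub>R u)) = \<omega> (z + h *\<^sub>R u) * stencil_kernel u"
    proof eventually_elim
      fix u :: "real^2"
      assume k: "stencil_kernel u = (\<Sum>j<4. ln (norm (u - plane (\<i>^j)))) - 4 * ln (norm u)"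
        and ne: "\<forall>p\<in>insert 0 ((\<lambda>j. plane (\<i>^j)) ` {..<4}). u \<noteq> p"
      have 1: "ln (norm (z + h *\<^sub>R plane (\<i>^j) - (z + h *\<^sub>R u))) = ln h + ln (norm (u - plane (\<i>^j)))" if "j < 4" for j
      proof -
        have "z + h *\<^sub>R plane (\<i>^j) - (z + h *\<^sub>R u) = - (h *\<^sub>R (u - plane (\<i>^j)))" by (simp add: algebra_simps)
        then have "norm (z + h *\<^sub>R plane (\<i>^j) - (z + h *\<^sub>R u)) = h * norm (u - plane (\<i>^j))" using h by simp
        moreover have "norm (u - plane (\<i>^j)) > 0" using ne that by auto
        ultimately show ?thesis using h by (simp add: ln_mult)
      qed
      have 2: "ln (norm (z - (z + h *\<^sub>R u))) = ln h + ln (norm u)" using h ne by (simp add: ln_mult)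
      have "(\<Sum>j<4. ln (norm (z + h *\<^sub>R plane (\<i>^j) - (z + h *\<^sub>R u))) * \<omega> (z + h *\<^sub>R u)) = (\<Sum>j<4. (ln h + ln (norm (u - plane (\<i>^j)))) * \<omega> (z + h *\<^sub>R u))"
        by (intro sum.cong) (use 1 in auto)
      also have "\<dots> = 4 * ln h * \<omega> (z + h *\<^sub>R u) + (\<Sum>j<4. ln (norm (u - plane (\<i>^j)))) * \<omega> (z + h *\<^sub>R u)"
        by (simp add: distrib_right sum.distrib sum_distrib_right)
      finally show "(\<Sum>j<4. ln (norm (z + h *\<^sub>R plane (\<i>^j) - (z + h *\<^sub>R u))) * \<omega> (z + h *\<^sub>R u)) - 4 * (ln (norm (z - (z + h *\<^sub>R u))) * \<omega> (z + h *\<^sub>R u)) = \<omega> (z + h *\<^sub>R u) * stencil_kernel u"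
        unfolding 2 k by (simp add: algebra_simps)
    qed
  qed measurable
  finally show ?thesis using h by simp
qed

text \<open>By the previous formula the difference is \<open>\<integral> (\<omega>(z + h u) - \<omega>(z)) k(u) du\<close>. Its \<open>L\<^sup>1\<close> norm is at most
\<open>\<integral> T(h u) |k(u)| du\<close>, where \<open>T(v)\<close> is the \<open>L\<^sup>1\<close> norm of \<open>\<omega>(\<cdot> + v) - \<omega>\<close>, and this tends to zero by
continuity of translations.\<close>

lemma stencil_log_potential_L1:
  assumes w: "bounded_density R M \<omega>" and h: "\<And>n. h n > 0" "h \<longlonglongrightarrow> 0"
  shows "integrable lborel (\<lambda>z. stencil (h n) (log_potential \<omega>) z / (h n)\<^sup>2 - (LINT u|lborel. stencil_kernel u) * \<omega> z)"
    "(\<lambda>n. LINT z|lborel. \<bar>stencil (h n) (log_potential \<omega>) z / (h n)\<^sup>2 - (LINT u|lborel. stencil_kernel u) * \<omega> z\<bar>) \<longlonglongrightarrow> 0"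
proof -
  have [measurable]: "\<omega> \<in> borel_measurable borel" using bounded_densityD(1)[OF w] .
  have iw: "integrable lborel \<omega>" by (rule density_integrable[OF w])
  define c where "c = (LINT u|lborel. stencil_kernel u)"
  define T where "T v = (LINT z|lborel. \<bar>\<omega> (z + v) - \<omega> z\<bar>)" for v
  define B where "B = (LINT z|lborel. \<bar>\<omega> z\<bar>)"
  note shift = integral_shift[where 'a="real^2" and 'b=real] integrable_shift_iff[where 'a="real^2" and 'b=real]
  have iT: "integrable lborel (\<lambda>z. \<bar>\<omega> (z + v) - \<omega> z\<bar>)" for v using shift(2)[of \<omega> v] iw by auto
  have T0: "0 \<le> T v" for v unfolding T_def by (rule Bochner_Integration.integral_nonneg) simp
  have TB: "T v \<le> 2 * B" for v
  proof -
    have "T v \<le> (LINT z|lborel. \<bar>\<omega> (z + v)\<bar> + \<bar>\<omega> z\<bar>)" unfolding T_def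
      by (intro integral_mono iT) (use shift(2)[of \<omega> v] iw in auto)
    also have "\<dots> = (LINT z|lborel. \<bar>\<omega> (z + v)\<bar>) + B" using shift(2)[of \<omega> v] iw unfolding B_def by simp
    also have "(LINT z|lborel. \<bar>\<omega> (z + v)\<bar>) = B" using shift(1)[of "\<lambda>z. \<bar>\<omega> z\<bar>" v] unfolding B_def .
    finally show ?thesis by simp
  qed
  have Tm [measurable]: "T \<in> borel_measurable borel" unfolding T_def by measurable
  define D where "D n z = stencil (h n) (log_potential \<omega>) z / (h n)\<^sup>2 - c * \<omega> z" for n z
  have ik: "integrable lborel (\<lambda>u. \<omega> (z + v *\<^sub>R u) * stencil_kernel u)" for z v
  proof (rule Bochner_Integration.integrable_bound[OF integrable_mult_right[OF integrable_abs[OF integrable_stencil_kernel], of M]])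
    show "AE u in lborel. norm (\<omega> (z + v *\<^sub>R u) * stencil_kernel u) \<le> norm (M * \<bar>stencil_kernel u\<bar>)"
      using bounded_densityD(2,5)[OF w] by (auto simp: abs_mult intro!: mult_right_mono)
  qed measurable
  have Deq: "D n z = (LINT u|lborel. (\<omega> (z + h n *\<^sub>R u) - \<omega> z) * stencil_kernel u)" for n z
  proof -
    have "D n z = (LINT u|lborel. \<omega> (z + h n *\<^sub>R u) * stencil_kernel u) - (LINT u|lborel. \<omega> z * stencil_kernel u)"
      unfolding D_def stencil_log_potential[OF w h(1)] c_def by simp
    then show ?thesis using ik[of z "h n"] integrable_stencil_kernel by (simp add: left_diff_distrib)
  qed
  have Dm [measurable]: "D n \<in> borel_measurable borel" for n unfolding Deq by measurable
  have nn: "(\<integral>\<^sup>+ z. ennreal \<bar>D n z\<bar> \<partial>lborel) \<le> ennreal (LINT u|lborel. T (h n *\<^sub>R u) * \<bar>stencil_kernel u\<bar>)"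
    and iTk: "integrable lborel (\<lambda>u. T (h n *\<^sub>R u) * \<bar>stencil_kernel u\<bar>)" for n
  proof -
    show iTk: "integrable lborel (\<lambda>u. T (h n *\<^sub>R u) * \<bar>stencil_kernel u\<bar>)"
    proof (rule Bochner_Integration.integrable_bound[OF integrable_mult_right[OF integrable_abs[OF integrable_stencil_kernel], of "2 * B"]])
      show "AE u in lborel. norm (T (h n *\<^sub>R u) * \<bar>stencil_kernel u\<bar>) \<le> norm (2 * B * \<bar>stencil_kernel u\<bar>)"
      proof (rule AE_I2)
        fix u
        have "\<bar>T (h n *\<^sub>R u)\<bar> \<le> \<bar>2 * B\<bar>" using T0[of "h n *\<^sub>R u"] TB[of "h n *\<^sub>R u"] by linarith
        from mult_right_mono[OF this, of "\<bar>stencil_kernel u\<bar>"] show "norm (T (h n *\<^sub>R u) * \<bar>stencil_kernel u\<bar>) \<le> norm (2 * B * \<bar>stencil_kernel u\<bar>)"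
          by (simp add: abs_mult)
      qed
    qed measurable
    have "(\<integral>\<^sup>+ z. ennreal \<bar>D n z\<bar> \<partial>lborel) \<le> (\<integral>\<^sup>+ z. (\<integral>\<^sup>+ u. ennreal (\<bar>\<omega> (z + h n *\<^sub>R u) - \<omega> z\<bar> * \<bar>stencil_kernel u\<bar>) \<partial>lborel) \<partial>lborel)"
    proof (rule nn_integral_mono)
      fix z
      have "ennreal \<bar>D n z\<bar> \<le> (\<integral>\<^sup>+ u. norm ((\<omega> (z + h n *\<^sub>R u) - \<omega> z) * stencil_kernel u) \<partial>lborel)"
        unfolding Deq real_norm_def[symmetric]
        by (rule integral_norm_bound_ennreal) (use ik[of z "h n"] integrable_stencil_kernel in \<open>simp add: left_diff_distrib\<close>)
      then show "ennreal \<bar>D n z\<bar> \<le> (\<integral>\<^sup>+ u. ennreal (\<bar>\<omega> (z + h n *\<^sub>R u) - \<omega> z\<bar> * \<bar>stencil_kernel u\<bar>) \<partial>lborel)"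
        by (simp add: abs_mult)
    qed
    also have "\<dots> = (\<integral>\<^sup>+ u. (\<integral>\<^sup>+ z. ennreal (\<bar>\<omega> (z + h n *\<^sub>R u) - \<omega> z\<bar> * \<bar>stencil_kernel u\<bar>) \<partial>lborel) \<partial>lborel)"
      by (rule lborel_pair.Fubini'[symmetric]) measurable
    also have "\<dots> = (\<integral>\<^sup>+ u. ennreal (T (h n *\<^sub>R u) * \<bar>stencil_kernel u\<bar>) \<partial>lborel)"
    proof (rule nn_integral_cong)
      fix u
      have "(\<integral>\<^sup>+ z. ennreal (\<bar>\<omega> (z + h n *\<^sub>R u) - \<omega> z\<bar> * \<bar>stencil_kernel u\<bar>) \<partial>lborel) = ennreal (LINT z|lborel. \<bar>\<omega> (z + h n *\<^sub>R u) - \<omega> z\<bar> * \<bar>stencil_kernel u\<bar>)"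
        by (rule nn_integral_eq_integral) (use iT in auto)
      then show "(\<integral>\<^sup>+ z. ennreal (\<bar>\<omega> (z + h n *\<^sub>R u) - \<omega> z\<bar> * \<bar>stencil_kernel u\<bar>) \<partial>lborel) = ennreal (T (h n *\<^sub>R u) * \<bar>stencil_kernel u\<bar>)"
        unfolding T_def by simp
    qed
    also have "\<dots> = ennreal (LINT u|lborel. T (h n *\<^sub>R u) * \<bar>stencil_kernel u\<bar>)"
      by (rule nn_integral_eq_integral[OF iTk]) (auto intro!: AE_I2 mult_nonneg_nonneg T0)
    finally show "(\<integral>\<^sup>+ z. ennreal \<bar>D n z\<bar> \<partial>lborel) \<le> ennreal (LINT u|lborel. T (h n *\<^sub>R u) * \<bar>stencil_kernel u\<bar>)" .
  qed
  have iD: "integrable lborel (D n)" for n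
  proof (rule integrableI_bounded)
    show "(\<integral>\<^sup>+ z. ennreal (norm (D n z)) \<partial>lborel) < \<infinity>" using le_less_trans[OF nn[of n] ennreal_less_top] by simp
  qed measurable
  then show "integrable lborel (\<lambda>z. stencil (h n) (log_potential \<omega>) z / (h n)\<^sup>2 - (LINT u|lborel. stencil_kernel u) * \<omega> z)"
    unfolding D_def c_def .
  have up: "(LINT z|lborel. \<bar>D n z\<bar>) \<le> (LINT u|lborel. T (h n *\<^sub>R u) * \<bar>stencil_kernel u\<bar>)" for n
  proof -
    have "ennreal (LINT z|lborel. \<bar>D n z\<bar>) = (\<integral>\<^sup>+ z. ennreal \<bar>D n z\<bar> \<partial>lborel)"
      by (rule nn_integral_eq_integral[symmetric]) (use iD in auto)
    with nn[of n] have "ennreal (LINT z|lborel. \<bar>D n z\<bar>) \<le> ennreal (LINT u|lborel. T (h n *\<^sub>R u) * \<bar>stencil_kernel u\<bar>)" by simp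
    moreover have "0 \<le> (LINT u|lborel. T (h n *\<^sub>R u) * \<bar>stencil_kernel u\<bar>)"
      by (intro Bochner_Integration.integral_nonneg mult_nonneg_nonneg T0) simp
    ultimately show ?thesis by (simp only: ennreal_le_iff)
  qed
  have "(\<lambda>n. LINT u|lborel. T (h n *\<^sub>R u) * \<bar>stencil_kernel u\<bar>) \<longlonglongrightarrow> integral\<^sup>L lborel (\<lambda>u::real^2. 0::real)"
  proof (rule integral_dominated_convergence[where w="\<lambda>u. 2 * B * \<bar>stencil_kernel u\<bar>"])
    show "AE u in lborel. (\<lambda>n. T (h n *\<^sub>R u) * \<bar>stencil_kernel u\<bar>) \<longlonglongrightarrow> 0"
    proof (rule AE_I2)
      fix u :: "real^2"
      have "(\<lambda>n. h n *\<^sub>R u) \<longlonglongrightarrow> 0 *\<^sub>R u" by (intro tendsto_intros h)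
      then have "(\<lambda>n. T (h n *\<^sub>R u)) \<longlonglongrightarrow> 0" unfolding T_def by (intro L1_translation_continuous iw) simp
      then show "(\<lambda>n. T (h n *\<^sub>R u) * \<bar>stencil_kernel u\<bar>) \<longlonglongrightarrow> 0" by (rule tendsto_mult_left_zero)
    qed
    show "AE u in lborel. norm (T (h n *\<^sub>R u) * \<bar>stencil_kernel u\<bar>) \<le> 2 * B * \<bar>stencil_kernel u\<bar>" for n
      using T0 TB by (auto simp: abs_mult intro!: AE_I2 mult_right_mono)
  qed (use integrable_stencil_kernel in \<open>measurable, auto\<close>)
  then have lim: "(\<lambda>n. LINT u|lborel. T (h n *\<^sub>R u) * \<bar>stencil_kernel u\<bar>) \<longlonglongrightarrow> 0" by simp
  have "(\<lambda>n. LINT z|lborel. \<bar>D n z\<bar>) \<longlonglongrightarrow> 0"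
    by (rule tendsto_sandwich[OF _ _ tendsto_const lim]) (use up in \<open>auto intro!: always_eventually Bochner_Integration.integral_nonneg\<close>)
  then show "(\<lambda>n. LINT z|lborel. \<bar>stencil (h n) (log_potential \<omega>) z / (h n)\<^sup>2 - (LINT u|lborel. stencil_kernel u) * \<omega> z\<bar>) \<longlonglongrightarrow> 0"
    unfolding D_def c_def .
qed

text \<open>Both the discrete Laplacian of the potential and the indicators of the shifted sets \<open>S + h \<i>\<^sup>j\<close> converge
in \<open>L\<^sup>1\<close>, so along a common subsequence they converge almost everywhere. For almost every \<open>z \<in> S\<close> all
stencil points then lie in \<open>S\<close> eventually, where the stencil applied to the constant \<open>b\<close> is zero; with
the assumption on \<open>V\<close> the multiple of \<open>\<omega> z\<close> in the limit must vanish.\<close>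

lemma density_zero_on_level_set:
  assumes w: "bounded_density R M \<omega>" and S [measurable]: "S \<in> sets borel" and fin: "emeasure lborel S < \<infinity>"
    and F: "\<And>z. z \<in> S \<Longrightarrow> \<alpha> * log_potential \<omega> z + V z = b" and \<alpha>: "\<alpha> \<noteq> 0"
    and V: "\<And>z. z \<in> S \<Longrightarrow> (\<lambda>n. stencil (inverse (Suc n)) V z / (inverse (Suc n))\<^sup>2) \<longlonglongrightarrow> 0"
  shows "AE z in lborel. z \<in> S \<longrightarrow> \<omega> z = 0"
proof -
  define h where "h n = inverse (real (Suc n))" for n
  have h: "h n > 0" "h \<longlonglongrightarrow> 0" for n
    unfolding h_def using LIMSEQ_inverse_real_of_nat by auto
  define c where "c = (LINT u|lborel. stencil_kernel u)"
  have c: "c > 0" using stencil_kernel_integral_pos by (simp add: c_def)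
  have [measurable]: "\<omega> \<in> borel_measurable borel" using bounded_densityD(1)[OF w] .
  have iS: "integrable lborel (indicator S :: real^2 \<Rightarrow> real)" using fin by auto
  note shift = integrable_shift_iff[where 'a="real^2" and 'b=real]
  have iSh: "integrable lborel (\<lambda>z. \<bar>indicator S (z + v) - indicator S z :: real\<bar>)" for v
    using shift[of "indicator S" v] iS by auto
  define D where "D n z = \<bar>stencil (h n) (log_potential \<omega>) z / (h n)\<^sup>2 - c * \<omega> z\<bar>" for n z
  (* At a point of S this counts the stencil points outside S. *)
  define E where "E n z = (\<Sum>j<4. \<bar>indicator S (z + h n *\<^sub>R plane (\<i>^j)) - indicator S z\<bar> :: real)" for n z
  have iD: "integrable lborel (D n)" for n unfolding D_def c_def by (intro integrable_abs stencil_log_potential_L1(1)[OF w h])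
  have iE: "integrable lborel (E n)" for n unfolding E_def by (intro Bochner_Integration.integrable_sum iSh)
  have E0: "0 \<le> E n z" for n z unfolding E_def by (intro sum_nonneg) auto
  have D0: "0 \<le> D n z" for n z unfolding D_def by auto
  have "(\<lambda>n. LINT z|lborel. norm (D n z + E n z)) \<longlonglongrightarrow> 0 + (\<Sum>j<(4::nat). 0)"
  proof -
    have "(LINT z|lborel. norm (D n z + E n z)) = (LINT z|lborel. D n z) + (\<Sum>j<4. LINT z|lborel. \<bar>indicator S (z + h n *\<^sub>R plane (\<i>^j)) - indicator S z\<bar>)" for n
    proof -
      have "(LINT z|lborel. norm (D n z + E n z)) = (LINT z|lborel. D n z + E n z)"
        using D0 E0 by (intro Bochner_Integration.integral_cong) auto
      also have "\<dots> = (LINT z|lborel. D n z) + (LINT z|lborel. E n z)" using iD iE by simp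
      also have "(LINT z|lborel. E n z) = (\<Sum>j<4. LINT z|lborel. \<bar>indicator S (z + h n *\<^sub>R plane (\<i>^j)) - indicator S z\<bar>)"
        unfolding E_def using iSh by (intro Bochner_Integration.integral_sum) auto
      finally show ?thesis .
    qed
    moreover have "(\<lambda>n. LINT z|lborel. D n z) \<longlonglongrightarrow> 0" unfolding D_def c_def by (rule stencil_log_potential_L1(2)[OF w h])
    moreover have "(\<lambda>n. LINT z|lborel. \<bar>indicator S (z + h n *\<^sub>R plane (\<i>^j)) - indicator S z :: real\<bar>) \<longlonglongrightarrow> 0" for j
    proof (rule L1_translation_continuous[OF iS])
      have "(\<lambda>n. h n *\<^sub>R plane (\<i>^j)) \<longlonglongrightarrow> 0 *\<^sub>R plane (\<i>^j)" by (intro tendsto_intros h)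
      then show "(\<lambda>n. h n *\<^sub>R plane (\<i>^j)) \<longlonglongrightarrow> 0" by simp
    qed
    ultimately show ?thesis by (simp only:) (intro tendsto_add tendsto_sum)
  qed
  then have "(\<lambda>n. LINT z|lborel. norm (D n z + E n z)) \<longlonglongrightarrow> 0" by simp
  from tendsto_L1_AE_subseq[OF _ this] iD iE obtain r where r: "strict_mono (r :: nat \<Rightarrow> nat)"
    and AE: "AE z in lborel. (\<lambda>n. D (r n) z + E (r n) z) \<longlonglongrightarrow> 0" by auto
  show ?thesis using AE
  proof (rule eventually_mono, intro impI)
    fix z assume lim: "(\<lambda>n. D (r n) z + E (r n) z) \<longlonglongrightarrow> 0" and z: "z \<in> S"
    have limD: "(\<lambda>n. D (r n) z) \<longlonglongrightarrow> 0"
      by (rule tendsto_sandwich[OF _ _ tendsto_const lim]) (use D0 E0 in auto)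
    have "\<forall>\<^sub>F n in sequentially. D (r n) z + E (r n) z < 1" using lim by (intro order_tendstoD) auto
    then have ev: "\<forall>\<^sub>F n in sequentially. \<alpha> * (stencil (h (r n)) (log_potential \<omega>) z / (h (r n))\<^sup>2) = - (stencil (h (r n)) V z / (h (r n))\<^sup>2)"
    proof eventually_elim
      case (elim n)
      have inS: "z + h (r n) *\<^sub>R plane (\<i>^j) \<in> S" if "j < 4" for j
      proof (rule ccontr)
        assume "z + h (r n) *\<^sub>R plane (\<i>^j) \<notin> S"
        then have "1 = \<bar>indicator S (z + h (r n) *\<^sub>R plane (\<i>^j)) - indicator S z :: real\<bar>" using z by simp
        also have "\<dots> \<le> E (r n) z" unfolding E_def using that by (intro member_le_sum) auto
        finally show False using elim D0[of "r n" z] by linarith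
      qed
      have "\<alpha> * stencil (h (r n)) (log_potential \<omega>) z + stencil (h (r n)) V z
        = (\<Sum>j<4. \<alpha> * log_potential \<omega> (z + h (r n) *\<^sub>R plane (\<i>^j)) + V (z + h (r n) *\<^sub>R plane (\<i>^j))) - 4 * (\<alpha> * log_potential \<omega> z + V z)"
        unfolding stencil_def by (simp add: sum.distrib sum_distrib_left algebra_simps)
      also have "\<dots> = 0" using F[OF z] F[OF inS] by simp
      finally have "\<alpha> * stencil (h (r n)) (log_potential \<omega>) z = - stencil (h (r n)) V z" by simp
      then show ?case by simp
    qed
    have "(\<lambda>n. stencil (h n) V z / (h n)\<^sup>2) \<longlonglongrightarrow> 0" using V[OF z] unfolding h_def .
    from LIMSEQ_subseq_LIMSEQ[OF this r] have "(\<lambda>n. - (stencil (h (r n)) V z / (h (r n))\<^sup>2)) \<longlonglongrightarrow> - 0"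
      unfolding comp_def by (rule tendsto_minus)
    with ev have 1: "(\<lambda>n. \<alpha> * (stencil (h (r n)) (log_potential \<omega>) z / (h (r n))\<^sup>2)) \<longlonglongrightarrow> 0"
      by (simp add: tendsto_cong)
    have "(\<lambda>n. stencil (h (r n)) (log_potential \<omega>) z / (h (r n))\<^sup>2 - c * \<omega> z) \<longlonglongrightarrow> 0"
      using limD unfolding D_def by (rule tendsto_rabs_zero_cancel)
    then have "(\<lambda>n. stencil (h (r n)) (log_potential \<omega>) z / (h (r n))\<^sup>2) \<longlonglongrightarrow> c * \<omega> z" by (rule LIM_zero_cancel)
    then have "(\<lambda>n. \<alpha> * (stencil (h (r n)) (log_potential \<omega>) z / (h (r n))\<^sup>2)) \<longlonglongrightarrow> \<alpha> * (c * \<omega> z)" by (intro tendsto_intros)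
    from LIMSEQ_unique[OF this 1] show "\<omega> z = 0" using \<alpha> c by simp
  qed
qed

section \<open>Harmonic functions\<close>

lemma Ck_on_2:
  "Ck_on 2 S f \<longleftrightarrow> (\<forall>x\<in>S. f differentiable (at x)) \<and>
    (\<forall>i\<in>Basis. (\<forall>x\<in>S. partial i f differentiable (at x)) \<and> (\<forall>j\<in>Basis. continuous_on S (partial j (partial i f))))"
  by (auto simp: numeral_2_eq_2)

lemma partial_has_real_derivative:
  assumes "f differentiable (at (p + t *\<^sub>R i))"
  shows "((\<lambda>s. f (p + s *\<^sub>R i)) has_real_derivative partial i f (p + t *\<^sub>R i)) (at t)"
proof -
  have "(f has_derivative frechet_derivative f (at (p + t *\<^sub>R i))) (at (p + t *\<^sub>R i))"
    using assms by (simp add: frechet_derivative_works)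
  moreover have "((\<lambda>s. p + s *\<^sub>R i) has_derivative (\<lambda>s. s *\<^sub>R i)) (at t)"
    by (auto intro!: derivative_eq_intros)
  ultimately have "((\<lambda>s. f (p + s *\<^sub>R i)) has_derivative (\<lambda>s. frechet_derivative f (at (p + t *\<^sub>R i)) (s *\<^sub>R i))) (at t)"
    by (rule has_derivative_compose[rotated])
  moreover have "frechet_derivative f (at (p + t *\<^sub>R i)) (s *\<^sub>R i) = partial i f (p + t *\<^sub>R i) * s" for s
    using linear_scale[OF linear_frechet_derivative[OF assms]] by (simp add: partial_def)
  ultimately show ?thesis by (simp add: has_field_derivative_def)
qed

lemma second_derivative_local_max:
  fixes g g' :: "real \<Rightarrow> real"
  assumes d: "d > 0" and g: "\<And>t. \<bar>t\<bar> < d \<Longrightarrow> (g has_real_derivative g' t) (at t)"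
    and g2: "(g' has_real_derivative l) (at 0)"
    and max: "\<And>t. \<bar>t\<bar> < d \<Longrightarrow> g t \<le> g 0"
  shows "l \<le> 0"
proof (rule ccontr)
  assume "\<not> l \<le> 0"
  then have l: "0 < l" by simp
  have z: "g' 0 = 0" by (rule DERIV_local_max[OF g[of 0] d]) (use d max in auto)
  obtain e where e: "e > 0" "\<And>h. h > 0 \<Longrightarrow> h < e \<Longrightarrow> 0 < g' h"
    using DERIV_pos_inc_right[OF g2 l] z by auto
  define t where "t = min d e / 2"
  have t: "0 < t" "t < d" "t < e" using d e by (auto simp: t_def)
  obtain s where s: "0 < s" "s < t" "g t - g 0 = (t - 0) * g' s"
    using MVT2[of 0 t g g'] t g by auto
  then have "g t > g 0" using e(2)[of s] t by (smt (verit) mult_pos_pos)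
  then show False using max[of t] t by simp
qed

text \<open>If \<open>u x > 0\<close>, then \<open>u + \<epsilon> |y|\<^sup>2\<close> with small \<open>\<epsilon>\<close> has an interior maximum, although its Laplacian is
positive there.\<close>

lemma weak_maximum_principle:
  fixes D :: "'a::euclidean_space set"
  assumes D: "open D" "bounded D" and u: "harmonic_on D u"
    and bd: "\<And>z e. z \<in> frontier D \<Longrightarrow> e > 0 \<Longrightarrow> \<forall>\<^sub>F y in at z within D. u y < e"
    and x: "x \<in> D"
  shows "u x \<le> 0"
proof (rule ccontr)
  assume "\<not> u x \<le> 0"
  then have m: "u x > 0" by simp
  have du: "\<And>y. y \<in> D \<Longrightarrow> u differentiable (at y)"
    and du2: "\<And>y i. y \<in> D \<Longrightarrow> i \<in> Basis \<Longrightarrow> partial i u differentiable (at y)"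
    and lap: "\<And>y. y \<in> D \<Longrightarrow> laplacian u y = 0"
    using u by (auto simp: harmonic_on_def Ck_on_2)
  have cont: "continuous_on D u"
    using du by (meson differentiable_imp_continuous_within continuous_at_imp_continuous_on)
  obtain B where B: "B > 0" "\<And>y. y \<in> D \<Longrightarrow> norm y \<le> B" using D(2) bounded_pos by blast
  (* With this choice the perturbation is below u x / 2 on D, so points with u < u x / 2 cannot
     compete with x and the maximum over the compact set K is one over D. *)
  define \<epsilon> where "\<epsilon> = u x / (4 * B\<^sup>2)"
  have \<epsilon>: "\<epsilon> > 0" "\<epsilon> * B\<^sup>2 < u x / 2" using m B by (auto simp: \<epsilon>_def field_simps)
  define K where "K = {y\<in>D. u y \<ge> u x / 2}"
  have "closed K"
    unfolding closed_sequential_limits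
  proof (intro allI impI, elim conjE)
    fix X l assume X: "\<forall>n. X n \<in> K" and l: "X \<longlonglongrightarrow> l"
    have lc: "l \<in> closure D" using X l unfolding K_def closure_sequential by blast
    have "l \<in> D"
    proof (rule ccontr)
      assume n: "l \<notin> D"
      then have "l \<in> frontier D" using lc D(1) by (simp add: frontier_def interior_open)
      then have "\<forall>\<^sub>F y in at l within D. u y < u x / 2" using bd[of l "u x / 2"] m by linarith
      moreover have "filterlim X (at l within D) sequentially"
        unfolding filterlim_at using l X n by (auto simp: K_def intro!: always_eventually)
      ultimately have "\<forall>\<^sub>F n in sequentially. u (X n) < u x / 2" by (rule eventually_compose_filterlim)
      then obtain N where "\<forall>n\<ge>N. u (X n) < u x / 2" by (auto simp: eventually_sequentially)
      then have "u (X N) < u x / 2" by blast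
      moreover have "X N \<in> K" using X by blast
      ultimately show False by (auto simp: K_def)
    qed
    moreover have lim: "(\<lambda>n. u (X n)) \<longlonglongrightarrow> u l"
      by (rule continuous_on_tendsto_compose[OF cont l calculation]) (use X in \<open>auto simp: K_def\<close>)
    moreover have "u x / 2 \<le> u l"
      by (rule LIMSEQ_le_const[OF lim]) (use X in \<open>auto simp: K_def\<close>)
    ultimately show "l \<in> K" by (simp add: K_def)
  qed
  then have "compact K" using D(2) by (auto simp: compact_eq_bounded_closed K_def intro: bounded_subset)
  moreover have "x \<in> K" using x m by (auto simp: K_def)
  moreover have "continuous_on K (\<lambda>y. u y + \<epsilon> * (y \<bullet> y))"
    by (intro continuous_intros continuous_on_subset[OF cont]) (auto simp: K_def)
  ultimately obtain p where p: "p \<in> K" and pm: "\<And>y. y \<in> K \<Longrightarrow> u y + \<epsilon> * (y \<bullet> y) \<le> u p + \<epsilon> * (p \<bullet> p)"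
    using continuous_attains_sup[of K "\<lambda>y. u y + \<epsilon> * (y \<bullet> y)"] by auto
  have pD: "p \<in> D" using p by (simp add: K_def)
  have gmax: "u y + \<epsilon> * (y \<bullet> y) \<le> u p + \<epsilon> * (p \<bullet> p)" if y: "y \<in> D" for y
  proof (cases "y \<in> K")
    case False
    then have "u y < u x / 2" using y by (auto simp: K_def)
    moreover have "\<epsilon> * (y \<bullet> y) \<le> \<epsilon> * B\<^sup>2"
      using \<epsilon>(1) B(2)[OF y] by (intro mult_left_mono) (auto simp: power2_norm_eq_inner[symmetric] power_mono)
    moreover have "0 \<le> \<epsilon> * (x \<bullet> x)" using \<epsilon> by simp
    ultimately show ?thesis using pm[OF \<open>x \<in> K\<close>] \<epsilon>(2) by linarith
  qed (rule pm)
  obtain d where d: "d > 0" "ball p d \<subseteq> D" using D(1) pD open_contains_ball by blast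
  have "partial i (partial i u) p + 2 * \<epsilon> \<le> 0" if i: "i \<in> Basis" for i
  proof (rule second_derivative_local_max[where d=d and g="\<lambda>t. u (p + t *\<^sub>R i) + \<epsilon> * ((p + t *\<^sub>R i) \<bullet> (p + t *\<^sub>R i))"
      and g'="\<lambda>t. partial i u (p + t *\<^sub>R i) + \<epsilon> * (2 * (p \<bullet> i) + 2 * t)"])
    have inD: "p + t *\<^sub>R i \<in> D" if "\<bar>t\<bar> < d" for t
      using d(2) that i by (auto simp: dist_norm subset_iff)
    have sq: "(p + t *\<^sub>R i) \<bullet> (p + t *\<^sub>R i) = p \<bullet> p + 2 * t * (p \<bullet> i) + t\<^sup>2" for t
      using i by (simp add: inner_simps inner_commute algebra_simps power2_eq_square)
    show "((\<lambda>t. u (p + t *\<^sub>R i) + \<epsilon> * ((p + t *\<^sub>R i) \<bullet> (p + t *\<^sub>R i))) has_real_derivative partial i u (p + t *\<^sub>R i) + \<epsilon> * (2 * (p \<bullet> i) + 2 * t)) (at t)"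
      if "\<bar>t\<bar> < d" for t
      unfolding sq by (rule DERIV_add[OF partial_has_real_derivative[OF du[OF inD[OF that]]]]) (auto intro!: derivative_eq_intros)
    have "((\<lambda>t. partial i u (p + t *\<^sub>R i)) has_real_derivative partial i (partial i u) (p + 0 *\<^sub>R i)) (at 0)"
      by (rule partial_has_real_derivative) (use du2[OF pD i] in simp)
    then show "((\<lambda>t. partial i u (p + t *\<^sub>R i) + \<epsilon> * (2 * (p \<bullet> i) + 2 * t)) has_real_derivative partial i (partial i u) p + 2 * \<epsilon>) (at 0)"
      by (auto intro!: derivative_eq_intros)
    show "u (p + t *\<^sub>R i) + \<epsilon> * ((p + t *\<^sub>R i) \<bullet> (p + t *\<^sub>R i)) \<le> u (p + 0 *\<^sub>R i) + \<epsilon> * ((p + 0 *\<^sub>R i) \<bullet> (p + 0 *\<^sub>R i))" if "\<bar>t\<bar> < d" for t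
      using gmax[OF inD[OF that]] by simp
  qed (use d in auto)
  then have "(\<Sum>i\<in>(Basis::'a set). partial i (partial i u) p + 2 * \<epsilon>) \<le> 0" by (rule sum_nonpos)
  then have "laplacian u p + 2 * \<epsilon> * DIM('a) \<le> 0" by (simp add: sum.distrib laplacian_def mult.commute)
  moreover have "2 * \<epsilon> * DIM('a) > 0" using \<epsilon> by simp
  ultimately show False using lap[OF pD] by linarith
qed

lemma has_derivative_imp_partial:
  assumes "(f has_derivative f') (at x)" shows "partial i f x = f' i"
  using frechet_derivative_at[OF assms] by (simp add: partial_def)

lemma harmonic_on_by_derivatives:
  fixes u :: "'a::euclidean_space \<Rightarrow> real"
  assumes D: "open D"
    and 1: "\<And>y. y \<in> D \<Longrightarrow> (u has_derivative (\<lambda>v. ua v y)) (at y)"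
    and 2: "\<And>y i. y \<in> D \<Longrightarrow> i \<in> Basis \<Longrightarrow> (ua i has_derivative (\<lambda>v. ub i v y)) (at y)"
    and c: "\<And>i j. i \<in> Basis \<Longrightarrow> j \<in> Basis \<Longrightarrow> continuous_on D (ub i j)"
    and l: "\<And>y. y \<in> D \<Longrightarrow> (\<Sum>i\<in>Basis. ub i i y) = 0"
  shows "harmonic_on D u"
proof -
  have p1: "partial i u y = ua i y" if "y \<in> D" for y i using has_derivative_imp_partial[OF 1[OF that]] .
  have d2: "(partial i u has_derivative (\<lambda>v. ub i v y)) (at y)" if "y \<in> D" "i \<in> Basis" for y i
    by (rule has_derivative_transform_within_open[OF 2[OF that] D that(1)]) (simp add: p1)
  have p2: "partial j (partial i u) y = ub i j y" if "y \<in> D" "i \<in> Basis" for i j y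
    using has_derivative_imp_partial[OF d2[OF that]] .
  show ?thesis
    unfolding harmonic_on_def Ck_on_2 laplacian_def
    using 1 d2 c l p2 by (auto simp: differentiable_def cong: continuous_on_cong)
qed

lemma harmonic_on_diff:
  fixes u v :: "'a::euclidean_space \<Rightarrow> real"
  assumes D: "open D" and u: "harmonic_on D u" and v: "harmonic_on D v"
  shows "harmonic_on D (\<lambda>y. a * u y - b * v y + c)"
proof (rule harmonic_on_by_derivatives[OF D, where ua="\<lambda>i y. a * frechet_derivative u (at y) i - b * frechet_derivative v (at y) i"
      and ub="\<lambda>i j y. a * frechet_derivative (partial i u) (at y) j - b * frechet_derivative (partial i v) (at y) j"])
  note H = u[unfolded harmonic_on_def Ck_on_2] v[unfolded harmonic_on_def Ck_on_2]
  show "((\<lambda>y. a * u y - b * v y + c) has_derivative (\<lambda>w. a * frechet_derivative u (at y) w - b * frechet_derivative v (at y) w)) (at y)" if "y \<in> D" for y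
    using H that by (auto intro!: derivative_eq_intros simp: frechet_derivative_works[symmetric])
  show "((\<lambda>y. a * frechet_derivative u (at y) i - b * frechet_derivative v (at y) i) has_derivative
    (\<lambda>w. a * frechet_derivative (partial i u) (at y) w - b * frechet_derivative (partial i v) (at y) w)) (at y)" if "y \<in> D" "i \<in> Basis" for y i
  proof -
    have d: "(partial i u has_derivative frechet_derivative (partial i u) (at y)) (at y)" "(partial i v has_derivative frechet_derivative (partial i v) (at y)) (at y)"
      using H that by (auto simp: frechet_derivative_works[symmetric])
    have "((\<lambda>y. a * partial i u y - b * partial i v y) has_derivative
      (\<lambda>w. a * frechet_derivative (partial i u) (at y) w - b * frechet_derivative (partial i v) (at y) w)) (at y)"
      by (intro has_derivative_diff has_derivative_mult_right d)
    moreover have "(\<lambda>y. a * partial i u y - b * partial i v y) = (\<lambda>y. a * frechet_derivative u (at y) i - b * frechet_derivative v (at y) i)"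
      by (simp add: fun_eq_iff partial_def)
    ultimately show ?thesis by simp
  qed
  show "continuous_on D (\<lambda>y. a * frechet_derivative (partial i u) (at y) j - b * frechet_derivative (partial i v) (at y) j)" if "i \<in> Basis" "j \<in> Basis" for i j
    using H that unfolding partial_def[of j "partial i u", symmetric, abs_def] partial_def[of j "partial i v", symmetric, abs_def] 
    by (auto intro!: continuous_intros simp: partial_def[symmetric])
  show "(\<Sum>i\<in>Basis. a * frechet_derivative (partial i u) (at y) i - b * frechet_derivative (partial i v) (at y) i) = 0" if "y \<in> D" for y
  proof -
    have "(\<Sum>i\<in>Basis. a * frechet_derivative (partial i u) (at y) i - b * frechet_derivative (partial i v) (at y) i) = a * laplacian u y - b * laplacian v y"
      by (simp add: laplacian_def partial_def sum_subtractf sum_distrib_left)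
    then show ?thesis using H that by auto
  qed
qed

lemma has_derivative_ln_cmod:
  assumes g: "(g has_field_derivative g') (at (cplx y))" and nz: "g (cplx y) \<noteq> 0"
  shows "((\<lambda>y. ln (cmod (g (cplx y)))) has_derivative (\<lambda>v. Re (cplx v * (g' / g (cplx y))))) (at y)"
proof -
  define z where "z = cplx y"
  have "((\<lambda>y. g (cplx y)) has_derivative (\<lambda>v. g' * cplx v)) (at y)"
    using has_derivative_compose[OF bounded_linear_imp_has_derivative[OF bounded_linear_cplx] g[unfolded has_field_derivative_def]] by simp
  then have "((\<lambda>y. g (cplx y) \<bullet> g (cplx y)) has_derivative (\<lambda>v. g z \<bullet> (g' * cplx v) + (g' * cplx v) \<bullet> g z)) (at y)"
    unfolding z_def by (intro has_derivative_inner)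
  then have 1: "((\<lambda>y. g (cplx y) \<bullet> g (cplx y)) has_derivative (\<lambda>v. 2 * ((g' * cplx v) \<bullet> g z))) (at y)"
    by (simp add: inner_commute mult_2[symmetric])
  have pos: "g z \<bullet> g z > 0" using nz by (simp add: z_def)
  have "((\<lambda>y. ln (g (cplx y) \<bullet> g (cplx y))) has_derivative (\<lambda>v. 2 * ((g' * cplx v) \<bullet> g z) * inverse (g z \<bullet> g z))) (at y)"
    using has_derivative_ln[OF pos[unfolded z_def] 1] unfolding z_def .
  then have "((\<lambda>y. (1/2) * ln (g (cplx y) \<bullet> g (cplx y))) has_derivative (\<lambda>v. (1/2) * (2 * ((g' * cplx v) \<bullet> g z) * inverse (g z \<bullet> g z)))) (at y)"
    by (rule has_derivative_mult_right)
  moreover have "(1/2) * ln (w \<bullet> w) = ln (cmod w)" for w :: complex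
    by (cases "w = 0") (simp_all add: power2_norm_eq_inner[symmetric] ln_realpow)
  moreover have "(1/2) * (2 * ((g' * cplx v) \<bullet> g z) * inverse (g z \<bullet> g z)) = Re (cplx v * (g' / g z))" for v
  proof -
    have "cplx v * (g' / g z) = (g' * cplx v) * cnj (g z) / (g z * cnj (g z))" using nz by (simp add: z_def field_simps)
    also have "g z * cnj (g z) = complex_of_real (g z \<bullet> g z)" by (simp add: complex_mult_cnj inner_complex_def power2_eq_square)
    finally have "Re (cplx v * (g' / g z)) = Re ((g' * cplx v) * cnj (g z)) / (g z \<bullet> g z)" by (simp only: Re_divide_of_real)
    also have "Re ((g' * cplx v) * cnj (g z)) = (g' * cplx v) \<bullet> g z" by (simp add: inner_complex_def)
    finally show ?thesis by (simp add: inverse_eq_divide)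
  qed
  ultimately show ?thesis unfolding z_def by simp
qed

lemma sum_Basis_real2: "(\<Sum>i\<in>(Basis::(real^2) set). f i) = f (axis 1 1) + f (axis 2 1)"
proof -
  have e: "(Basis::(real^2) set) = {axis 1 1, axis 2 1}" by (auto simp: Basis_vec_def UNIV_2)
  have "axis 1 1 \<noteq> (axis 2 1 :: real^2)" by (simp add: axis_eq_axis)
  then show ?thesis unfolding e by simp
qed

lemma cplx_axis [simp]: "cplx (axis 1 1) = 1" "cplx (axis 2 1) = \<i>"
  by (simp_all add: cplx_def axis_def complex_eq_iff)

lemma open_cplx_image: "open D \<Longrightarrow> open (cplx ` D)"
proof -
  assume "open D"
  moreover have "cplx ` D = plane -` D" by (auto simp: image_iff) (metis cplx_plane)
  ultimately show ?thesis using open_vimage[of D plane] continuous_on_plane[OF continuous_on_id, of UNIV] by simp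
qed

lemma harmonic_on_ln_cmod:
  assumes D: "open D" and g: "g holomorphic_on cplx ` D" and nz: "\<And>y. y \<in> D \<Longrightarrow> g (cplx y) \<noteq> 0"
  shows "harmonic_on D (\<lambda>y. ln (cmod (g (cplx y))))"
proof -
  define q where "q w = deriv g w / g w" for w
  have o: "open (cplx ` D)" by (rule open_cplx_image[OF D])
  have nz': "\<And>w. w \<in> cplx ` D \<Longrightarrow> g w \<noteq> 0" using nz by auto
  have hq: "q holomorphic_on cplx ` D" unfolding q_def
    by (intro holomorphic_intros g o) (use nz' in auto)
  have cq: "continuous_on (cplx ` D) (deriv q)"
    by (intro holomorphic_on_imp_continuous_on holomorphic_deriv hq o)
  have cq2: "continuous_on D (\<lambda>y. deriv q (cplx y))"
    by (rule continuous_on_compose2[OF cq]) (auto intro!: continuous_intros)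
  show ?thesis
  proof (rule harmonic_on_by_derivatives[OF D, where ua="\<lambda>v y. Re (cplx v * q (cplx y))" and ub="\<lambda>i v y. Re (cplx i * (deriv q (cplx y) * cplx v))"])
    show "((\<lambda>y. ln (cmod (g (cplx y)))) has_derivative (\<lambda>v. Re (cplx v * q (cplx y)))) (at y)" if y: "y \<in> D" for y
      unfolding q_def by (rule has_derivative_ln_cmod[OF holomorphic_derivI[OF g o] nz[OF y]]) (use y in auto)
    show "((\<lambda>y. Re (cplx i * q (cplx y))) has_derivative (\<lambda>v. Re (cplx i * (deriv q (cplx y) * cplx v)))) (at y)" if y: "y \<in> D" for y i
    proof -
      have "(q has_field_derivative deriv q (cplx y)) (at (cplx y))" by (rule holomorphic_derivI[OF hq o]) (use y in auto)
      then have "((\<lambda>y. q (cplx y)) has_derivative (\<lambda>v. deriv q (cplx y) * cplx v)) (at y)"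
        unfolding has_field_derivative_def
        using has_derivative_compose[OF bounded_linear_imp_has_derivative[OF bounded_linear_cplx]] by blast
      then show ?thesis by (intro has_derivative_Re has_derivative_mult_right)
    qed
    show "continuous_on D (\<lambda>y. Re (cplx i * (deriv q (cplx y) * cplx j)))" for i j
      by (intro continuous_intros cq2)
    show "(\<Sum>i\<in>Basis. Re (cplx i * (deriv q (cplx y) * cplx i))) = 0" for y
      by (simp add: sum_Basis_real2)
  qed
qed

lemma Re_mult_eq_inner: "Re (cplx v * q) = plane (cnj q) \<bullet> v"
  by (simp add: cplx_def plane_def inner_vec_def sum_2)


text \<open>Here \<open>u\<close> is the real part of a primitive \<open>Q\<close> of \<open>q\<close>, up to a constant. In the second estimate the Taylor
terms of \<open>Q\<close> of orders one and two cancel, because \<open>\<Sum>\<^sub>j \<i>\<^sup>j = \<Sum>\<^sub>j \<i>\<^sup>2\<^sup>j = 0\<close> over \<open>j < 4\<close>. The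
remainder is controlled by \<open>q''\<close> and hence by \<open>B\<close>, through Cauchy's inequality. All constants depend
on \<open>q\<close> only through \<open>B\<close>, so the estimates are uniform for families.\<close>

lemma holomorphic_gradient_estimates:
  fixes q :: "complex \<Rightarrow> complex" and u :: "real^2 \<Rightarrow> real"
  assumes q: "q holomorphic_on ball (cplx a) r" and B: "\<And>z. z \<in> ball (cplx a) r \<Longrightarrow> cmod (q z) \<le> B"
    and r: "r > 0"
    and u: "\<And>y. y \<in> ball a r \<Longrightarrow> (u has_derivative (\<lambda>v. Re (cplx v * q (cplx y)))) (at y)"
  shows "y \<in> ball a r \<Longrightarrow> z \<in> ball a r \<Longrightarrow> \<bar>u y - u z\<bar> \<le> B * norm (y - z)"
    and "0 < h \<Longrightarrow> h < r / 4 \<Longrightarrow> \<bar>stencil h u a\<bar> \<le> 64 * B / r\<^sup>2 * h^3"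
proof -
  have inb: "cplx y \<in> ball (cplx a) r" if "y \<in> ball a r" for y using that by (simp add: dist_norm cplx_diff[symmetric])
  show "\<bar>u y - u z\<bar> \<le> B * norm (y - z)" if yz: "y \<in> ball a r" "z \<in> ball a r"
    using B[OF inb] by (intro gradient_bound_imp_Lipschitz[OF convex_ball yz u[unfolded Re_mult_eq_inner]]) auto
  show "\<bar>stencil h u a\<bar> \<le> 64 * B / r\<^sup>2 * h^3" if h: "0 < h" "h < r / 4"
  proof -
    obtain Q where Q: "\<And>x. x \<in> ball (cplx a) r \<Longrightarrow> (Q has_field_derivative q x) (at x within ball (cplx a) r)"
      using holomorphic_convex_primitive'[OF convex_ball open_ball q] by blast
    have Q': "(Q has_field_derivative q x) (at x)" if "x \<in> ball (cplx a) r" for x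
      using Q[OF that] that by (simp add: at_within_open[OF _ open_ball])
    have const: "\<exists>k. \<forall>y\<in>ball a r. u y - Re (Q (cplx y)) = k"
    proof -
      have "((\<lambda>y. u y - Re (Q (cplx y))) has_derivative (\<lambda>v. 0)) (at y within ball a r)" if y: "y \<in> ball a r" for y
      proof -
        have "((\<lambda>y. Q (cplx y)) has_derivative (\<lambda>v. q (cplx y) * cplx v)) (at y)"
          using has_derivative_compose[OF bounded_linear_imp_has_derivative[OF bounded_linear_cplx] Q'[OF inb[OF y], unfolded has_field_derivative_def]] by simp
        then have "((\<lambda>y. u y - Re (Q (cplx y))) has_derivative (\<lambda>v. Re (cplx v * q (cplx y)) - Re (q (cplx y) * cplx v))) (at y)"
          by (intro has_derivative_diff u[OF y] has_derivative_Re)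
        then show ?thesis by (simp add: mult.commute has_derivative_at_withinI)
      qed
      then show ?thesis using has_derivative_zero_constant[OF convex_ball, of a r "\<lambda>y. u y - Re (Q (cplx y))"] by auto
    qed
    then obtain k where k: "\<And>y. y \<in> ball a r \<Longrightarrow> u y = Re (Q (cplx y)) + k" by (auto simp: algebra_simps)
    define F where "F i = (case i of 0 \<Rightarrow> Q | Suc j \<Rightarrow> (deriv ^^ j) q)" for i
    define B3 where "B3 = 16 * B / r\<^sup>2 * 2"
    have b3: "cmod ((deriv ^^ 2) q x) \<le> B3" if x: "x \<in> ball (cplx a) (r/4)" for x
    proof -
      have sub: "cball x (r/4) \<subseteq> ball (cplx a) r"
      proof
        fix w assume "w \<in> cball x (r/4)"
        then have "dist (cplx a) w < r/4 + r/4" using dist_triangle[of "cplx a" w x] x by (simp add: dist_commute)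
        then show "w \<in> ball (cplx a) r" using r by simp
      qed
      have "cmod ((deriv ^^ 2) q x) \<le> fact 2 * B / (r/4)^2"
      proof (rule Cauchy_inequality)
        show "q holomorphic_on ball x (r/4)" using q by (rule holomorphic_on_subset) (use sub ball_subset_cball in blast)
        show "continuous_on (cball x (r/4)) q" using holomorphic_on_imp_continuous_on[OF q] sub by (rule continuous_on_subset)
        show "cmod (q w) \<le> B" if "cmod (x - w) = r/4" for w using that sub by (intro B) (auto simp: dist_norm)
      qed (use r in auto)
      then show ?thesis unfolding B3_def by (simp add: power_divide field_simps)
    qed
    have tay: "cmod (Q (cplx a + w) - (Q (cplx a) + q (cplx a) * w + deriv q (cplx a) * w^2 / 2)) \<le> B3 * h^3 / 2" if w: "cmod w = h" for w
    proof -
      have fact2: "fact 2 = (2::complex)" by (simp add: fact_numeral)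
      have "cmod (F 0 (cplx a + w) - (\<Sum>i\<le>2. F i (cplx a) * (cplx a + w - cplx a)^i / fact i)) \<le> B3 * cmod (cplx a + w - cplx a)^Suc 2 / fact 2"
      proof (rule complex_Taylor[of "ball (cplx a) (r/4)"])
        show "(F i has_field_derivative F (Suc i) x) (at x within ball (cplx a) (r/4))" if x: "x \<in> ball (cplx a) (r/4)" for i x
        proof (cases i)
          case 0
          have "x \<in> ball (cplx a) r" using x r by auto
          from Q'[OF this] show ?thesis by (simp add: F_def 0 has_field_derivative_at_within)
        next
          case (Suc j)
          have "((deriv ^^ j) q has_field_derivative deriv ((deriv ^^ j) q) x) (at x)"
            by (rule holomorphic_derivI[OF holomorphic_higher_deriv[OF q open_ball] open_ball]) (use x r in auto)
          then show ?thesis by (simp add: F_def Suc has_field_derivative_at_within)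
        qed
        show "cmod (F (Suc 2) x) \<le> B3" if "x \<in> ball (cplx a) (r/4)" for x using b3[OF that] by (simp add: F_def)
      qed (use h r w in \<open>auto simp: dist_norm\<close>)
      moreover have "(\<Sum>i\<le>2. F i (cplx a) * w^i / fact i) = Q (cplx a) + q (cplx a) * w + deriv q (cplx a) * w^2 / 2"
        by (simp add: numeral_2_eq_2 F_def fact2)
      ultimately show ?thesis using w by (simp add: F_def numeral_3_eq_3 numeral_2_eq_2)
    qed
    define w where "w j = h *\<^sub>R \<i>^j" for j :: nat
    have cw: "cmod (w j) = h" for j using h by (simp add: w_def norm_power)
    have c2w: "cplx (a + h *\<^sub>R plane (\<i>^j)) = cplx a + w j" for j by (simp add: cplx_add cplx_scaleR w_def)
    have inba: "a + h *\<^sub>R plane (\<i>^j) \<in> ball a r" for j using h r by (simp add: dist_norm norm_power)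
    have "stencil h u a = Re ((\<Sum>j<4. Q (cplx a + w j)) - 4 * Q (cplx a))"
      unfolding stencil_def using k[OF inba] k[of a] r by (simp add: c2w sum.distrib)
    also have "(\<Sum>j<4. Q (cplx a + w j)) - 4 * Q (cplx a) = (\<Sum>j<4. Q (cplx a + w j) - (Q (cplx a) + q (cplx a) * w j + deriv q (cplx a) * (w j)^2 / 2))"
    proof -
      have s1: "(\<Sum>j<(4::nat). w j) = 0" and s2: "(\<Sum>j<(4::nat). (w j)^2) = 0"
        by (simp_all add: w_def eval_nat_numeral lessThan_Suc scaleR_conv_of_real algebra_simps)
      have "(\<Sum>j<4. Q (cplx a + w j) - (Q (cplx a) + q (cplx a) * w j + deriv q (cplx a) * (w j)^2 / 2))
        = (\<Sum>j<4. Q (cplx a + w j)) - (4 * Q (cplx a) + q (cplx a) * (\<Sum>j<4. w j) + deriv q (cplx a) / 2 * (\<Sum>j<4. (w j)^2))"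
        by (simp add: sum_subtractf sum.distrib sum_distrib_left)
      then show ?thesis using s1 s2 by simp
    qed
    finally have st: "stencil h u a = Re (\<Sum>j<4. Q (cplx a + w j) - (Q (cplx a) + q (cplx a) * w j + deriv q (cplx a) * (w j)^2 / 2))" .
    have "\<bar>stencil h u a\<bar> \<le> (\<Sum>j<4. cmod (Q (cplx a + w j) - (Q (cplx a) + q (cplx a) * w j + deriv q (cplx a) * (w j)^2 / 2)))"
      unfolding st by (rule order_trans[OF abs_Re_le_cmod norm_sum])
    also have "\<dots> \<le> (\<Sum>j<(4::nat). B3 * h^3 / 2)" by (intro sum_mono tay cw)
    also have "\<dots> = 64 * B / r\<^sup>2 * h^3" by (simp add: B3_def)
    finally show ?thesis .
  qed
qed

section \<open>Green's function through the Riemann map\<close>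

lemma simply_connected_cplx_image:
  assumes "simply_connected D" shows "simply_connected (cplx ` D)"
proof -
  have "D homeomorphic cplx ` D"
    unfolding homeomorphic_def homeomorphism_def
    by (intro exI[of _ cplx] exI[of _ plane]) (auto intro!: continuous_intros simp: image_iff)
  then show ?thesis using assms homeomorphic_simply_connected by blast
qed

text \<open>The boundary behaviour is that of a homeomorphism: the preimage of a smaller closed disc is compact
in \<open>D\<close>, so points near the boundary are mapped outside it.\<close>

lemma Riemann_map_exists:
  assumes D: "open D" "bounded D" "D \<noteq> {}" "simply_connected D"
  shows "\<exists>f. f holomorphic_on cplx ` D \<and> inj_on f (cplx ` D) \<and> (\<forall>z\<in>cplx ` D. cmod (f z) < 1) \<and>
    (\<forall>z\<in>frontier D. ((\<lambda>y. cmod (f (cplx y))) \<longlongrightarrow> 1) (at z within D))"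
proof -
  have o: "open (cplx ` D)" by (rule open_cplx_image[OF D(1)])
  have sc: "simply_connected (cplx ` D)" by (rule simply_connected_cplx_image[OF D(4)])
  have ne: "cplx ` D \<noteq> {}" using D by auto
  have nu: "cplx ` D \<noteq> UNIV"
  proof
    assume "cplx ` D = UNIV"
    then have "D = UNIV" by (metis (no_types, opaque_lifting) UNIV_I UNIV_eq_I cplx_eq_iff imageE)
    then show False using D(2) not_bounded_UNIV by simp
  qed
  obtain f g where f: "f holomorphic_on cplx ` D" and g: "g holomorphic_on ball 0 1"
    and fg: "\<And>z. z \<in> cplx ` D \<Longrightarrow> f z \<in> ball 0 1 \<and> g (f z) = z"
    and gf: "\<And>z. z \<in> ball 0 1 \<Longrightarrow> g z \<in> cplx ` D \<and> f (g z) = z"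
    using Riemann_mapping_theorem[of "cplx ` D"] o sc ne nu by blast
  have inj: "inj_on f (cplx ` D)" by (rule inj_on_inverseI[of _ g]) (use fg in auto)
  have bd: "((\<lambda>y. cmod (f (cplx y))) \<longlongrightarrow> 1) (at z within D)" if z: "z \<in> frontier D" for z
  proof (rule tendstoI)
    fix e :: real assume e: "e > 0"
    define e' where "e' = min e (1/2)"
    have e': "0 < e'" "e' \<le> e" "e' < 1" using e by (auto simp: e'_def)
    define C where "C = plane ` g ` cball 0 (1 - e')"
    have sub: "cball (0::complex) (1 - e') \<subseteq> ball 0 1" using e' by auto
    have "compact C" unfolding C_def
      by (intro compact_continuous_image continuous_intros continuous_on_subset[OF holomorphic_on_imp_continuous_on[OF g]] sub) auto
    then have "open (- C)" using compact_imp_closed by blast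
    moreover have "C \<subseteq> D"
    proof
      fix y assume "y \<in> C"
      then obtain w where w: "w \<in> cball 0 (1 - e')" "y = plane (g w)" by (auto simp: C_def)
      then have "w \<in> ball 0 1" using e' by simp
      then show "y \<in> D" using gf[of w] w by auto
    qed
    then have "z \<in> - C" using z D(1) by (auto simp: frontier_def interior_open)
    ultimately have "\<forall>\<^sub>F y in at z within D. y \<in> - C" using eventually_at_topological by blast
    moreover have "\<forall>\<^sub>F y in at z within D. y \<in> D" by (simp add: eventually_at_filter)
    ultimately show "\<forall>\<^sub>F y in at z within D. dist (cmod (f (cplx y))) 1 < e"
    proof eventually_elim
      case (elim y)
      have 1: "cmod (f (cplx y)) < 1" "g (f (cplx y)) = cplx y" using fg[of "cplx y"] elim by auto
      have "\<not> cmod (f (cplx y)) \<le> 1 - e'"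
      proof
        assume "cmod (f (cplx y)) \<le> 1 - e'"
        then have "plane (g (f (cplx y))) \<in> C" unfolding C_def by (intro imageI) simp
        then show False using 1 elim by simp
      qed
      then show ?case using 1 e' by (simp add: dist_real_def)
    qed
  qed
  show ?thesis using f inj fg bd by (intro exI[of _ f]) auto
qed

locale green_domain =
  fixes D :: "(real^2) set" and G h :: "real^2 \<Rightarrow> real^2 \<Rightarrow> real" and f :: "complex \<Rightarrow> complex"
  assumes openD: "open D" and bddD: "bounded D" and neD: "D \<noteq> {}" and scD: "simply_connected D"
    and gf: "greens_function D G h"
    and holf: "f holomorphic_on cplx ` D" and injf: "inj_on f (cplx ` D)"
    and fdisc: "\<And>z. z \<in> cplx ` D \<Longrightarrow> cmod (f z) < 1"
    and fbd: "\<And>z. z \<in> frontier D \<Longrightarrow> ((\<lambda>y. cmod (f (cplx y))) \<longlongrightarrow> 1) (at z within D)"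
begin

lemma open_image: "open (cplx ` D)" by (rule open_cplx_image[OF openD])

text \<open>The value on the diagonal removes the singularity.\<close>

definition diff_quot :: "complex \<Rightarrow> complex \<Rightarrow> complex" where
  "diff_quot a w = (if w = a then deriv f a else (f w - f a) / (w - a))"

definition green_factor :: "complex \<Rightarrow> complex \<Rightarrow> complex" where
  "green_factor a w = diff_quot a w / (1 - cnj (f a) * f w)"

lemma diff_quot_nz: "a \<in> cplx ` D \<Longrightarrow> w \<in> cplx ` D \<Longrightarrow> diff_quot a w \<noteq> 0"
  using holomorphic_injective_imp_regular[OF holf open_image injf, of a] injf
  by (auto simp: diff_quot_def inj_on_def)

lemma denominator_nz: "a \<in> cplx ` D \<Longrightarrow> w \<in> cplx ` D \<Longrightarrow> 1 - cnj (f a) * f w \<noteq> 0"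
proof
  assume a: "a \<in> cplx ` D" "w \<in> cplx ` D" and e: "1 - cnj (f a) * f w = 0"
  have "cmod (cnj (f a) * f w) < 1"
    using fdisc[OF a(1)] fdisc[OF a(2)] mult_strict_mono'[of "cmod (f a)" 1 "cmod (f w)" 1] by (simp add: norm_mult)
  moreover have "cnj (f a) * f w = 1" using e by simp
  ultimately show False by simp
qed

lemma green_factor_nz: "a \<in> cplx ` D \<Longrightarrow> w \<in> cplx ` D \<Longrightarrow> green_factor a w \<noteq> 0"
  using diff_quot_nz denominator_nz by (simp add: green_factor_def)

lemma green_factor_holomorphic:
  assumes a: "a \<in> cplx ` D" shows "green_factor a holomorphic_on cplx ` D"
proof -
  have "diff_quot a holomorphic_on cplx ` D"
    unfolding diff_quot_def using pole_lemma[OF holf, of a] a open_image by (simp add: interior_open)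
  then show ?thesis unfolding green_factor_def using denominator_nz[OF a] by (intro holomorphic_intros holf) auto
qed

lemma cmod_green_factor_commute: "cmod (green_factor a w) = cmod (green_factor w a)"
proof -
  have "cmod (1 - cnj (f a) * f w) = cmod (cnj (1 - cnj (f a) * f w))" by (simp only: complex_mod_cnj)
  also have "cnj (1 - cnj (f a) * f w) = 1 - cnj (f w) * f a" by simp
  finally show ?thesis by (auto simp: green_factor_def diff_quot_def norm_divide norm_minus_commute)
qed

text \<open>By conformal invariance, this is the Green's function of the unit disc transported by the Riemann map;
dividing out the pole leaves \<open>disc_regular\<close>.\<close>

definition disc_green :: "real^2 \<Rightarrow> real^2 \<Rightarrow> real" where
  "disc_green x y = 1 / (2 * pi) * ln (cmod (1 - cnj (f (cplx x)) * f (cplx y)) / cmod (f (cplx y) - f (cplx x)))"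

definition disc_regular :: "real^2 \<Rightarrow> real^2 \<Rightarrow> real" where
  "disc_regular x y = 1 / (2 * pi) * ln (cmod (green_factor (cplx x) (cplx y)))"

lemma f_neq: "x \<in> D \<Longrightarrow> y \<in> D \<Longrightarrow> x \<noteq> y \<Longrightarrow> f (cplx y) - f (cplx x) \<noteq> 0"
  using injf by (auto simp: inj_on_def)

lemma disc_green_eq:
  assumes "x \<in> D" "y \<in> D" "x \<noteq> y"
  shows "disc_green x y = 1 / (2 * pi) * ln (1 / norm (x - y)) - disc_regular x y"
proof -
  have p: "cmod (f (cplx y) - f (cplx x)) > 0" using f_neq[OF assms] by simp
  have q: "cmod (1 - cnj (f (cplx x)) * f (cplx y)) > 0" using denominator_nz[of "cplx x" "cplx y"] assms by simp
  have n: "norm (x - y) > 0" using assms by simp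
  have "cmod (green_factor (cplx x) (cplx y)) = (cmod (f (cplx y) - f (cplx x)) / norm (x - y)) / cmod (1 - cnj (f (cplx x)) * f (cplx y))"
  proof -
    have "cmod (cplx y - cplx x) = norm (x - y)" by (metis cplx_diff norm_cplx norm_minus_commute)
    then show ?thesis using assms by (simp add: green_factor_def diff_quot_def norm_divide norm_mult)
  qed
  then have "ln (cmod (green_factor (cplx x) (cplx y))) = ln (cmod (f (cplx y) - f (cplx x))) - ln (norm (x - y)) - ln (cmod (1 - cnj (f (cplx x)) * f (cplx y)))"
    using p q n by (simp add: ln_div ln_mult)
  then have "ln (cmod (1 - cnj (f (cplx x)) * f (cplx y)) / cmod (f (cplx y) - f (cplx x))) = ln (1 / norm (x - y)) - ln (cmod (green_factor (cplx x) (cplx y)))"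
    using p q n by (simp add: ln_div)
  then show ?thesis unfolding disc_green_def disc_regular_def by (simp only: right_diff_distrib)
qed

lemma cmod_disc_identity: "(cmod (1 - cnj a * b))\<^sup>2 = (cmod (b - a))\<^sup>2 + (1 - (cmod a)\<^sup>2) * (1 - (cmod b)\<^sup>2)"
  unfolding cmod_power2 by (simp add: algebra_simps power2_eq_square)

text \<open>In this form positivity and the vanishing boundary values are visible, since the second factor of the
numerator tends to zero when \<open>|f(y)| \<rightarrow> 1\<close>.\<close>

lemma disc_green_alt:
  assumes "x \<in> D" "y \<in> D" "x \<noteq> y"
  shows "disc_green x y = 1 / (4 * pi) * ln (1 + (1 - (cmod (f (cplx x)))\<^sup>2) * (1 - (cmod (f (cplx y)))\<^sup>2) / (cmod (f (cplx y) - f (cplx x)))\<^sup>2)"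
proof -
  let ?p = "cmod (f (cplx y) - f (cplx x))" and ?q = "cmod (1 - cnj (f (cplx x)) * f (cplx y))"
  have p: "?p > 0" using f_neq[OF assms] by simp
  have q: "?q > 0" using denominator_nz[of "cplx x" "cplx y"] assms by simp
  have "1 + (1 - (cmod (f (cplx x)))\<^sup>2) * (1 - (cmod (f (cplx y)))\<^sup>2) / ?p\<^sup>2 = (?q / ?p)\<^sup>2"
    using p cmod_disc_identity[of "f (cplx x)" "f (cplx y)"] by (simp add: power_divide field_simps)
  moreover have "ln ((?q / ?p)\<^sup>2) = 2 * ln (?q / ?p)" using p q by (subst ln_realpow) auto
  ultimately show ?thesis unfolding disc_green_def by simp
qed

lemma disc_green_pos:
  assumes "x \<in> D" "y \<in> D" "x \<noteq> y" shows "disc_green x y > 0"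
proof -
  have a: "1 - (cmod (f (cplx x)))\<^sup>2 > 0" "1 - (cmod (f (cplx y)))\<^sup>2 > 0"
    using fdisc[of "cplx x"] fdisc[of "cplx y"] assms by (auto simp: abs_square_less_1)
  have "(cmod (f (cplx y) - f (cplx x)))\<^sup>2 > 0" using f_neq[OF assms] by simp
  then have "(1 - (cmod (f (cplx x)))\<^sup>2) * (1 - (cmod (f (cplx y)))\<^sup>2) / (cmod (f (cplx y) - f (cplx x)))\<^sup>2 > 0"
    using a by (intro divide_pos_pos mult_pos_pos) auto
  then show ?thesis unfolding disc_green_alt[OF assms] by simp
qed

lemma eventually_in_D: "\<forall>\<^sub>F y in at z within D. y \<in> D" by (simp add: eventually_at_filter)

lemma eventually_neq: "x \<in> D \<Longrightarrow> z \<in> frontier D \<Longrightarrow> \<forall>\<^sub>F y in at z within D. y \<noteq> x"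
proof -
  assume "x \<in> D" "z \<in> frontier D"
  then have "z \<noteq> x" using openD by (auto simp: frontier_def interior_open)
  then have "open (- {x})" "z \<in> - {x}" by auto
  then have "\<forall>\<^sub>F y in at z within D. y \<in> - {x}" using eventually_at_topological by blast
  then show ?thesis by simp
qed

lemma disc_green_boundary:
  assumes x: "x \<in> D" and z: "z \<in> frontier D"
  shows "(disc_green x \<longlongrightarrow> 0) (at z within D)"
proof -
  let ?a = "cmod (f (cplx x))" and ?b = "\<lambda>y. cmod (f (cplx y))"
  have a1: "?a < 1" using fdisc x by auto
  have up: "((\<lambda>y. (1 - (?b y)\<^sup>2) / (?b y - ?a)\<^sup>2) \<longlongrightarrow> (1 - 1\<^sup>2) / (1 - ?a)\<^sup>2) (at z within D)"
    using a1 by (intro tendsto_intros fbd[OF z]) auto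
  have "((\<lambda>y. (1 - ?a\<^sup>2) * (1 - (?b y)\<^sup>2) / (cmod (f (cplx y) - f (cplx x)))\<^sup>2) \<longlongrightarrow> 0) (at z within D)"
  proof (rule tendsto_sandwich[OF _ _ tendsto_const])
    show "((\<lambda>y. (1 - (?b y)\<^sup>2) / (?b y - ?a)\<^sup>2) \<longlongrightarrow> 0) (at z within D)" using up by simp
    show "\<forall>\<^sub>F y in at z within D. 0 \<le> (1 - ?a\<^sup>2) * (1 - (?b y)\<^sup>2) / (cmod (f (cplx y) - f (cplx x)))\<^sup>2"
      using eventually_in_D
    proof eventually_elim
      case (elim y)
      have "1 - ?a\<^sup>2 \<ge> 0" "1 - (?b y)\<^sup>2 \<ge> 0" using fdisc[of "cplx x"] fdisc[of "cplx y"] x elim by (auto simp: abs_square_le_1)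
      then show ?case by simp
    qed
    have "\<forall>\<^sub>F y in at z within D. ?a < ?b y" using order_tendstoD(1)[OF fbd[OF z] a1] .
    then show "\<forall>\<^sub>F y in at z within D. (1 - ?a\<^sup>2) * (1 - (?b y)\<^sup>2) / (cmod (f (cplx y) - f (cplx x)))\<^sup>2 \<le> (1 - (?b y)\<^sup>2) / (?b y - ?a)\<^sup>2"
      using eventually_in_D
    proof eventually_elim
      case (elim y)
      have b: "1 - (?b y)\<^sup>2 \<ge> 0" using fdisc[of "cplx y"] elim by (auto simp: abs_square_le_1)
      have "?b y - ?a \<le> cmod (f (cplx y) - f (cplx x))" by (rule norm_triangle_ineq2)
      then have "(?b y - ?a)\<^sup>2 \<le> (cmod (f (cplx y) - f (cplx x)))\<^sup>2" using elim by (intro power_mono) auto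
      moreover have "(1 - ?a\<^sup>2) * (1 - (?b y)\<^sup>2) \<le> 1 * (1 - (?b y)\<^sup>2)" by (intro mult_right_mono b) simp
      ultimately show ?case using elim b by (intro frac_le) auto
    qed
  qed
  then have "((\<lambda>y. 1 / (4 * pi) * ln (1 + (1 - ?a\<^sup>2) * (1 - (?b y)\<^sup>2) / (cmod (f (cplx y) - f (cplx x)))\<^sup>2)) \<longlongrightarrow> 1 / (4 * pi) * ln (1 + 0)) (at z within D)"
    by (intro tendsto_intros) auto
  then have "((\<lambda>y. 1 / (4 * pi) * ln (1 + (1 - ?a\<^sup>2) * (1 - (?b y)\<^sup>2) / (cmod (f (cplx y) - f (cplx x)))\<^sup>2)) \<longlongrightarrow> 0) (at z within D)" by simp
  then show ?thesis
  proof (rule Lim_transform_eventually)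
    show "\<forall>\<^sub>F y in at z within D. 1 / (4 * pi) * ln (1 + (1 - ?a\<^sup>2) * (1 - (?b y)\<^sup>2) / (cmod (f (cplx y) - f (cplx x)))\<^sup>2) = disc_green x y"
      using eventually_in_D eventually_neq[OF x z] by eventually_elim (use disc_green_alt x in auto)
  qed
qed

lemma disc_regular_harmonic: "x \<in> D \<Longrightarrow> harmonic_on D (\<lambda>y. ln (cmod (green_factor (cplx x) (cplx y))))"
  by (rule harmonic_on_ln_cmod[OF openD green_factor_holomorphic]) (use green_factor_nz in blast)+

lemma G_eq: "x \<in> D \<Longrightarrow> y \<in> D \<Longrightarrow> x \<noteq> y \<Longrightarrow> G x y = 1 / (2 * pi) * ln (1 / norm (x - y)) - h x y"
  and h_harmonic: "x \<in> D \<Longrightarrow> harmonic_on D (h x)"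
  and G_boundary: "x \<in> D \<Longrightarrow> z \<in> frontier D \<Longrightarrow> (G x \<longlongrightarrow> 0) (at z within D)"
  using gf by (auto simp: greens_function_def)

text \<open>Off the diagonal the difference of the two regular parts is the difference of two Green's functions,
which vanishes at the boundary. It is harmonic in all of \<open>D\<close>, so the maximum principle, applied to it and
to its negative, also fixes the value at the pole.\<close>

lemma h_eq_disc_regular:
  assumes x: "x \<in> D" and y: "y \<in> D"
  shows "h x y = disc_regular x y"
proof -
  have lim: "((\<lambda>y. disc_green x y - G x y) \<longlongrightarrow> 0 - 0) (at z within D)" if "z \<in> frontier D" for z
    using disc_green_boundary[OF x that] G_boundary[OF x that] by (rule tendsto_diff)
  have eq: "\<forall>\<^sub>F y in at z within D. disc_green x y - G x y = h x y - disc_regular x y" if "z \<in> frontier D" for z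
    using eventually_in_D eventually_neq[OF x that]
    by eventually_elim (use disc_green_eq[OF x] G_eq[OF x] in auto)
  have "1 * h x y - 1 / (2 * pi) * ln (cmod (green_factor (cplx x) (cplx y))) + 0 \<le> 0"
  proof (rule weak_maximum_principle[OF openD bddD _ _ y, where u="\<lambda>y. 1 * h x y - 1 / (2 * pi) * ln (cmod (green_factor (cplx x) (cplx y))) + 0"])
    show "harmonic_on D (\<lambda>y. 1 * h x y - 1 / (2 * pi) * ln (cmod (green_factor (cplx x) (cplx y))) + 0)"
      by (rule harmonic_on_diff[OF openD h_harmonic[OF x] disc_regular_harmonic[OF x]])
    show "\<forall>\<^sub>F y in at z within D. 1 * h x y - 1 / (2 * pi) * ln (cmod (green_factor (cplx x) (cplx y))) + 0 < e" if "z \<in> frontier D" "e > 0" for z e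
    proof -
      have "\<forall>\<^sub>F y in at z within D. disc_green x y - G x y < e" using order_tendstoD(2)[OF lim[OF that(1)], of e] that by simp
      then show ?thesis using eq[OF that(1)] by eventually_elim (simp add: disc_regular_def)
    qed
  qed
  moreover have "1 / (2 * pi) * ln (cmod (green_factor (cplx x) (cplx y))) - 1 * h x y + 0 \<le> 0"
  proof (rule weak_maximum_principle[OF openD bddD _ _ y, where u="\<lambda>y. 1 / (2 * pi) * ln (cmod (green_factor (cplx x) (cplx y))) - 1 * h x y + 0"])
    show "harmonic_on D (\<lambda>y. 1 / (2 * pi) * ln (cmod (green_factor (cplx x) (cplx y))) - 1 * h x y + 0)"
      by (rule harmonic_on_diff[OF openD disc_regular_harmonic[OF x] h_harmonic[OF x]])
    show "\<forall>\<^sub>F y in at z within D. 1 / (2 * pi) * ln (cmod (green_factor (cplx x) (cplx y))) - 1 * h x y + 0 < e" if "z \<in> frontier D" "e > 0" for z e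
    proof -
      have "\<forall>\<^sub>F y in at z within D. - e < disc_green x y - G x y" using order_tendstoD(1)[OF lim[OF that(1)], of "- e"] that by simp
      then show ?thesis using eq[OF that(1)] by eventually_elim (simp add: disc_regular_def)
    qed
  qed
  ultimately show ?thesis by (simp add: disc_regular_def)
qed

lemma h_commute: "x \<in> D \<Longrightarrow> y \<in> D \<Longrightarrow> h x y = h y x"
  by (simp add: h_eq_disc_regular disc_regular_def cmod_green_factor_commute)

lemma G_eq_disc_green: "x \<in> D \<Longrightarrow> y \<in> D \<Longrightarrow> x \<noteq> y \<Longrightarrow> G x y = disc_green x y"
  by (simp add: G_eq disc_green_eq h_eq_disc_regular)

lemma G_pos: "x \<in> D \<Longrightarrow> y \<in> D \<Longrightarrow> x \<noteq> y \<Longrightarrow> G x y > 0"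
  by (simp add: G_eq_disc_green disc_green_pos)

lemma G_commute: "x \<in> D \<Longrightarrow> y \<in> D \<Longrightarrow> x \<noteq> y \<Longrightarrow> G x y = G y x"
  by (simp add: G_eq h_commute norm_minus_commute)

text \<open>Adding one makes \<open>ln dm\<close> nonnegative.\<close>

definition dm :: real where "dm = 1 + diameter D"

lemma dm_bound: "x \<in> D \<Longrightarrow> y \<in> D \<Longrightarrow> norm (x - y) \<le> dm" "dm \<ge> 1"
  using diameter_bounded_bound[OF bddD] diameter_ge_0[OF bddD] by (auto simp: dm_def dist_norm intro: add_increasing)

lemma h_affine_harmonic: "x \<in> D \<Longrightarrow> harmonic_on D (\<lambda>y. a * h x y + c)"
  using harmonic_on_diff[OF openD h_harmonic h_harmonic, of x x a 0 c] by simp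

lemma h_lower:
  assumes x: "x \<in> D" and y: "y \<in> D"
  shows "h x y \<ge> - (1 / (2 * pi) * ln dm)"
proof -
  have "- 1 * h x y + - (1 / (2 * pi) * ln dm) \<le> 0"
  proof (rule weak_maximum_principle[OF openD bddD h_affine_harmonic[OF x] _ y])
    fix z e assume z: "z \<in> frontier D" and e: "(e::real) > 0"
    have "\<forall>\<^sub>F y in at z within D. G x y < e" using order_tendstoD(2)[OF G_boundary[OF x z], of e] e by simp
    then show "\<forall>\<^sub>F y in at z within D. - 1 * h x y + - (1 / (2 * pi) * ln dm) < e"
      using eventually_in_D eventually_neq[OF x z]
    proof eventually_elim
      case (elim y)
      have "ln (norm (x - y)) \<le> ln dm" using elim dm_bound(1)[OF x, of y] by (intro ln_mono) auto
      then have "1 / (2 * pi) * ln (norm (x - y)) \<le> 1 / (2 * pi) * ln dm" by (intro mult_left_mono) auto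
      moreover have "G x y = - (1 / (2 * pi) * ln (norm (x - y))) - h x y" using G_eq[OF x, of y] elim by (simp add: ln_div)
      ultimately show ?case using elim by linarith
    qed
  qed
  then show ?thesis by simp
qed

lemma G_upper:
  assumes "x \<in> D" "y \<in> D" "x \<noteq> y"
  shows "G x y \<le> 1 / (2 * pi) * (ln dm - ln (norm (x - y)))"
  using h_lower[OF assms(1,2)] G_eq[OF assms] assms by (simp add: ln_div algebra_simps)

lemma h_upper:
  assumes x: "x \<in> D" and y: "y \<in> D" and r: "r > 0" "ball x r \<subseteq> D"
  shows "h x y \<le> 1 / (2 * pi) * - ln (r / 2)"
proof -
  have "1 * h x y + - (1 / (2 * pi) * - ln (r / 2)) \<le> 0"
  proof (rule weak_maximum_principle[OF openD bddD h_affine_harmonic[OF x] _ y])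
    fix z e assume z: "z \<in> frontier D" and e: "(e::real) > 0"
    have "\<forall>\<^sub>F y in at z within D. - e < G x y" using order_tendstoD(1)[OF G_boundary[OF x z], of "- e"] e by simp
    moreover have "\<forall>\<^sub>F y in at z within D. dist y z < r / 2" using r by (auto simp: eventually_at intro!: exI[of _ "r/2"])
    ultimately show "\<forall>\<^sub>F y in at z within D. 1 * h x y + - (1 / (2 * pi) * - ln (r / 2)) < e"
      using eventually_in_D eventually_neq[OF x z]
    proof eventually_elim
      case (elim y)
      have "z \<notin> ball x r" using r z openD by (auto simp: frontier_def interior_open)
      then have "dist x z \<ge> r" by simp
      then have "norm (x - y) \<ge> r / 2" using dist_triangle[of x z y] elim by (simp add: dist_norm)
      then have "ln (r / 2) \<le> ln (norm (x - y))" using r by (intro ln_mono) auto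
      then have "1 / (2 * pi) * ln (r / 2) \<le> 1 / (2 * pi) * ln (norm (x - y))" by (intro mult_left_mono) auto
      moreover have "G x y = - (1 / (2 * pi) * ln (norm (x - y))) - h x y" using G_eq[OF x, of y] elim by (simp add: ln_div)
      moreover have "1 / (2 * pi) * - ln (r / 2) = - (1 / (2 * pi) * ln (r / 2))" by simp
      ultimately show ?case using elim by linarith
    qed
  qed
  then show ?thesis by simp
qed

text \<open>Let \<open>s\<close> be a holomorphic square root of \<open>z - p\<close>. Since \<open>y - x = (s(y) - s(x)) (s(y) + s(x))\<close>, the function
\<open>1/(2 pi) ln (2 sqrt dm / |s(y) - s(x)|)\<close> has the same pole as \<open>G(x, y)\<close> and is nonnegative, so it
dominates \<open>G(x, \<cdot>)\<close> by the maximum principle. Comparing the regular parts at \<open>y = x\<close>, where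
\<open>|2 s(x)| = 2 sqrt |x - p|\<close>, gives the bound.\<close>

lemma h_diag_blowup:
  assumes x: "x \<in> D" and p: "p \<in> frontier D"
  shows "h x x \<ge> - (1 / (2 * pi) * (ln (2 * sqrt dm) + ln (2 * sqrt (norm (x - p)))))"
proof -
  have pc: "cplx p \<notin> cplx ` D" using p openD by (auto simp: frontier_def interior_open)
  have sc: "simply_connected (cplx ` D)" by (rule simply_connected_cplx_image[OF scD])
  have "(\<lambda>z. z - cplx p) holomorphic_on cplx ` D \<and> (\<forall>z\<in>cplx ` D. z - cplx p \<noteq> 0)" using pc by (auto intro!: holomorphic_intros)
  then obtain s where s: "s holomorphic_on cplx ` D" "\<And>z. z \<in> cplx ` D \<Longrightarrow> z - cplx p = (s z)\<^sup>2"
    using simply_connected_eq_holomorphic_sqrt[OF open_image] sc by metis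
  have cs: "cmod (s (cplx y)) = sqrt (norm (y - p))" if "y \<in> D" for y
  proof -
    have "(cmod (s (cplx y)))\<^sup>2 = norm (y - p)"
      using s(2)[of "cplx y"] that norm_cplx[of "y - p"] by (simp add: norm_power[symmetric] cplx_diff)
    then show ?thesis by (metis norm_ge_zero real_sqrt_unique)
  qed
  have ypd: "norm (y - p) \<le> dm" if y: "y \<in> D" for y
  proof -
    have "p \<in> closure D" using p by (simp add: frontier_def)
    moreover have "closed {q. norm (y - q) \<le> dm}" by (intro closed_Collect_le continuous_intros)
    moreover have "D \<subseteq> {q. norm (y - q) \<le> dm}" using dm_bound(1)[OF y] by auto
    ultimately show ?thesis using closure_minimal[of D "{q. norm (y - q) \<le> dm}"] by blast
  qed
  have snz: "s (cplx y) + s (cplx x) \<noteq> 0" if y: "y \<in> D" for y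
  proof
    assume "s (cplx y) + s (cplx x) = 0"
    then have "s (cplx y) = - s (cplx x)" by (simp add: add_eq_0_iff2)
    then have "cplx y - cplx p = cplx x - cplx p" using s(2)[of "cplx y"] s(2)[of "cplx x"] x y by simp
    then have "y = x" by simp
    then have "s (cplx x) = 0" using \<open>s (cplx y) + s (cplx x) = 0\<close> by simp
    then show False using s(2)[of "cplx x"] x pc by auto
  qed
  have prod: "norm (y - x) = cmod (s (cplx y) + s (cplx x)) * cmod (s (cplx y) - s (cplx x))" if y: "y \<in> D" for y
  proof -
    have "cplx y - cplx x = (cplx y - cplx p) - (cplx x - cplx p)" by simp
    also have "\<dots> = (s (cplx y))\<^sup>2 - (s (cplx x))\<^sup>2" using x y by (simp only: s(2) imageI)
    also have "\<dots> = (s (cplx y) + s (cplx x)) * (s (cplx y) - s (cplx x))" by (simp add: power2_eq_square algebra_simps)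
    finally show ?thesis using norm_cplx[of "y - x"] by (simp add: cplx_diff norm_mult)
  qed
  have hs: "harmonic_on D (\<lambda>y. ln (cmod (s (cplx y) + s (cplx x))))"
    by (rule harmonic_on_ln_cmod[OF openD, where g="\<lambda>w. s w + s (cplx x)"]) (use snz in \<open>auto intro!: holomorphic_intros s\<close>)
  have "(- 1) * h x x - 1 / (2 * pi) * ln (cmod (s (cplx x) + s (cplx x))) + - (1 / (2 * pi) * ln (2 * sqrt dm)) \<le> 0"
  proof (rule weak_maximum_principle[OF openD bddD harmonic_on_diff[OF openD h_harmonic[OF x] hs] _ x])
    fix z e assume z: "z \<in> frontier D" and e: "(e::real) > 0"
    have "\<forall>\<^sub>F y in at z within D. G x y < e" using order_tendstoD(2)[OF G_boundary[OF x z], of e] e by simp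
    then show "\<forall>\<^sub>F y in at z within D. (- 1) * h x y - 1 / (2 * pi) * ln (cmod (s (cplx y) + s (cplx x))) + - (1 / (2 * pi) * ln (2 * sqrt dm)) < e"
      using eventually_in_D eventually_neq[OF x z]
    proof eventually_elim
      case (elim y)
      have n0: "norm (y - x) > 0" using elim by simp
      have a: "cmod (s (cplx y) + s (cplx x)) > 0" using snz elim by simp
      have b: "cmod (s (cplx y) - s (cplx x)) > 0" using n0 prod[of y] elim a by (auto simp: zero_less_mult_iff)
      have "cmod (s (cplx y) - s (cplx x)) \<le> sqrt (norm (y - p)) + sqrt (norm (x - p))"
        using norm_triangle_ineq4[of "s (cplx y)" "s (cplx x)"] cs elim x by simp
      also have "\<dots> \<le> sqrt dm + sqrt dm" by (intro add_mono real_sqrt_le_mono ypd x) (use elim in auto)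
      finally have "ln (cmod (s (cplx y) - s (cplx x))) \<le> ln (2 * sqrt dm)" using b by (intro ln_mono) auto
      moreover have "ln (norm (x - y)) = ln (cmod (s (cplx y) + s (cplx x))) + ln (cmod (s (cplx y) - s (cplx x)))"
        using prod[of y] elim a b by (simp add: norm_minus_commute ln_mult)
      ultimately have "ln (norm (x - y)) \<le> ln (cmod (s (cplx y) + s (cplx x))) + ln (2 * sqrt dm)" by simp
      then have "1 / (2 * pi) * ln (norm (x - y)) \<le> 1 / (2 * pi) * (ln (cmod (s (cplx y) + s (cplx x))) + ln (2 * sqrt dm))" by (intro mult_left_mono) auto
      moreover have "G x y = - (1 / (2 * pi) * ln (norm (x - y))) - h x y" using G_eq[OF x, of y] elim by (simp add: ln_div)
      ultimately show ?case using elim by (simp add: distrib_left)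
    qed
  qed
  moreover have "cmod (s (cplx x) + s (cplx x)) = 2 * sqrt (norm (x - p))"
    using cs[OF x] by (simp add: mult_2[symmetric] norm_mult)
  ultimately show ?thesis by (simp add: algebra_simps)
qed

end

context green_domain
begin

section \<open>The potential of a bounded density in the domain\<close>

text \<open>The bounds on \<open>h\<close> from above and below, which are uniform in \<open>y\<close>, bound the nonvanishing function
\<open>green_factor\<close> and its reciprocal near \<open>x\<close>. Cauchy's inequality then bounds its logarithmic derivative, of
which the gradient of \<open>h(\<cdot>, y)\<close> is the real part.\<close>

lemma h_local_holomorphic:
  assumes x: "x \<in> D"
  obtains r B where "r > 0" "ball x r \<subseteq> D" "B \<ge> 0"
    "\<And>y. y \<in> D \<Longrightarrow> \<exists>q. q holomorphic_on ball (cplx x) r \<and> (\<forall>w\<in>ball (cplx x) r. cmod (q w) \<le> B) \<and>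
       (\<forall>z\<in>ball x r. ((\<lambda>z. h z y) has_derivative (\<lambda>v. Re (cplx v * q (cplx z)))) (at z))"
proof -
  obtain r0 where r0: "r0 > 0" "ball x r0 \<subseteq> D" using openD x open_contains_ball by blast
  define r where "r = r0 / 4"
  have r: "r > 0" "ball x (4 * r) \<subseteq> D" using r0 by (auto simp: r_def)
  have sub: "ball x r \<subseteq> D" using r by (intro order_trans[OF _ r(2)]) auto
  define B where "B = 1 / (2 * pi) * (2 / r\<^sup>2 * dm)"
  have "B \<ge> 0" using dm_bound(2) r by (simp add: B_def)
  show ?thesis
  proof (rule that[OF r(1) sub \<open>B \<ge> 0\<close>])
    fix y assume y: "y \<in> D"
    define g where "g = green_factor (cplx y)"
    have hg: "g holomorphic_on cplx ` D" unfolding g_def by (rule green_factor_holomorphic) (use y in auto)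
    have gn: "g w \<noteq> 0" if "w \<in> cplx ` D" for w unfolding g_def by (rule green_factor_nz) (use that y in auto)
    have hz: "h z y = 1 / (2 * pi) * ln (cmod (g (cplx z)))" if "z \<in> D" for z
      using h_commute[OF that y] h_eq_disc_regular[OF y that] by (simp add: disc_regular_def g_def)
    define q where "q w = complex_of_real (1 / (2 * pi)) * (deriv g w / g w)" for w
    have lnb: "ln (cmod (g (cplx z))) \<le> - ln r" "- ln dm \<le> ln (cmod (g (cplx z)))" if z: "z \<in> ball x (2 * r)" for z
    proof -
      have zD: "z \<in> D" using z r by (intro subsetD[OF r(2)]) auto
      have "ball z (2 * r) \<subseteq> ball x (4 * r)"
      proof
        fix w assume "w \<in> ball z (2 * r)"
        then have "dist x w < 2 * r + 2 * r" using dist_triangle[of x w z] z by simp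
        then show "w \<in> ball x (4 * r)" by simp
      qed
      then have "h z y \<le> 1 / (2 * pi) * - ln (2 * r / 2)" using r by (intro h_upper[OF zD y]) auto
      then have "1 / (2 * pi) * ln (cmod (g (cplx z))) \<le> 1 / (2 * pi) * - ln r" unfolding hz[OF zD] by simp
      then show "ln (cmod (g (cplx z))) \<le> - ln r" by (rule mult_left_le_imp_le) simp
      have "- (1 / (2 * pi) * ln dm) \<le> h z y" by (rule h_lower[OF zD y])
      then have "1 / (2 * pi) * - ln dm \<le> 1 / (2 * pi) * ln (cmod (g (cplx z)))" unfolding hz[OF zD] by simp
      then show "- ln dm \<le> ln (cmod (g (cplx z)))" by (rule mult_left_le_imp_le) simp
    qed
    have gb: "cmod (g w) \<le> 1 / r" "1 / dm \<le> cmod (g w)" if w: "w \<in> ball (cplx x) (2 * r)" for w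
    proof -
      have rw: "plane w \<in> ball x (2 * r)" using w norm_cplx[of "x - plane w"] by (simp add: dist_norm cplx_diff)
      have "plane w \<in> D" using rw r by (intro subsetD[OF r(2)]) auto
      then have "w \<in> cplx ` D" by (metis cplx_plane imageI)
      then have p: "cmod (g w) > 0" using gn by simp
      have "ln (cmod (g w)) \<le> ln (1 / r)" using lnb(1)[OF rw] r by (simp add: ln_div)
      then show "cmod (g w) \<le> 1 / r" using p r by (subst (asm) ln_le_cancel_iff) auto
      have "ln (1 / dm) \<le> ln (cmod (g w))" using lnb(2)[OF rw] dm_bound(2) by (simp add: ln_div)
      then show "1 / dm \<le> cmod (g w)" using p dm_bound(2) by (subst (asm) ln_le_cancel_iff) auto
    qed
    have bsub: "ball (cplx x) (2 * r) \<subseteq> cplx ` D"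
    proof
      fix w assume w: "w \<in> ball (cplx x) (2 * r)"
      have "plane w \<in> ball x (4 * r)" using w norm_cplx[of "x - plane w"] r by (simp add: dist_norm cplx_diff)
      then show "w \<in> cplx ` D" using r(2) by (metis cplx_plane imageI subsetD)
    qed
    have bsub1: "ball (cplx x) r \<subseteq> cplx ` D" using bsub r by (rule_tac order_trans[OF _ bsub]) auto
    have hq: "q holomorphic_on ball (cplx x) r"
      unfolding q_def using bsub1 gn
      by (intro holomorphic_intros holomorphic_on_subset[OF hg] holomorphic_on_subset[OF holomorphic_deriv[OF hg open_image]]) auto
    have qb: "cmod (q w) \<le> B" if w: "w \<in> ball (cplx x) r" for w
    proof -
      have cs: "cball w (r/2) \<subseteq> ball (cplx x) (2 * r)"
      proof
        fix u assume "u \<in> cball w (r/2)"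
        then have "dist (cplx x) u < r + r / 2" using dist_triangle[of "cplx x" u w] w by simp
        then show "u \<in> ball (cplx x) (2 * r)" using r by simp
      qed
      have cs1: "ball w (r/2) \<subseteq> ball (cplx x) (2 * r)" using cs ball_subset_cball by blast
      have "cmod ((deriv ^^ 1) g w) \<le> fact 1 * (1 / r) / (r/2)^1"
      proof (rule Cauchy_inequality)
        show "g holomorphic_on ball w (r/2)" by (rule holomorphic_on_subset[OF hg order_trans[OF cs1 bsub]])
        show "continuous_on (cball w (r/2)) g" by (rule continuous_on_subset[OF holomorphic_on_imp_continuous_on[OF hg] order_trans[OF cs bsub]])
        show "cmod (g u) \<le> 1 / r" if "cmod (w - u) = r/2" for u
          using that cs by (intro gb) (auto simp: dist_norm)
      qed (use r in auto)
      then have d: "cmod (deriv g w) \<le> 2 / r\<^sup>2" using r by (simp add: field_simps power2_eq_square)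
      have "w \<in> ball (cplx x) (2 * r)" using w r by auto
      note l = gb(2)[OF this]
      have "cmod (deriv g w / g w) \<le> (2 / r\<^sup>2) / (1 / dm)"
        unfolding norm_divide using d l dm_bound(2) r by (intro frac_le) auto
      then have "1 / (2 * pi) * cmod (deriv g w / g w) \<le> B" unfolding B_def by (intro mult_left_mono) auto
      then show ?thesis unfolding q_def norm_mult norm_of_real by simp
    qed
    have der: "((\<lambda>z. h z y) has_derivative (\<lambda>v. Re (cplx v * q (cplx z)))) (at z)" if z: "z \<in> ball x r" for z
    proof -
      have zD: "z \<in> D" using z sub by auto
      have "(g has_field_derivative deriv g (cplx z)) (at (cplx z))" by (rule holomorphic_derivI[OF hg open_image]) (use zD in auto)
      then have "((\<lambda>z. ln (cmod (g (cplx z)))) has_derivative (\<lambda>v. Re (cplx v * (deriv g (cplx z) / g (cplx z))))) (at z)"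
        by (rule has_derivative_ln_cmod) (use gn zD in auto)
      then have "((\<lambda>z. 1 / (2 * pi) * ln (cmod (g (cplx z)))) has_derivative (\<lambda>v. 1 / (2 * pi) * Re (cplx v * (deriv g (cplx z) / g (cplx z))))) (at z)"
        by (rule has_derivative_mult_right)
      moreover have "1 / (2 * pi) * Re (cplx v * (deriv g (cplx z) / g (cplx z))) = Re (cplx v * q (cplx z))" for v
      proof -
        have "cplx v * q (cplx z) = complex_of_real (1 / (2 * pi)) * (cplx v * (deriv g (cplx z) / g (cplx z)))" unfolding q_def by (simp only: mult_ac)
        then show ?thesis by (simp only: Re_complex_of_real Im_complex_of_real times_complex.simps mult_zero_left diff_0_right)
      qed
      ultimately have "((\<lambda>z. 1 / (2 * pi) * ln (cmod (g (cplx z)))) has_derivative (\<lambda>v. Re (cplx v * q (cplx z)))) (at z)" by simp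
      then show ?thesis
        by (rule has_derivative_transform_within_open[OF _ openD zD]) (simp add: hz)
    qed
    show "\<exists>q. q holomorphic_on ball (cplx x) r \<and> (\<forall>w\<in>ball (cplx x) r. cmod (q w) \<le> B) \<and>
       (\<forall>z\<in>ball x r. ((\<lambda>z. h z y) has_derivative (\<lambda>v. Re (cplx v * q (cplx z)))) (at z))"
      using hq qb der by (intro exI[of _ q]) blast
  qed
qed

text \<open>On the diagonal \<open>h(x, x) = 1/(2 pi) ln (|f'(x)| / (1 - |f(x)|\<^sup>2))\<close>.\<close>

lemma kirchhoff_differentiable:
  assumes x: "x \<in> D" shows "kirchhoff_routh h differentiable (at x)"
proof -
  define F where "F y = f (cplx y)" for y
  have fd: "(f has_field_derivative deriv f (cplx x)) (at (cplx x))" by (rule holomorphic_derivI[OF holf open_image]) (use x in auto)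
  have dfh: "(deriv f) holomorphic_on cplx ` D" by (rule holomorphic_deriv[OF holf open_image])
  have dfn: "deriv f (cplx y) \<noteq> 0" if "y \<in> D" for y
    using holomorphic_injective_imp_regular[OF holf open_image injf, of "cplx y"] that by auto
  have 1: "(\<lambda>y. ln (cmod (deriv f (cplx y)))) differentiable (at x)"
    using has_derivative_ln_cmod[OF holomorphic_derivI[OF dfh open_image], of x] dfn[OF x] x by (auto simp: differentiable_def)
  have Fd: "(F has_derivative (\<lambda>v. deriv f (cplx x) * cplx v)) (at x)"
    unfolding F_def using has_derivative_compose[OF bounded_linear_imp_has_derivative[OF bounded_linear_cplx] fd[unfolded has_field_derivative_def]] by simp
  have pos: "1 - F y \<bullet> F y > 0" if "y \<in> D" for y
    using fdisc[of "cplx y"] that by (simp add: F_def power2_norm_eq_inner[symmetric] abs_square_less_1)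
  have "((\<lambda>y. ln (1 - F y \<bullet> F y)) has_derivative (\<lambda>v. (0 - (F x \<bullet> (deriv f (cplx x) * cplx v) + (deriv f (cplx x) * cplx v) \<bullet> F x)) * inverse (1 - F x \<bullet> F x))) (at x)"
    by (intro has_derivative_ln has_derivative_diff has_derivative_const has_derivative_inner Fd pos x)
  then have 2: "(\<lambda>y. ln (1 - F y \<bullet> F y)) differentiable (at x)" by (auto simp: differentiable_def)
  have "(\<lambda>y. 1 / 2 * (1 / (2 * pi)) * (ln (cmod (deriv f (cplx y))) - ln (1 - F y \<bullet> F y))) differentiable (at x)"
    by (intro differentiable_mult differentiable_const differentiable_diff 1 2)
  then obtain L where L: "((\<lambda>y. 1 / 2 * (1 / (2 * pi)) * (ln (cmod (deriv f (cplx y))) - ln (1 - F y \<bullet> F y))) has_derivative L) (at x)"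
    by (auto simp: differentiable_def)
  have "(kirchhoff_routh h has_derivative L) (at x)"
  proof (rule has_derivative_transform_within_open[OF L openD x])
    fix y assume y: "y \<in> D"
    have "1 - cnj (F y) * F y = complex_of_real (1 - F y \<bullet> F y)"
      by (simp add: inner_complex_def complex_eq_iff power2_eq_square)
    then have "cmod (1 - cnj (F y) * F y) = 1 - F y \<bullet> F y" using pos[OF y] by (simp only: norm_of_real abs_of_pos)
    then have "disc_regular y y = 1 / (2 * pi) * ln (cmod (deriv f (cplx y)) / (1 - F y \<bullet> F y))"
      by (simp add: disc_regular_def green_factor_def diff_quot_def norm_divide F_def)
    then show "1 / 2 * (1 / (2 * pi)) * (ln (cmod (deriv f (cplx y))) - ln (1 - F y \<bullet> F y)) = kirchhoff_routh h y"
      using h_eq_disc_regular[OF y y] pos[OF y] dfn[OF y] by (simp add: kirchhoff_routh_def ln_div)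
  qed
  then show ?thesis by (auto simp: differentiable_def)
qed

text \<open>This agrees with \<open>G\<close> off the diagonal of \<open>D \<times> D\<close> and is Borel measurable as a function of two variables,
as Fubini's theorem requires; nothing is known about \<open>G\<close> on the diagonal and outside \<open>D\<close>.\<close>

definition green_kernel :: "real^2 \<Rightarrow> real^2 \<Rightarrow> real" where
  "green_kernel x y = (if x \<in> D \<and> y \<in> D then disc_green x y else 0)"

definition regular_kernel :: "real^2 \<Rightarrow> real^2 \<Rightarrow> real" where
  "regular_kernel x y = (if x \<in> D \<and> y \<in> D then h x y else 0)"

lemma D_borel [measurable]: "D \<in> sets borel" using openD by auto

lemma green_kernel_measurable_pair: "(\<lambda>p. green_kernel (fst p) (snd p)) \<in> borel_measurable (borel \<Otimes>\<^sub>M borel)"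
proof -
  define F where "F y = indicator D y *\<^sub>R f (cplx y)" for y
  have "continuous_on D (\<lambda>y. f (cplx y))"
    by (rule continuous_on_compose2[OF holomorphic_on_imp_continuous_on[OF holf]]) (auto intro!: continuous_intros)
  then have F [measurable]: "F \<in> borel_measurable borel"
    unfolding F_def by (intro borel_measurable_continuous_on_indicator) auto
  have [measurable]: "cnj \<in> borel_measurable borel" by (intro borel_measurable_continuous_onI continuous_intros)
  have "(\<lambda>p. green_kernel (fst p) (snd p)) = (\<lambda>p. indicator D (fst p) * (indicator D (snd p) * (1 / (2 * pi) * ln (cmod (1 - cnj (F (fst p)) * F (snd p)) / cmod (F (snd p) - F (fst p))))))"
    by (auto simp: fun_eq_iff green_kernel_def disc_green_def F_def)
  also have "\<dots> \<in> borel_measurable (borel \<Otimes>\<^sub>M borel)"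
    by measurable
  finally show ?thesis .
qed

lemma green_kernel_measurable [measurable]:
  assumes [measurable]: "u \<in> borel_measurable M" "v \<in> borel_measurable M"
  shows "(\<lambda>t. green_kernel (u t) (v t)) \<in> borel_measurable M"
proof -
  have "(\<lambda>t. (u t, v t)) \<in> M \<rightarrow>\<^sub>M (borel \<Otimes>\<^sub>M borel)" by measurable
  from measurable_compose[OF this green_kernel_measurable_pair] show ?thesis by simp
qed

lemma green_kernel_eq: "x \<in> D \<Longrightarrow> y \<in> D \<Longrightarrow> x \<noteq> y \<Longrightarrow> green_kernel x y = G x y" by (simp add: green_kernel_def G_eq_disc_green)

lemma green_kernel_commute: "green_kernel x y = green_kernel y x"
proof (cases "x \<in> D \<and> y \<in> D \<and> x \<noteq> y")
  case True
  then show ?thesis using green_kernel_eq G_commute by metis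
qed (auto simp: green_kernel_def)

lemma green_kernel_nonneg: "green_kernel x y \<ge> 0"
proof (cases "x \<in> D \<and> y \<in> D \<and> x \<noteq> y")
  case True
  then show ?thesis using green_kernel_eq[of x y] G_pos[of x y] by simp
next
  case False
  then show ?thesis by (auto simp: green_kernel_def disc_green_def)
qed

lemma regular_kernel_measurable [measurable]: "regular_kernel x \<in> borel_measurable borel"
proof (cases "x \<in> D")
  case True
  have "continuous_on D (\<lambda>y. green_factor (cplx x) (cplx y))"
    by (rule continuous_on_compose2[OF holomorphic_on_imp_continuous_on[OF green_factor_holomorphic]]) (use True in \<open>auto intro!: continuous_intros\<close>)
  then have "continuous_on D (\<lambda>y. 1 / (2 * pi) * ln (cmod (green_factor (cplx x) (cplx y))))"
    by (intro continuous_intros) (use green_factor_nz True in auto)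
  then have "(\<lambda>y. indicator D y *\<^sub>R (1 / (2 * pi) * ln (cmod (green_factor (cplx x) (cplx y))))) \<in> borel_measurable borel"
    by (intro borel_measurable_continuous_on_indicator) auto
  also have "(\<lambda>y. indicator D y *\<^sub>R (1 / (2 * pi) * ln (cmod (green_factor (cplx x) (cplx y))))) = regular_kernel x"
    using True h_eq_disc_regular[OF True] by (auto simp: fun_eq_iff regular_kernel_def disc_regular_def)
  finally show ?thesis .
next
  case False
  then have "regular_kernel x = (\<lambda>_. 0)" by (auto simp: regular_kernel_def)
  then show ?thesis by simp
qed

definition domain_density :: "real \<Rightarrow> (real^2 \<Rightarrow> real) \<Rightarrow> bool" where
  "domain_density M \<omega> \<longleftrightarrow> M \<ge> 0 \<and> \<omega> \<in> borel_measurable borel \<and> (\<forall>y. \<bar>\<omega> y\<bar> \<le> M * indicator D y)"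

definition domain_radius :: real where "domain_radius = (SOME R. R > 0 \<and> (\<forall>y\<in>D. norm y \<le> R))"

lemma domain_radius_bound: "domain_radius > 0" "y \<in> D \<Longrightarrow> norm y \<le> domain_radius"
proof -
  have "\<exists>R. R > 0 \<and> (\<forall>y\<in>D. norm y \<le> R)" using bddD bounded_pos by blast
  from someI_ex[OF this] show "domain_radius > 0" "y \<in> D \<Longrightarrow> norm y \<le> domain_radius" unfolding domain_radius_def by auto
qed

lemma domain_densityD:
  assumes "domain_density M \<omega>"
  shows "M \<ge> 0" "\<omega> \<in> borel_measurable borel" "\<bar>\<omega> y\<bar> \<le> M" "y \<notin> D \<Longrightarrow> \<omega> y = 0" "\<bar>\<omega> y\<bar> \<le> M * indicator D y"
    "bounded_density domain_radius M \<omega>" "integrable lborel \<omega>"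
proof -
  show 1: "M \<ge> 0" "\<omega> \<in> borel_measurable borel" "\<And>y. \<bar>\<omega> y\<bar> \<le> M * indicator D y" using assms by (auto simp: domain_density_def)
  show "\<bar>\<omega> y\<bar> \<le> M" using 1(3)[of y] 1(1) by (cases "y \<in> D") auto
  show z: "y \<notin> D \<Longrightarrow> \<omega> y = 0" for y using 1(3)[of y] by auto
  have "\<bar>\<omega> y\<bar> \<le> M * indicator (cball 0 domain_radius) y" for y
    using 1(1) 1(3)[of y] domain_radius_bound(2)[of y] by (cases "y \<in> D") (auto simp: indicator_def)
  then show b: "bounded_density domain_radius M \<omega>" using 1 by (auto simp: bounded_density_def)
  then show "integrable lborel \<omega>" by (rule density_integrable)
qed

lemma integrable_indicator_D: "integrable lborel (indicator D :: real^2 \<Rightarrow> real)"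
proof -
  have "emeasure lborel D < \<infinity>" by (rule emeasure_bounded_finite[OF bddD])
  then show ?thesis by auto
qed

definition potential :: "(real^2 \<Rightarrow> real) \<Rightarrow> real^2 \<Rightarrow> real" where
  "potential \<omega> z = (LINT y|lborel. green_kernel z y * \<omega> y)"

text \<open>A bound for \<open>\<integral>\<^sub>D G(z, y) dy\<close> that does not depend on \<open>z\<close>.\<close>

definition kernel_mass :: real where
  "kernel_mass = (LINT w|lborel. indicator (cball (0::real^2) dm) w * (1 / (2 * pi) * \<bar>ln dm - ln (norm w)\<bar>))"

lemma integrable_kernel_mass: "integrable lborel (\<lambda>w::real^2. indicator (cball 0 dm) w * (1 / (2 * pi) * \<bar>ln dm - ln (norm w)\<bar>))"
proof -
  have "integrable lborel (\<lambda>w::real^2. 1 / (2 * pi) * \<bar>indicator (cball 0 dm) w * ln dm - indicator (cball 0 dm) w * ln (norm w)\<bar>)"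
    by (intro integrable_mult_right integrable_abs Bochner_Integration.integrable_diff integrable_indicator_bounded integrable_ln_norm_ball)
  then show ?thesis by (rule Bochner_Integration.integrable_cong[THEN iffD1, rotated -1]) (auto simp: indicator_def)
qed

lemma kernel_mass_nonneg: "kernel_mass \<ge> 0" unfolding kernel_mass_def by (rule Bochner_Integration.integral_nonneg) (auto simp: indicator_def)

lemma green_kernel_le: 
  assumes "y \<in> D" "x \<in> D"
  shows "green_kernel x y \<le> indicator (cball 0 dm) (x - y) * (1 / (2 * pi) * \<bar>ln dm - ln (norm (x - y))\<bar>)"
proof (cases "x = y")
  case False
  have "green_kernel x y \<le> 1 / (2 * pi) * (ln dm - ln (norm (x - y)))" using G_upper[of x y] green_kernel_eq[of x y] assms False by simp
  also have "\<dots> \<le> 1 / (2 * pi) * \<bar>ln dm - ln (norm (x - y))\<bar>" by (intro mult_left_mono) auto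
  finally show ?thesis using dm_bound(1)[of x y] assms by simp
qed (auto simp: green_kernel_def disc_green_def)

lemma integrable_potential:
  assumes w: "domain_density M \<omega>"
  shows "integrable lborel (\<lambda>y. green_kernel z y * \<omega> y)" "(LINT y|lborel. \<bar>green_kernel z y * \<omega> y\<bar>) \<le> M * kernel_mass"
proof -
  note [measurable] = domain_densityD(2)[OF w]
  let ?k = "\<lambda>w::real^2. indicator (cball 0 dm) w * (1 / (2 * pi) * \<bar>ln dm - ln (norm w)\<bar>)"
  have ik: "integrable lborel (\<lambda>y. M * ?k (z - y))"
    by (rule integrable_mult_right) (subst integrable_reflect_iff[where f="?k"], rule integrable_kernel_mass)
  have b: "\<bar>green_kernel z y * \<omega> y\<bar> \<le> M * ?k (z - y)" for y
  proof (cases "z \<in> D \<and> y \<in> D")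
    case True
    have "\<bar>green_kernel z y * \<omega> y\<bar> = green_kernel z y * \<bar>\<omega> y\<bar>" using green_kernel_nonneg by (simp add: abs_mult)
    also have "\<dots> \<le> ?k (z - y) * M" using green_kernel_le[of y z] True domain_densityD(3)[OF w, of y] green_kernel_nonneg[of z y]
      by (intro mult_mono) (auto simp: indicator_def)
    finally show ?thesis by (simp add: mult.commute)
  next
    case False
    then show ?thesis using domain_densityD(1)[OF w] by (auto simp: green_kernel_def indicator_def)
  qed
  show i: "integrable lborel (\<lambda>y. green_kernel z y * \<omega> y)"
    by (rule Bochner_Integration.integrable_bound[OF ik]) (measurable, rule AE_I2, unfold real_norm_def, rule order_trans[OF b abs_ge_self])
  have "(LINT y|lborel. \<bar>green_kernel z y * \<omega> y\<bar>) \<le> (LINT y|lborel. M * ?k (z - y))"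
    by (rule integral_mono[OF integrable_abs[OF i] ik b])
  also have "\<dots> = M * kernel_mass" using integral_reflect[where f="?k"] by (simp add: kernel_mass_def)
  finally show "(LINT y|lborel. \<bar>green_kernel z y * \<omega> y\<bar>) \<le> M * kernel_mass" .
qed

lemma potential_bound: "domain_density M \<omega> \<Longrightarrow> \<bar>potential \<omega> z\<bar> \<le> M * kernel_mass"
  unfolding potential_def by (rule order_trans[OF integral_abs_bound integrable_potential(2)])

lemma potential_measurable [measurable]:
  assumes [measurable]: "\<omega> \<in> borel_measurable borel" shows "potential \<omega> \<in> borel_measurable borel"
  unfolding potential_def by measurable

lemma integrable_potential_mult:
  assumes w: "domain_density M \<omega>" and v: "domain_density N v"
  shows "integrable lborel (\<lambda>x. v x * potential \<omega> x)"
proof -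
  note [measurable] = domain_densityD(2)[OF w] domain_densityD(2)[OF v]
  show ?thesis
  proof (rule Bochner_Integration.integrable_bound[OF integrable_mult_right[OF domain_densityD(7)[OF v], of "M * kernel_mass"]])
    show "AE x in lborel. norm (v x * potential \<omega> x) \<le> norm (M * kernel_mass * v x)"
    proof (rule AE_I2)
      fix x
      have "\<bar>v x\<bar> * \<bar>potential \<omega> x\<bar> \<le> \<bar>v x\<bar> * (M * kernel_mass)" by (intro mult_left_mono potential_bound[OF w]) simp
      then show "norm (v x * potential \<omega> x) \<le> norm (M * kernel_mass * v x)"
        using domain_densityD(1)[OF w] kernel_mass_nonneg by (simp add: abs_mult mult.commute)
    qed
  qed measurable
qed

lemma potential_symmetric:
  assumes w: "domain_density M \<omega>" and v: "domain_density N v"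
  shows "(LINT x|lborel. v x * potential \<omega> x) = (LINT x|lborel. \<omega> x * potential v x)"
proof -
  note [measurable] = domain_densityD(2)[OF w] domain_densityD(2)[OF v]
  have int: "integrable (lborel \<Otimes>\<^sub>M lborel) (\<lambda>(x, y). v x * (green_kernel x y * \<omega> y))"
  proof (rule lborel_pair.Fubini_integrable)
    show "integrable lborel (\<lambda>x. LINT y|lborel. norm (case (x, y) of (x, y) \<Rightarrow> v x * (green_kernel x y * \<omega> y)))"
    proof (rule Bochner_Integration.integrable_bound[OF integrable_mult_right[OF domain_densityD(7)[OF v], of "M * kernel_mass"]])
      show "AE x in lborel. norm (LINT y|lborel. norm (case (x, y) of (x, y) \<Rightarrow> v x * (green_kernel x y * \<omega> y))) \<le> norm (M * kernel_mass * v x)"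
      proof (rule AE_I2)
        fix x
        have "(LINT y|lborel. norm (case (x, y) of (x, y) \<Rightarrow> v x * (green_kernel x y * \<omega> y))) = \<bar>v x\<bar> * (LINT y|lborel. \<bar>green_kernel x y * \<omega> y\<bar>)"
          by (simp add: abs_mult)
        also have "\<dots> \<le> \<bar>v x\<bar> * (M * kernel_mass)" by (intro mult_left_mono integrable_potential(2)[OF w]) simp
        finally have 1: "(LINT y|lborel. norm (case (x, y) of (x, y) \<Rightarrow> v x * (green_kernel x y * \<omega> y))) \<le> \<bar>v x\<bar> * (M * kernel_mass)" .
        have 2: "0 \<le> (LINT y|lborel. norm (case (x, y) of (x, y) \<Rightarrow> v x * (green_kernel x y * \<omega> y)))" by (rule Bochner_Integration.integral_nonneg) simp
        show "norm (LINT y|lborel. norm (case (x, y) of (x, y) \<Rightarrow> v x * (green_kernel x y * \<omega> y))) \<le> norm (M * kernel_mass * v x)"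
          using 1 2 domain_densityD(1)[OF w] kernel_mass_nonneg by (simp only: real_norm_def abs_mult abs_of_nonneg mult.commute)
      qed
    qed measurable
    show "AE x in lborel. integrable lborel (\<lambda>y. case (x, y) of (x, y) \<Rightarrow> v x * (green_kernel x y * \<omega> y))"
      using integrable_potential(1)[OF w] by auto
  qed measurable
  have "(LINT x|lborel. v x * potential \<omega> x) = (LINT x|lborel. (LINT y|lborel. v x * (green_kernel x y * \<omega> y)))"
    unfolding potential_def by simp
  also have "\<dots> = (LINT y|lborel. (LINT x|lborel. v x * (green_kernel x y * \<omega> y)))"
    by (rule lborel_pair.Fubini_integral[OF int, symmetric])
  also have "\<dots> = (LINT y|lborel. \<omega> y * potential v y)"
  proof (rule Bochner_Integration.integral_cong[OF refl])
    fix y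
    have "(LINT x|lborel. v x * (green_kernel x y * \<omega> y)) = (LINT x|lborel. \<omega> y * (green_kernel y x * v x))"
      using green_kernel_commute by (intro Bochner_Integration.integral_cong) (auto simp: mult_ac)
    then show "(LINT x|lborel. v x * (green_kernel x y * \<omega> y)) = \<omega> y * potential v y" unfolding potential_def by simp
  qed
  finally show ?thesis .
qed

end

text \<open>A gradient is a pointwise limit of difference quotients, which are measurable in the parameter.\<close>

lemma borel_measurable_gradient:
  fixes p :: "'a::euclidean_space \<Rightarrow> 'b \<Rightarrow> real" and g :: "'b \<Rightarrow> 'a"
  assumes U: "open U" "a \<in> U"
    and p: "\<And>z. z \<in> U \<Longrightarrow> p z \<in> borel_measurable M"
    and der: "\<And>y. y \<in> space M \<Longrightarrow> ((\<lambda>z. p z y) has_derivative (\<lambda>v. g y \<bullet> v)) (at a)"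
  shows "g \<in> borel_measurable M"
proof -
  obtain r where r: "r > 0" "ball a r \<subseteq> U" using U open_contains_ball by blast
  have "(\<lambda>y. g y \<bullet> i) \<in> borel_measurable M" if i: "i \<in> Basis" for i
  proof (rule borel_measurable_LIMSEQ_real)
    define t where "t n = r / 2 * inverse (real (Suc n))" for n
    have t: "t n > 0" "t n < r" for n
    proof -
      show "t n > 0" using r by (simp add: t_def)
      have "inverse (real (Suc n)) \<le> 1" by (simp add: inverse_le_1_iff)
      then have "t n \<le> r / 2 * 1" unfolding t_def using r by (intro mult_left_mono) auto
      then show "t n < r" using r by linarith
    qed
    have t0: "t \<longlonglongrightarrow> 0" unfolding t_def by (rule tendsto_mult_right_zero[OF LIMSEQ_inverse_real_of_nat])
    have inU: "a + t n *\<^sub>R i \<in> U" for n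
      using t[of n] i by (intro subsetD[OF r(2)]) (simp add: dist_norm)
    show "(\<lambda>y. (p (a + t n *\<^sub>R i) y - p a y) / t n) \<in> borel_measurable M" for n
      using p[OF inU[of n]] p[OF U(2)] by measurable
    fix y assume y: "y \<in> space M"
    show "(\<lambda>n. (p (a + t n *\<^sub>R i) y - p a y) / t n) \<longlonglongrightarrow> g y \<bullet> i"
      by (rule gradient_difference_quotient_tendsto[OF der[OF y] t0 t(1)])
  qed
  then show ?thesis by (subst borel_measurable_euclidean_space) blast
qed

context green_domain
begin

definition regular_potential :: "(real^2 \<Rightarrow> real) \<Rightarrow> real^2 \<Rightarrow> real" where
  "regular_potential \<omega> z = (LINT y|lborel. regular_kernel z y * \<omega> y)"

lemma
  assumes w: "domain_density M \<omega>" and z: "z \<in> D"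
  shows integrable_regular_potential: "integrable lborel (\<lambda>y. regular_kernel z y * \<omega> y)"
    and potential_eq: "potential \<omega> z = - (1 / (2 * pi)) * log_potential \<omega> z - regular_potential \<omega> z"
proof -
  note [measurable] = domain_densityD(2)[OF w]
  have il: "integrable lborel (\<lambda>y. ln (norm (z - y)) * \<omega> y)" by (rule integrable_log_potential[OF domain_densityD(6)[OF w]])
  have ig: "integrable lborel (\<lambda>y. green_kernel z y * \<omega> y)" by (rule integrable_potential[OF w])
  have i: "integrable lborel (\<lambda>y. - (1 / (2 * pi)) * (ln (norm (z - y)) * \<omega> y) - green_kernel z y * \<omega> y)"
    by (intro Bochner_Integration.integrable_diff integrable_mult_right il ig)
  have ae: "AE y in lborel. - (1 / (2 * pi)) * (ln (norm (z - y)) * \<omega> y) - green_kernel z y * \<omega> y = regular_kernel z y * \<omega> y"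
    using AE_neq_point[of z]
  proof (rule eventually_mono)
    fix y assume y: "y \<noteq> z"
    show "- (1 / (2 * pi)) * (ln (norm (z - y)) * \<omega> y) - green_kernel z y * \<omega> y = regular_kernel z y * \<omega> y"
    proof (cases "y \<in> D")
      case True
      have "green_kernel z y = 1 / (2 * pi) * ln (1 / norm (z - y)) - h z y" using green_kernel_eq[of z y] G_eq[of z y] y z True by simp
      then have e: "green_kernel z y = - (1 / (2 * pi)) * ln (norm (z - y)) - regular_kernel z y" using y z True by (simp add: ln_div regular_kernel_def)
      have gen: "a * (l * w) - (a * l - b) * w = b * w" for a l w b :: real by (simp add: algebra_simps)
      show ?thesis unfolding e by (rule gen)
    qed (use domain_densityD(4)[OF w] in simp)
  qed
  show ih: "integrable lborel (\<lambda>y. regular_kernel z y * \<omega> y)"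
    by (rule integrable_cong_AE_imp[OF i _ ae]) measurable
  have "regular_potential \<omega> z = (LINT y|lborel. - (1 / (2 * pi)) * (ln (norm (z - y)) * \<omega> y) - green_kernel z y * \<omega> y)"
    unfolding regular_potential_def by (rule integral_cong_AE) (use ae in \<open>auto elim: eventually_mono\<close>)
  also have "\<dots> = - (1 / (2 * pi)) * log_potential \<omega> z - potential \<omega> z"
    unfolding log_potential_def potential_def using il ig by simp
  finally show "potential \<omega> z = - (1 / (2 * pi)) * log_potential \<omega> z - regular_potential \<omega> z" by simp
qed

definition areaD :: real where "areaD = (LINT y|lborel. indicator D y)"

lemma areaD_nonneg: "areaD \<ge> 0" unfolding areaD_def by (rule Bochner_Integration.integral_nonneg) simp

lemma integrable_const_D: "integrable lborel (\<lambda>y. K * indicator D y :: real)" "(LINT y|lborel. K * indicator D y) = K * areaD"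
  using integrable_indicator_D by (simp_all add: areaD_def)

lemma regular_potential_estimates:
  assumes x: "x \<in> D"
  obtains r L where "r > 0" "ball x r \<subseteq> D" "L \<ge> 0"
    "\<And>M \<omega> z. domain_density M \<omega> \<Longrightarrow> z \<in> ball x r \<Longrightarrow> \<exists>g. (regular_potential \<omega> has_derivative (\<lambda>v. g \<bullet> v)) (at z) \<and> norm g \<le> M * L"
    "\<And>M \<omega> s. domain_density M \<omega> \<Longrightarrow> 0 < s \<Longrightarrow> s < r / 4 \<Longrightarrow> \<bar>stencil s (regular_potential \<omega>) x\<bar> \<le> M * L * s^3"
proof -
  obtain r B where r: "r > 0" "ball x r \<subseteq> D" "B \<ge> 0" and
    ex: "\<And>y. y \<in> D \<Longrightarrow> \<exists>q. q holomorphic_on ball (cplx x) r \<and> (\<forall>w\<in>ball (cplx x) r. cmod (q w) \<le> B) \<and>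
       (\<forall>z\<in>ball x r. ((\<lambda>z. h z y) has_derivative (\<lambda>v. Re (cplx v * q (cplx z)))) (at z))"
    using h_local_holomorphic[OF x] by metis
  from ex obtain q where q: "\<And>y. y \<in> D \<Longrightarrow> q y holomorphic_on ball (cplx x) r"
      "\<And>y w. y \<in> D \<Longrightarrow> w \<in> ball (cplx x) r \<Longrightarrow> cmod (q y w) \<le> B"
      "\<And>y z. y \<in> D \<Longrightarrow> z \<in> ball x r \<Longrightarrow> ((\<lambda>z. h z y) has_derivative (\<lambda>v. Re (cplx v * q y (cplx z)))) (at z)"
    by metis
  have inb: "cplx z \<in> ball (cplx x) r" if "z \<in> ball x r" for z using that norm_cplx[of "x - z"] by (simp add: dist_norm cplx_diff)
  define L where "L = B * areaD + 64 * B / r\<^sup>2 * areaD"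
  have L: "L \<ge> 0" "B * areaD \<le> L" "64 * B / r\<^sup>2 * areaD \<le> L" using r areaD_nonneg by (auto simp: L_def)
  have hbd: "((\<lambda>z. regular_kernel z y) has_derivative (\<lambda>v. Re (cplx v * q y (cplx z)))) (at z)" if "y \<in> D" "z \<in> ball x r" for y z
    by (rule has_derivative_transform_within_open[OF q(3)[OF that] openD]) (use that r in \<open>auto simp: regular_kernel_def\<close>)
  show ?thesis
  proof (rule that[OF r(1,2) L(1)])
    fix M \<omega> z assume w: "domain_density M \<omega>" and z: "z \<in> ball x r"
    note [measurable] = domain_densityD(2)[OF w]
    define g where "g y = (if y \<in> D then \<omega> y *\<^sub>R plane (cnj (q y (cplx z))) else 0)" for y
    have der: "((\<lambda>z. regular_kernel z y * \<omega> y) has_derivative (\<lambda>v. g y \<bullet> v)) (at z)" for y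
    proof (cases "y \<in> D")
      case True
      have "((\<lambda>z. regular_kernel z y * \<omega> y) has_derivative (\<lambda>v. Re (cplx v * q y (cplx z)) * \<omega> y)) (at z)"
        by (rule has_derivative_mult_left[OF hbd[OF True z]])
      then show ?thesis unfolding g_def Re_mult_eq_inner using True by (simp add: mult.commute)
    next
      case False
      then show ?thesis using domain_densityD(4)[OF w] by (simp add: g_def)
    qed
    have Dz: "z \<in> D" using z r by auto
    have lip: "\<bar>regular_kernel u y * \<omega> y - regular_kernel z y * \<omega> y\<bar> \<le> (M * B * indicator D y) * norm (u - z)" if u: "u \<in> ball x r" for u y
    proof (cases "y \<in> D")
      case True
      have "\<bar>regular_kernel u y - regular_kernel z y\<bar> \<le> B * norm (u - z)"
        by (rule holomorphic_gradient_estimates(1)[OF q(1)[OF True] q(2)[OF True] r(1) hbd[OF True] u z])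
      then have "\<bar>\<omega> y\<bar> * \<bar>regular_kernel u y - regular_kernel z y\<bar> \<le> M * (B * norm (u - z))" using domain_densityD(1,3)[OF w] by (intro mult_mono) auto
      moreover have "\<bar>regular_kernel u y * \<omega> y - regular_kernel z y * \<omega> y\<bar> = \<bar>\<omega> y\<bar> * \<bar>regular_kernel u y - regular_kernel z y\<bar>" by (simp add: abs_mult[symmetric] algebra_simps)
      ultimately show ?thesis using True by simp
    qed (use domain_densityD(4)[OF w] in simp)
    have meas: "g \<in> borel_measurable lborel"
      by (rule borel_measurable_gradient[of "ball x r" z "\<lambda>z y. regular_kernel z y * \<omega> y", OF open_ball z _ der]) measurable
    note K = has_derivative_integral_Lipschitz_kernel[where U="ball x r" and a=z and M=lborel and p="\<lambda>z y. regular_kernel z y * \<omega> y" and g=g and L="\<lambda>y. M * B * indicator D y",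
        OF open_ball z _ meas integrable_const_D(1) lip der]
    have 1: "(regular_potential \<omega> has_derivative (\<lambda>v. (LINT y|lborel. g y) \<bullet> v)) (at z)"
      unfolding regular_potential_def by (rule K(1)) (use integrable_regular_potential[OF w] r in auto)
    have ng: "norm (g y) \<le> M * B * indicator D y" for y
    proof (cases "y \<in> D")
      case True
      have "norm (g y) = \<bar>\<omega> y\<bar> * cmod (q y (cplx z))" using True by (simp add: g_def)
      also have "\<dots> \<le> M * B" using domain_densityD(1,3)[OF w] q(2)[OF True inb[OF z]] by (intro mult_mono) auto
      finally show ?thesis using True by simp
    qed (simp add: g_def)
    have "norm (LINT y|lborel. g y) \<le> (LINT y|lborel. M * B * indicator D y)"
    proof (rule order_trans[OF integral_norm_bound integral_mono])
      show "integrable lborel (\<lambda>y. norm (g y))"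
        by (intro integrable_norm K(2)) (use integrable_regular_potential[OF w] r in auto)
    qed (use ng integrable_const_D(1) in auto)
    also have "\<dots> = M * (B * areaD)" using integrable_const_D(2)[of "M * B"] by simp
    also have "\<dots> \<le> M * L" using L domain_densityD(1)[OF w] by (intro mult_left_mono) auto
    finally show "\<exists>g. (regular_potential \<omega> has_derivative (\<lambda>v. g \<bullet> v)) (at z) \<and> norm g \<le> M * L" using 1 by blast
  next
    fix M \<omega> s assume w: "domain_density M \<omega>" and s: "0 < s" "s < r / 4"
    note [measurable] = domain_densityD(2)[OF w]
    have inb': "x + s *\<^sub>R plane (\<i>^j) \<in> ball x r" for j using s r by (simp add: dist_norm norm_power)
    have inD: "x + s *\<^sub>R plane (\<i>^j) \<in> D" for j using inb' r by blast
    have st: "stencil s (regular_potential \<omega>) x = (LINT y|lborel. stencil s (\<lambda>z. regular_kernel z y) x * \<omega> y)"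
    proof -
      have "(LINT y|lborel. stencil s (\<lambda>z. regular_kernel z y) x * \<omega> y) = (LINT y|lborel. (\<Sum>j<4. regular_kernel (x + s *\<^sub>R plane (\<i>^j)) y * \<omega> y) - 4 * (regular_kernel x y * \<omega> y))"
        unfolding stencil_def by (intro Bochner_Integration.integral_cong) (auto simp: left_diff_distrib sum_distrib_right)
      also have "\<dots> = stencil s (regular_potential \<omega>) x"
        unfolding stencil_def regular_potential_def using integrable_regular_potential[OF w inD] integrable_regular_potential[OF w x] by simp
      finally show ?thesis by simp
    qed
    have int: "integrable lborel (\<lambda>y. stencil s (\<lambda>z. regular_kernel z y) x * \<omega> y)"
    proof -
      have "integrable lborel (\<lambda>y. (\<Sum>j<4. regular_kernel (x + s *\<^sub>R plane (\<i>^j)) y * \<omega> y) - 4 * (regular_kernel x y * \<omega> y))"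
        by (intro Bochner_Integration.integrable_diff Bochner_Integration.integrable_sum integrable_mult_right integrable_regular_potential[OF w] inD x)
      then show ?thesis unfolding stencil_def by (simp add: left_diff_distrib sum_distrib_right mult.assoc)
    qed
    have b: "\<bar>stencil s (\<lambda>z. regular_kernel z y) x * \<omega> y\<bar> \<le> M * (64 * B / r\<^sup>2 * s^3) * indicator D y" for y
    proof (cases "y \<in> D")
      case True
      have "\<bar>stencil s (\<lambda>z. regular_kernel z y) x\<bar> \<le> 64 * B / r\<^sup>2 * s^3"
        by (rule holomorphic_gradient_estimates(2)[OF q(1)[OF True] q(2)[OF True] r(1) hbd[OF True] s])
      then have "\<bar>\<omega> y\<bar> * \<bar>stencil s (\<lambda>z. regular_kernel z y) x\<bar> \<le> M * (64 * B / r\<^sup>2 * s^3)" using domain_densityD(1,3)[OF w] by (intro mult_mono) auto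
      then show ?thesis using True by (simp add: abs_mult mult.commute)
    qed (use domain_densityD(4)[OF w] in simp)
    have "\<bar>stencil s (regular_potential \<omega>) x\<bar> \<le> (LINT y|lborel. M * (64 * B / r\<^sup>2 * s^3) * indicator D y)"
      unfolding st
      by (rule order_trans[OF integral_abs_bound integral_mono[OF integrable_abs[OF int] integrable_const_D(1) b]])
    also have "\<dots> = M * (64 * B / r\<^sup>2 * areaD) * s^3" unfolding integrable_const_D(2) by simp
    also have "\<dots> \<le> M * L * s^3" using L domain_densityD(1)[OF w] s by (intro mult_right_mono mult_left_mono) auto
    finally show "\<bar>stencil s (regular_potential \<omega>) x\<bar> \<le> M * L * s^3" .
  qed
qed

lemma potential_has_derivative:
  assumes x: "x \<in> D"
  obtains r L where "r > 0" "ball x r \<subseteq> D" "L \<ge> 0"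
    "\<And>M \<omega> z. domain_density M \<omega> \<Longrightarrow> z \<in> ball x r \<Longrightarrow> \<exists>g. (potential \<omega> has_derivative (\<lambda>v. g \<bullet> v)) (at z) \<and> norm g \<le> M * L"
proof -
  obtain r L where r: "r > 0" "ball x r \<subseteq> D" "L \<ge> 0" and
    H: "\<And>M \<omega> z. domain_density M \<omega> \<Longrightarrow> z \<in> ball x r \<Longrightarrow> \<exists>g. (regular_potential \<omega> has_derivative (\<lambda>v. g \<bullet> v)) (at z) \<and> norm g \<le> M * L"
    using regular_potential_estimates[OF x] by metis
  define I where "I = (LINT w|lborel. indicator (cball (0::real^2) (domain_radius + domain_radius)) w * (1 / norm w))"
  have ii: "integrable lborel (\<lambda>w::real^2. indicator (cball 0 R) w * (1 / norm w))" for R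
    using integrable_inverse_norm_ball[of R] by simp
  have I0: "I \<ge> 0" unfolding I_def by (rule Bochner_Integration.integral_nonneg) simp
  show ?thesis
  proof (rule that[OF r(1,2), of "1 / (2 * pi) * I + L"])
    show "0 \<le> 1 / (2 * pi) * I + L" using I0 r by simp
    fix M \<omega> z assume w: "domain_density M \<omega>" and z: "z \<in> ball x r"
    have zD: "z \<in> D" using z r by auto
    obtain g where g: "(regular_potential \<omega> has_derivative (\<lambda>v. g \<bullet> v)) (at z)" "norm g \<le> M * L" using H[OF w z] by blast
    define k where "k = (LINT y|lborel. \<omega> y *\<^sub>R smooth_ln_grad 0 (z - y))"
    have k: "(log_potential \<omega> has_derivative (\<lambda>v. k \<bullet> v)) (at z)" unfolding k_def by (rule log_potential_has_derivative[OF domain_densityD(6)[OF w]])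
    have "norm k \<le> M * (LINT w|lborel. indicator (cball (0::real^2) (domain_radius + norm z)) w * (1 / norm w))"
      unfolding k_def by (rule log_potential_gradient_bound[OF domain_densityD(6)[OF w]])
    also have "\<dots> \<le> M * I"
      unfolding I_def by (intro mult_left_mono integral_mono ii) (use domain_radius_bound(2)[OF zD] domain_densityD(1)[OF w] in \<open>auto simp: indicator_def\<close>)
    finally have kb: "norm k \<le> M * I" .
    have "((\<lambda>z. - (1 / (2 * pi)) * log_potential \<omega> z - regular_potential \<omega> z) has_derivative (\<lambda>v. - (1 / (2 * pi)) * (k \<bullet> v) - g \<bullet> v)) (at z)"
      by (intro has_derivative_diff has_derivative_mult_right k g)
    then have "(potential \<omega> has_derivative (\<lambda>v. - (1 / (2 * pi)) * (k \<bullet> v) - g \<bullet> v)) (at z)"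
      by (rule has_derivative_transform_within_open[OF _ openD zD]) (simp add: potential_eq[OF w])
    moreover have "- (1 / (2 * pi)) * (k \<bullet> v) - g \<bullet> v = (- (1 / (2 * pi)) *\<^sub>R k - g) \<bullet> v" for v by (simp add: inner_diff_left)
    moreover have "norm (- (1 / (2 * pi)) *\<^sub>R k - g) \<le> M * (1 / (2 * pi) * I + L)"
    proof -
      have "norm (- (1 / (2 * pi)) *\<^sub>R k - g) \<le> 1 / (2 * pi) * norm k + norm g"
        using norm_triangle_ineq4[of "- (1 / (2 * pi)) *\<^sub>R k" g] by simp
      also have "\<dots> \<le> 1 / (2 * pi) * (M * I) + M * L" using kb g by (intro add_mono mult_left_mono) auto
      finally show ?thesis by (simp add: algebra_simps)
    qed
    ultimately show "\<exists>g. (potential \<omega> has_derivative (\<lambda>v. g \<bullet> v)) (at z) \<and> norm g \<le> M * (1 / (2 * pi) * I + L)" by auto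
  qed
qed

text \<open>The constants are uniform over all densities with the same bound: this is the equicontinuity on which
the compactness argument rests.\<close>

lemma potential_Lipschitz:
  assumes x: "x \<in> D"
  obtains r L where "r > 0" "ball x r \<subseteq> D" "L \<ge> 0"
    "\<And>M \<omega> y z. domain_density M \<omega> \<Longrightarrow> y \<in> ball x r \<Longrightarrow> z \<in> ball x r \<Longrightarrow> \<bar>potential \<omega> y - potential \<omega> z\<bar> \<le> M * L * norm (y - z)"
proof -
  obtain r L where r: "r > 0" "ball x r \<subseteq> D" "L \<ge> 0" and
    H: "\<And>M \<omega> z. domain_density M \<omega> \<Longrightarrow> z \<in> ball x r \<Longrightarrow> \<exists>g. (potential \<omega> has_derivative (\<lambda>v. g \<bullet> v)) (at z) \<and> norm g \<le> M * L"
    using potential_has_derivative[OF x] by metis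
  show ?thesis
  proof (rule that[OF r])
    fix M \<omega> y z assume w: "domain_density M \<omega>" and yz: "y \<in> ball x r" "z \<in> ball x r"
    from H[OF w] obtain g where g: "\<And>z. z \<in> ball x r \<Longrightarrow> (potential \<omega> has_derivative (\<lambda>v. g z \<bullet> v)) (at z)" "\<And>z. z \<in> ball x r \<Longrightarrow> norm (g z) \<le> M * L"
      by metis
    show "\<bar>potential \<omega> y - potential \<omega> z\<bar> \<le> M * L * norm (y - z)"
      by (rule gradient_bound_imp_Lipschitz[OF convex_ball yz g])
  qed
qed

end

context green_domain
begin

section \<open>Compactness and existence of a maximiser\<close>

definition admissible :: "real \<Rightarrow> (real^2 \<Rightarrow> real) \<Rightarrow> bool" where
  "admissible \<mu> \<omega> \<longleftrightarrow> \<omega> \<in> borel_measurable borel \<and> (\<forall>y. 0 \<le> \<omega> y \<and> \<omega> y \<le> \<mu> * indicator D y) \<and> (LINT y|lborel. \<omega> y) = 1"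

lemma admissibleD:
  assumes "admissible \<mu> \<omega>"
  shows "domain_density \<mu> \<omega>" "\<omega> \<in> borel_measurable borel" "0 \<le> \<omega> y" "\<omega> y \<le> \<mu>" "y \<notin> D \<Longrightarrow> \<omega> y = 0" "\<omega> y \<le> \<mu> * indicator D y"
    "(LINT y|lborel. \<omega> y) = 1" "\<mu> \<ge> 0" "integrable lborel \<omega>"
proof -
  note a = assms[unfolded admissible_def]
  show 1: "\<omega> \<in> borel_measurable borel" "\<And>y. 0 \<le> \<omega> y" "\<And>y. \<omega> y \<le> \<mu> * indicator D y" "(LINT y|lborel. \<omega> y) = 1" using a by auto
  obtain p where p: "p \<in> D" using neD by blast
  show m: "\<mu> \<ge> 0" using 1(2)[of p] 1(3)[of p] p by simp
  show d: "domain_density \<mu> \<omega>" unfolding domain_density_def using 1 m by auto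
  show "\<omega> y \<le> \<mu>" "y \<notin> D \<Longrightarrow> \<omega> y = 0" using domain_densityD(3,4)[OF d] 1(2) by (auto simp: abs_le_iff)
  show "integrable lborel \<omega>" by (rule domain_densityD(7)[OF d])
qed

lemma admissible_convex:
  assumes v: "admissible \<mu> v" and w: "admissible \<mu> w" and t: "0 \<le> t" "t \<le> 1"
  shows "admissible \<mu> (\<lambda>y. (1 - t) * v y + t * w y)"
proof -
  note [measurable] = admissibleD(2)[OF v] admissibleD(2)[OF w]
  have "(1 - t) * v y + t * w y \<le> \<mu> * indicator D y" for y
  proof -
    have "(1 - t) * v y + t * w y \<le> (1 - t) * (\<mu> * indicator D y) + t * (\<mu> * indicator D y)"
      using t by (intro add_mono mult_left_mono admissibleD(6)[OF v] admissibleD(6)[OF w]) auto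
    also have "\<dots> = \<mu> * indicator D y" by (simp add: algebra_simps)
    finally show ?thesis .
  qed
  moreover have "(LINT y|lborel. (1 - t) * v y + t * w y) = 1"
    using admissibleD(7,9)[OF v] admissibleD(7,9)[OF w] by simp
  ultimately show ?thesis unfolding admissible_def using t admissibleD(3)[OF v] admissibleD(3)[OF w] by auto
qed

lemma potential_linear:
  assumes v: "domain_density M v" and w: "domain_density N w"
  shows "potential (\<lambda>y. a * v y + b * w y) z = a * potential v z + b * potential w z"
proof -
  have "potential (\<lambda>y. a * v y + b * w y) z = (LINT y|lborel. a * (green_kernel z y * v y) + b * (green_kernel z y * w y))"
    unfolding potential_def by (intro Bochner_Integration.integral_cong) (auto simp: algebra_simps)
  also have "\<dots> = a * potential v z + b * potential w z"
    unfolding potential_def using integrable_potential(1)[OF v] integrable_potential(1)[OF w] by simp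
  finally show ?thesis .
qed

text \<open>Iterated midpoints of members of a tail of the sequence; the parallelogram law uses midpoints only.\<close>

inductive midpoint_hull :: "(nat \<Rightarrow> real^2 \<Rightarrow> real) \<Rightarrow> nat \<Rightarrow> (real^2 \<Rightarrow> real) \<Rightarrow> bool" for w n where
  base: "k \<ge> n \<Longrightarrow> midpoint_hull w n (w k)"
| mid: "midpoint_hull w n u \<Longrightarrow> midpoint_hull w n v \<Longrightarrow> midpoint_hull w n (\<lambda>y. (1 - 1/2) * u y + (1/2) * v y)"

lemma midpoint_hull_mono: "midpoint_hull w n u \<Longrightarrow> m \<le> n \<Longrightarrow> midpoint_hull w m u"
proof (induction rule: midpoint_hull.induct)
  case (mid u v)
  then show ?case by (intro midpoint_hull.mid)
qed (auto intro: midpoint_hull.base)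

lemma midpoint_hull_admissible: "midpoint_hull w n u \<Longrightarrow> (\<And>k. admissible \<mu> (w k)) \<Longrightarrow> admissible \<mu> u"
proof (induction rule: midpoint_hull.induct)
  case (mid u v)
  then show ?case using admissible_convex[of \<mu> u v "1/2"] by simp
qed

lemma midpoint_hull_potential:
  assumes "midpoint_hull w n u" "\<And>k. admissible \<mu> (w k)" "\<And>k. k \<ge> n \<Longrightarrow> \<bar>potential (w k) z - l\<bar> \<le> e"
  shows "\<bar>potential u z - l\<bar> \<le> e"
  using assms(1)
proof (induction rule: midpoint_hull.induct)
  case (base k)
  then show ?case using assms(3) by simp
next
  case (mid u v)
  have "potential (\<lambda>y. (1 - 1/2) * u y + (1/2) * v y) z = (1 - 1/2) * potential u z + (1/2) * potential v z"
    by (rule potential_linear[OF admissibleD(1)[OF midpoint_hull_admissible[OF mid(1) assms(2)]] admissibleD(1)[OF midpoint_hull_admissible[OF mid(2) assms(2)]]])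
  then show ?case using mid.IH by (simp add: abs_le_iff)
qed

lemma admissible_square_integrable:
  assumes v: "admissible \<mu> v" and w: "admissible \<mu> w"
  shows "integrable lborel (\<lambda>y. v y * w y)"
proof -
  note [measurable] = admissibleD(2)[OF v] admissibleD(2)[OF w]
  show ?thesis
  proof (rule Bochner_Integration.integrable_bound[OF integrable_mult_right[OF admissibleD(9)[OF v], of \<mu>]])
    show "AE y in lborel. norm (v y * w y) \<le> norm (\<mu> * v y)"
    proof (rule AE_I2)
      fix y
      have "v y * w y \<le> v y * \<mu>" by (intro mult_left_mono admissibleD(3)[OF v] admissibleD(4)[OF w])
      then show "norm (v y * w y) \<le> norm (\<mu> * v y)"
        using admissibleD(3)[OF w, of y] admissibleD(3)[OF v, of y] admissibleD(8)[OF w] by (simp add: abs_mult mult.commute)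
    qed
  qed measurable
qed

text \<open>First a subsequence is chosen whose potentials converge on a countable dense set, hence everywhere in
\<open>D\<close> by equicontinuity. Let \<open>V n\<close> almost minimise the \<open>L\<^sup>2\<close> norm in the hull of the \<open>n\<close>-th tail. The
minima increase to a limit, so by the parallelogram law \<open>V\<close> is Cauchy in \<open>L\<^sup>2\<close>, therefore in \<open>L\<^sup>1\<close>, and
a subsequence converges almost everywhere to some \<open>v\<close>. Averaging over tails does not change the limit
of the potentials, so \<open>v\<close> has the limit potential.\<close>

lemma admissible_compact:
  assumes w: "\<And>n. admissible \<mu> (w n)"
  obtains r v where "strict_mono (r :: nat \<Rightarrow> nat)" "admissible \<mu> v" "\<And>z. z \<in> D \<Longrightarrow> (\<lambda>n. potential (w (r n)) z) \<longlonglongrightarrow> potential v z"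
proof -
  have mu: "\<mu> \<ge> 0" by (rule admissibleD(8)[OF w])
  obtain Q :: "(real^2) set" where Q: "countable Q" "\<And>X. open X \<Longrightarrow> X \<noteq> {} \<Longrightarrow> \<exists>q\<in>Q. q \<in> X"
    using countable_dense_setE by metis
  obtain r where r: "strict_mono (r :: nat \<Rightarrow> nat)" and rQ: "\<And>q. q \<in> Q \<Longrightarrow> \<exists>l. (\<lambda>n. potential (w (r n)) q) \<longlonglongrightarrow> l"
    using function_convergent_subsequence[OF Q(1), of "\<lambda>n. potential (w n)" "\<mu> * kernel_mass"] potential_bound[OF admissibleD(1)[OF w]] by auto
  have "Cauchy (\<lambda>n. potential (w (r n)) z)" if z: "z \<in> D" for z
  proof (rule metric_CauchyI)
    fix e :: real assume e: "e > 0"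
    obtain \<rho> L where L: "\<rho> > 0" "ball z \<rho> \<subseteq> D" "L \<ge> 0"
      "\<And>M \<omega> a b. domain_density M \<omega> \<Longrightarrow> a \<in> ball z \<rho> \<Longrightarrow> b \<in> ball z \<rho> \<Longrightarrow> \<bar>potential \<omega> a - potential \<omega> b\<bar> \<le> M * L * norm (a - b)"
      using potential_Lipschitz[OF z] by metis
    define d where "d = min \<rho> (e / (3 * (\<mu> * L + 1)))"
    have mL: "\<mu> * L \<ge> 0" using mu L by simp
    have d: "d > 0" using L e mL by (simp add: d_def)
    obtain q where q: "q \<in> Q" "q \<in> ball z d" using Q(2)[of "ball z d"] d by auto
    have near: "\<bar>potential (w n) z - potential (w n) q\<bar> < e / 3" for n
    proof -
      have "\<bar>potential (w n) z - potential (w n) q\<bar> \<le> \<mu> * L * norm (z - q)"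
        by (rule L(4)[OF admissibleD(1)[OF w]]) (use q L in \<open>auto simp: d_def\<close>)
      also have "\<dots> \<le> (\<mu> * L + 1) * norm (z - q)" by (simp add: algebra_simps)
      also have "\<dots> < (\<mu> * L + 1) * d" using q mL by (intro mult_strict_left_mono) (auto simp: dist_norm)
      also have "\<dots> \<le> (\<mu> * L + 1) * (e / (3 * (\<mu> * L + 1)))" using mL by (intro mult_left_mono) (auto simp: d_def)
      also have "\<dots> = e / 3" using mL by (simp add: field_simps)
      finally show ?thesis .
    qed
    have "Cauchy (\<lambda>n. potential (w (r n)) q)" using rQ[OF q(1)] LIMSEQ_imp_Cauchy by blast
    then obtain N where N: "\<And>m n. m \<ge> N \<Longrightarrow> n \<ge> N \<Longrightarrow> dist (potential (w (r m)) q) (potential (w (r n)) q) < e / 3"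
      using metric_CauchyD[of "\<lambda>n. potential (w (r n)) q" "e/3"] e by auto
    show "\<exists>N. \<forall>m\<ge>N. \<forall>n\<ge>N. dist (potential (w (r m)) z) (potential (w (r n)) z) < e"
    proof (intro exI allI impI)
      fix m n assume "m \<ge> N" "n \<ge> N"
      then show "dist (potential (w (r m)) z) (potential (w (r n)) z) < e"
        using N[of m n] near[of "r m"] near[of "r n"] unfolding dist_real_def by linarith
    qed
  qed
  then have "\<exists>l. (\<lambda>n. potential (w (r n)) z) \<longlonglongrightarrow> l" if "z \<in> D" for z
    using that Cauchy_convergent_iff convergent_def by metis
  then obtain l where l: "\<And>z. z \<in> D \<Longrightarrow> (\<lambda>n. potential (w (r n)) z) \<longlonglongrightarrow> l z" by metis
  define W where "W n = w (r n)" for n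
  have W: "admissible \<mu> (W n)" for n using w by (simp add: W_def)
  define N where "N u = (LINT y|lborel. u y * u y)" for u :: "real^2 \<Rightarrow> real"
  define S where "S n = N ` {u. midpoint_hull W n u}" for n
  have N0: "N u \<ge> 0" for u unfolding N_def by (rule Bochner_Integration.integral_nonneg) simp
  have Nmu: "N u \<le> \<mu>" if "admissible \<mu> u" for u
  proof -
    have "N u \<le> (LINT y|lborel. \<mu> * u y)" unfolding N_def
      by (rule integral_mono[OF admissible_square_integrable[OF that that] integrable_mult_right[OF admissibleD(9)[OF that]]])
         (intro mult_right_mono admissibleD(3,4)[OF that])
    then show ?thesis using admissibleD(7)[OF that] by simp
  qed
  define d where "d n = Inf (S n)" for n
  have Sne: "S n \<noteq> {}" for n unfolding S_def using midpoint_hull.base[of n n W] by auto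
  have Sbd: "bdd_below (S n)" for n unfolding S_def using N0 by (intro bdd_belowI[of _ 0]) auto
  have dle: "d n \<le> N u" if "midpoint_hull W n u" for n u unfolding d_def
    by (rule cInf_lower[OF _ Sbd]) (use that in \<open>auto simp: S_def\<close>)
  have "\<exists>u. midpoint_hull W n u \<and> N u < d n + inverse (real (Suc n))" for n
  proof -
    have "Inf (S n) < d n + inverse (real (Suc n))" by (simp add: d_def)
    from cInf_lessD[OF Sne this] show ?thesis by (auto simp: S_def)
  qed
  then obtain V where V: "\<And>n. midpoint_hull W n (V n)" "\<And>n. N (V n) < d n + inverse (real (Suc n))" by metis
  have Va: "admissible \<mu> (V n)" for n by (rule midpoint_hull_admissible[OF V(1) W])
  have dmono: "d m \<le> d n" if "m \<le> n" for m n
    unfolding d_def by (rule cInf_superset_mono[OF Sne Sbd]) (use midpoint_hull_mono that in \<open>auto simp: S_def\<close>)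
  have dbd: "d n \<le> \<mu>" for n using dle[OF V(1)[of n]] Nmu[OF Va[of n]] by linarith
  have "Bseq d"
  proof (rule BseqI'[of _ \<mu>])
    have "0 \<le> d n" for n unfolding d_def by (rule cInf_greatest[OF Sne]) (use N0 in \<open>auto simp: S_def\<close>)
    then show "norm (d n) \<le> \<mu>" for n using dbd[of n] by simp
  qed
  then have "convergent d" using dmono by (intro Bseq_monoseq_convergent) (auto simp: monoseq_def)
  then have Cd: "Cauchy d" by (simp add: Cauchy_convergent_iff)
  have para: "(LINT y|lborel. (V m y - V n y)\<^sup>2) \<le> 2 * inverse (real (Suc m)) + 2 * inverse (real (Suc n)) + 2 * (d n - d m)" if mn: "m \<le> n" for m n
  proof -
    define u where "u = (\<lambda>y. (1 - 1/2) * V m y + (1/2) * V n y)"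
    have um: "midpoint_hull W m u" unfolding u_def by (intro midpoint_hull.mid V midpoint_hull_mono[OF V(1) mn])
    note si = admissible_square_integrable[OF Va[of m] Va[of m]] admissible_square_integrable[OF Va[of n] Va[of n]] admissible_square_integrable[OF midpoint_hull_admissible[OF um W] midpoint_hull_admissible[OF um W]]
    have "(LINT y|lborel. (V m y - V n y)\<^sup>2) = (LINT y|lborel. 2 * (V m y * V m y) + 2 * (V n y * V n y) - 4 * (u y * u y))"
      by (intro Bochner_Integration.integral_cong) (auto simp: u_def power2_eq_square field_simps)
    also have "\<dots> = 2 * N (V m) + 2 * N (V n) - 4 * N u" unfolding N_def using si by simp
    finally have X: "(LINT y|lborel. (V m y - V n y)\<^sup>2) = 2 * N (V m) + 2 * N (V n) - 4 * N u" .
    have gen: "X \<le> 2 * a + 2 * b + 2 * (q - p)" if "X = 2 * A + 2 * B - 4 * U" "A < p + a" "B < q + b" "p \<le> U" for X A B U a b p q :: real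
    proof -
      have "A + B \<le> (p + a) + (q + b)" using that by (intro add_mono) auto
      then have "2 * A + 2 * B \<le> 2 * ((p + a) + (q + b))" by simp
      moreover have "4 * U \<ge> 4 * p" using that by simp
      ultimately have "X \<le> 2 * ((p + a) + (q + b)) - 4 * p" unfolding that(1) by (rule diff_mono)
      also have "\<dots> = 2 * a + 2 * b + 2 * (q - p)" by (simp add: algebra_simps)
      finally show ?thesis .
    qed
    show ?thesis by (rule gen[OF X V(2)[of m] V(2)[of n] dle[OF um]])
  qed
  have sqint: "integrable lborel (\<lambda>y. (V m y - V n y)\<^sup>2)" for m n
  proof -
    note si = admissible_square_integrable[OF Va[of m] Va[of m]] admissible_square_integrable[OF Va[of n] Va[of n]] admissible_square_integrable[OF Va[of m] Va[of n]]
    have "integrable lborel (\<lambda>y. V m y * V m y + V n y * V n y - 2 * (V m y * V n y))" using si by simp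
    then show ?thesis by (simp add: power2_eq_square algebra_simps)
  qed
  have L1: "\<exists>N. \<forall>i\<ge>N. \<forall>j\<ge>N. (LINT y|lborel. norm (V i y - V j y)) < e" if e: "e > 0" for e
  proof -
    (* On D, |t| is at most \<epsilon> + t^2 / \<epsilon>, which bounds the L1 norm on a set of finite measure
       by the square of the L2 norm. *)
    define \<epsilon> where "\<epsilon> = e / (2 * (areaD + 1))"
    have \<epsilon>: "\<epsilon> > 0" "\<epsilon> * areaD < e / 2 + e / 4" using e areaD_nonneg by (auto simp: \<epsilon>_def field_simps add_pos_nonneg)
    define \<eta> where "\<eta> = \<epsilon> * e / 4"
    have \<eta>: "\<eta> > 0" using \<epsilon> e by (simp add: \<eta>_def)
    obtain N1 where N1: "\<And>m n. m \<ge> N1 \<Longrightarrow> n \<ge> N1 \<Longrightarrow> dist (d m) (d n) < \<eta> / 8"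
      using metric_CauchyD[OF Cd, of "\<eta>/8"] \<eta> by auto
    have "\<forall>\<^sub>F n in sequentially. inverse (real (Suc n)) < \<eta> / 8"
      using \<eta> by (intro order_tendstoD[OF LIMSEQ_inverse_real_of_nat]) auto
    then obtain N2 where N2: "\<And>n. n \<ge> N2 \<Longrightarrow> inverse (real (Suc n)) < \<eta> / 8" by (auto simp: eventually_sequentially)
    have main: "(LINT y|lborel. norm (V i y - V j y)) < e" if ij: "i \<le> j" "i \<ge> max N1 N2" for i j
    proof -
      have "d j - d i < \<eta> / 8" using N1[of i j] ij abs_ge_minus_self[of "d i - d j"] unfolding dist_real_def by simp
      then have sq: "(LINT y|lborel. (V i y - V j y)\<^sup>2) < \<eta>"
        using para[OF ij(1)] N2[of i] N2[of j] ij \<eta> by (simp add: algebra_simps)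
      have "(LINT y|lborel. norm (V i y - V j y)) \<le> (LINT y|lborel. \<epsilon> * indicator D y + (1 / \<epsilon>) * (V i y - V j y)\<^sup>2)"
      proof (rule integral_mono)
        show "integrable lborel (\<lambda>y. norm (V i y - V j y))" using admissibleD(9)[OF Va] by auto
        show "integrable lborel (\<lambda>y. \<epsilon> * indicator D y + (1 / \<epsilon>) * (V i y - V j y)\<^sup>2)"
          by (intro Bochner_Integration.integrable_add integrable_const_D integrable_mult_right sqint)
        fix y
        show "norm (V i y - V j y) \<le> \<epsilon> * indicator D y + (1 / \<epsilon>) * (V i y - V j y)\<^sup>2"
        proof (cases "y \<in> D")
          case True
          let ?t = "\<bar>V i y - V j y\<bar>"
          have "?t * \<epsilon> \<le> \<epsilon> * \<epsilon> + ?t\<^sup>2"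
          proof -
            have gen: "c \<le> b + a" if "2 * c \<le> a + b" "0 \<le> c" for a b c :: real using that by simp
            have "2 * (?t * \<epsilon>) \<le> ?t\<^sup>2 + \<epsilon> * \<epsilon>" using sum_squares_bound[of ?t \<epsilon>] by (simp add: power2_eq_square mult.assoc)
            moreover have "0 \<le> ?t * \<epsilon>" using \<epsilon>(1) by simp
            ultimately show ?thesis by (rule gen)
          qed
          then have "?t \<le> \<epsilon> + (1 / \<epsilon>) * ?t\<^sup>2" using \<epsilon>(1) by (simp add: field_simps)
          then show ?thesis using True by simp
        next
          case False
          then show ?thesis using admissibleD(5)[OF Va] by simp
        qed
      qed
      also have "\<dots> = \<epsilon> * areaD + (1 / \<epsilon>) * (LINT y|lborel. (V i y - V j y)\<^sup>2)"
        using integrable_const_D[of \<epsilon>] sqint[of i j] by simp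
      also have "\<dots> < (e / 2 + e / 4) + (1 / \<epsilon>) * \<eta>"
        using \<epsilon> sq by (intro add_strict_mono mult_strict_left_mono) auto
      also have "\<dots> = e" using \<epsilon> by (simp add: \<eta>_def)
      finally show ?thesis .
    qed
    show ?thesis
    proof (intro exI[of _ "max N1 N2"] allI impI)
      fix i j assume ij: "max N1 N2 \<le> i" "max N1 N2 \<le> j"
      show "(LINT y|lborel. norm (V i y - V j y)) < e"
      proof (cases "i \<le> j")
        case False
        have "(LINT y|lborel. norm (V i y - V j y)) = (LINT y|lborel. norm (V j y - V i y))" by (simp add: norm_minus_commute abs_minus_commute)
        then show ?thesis using main[of j i] False ij by simp
      qed (use main ij in auto)
    qed
  qed
  obtain s where s: "strict_mono s" "AE y in lborel. Cauchy (\<lambda>i. V (s i) y)"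
    using cauchy_L1_AE_cauchy_subseq[of lborel V] admissibleD(9)[OF Va] L1 by blast
  note [measurable] = admissibleD(2)[OF Va]
  (* The truncation gives the limit the right bounds also where the sequence diverges. *)
  define v where "v y = max 0 (min (\<mu> * indicator D y) (lim (\<lambda>i. V (s i) y)))" for y
  have vm [measurable]: "v \<in> borel_measurable borel" unfolding v_def by measurable
  have vlim: "AE y in lborel. (\<lambda>i. V (s i) y) \<longlonglongrightarrow> v y" using s(2)
  proof (rule eventually_mono)
    fix y assume "Cauchy (\<lambda>i. V (s i) y)"
    then have "(\<lambda>i. V (s i) y) \<longlonglongrightarrow> lim (\<lambda>i. V (s i) y)" by (simp add: Cauchy_convergent_iff convergent_LIMSEQ_iff)
    moreover from this have "0 \<le> lim (\<lambda>i. V (s i) y)" "lim (\<lambda>i. V (s i) y) \<le> \<mu> * indicator D y"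
      using admissibleD(3,6)[OF Va] by (auto intro: LIMSEQ_le_const LIMSEQ_le_const2)
    ultimately show "(\<lambda>i. V (s i) y) \<longlonglongrightarrow> v y" by (simp add: v_def)
  qed
  have "(\<lambda>i. LINT y|lborel. V (s i) y) \<longlonglongrightarrow> (LINT y|lborel. v y)"
    by (rule integral_dominated_convergence[where w="\<lambda>y. \<mu> * indicator D y", OF _ _ integrable_const_D(1) vlim]) (use admissibleD(3,6)[OF Va] in auto)
  then have v1: "(LINT y|lborel. v y) = 1" using admissibleD(7)[OF Va] by (simp add: LIMSEQ_const_iff)
  have "0 \<le> v y \<and> v y \<le> \<mu> * indicator D y" for y using mu by (auto simp: v_def)
  then have va: "admissible \<mu> v" unfolding admissible_def using v1 vm by blast
  have dmu: "domain_density \<mu> (\<lambda>y. \<mu> * indicator D y)" using mu by (auto simp: domain_density_def)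
  have potlim: "(\<lambda>i. potential (V (s i)) z) \<longlonglongrightarrow> potential v z" for z
    unfolding potential_def
  proof (rule integral_dominated_convergence[where w="\<lambda>y. green_kernel z y * (\<mu> * indicator D y)"])
    show "integrable lborel (\<lambda>y. green_kernel z y * (\<mu> * indicator D y))" by (rule integrable_potential(1)[OF dmu])
    show "AE y in lborel. (\<lambda>i. green_kernel z y * V (s i) y) \<longlonglongrightarrow> green_kernel z y * v y"
      using vlim by eventually_elim (intro tendsto_intros)
    show "AE y in lborel. norm (green_kernel z y * V (s i) y) \<le> green_kernel z y * (\<mu> * indicator D y)" for i
    proof (rule AE_I2)
      fix y
      have "\<bar>V (s i) y\<bar> \<le> \<mu> * indicator D y" using admissibleD(3,6)[OF Va, of "s i" y] by simp
      then show "norm (green_kernel z y * V (s i) y) \<le> green_kernel z y * (\<mu> * indicator D y)"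
        using green_kernel_nonneg[of z y] by (simp add: abs_mult mult_left_mono)
    qed
  qed measurable
  have "potential v z = l z" if z: "z \<in> D" for z
  proof -
    have "(\<lambda>n. potential (V n) z) \<longlonglongrightarrow> l z"
    proof (rule LIMSEQ_I)
      fix e :: real assume e: "e > 0"
      obtain n0 where n0: "\<And>n. n \<ge> n0 \<Longrightarrow> norm (potential (W n) z - l z) < e / 2"
        using LIMSEQ_D[OF l[OF z], of "e/2"] e by (auto simp: W_def)
      have "\<bar>potential (V n) z - l z\<bar> \<le> e / 2" if "n \<ge> n0" for n
        by (rule midpoint_hull_potential[OF V(1) W]) (use n0 that in \<open>auto intro: less_imp_le\<close>)
      moreover have "e / 2 < e" using e by simp
      ultimately show "\<exists>no. \<forall>n\<ge>no. norm (potential (V n) z - l z) < e"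
        unfolding real_norm_def using le_less_trans by blast
    qed
    from LIMSEQ_subseq_LIMSEQ[OF this s(1)] have "(\<lambda>i. potential (V (s i)) z) \<longlonglongrightarrow> l z" by (simp add: comp_def)
    then show ?thesis using potlim LIMSEQ_unique by blast
  qed
  then show ?thesis using that[OF r va] l by simp
qed

definition energy :: "(real^2 \<Rightarrow> real) \<Rightarrow> real^2 \<Rightarrow> real" where
  "energy \<omega> x = 1 / 2 * (LINT y|lborel. \<omega> y * potential \<omega> y) + potential \<omega> x - kirchhoff_routh h x"

lemma potential_nonneg: "admissible \<mu> \<omega> \<Longrightarrow> 0 \<le> potential \<omega> z"
  unfolding potential_def by (intro Bochner_Integration.integral_nonneg mult_nonneg_nonneg green_kernel_nonneg admissibleD(3))

lemma admissible_exists: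
  assumes mu: "\<mu> > 1 / areaD" and a: "areaD > 0"
  shows "admissible \<mu> (\<lambda>y. 1 / areaD * indicator D y)"
  unfolding admissible_def using integrable_const_D(2)[of "1 / areaD"] a mu by (auto simp: indicator_def)

text \<open>In a maximising sequence the values \<open>H(z n)\<close> stay bounded, so the points accumulate inside \<open>D\<close>. The
interaction energy passes to the limit although the densities converge only through their potentials:
by symmetry \<open>\<integral> v\<^sub>n (G * w) = \<integral> w (G * v\<^sub>n)\<close>, and potentials converge boundedly.\<close>

lemma maximizer_exists:
  assumes mu: "\<mu> > 1 / areaD" and a: "areaD > 0"
  obtains \<omega> x where "admissible \<mu> \<omega>" "x \<in> D" "\<And>v z. admissible \<mu> v \<Longrightarrow> z \<in> D \<Longrightarrow> energy v z \<le> energy \<omega> x"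
proof -
  define P where "P = \<mu> * kernel_mass"
  have P: "0 \<le> potential v z" "potential v z \<le> P" if "admissible \<mu> v" for v z
    using potential_nonneg[OF that] potential_bound[OF admissibleD(1)[OF that], of z] by (auto simp: P_def)
  have quad: "0 \<le> (LINT y|lborel. v y * potential v y)" "(LINT y|lborel. v y * potential v y) \<le> P" if v: "admissible \<mu> v" for v
  proof -
    show "0 \<le> (LINT y|lborel. v y * potential v y)" by (intro Bochner_Integration.integral_nonneg mult_nonneg_nonneg P(1)[OF v] admissibleD(3)[OF v])
    have "(LINT y|lborel. v y * potential v y) \<le> (LINT y|lborel. v y * P)"
      by (rule integral_mono[OF integrable_potential_mult[OF admissibleD(1)[OF v] admissibleD(1)[OF v]] integrable_mult_left[OF admissibleD(9)[OF v]]])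
         (intro mult_left_mono P(2)[OF v] admissibleD(3)[OF v])
    then show "(LINT y|lborel. v y * potential v y) \<le> P" using admissibleD(7)[OF v] by simp
  qed
  define c where "c = 1 / 2 * (1 / (2 * pi) * ln dm)"
  have H: "- c \<le> kirchhoff_routh h z" if "z \<in> D" for z
    using h_lower[OF that that] by (simp add: kirchhoff_routh_def c_def)
  define E where "E = {energy v z | v z. admissible \<mu> v \<and> z \<in> D}"
  obtain p where p: "p \<in> D" using neD by blast
  have Ene: "E \<noteq> {}" unfolding E_def using admissible_exists[OF mu a] p by blast
  have up: "energy v z \<le> 3 / 2 * P + c" if "admissible \<mu> v" "z \<in> D" for v z
    using quad(2)[OF that(1)] P(2)[OF that(1), of z] H[OF that(2)] unfolding energy_def by linarith
  have Ebd: "bdd_above E" by (rule bdd_aboveI[of _ "3 / 2 * P + c"]) (use up in \<open>unfold E_def, blast\<close>)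
  define m where "m = Sup E"
  have le: "energy v z \<le> m" if "admissible \<mu> v" "z \<in> D" for v z
    unfolding m_def by (rule cSup_upper[OF _ Ebd]) (use that in \<open>auto simp: E_def\<close>)
  have "\<exists>v z. admissible \<mu> v \<and> z \<in> D \<and> m - inverse (real (Suc n)) < energy v z" for n
  proof -
    have "m - inverse (real (Suc n)) < Sup E" by (simp add: m_def)
    from less_cSupD[OF Ene this] show ?thesis by (auto simp: E_def)
  qed
  then obtain v z where v: "\<And>n. admissible \<mu> (v n)" and z: "\<And>n. z n \<in> D" and en: "\<And>n. m - inverse (real (Suc n)) < energy (v n) (z n)" by metis
  obtain r w where r: "strict_mono (r :: nat \<Rightarrow> nat)" and w: "admissible \<mu> w" and pw: "\<And>y. y \<in> D \<Longrightarrow> (\<lambda>n. potential (v (r n)) y) \<longlonglongrightarrow> potential w y"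
    using admissible_compact[of \<mu> v] v by metis
  have "compact (closure D)" using bddD by (simp add: compact_closure)
  then obtain x t where x: "x \<in> closure D" and t: "strict_mono (t :: nat \<Rightarrow> nat)" and zx: "(\<lambda>n. z (r (t n))) \<longlonglongrightarrow> x"
    using compact_imp_seq_compact[THEN seq_compactE, of "closure D" "\<lambda>n. z (r n)"] z closure_subset by (auto simp: comp_def) blast
  define k where "k n = r (t n)" for n
  have k: "strict_mono k" unfolding k_def using r t by (auto simp: strict_mono_def)
  have zk: "(\<lambda>n. z (k n)) \<longlonglongrightarrow> x" using zx by (simp add: k_def)
  have pk: "(\<lambda>n. potential (v (k n)) y) \<longlonglongrightarrow> potential w y" if "y \<in> D" for y
    using LIMSEQ_subseq_LIMSEQ[OF pw[OF that] t] by (simp add: k_def comp_def)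
  have ek: "(\<lambda>n. m - inverse (real (Suc (k n)))) \<longlonglongrightarrow> m"
  proof -
    have "(\<lambda>n. m - inverse (real (Suc n))) \<longlonglongrightarrow> m - 0" by (intro tendsto_intros LIMSEQ_inverse_real_of_nat)
    from LIMSEQ_subseq_LIMSEQ[OF this k] show ?thesis by (simp add: comp_def)
  qed
  have xD: "x \<in> D"
  proof (rule ccontr)
    assume "x \<notin> D"
    then have fr: "x \<in> frontier D" using x openD by (simp add: frontier_def interior_open)
    define q where "q n = norm (z (k n) - x)" for n
    have q0: "q \<longlonglongrightarrow> 0" unfolding q_def using tendsto_norm_zero[OF LIM_zero[OF zk]] .
    have qpos: "q n > 0" for n using z[of "k n"] \<open>x \<notin> D\<close> by (auto simp: q_def)
    have sq: "filterlim (\<lambda>n. 2 * sqrt (q n)) (at_right 0) sequentially"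
    proof -
      have "(\<lambda>n. 2 * sqrt (q n)) \<longlonglongrightarrow> 2 * sqrt 0" by (intro tendsto_intros q0)
      then show ?thesis using qpos by (auto simp: filterlim_at less_imp_neq[symmetric] intro!: always_eventually)
    qed
    have lnlim: "filterlim (\<lambda>n. ln (2 * sqrt (q n))) at_bot sequentially"
      by (rule filterlim_compose[OF ln_at_0 sq])
    define K where "K = 4 * pi * (m - 1 - 3 / 2 * P) - ln (2 * sqrt dm)"
    have "\<forall>\<^sub>F n in sequentially. ln (2 * sqrt (q n)) \<le> K - 1" using lnlim by (simp add: filterlim_at_bot)
    then obtain n where n: "ln (2 * sqrt (q n)) \<le> K - 1" by (auto simp: eventually_sequentially)
    have "inverse (real (Suc (k n))) \<le> 1" by (simp add: inverse_le_1_iff)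
    then have "m - 1 < energy (v (k n)) (z (k n))" using en[of "k n"] by linarith
    also have "\<dots> \<le> 3 / 2 * P - kirchhoff_routh h (z (k n))"
      using quad(2)[OF v[of "k n"]] P(2)[OF v[of "k n"], of "z (k n)"] unfolding energy_def by linarith
    finally have "kirchhoff_routh h (z (k n)) < 3 / 2 * P - m + 1" by linarith
    then have "1 / 2 * h (z (k n)) (z (k n)) < 3 / 2 * P - m + 1" by (simp add: kirchhoff_routh_def)
    moreover have "h (z (k n)) (z (k n)) \<ge> - (1 / (2 * pi) * (ln (2 * sqrt dm) + ln (2 * sqrt (q n))))"
      unfolding q_def by (rule h_diag_blowup[OF z fr])
    ultimately have "m - 1 - 3 / 2 * P < 1 / (4 * pi) * (ln (2 * sqrt dm) + ln (2 * sqrt (q n)))" by simp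
    then have "4 * pi * (m - 1 - 3 / 2 * P) < ln (2 * sqrt dm) + ln (2 * sqrt (q n))"
      by (simp add: less_divide_eq mult.commute)
    then show False using n by (simp add: K_def)
  qed
  have pz: "(\<lambda>n. potential (v (k n)) (z (k n))) \<longlonglongrightarrow> potential w x"
  proof -
    obtain \<rho> L where L: "\<rho> > 0" "ball x \<rho> \<subseteq> D" "L \<ge> 0"
      "\<And>M \<omega> a b. domain_density M \<omega> \<Longrightarrow> a \<in> ball x \<rho> \<Longrightarrow> b \<in> ball x \<rho> \<Longrightarrow> \<bar>potential \<omega> a - potential \<omega> b\<bar> \<le> M * L * norm (a - b)"
      using potential_Lipschitz[OF xD] by metis
    have "\<forall>\<^sub>F n in sequentially. z (k n) \<in> ball x \<rho>"
      using topological_tendstoD[OF zk open_ball[of x \<rho>]] L by simp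
    then have ev: "\<forall>\<^sub>F n in sequentially. norm (potential (v (k n)) (z (k n)) - potential (v (k n)) x) \<le> \<mu> * L * norm (z (k n) - x)"
      by eventually_elim (use L(1) L(4)[OF admissibleD(1)[OF v]] in auto)
    have "(\<lambda>n. \<mu> * L * norm (z (k n) - x)) \<longlonglongrightarrow> 0"
      by (rule tendsto_mult_right_zero[OF tendsto_norm_zero[OF LIM_zero[OF zk]]])
    from Lim_null_comparison[OF ev this] have "(\<lambda>n. potential (v (k n)) (z (k n)) - potential (v (k n)) x) \<longlonglongrightarrow> 0" .
    from tendsto_add[OF this pk[OF xD]] show ?thesis by simp
  qed
  have kz: "(\<lambda>n. kirchhoff_routh h (z (k n))) \<longlonglongrightarrow> kirchhoff_routh h x"
    using isCont_tendsto_compose[OF _ zk] differentiable_imp_continuous_within[OF kirchhoff_differentiable[OF xD]] by blast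
  have qz: "(\<lambda>n. LINT y|lborel. v (k n) y * potential (v (k n)) y) \<longlonglongrightarrow> (LINT y|lborel. w y * potential w y)"
  proof -
    note [measurable] = admissibleD(2)[OF v] admissibleD(2)[OF w]
    have 1: "(\<lambda>n. LINT y|lborel. v (k n) y * potential w y) \<longlonglongrightarrow> (LINT y|lborel. w y * potential w y)"
    proof -
      have "(LINT y|lborel. v (k n) y * potential w y) = (LINT y|lborel. w y * potential (v (k n)) y)" for n
        by (rule potential_symmetric[OF admissibleD(1)[OF w] admissibleD(1)[OF v]])
      moreover have "(\<lambda>n. LINT y|lborel. w y * potential (v (k n)) y) \<longlonglongrightarrow> (LINT y|lborel. w y * potential w y)"
      proof (rule integral_dominated_convergence[where w="\<lambda>y. w y * P"])
        show "AE y in lborel. (\<lambda>n. w y * potential (v (k n)) y) \<longlonglongrightarrow> w y * potential w y"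
        proof (rule AE_I2)
          fix y show "(\<lambda>n. w y * potential (v (k n)) y) \<longlonglongrightarrow> w y * potential w y"
            by (cases "y \<in> D") (auto intro!: tendsto_intros pk simp: admissibleD(5)[OF w])
        qed
        show "AE y in lborel. norm (w y * potential (v (k n)) y) \<le> w y * P" for n
          using P[OF v] admissibleD(3)[OF w] by (auto simp: abs_mult intro!: mult_left_mono)
      qed (use admissibleD(9)[OF w] in \<open>measurable, auto\<close>)
      ultimately show ?thesis by simp
    qed
    have 2: "(\<lambda>n. LINT y|lborel. \<mu> * indicator D y * \<bar>potential (v (k n)) y - potential w y\<bar>) \<longlonglongrightarrow> integral\<^sup>L lborel (\<lambda>y::real^2. 0::real)"
    proof (rule integral_dominated_convergence[where w="\<lambda>y. \<mu> * (2 * P) * indicator D y"])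
      show "AE y in lborel. (\<lambda>n. \<mu> * indicator D y * \<bar>potential (v (k n)) y - potential w y\<bar>) \<longlonglongrightarrow> 0"
      proof (rule AE_I2)
        fix y show "(\<lambda>n. \<mu> * indicator D y * \<bar>potential (v (k n)) y - potential w y\<bar>) \<longlonglongrightarrow> 0"
        proof (cases "y \<in> D")
          case True
          have "(\<lambda>n. potential (v (k n)) y - potential w y) \<longlonglongrightarrow> 0" using pk[OF True] by (rule LIM_zero)
          then show ?thesis by (intro tendsto_mult_right_zero tendsto_rabs_zero)
        qed simp
      qed
      show "AE y in lborel. norm (\<mu> * indicator D y * \<bar>potential (v (k n)) y - potential w y\<bar>) \<le> \<mu> * (2 * P) * indicator D y" for n
      proof (rule AE_I2)
        fix y
        have "\<bar>potential (v (k n)) y - potential w y\<bar> \<le> 2 * P" using P[OF v, of "k n" y] P[OF w, of y] by linarith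
        then show "norm (\<mu> * indicator D y * \<bar>potential (v (k n)) y - potential w y\<bar>) \<le> \<mu> * (2 * P) * indicator D y"
          using admissibleD(8)[OF w] by (auto simp: abs_mult indicator_def intro!: mult_left_mono)
      qed
    qed (use integrable_const_D(1) openD in \<open>measurable, auto\<close>)
    have "(\<lambda>n. (LINT y|lborel. v (k n) y * potential (v (k n)) y) - (LINT y|lborel. v (k n) y * potential w y)) \<longlonglongrightarrow> 0"
    proof (rule Lim_null_comparison[OF always_eventually])
      show "(\<lambda>n. LINT y|lborel. \<mu> * indicator D y * \<bar>potential (v (k n)) y - potential w y\<bar>) \<longlonglongrightarrow> 0" using 2 by simp
      show "\<forall>n. norm ((LINT y|lborel. v (k n) y * potential (v (k n)) y) - (LINT y|lborel. v (k n) y * potential w y)) \<le> (LINT y|lborel. \<mu> * indicator D y * \<bar>potential (v (k n)) y - potential w y\<bar>)"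
      proof
        fix n
        have ii: "integrable lborel (\<lambda>y. v (k n) y * potential (v (k n)) y)" "integrable lborel (\<lambda>y. v (k n) y * potential w y)"
          by (rule integrable_potential_mult[OF admissibleD(1)[OF v] admissibleD(1)[OF v]], rule integrable_potential_mult[OF admissibleD(1)[OF w] admissibleD(1)[OF v]])
        have id: "integrable lborel (\<lambda>y. \<mu> * indicator D y * \<bar>potential (v (k n)) y - potential w y\<bar>)"
        proof (rule Bochner_Integration.integrable_bound[OF integrable_const_D(1)[of "\<mu> * (2 * P)"]])
          show "AE y in lborel. norm (\<mu> * indicator D y * \<bar>potential (v (k n)) y - potential w y\<bar>) \<le> norm (\<mu> * (2 * P) * indicator D y)"
          proof (rule AE_I2)
            fix y
            have "\<bar>potential (v (k n)) y - potential w y\<bar> \<le> \<bar>2 * P\<bar>" using P[OF v, of "k n" y] P[OF w, of y] by linarith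
            then show "norm (\<mu> * indicator D y * \<bar>potential (v (k n)) y - potential w y\<bar>) \<le> norm (\<mu> * (2 * P) * indicator D y)"
              using admissibleD(8)[OF w] by (auto simp: abs_mult indicator_def intro!: mult_left_mono)
          qed
        qed measurable
        have "(LINT y|lborel. v (k n) y * potential (v (k n)) y) - (LINT y|lborel. v (k n) y * potential w y) = (LINT y|lborel. v (k n) y * (potential (v (k n)) y - potential w y))"
          using ii by (simp add: right_diff_distrib)
        also have "norm \<dots> \<le> (LINT y|lborel. norm (v (k n) y * (potential (v (k n)) y - potential w y)))" by (rule integral_norm_bound)
        also have "\<dots> \<le> (LINT y|lborel. \<mu> * indicator D y * \<bar>potential (v (k n)) y - potential w y\<bar>)"
        proof (rule integral_mono[OF _ id])
          show "integrable lborel (\<lambda>y. norm (v (k n) y * (potential (v (k n)) y - potential w y)))"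
            using ii by (simp add: right_diff_distrib)
          fix y
          have "v (k n) y * \<bar>potential (v (k n)) y - potential w y\<bar> \<le> \<mu> * indicator D y * \<bar>potential (v (k n)) y - potential w y\<bar>"
            by (intro mult_right_mono admissibleD(6)[OF v]) simp
          then show "norm (v (k n) y * (potential (v (k n)) y - potential w y)) \<le> \<mu> * indicator D y * \<bar>potential (v (k n)) y - potential w y\<bar>"
            using admissibleD(3)[OF v, of "k n" y] by (simp add: abs_mult)
        qed
        finally show "norm ((LINT y|lborel. v (k n) y * potential (v (k n)) y) - (LINT y|lborel. v (k n) y * potential w y)) \<le> (LINT y|lborel. \<mu> * indicator D y * \<bar>potential (v (k n)) y - potential w y\<bar>)" .
      qed
    qed
    from tendsto_add[OF this 1] show ?thesis by simp
  qed
  have "(\<lambda>n. energy (v (k n)) (z (k n))) \<longlonglongrightarrow> energy w x"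
    unfolding energy_def by (intro tendsto_intros qz pz kz)
  then have "m \<le> energy w x"
    by (rule LIMSEQ_le[OF ek]) (use en less_imp_le in auto)
  then show ?thesis using that[OF w xD] le by fastforce
qed

end

section \<open>First variation and the form of the maximiser\<close>

lemma stencil_sq_tendsto:
  assumes C: "C \<ge> 0" "r > 0" and b: "\<And>s. 0 < s \<Longrightarrow> s < r \<Longrightarrow> \<bar>stencil s F z\<bar> \<le> C * s^3"
  shows "(\<lambda>n. stencil (inverse (Suc n)) F z / (inverse (Suc n))\<^sup>2) \<longlonglongrightarrow> 0"
proof (rule Lim_null_comparison)
  show "(\<lambda>n. C * inverse (real (Suc n))) \<longlonglongrightarrow> 0" by (rule tendsto_mult_right_zero[OF LIMSEQ_inverse_real_of_nat])
  have "\<forall>\<^sub>F n in sequentially. inverse (real (Suc n)) < r"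
    using C by (intro order_tendstoD[OF LIMSEQ_inverse_real_of_nat]) auto
  then show "\<forall>\<^sub>F n in sequentially. norm (stencil (inverse (Suc n)) F z / (inverse (Suc n))\<^sup>2) \<le> C * inverse (real (Suc n))"
  proof eventually_elim
    case (elim n)
    define s where "s = inverse (real (Suc n))"
    have s: "0 < s" "s < r" using elim by (auto simp: s_def)
    have "\<bar>stencil s F z\<bar> / s\<^sup>2 \<le> C * s^3 / s\<^sup>2" by (intro divide_right_mono b s) simp
    also have "\<dots> = C * s" using s by (simp add: power3_eq_cube power2_eq_square)
    finally show ?case unfolding s_def[symmetric] by simp
  qed
qed

lemma stencil_ln_norm:
  assumes z: "z \<noteq> x"
  shows "(\<lambda>n. stencil (inverse (Suc n)) (\<lambda>z. ln (norm (z - x))) z / (inverse (Suc n))\<^sup>2) \<longlonglongrightarrow> 0"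
proof -
  define r where "r = norm (z - x) / 2"
  have r: "r > 0" using z by (simp add: r_def)
  have far: "cmod (w - cplx x) \<ge> r" if "w \<in> ball (cplx z) r" for w
  proof -
    have "2 * r = cmod (cplx z - cplx x)" by (simp add: r_def cplx_diff[symmetric])
    also have "\<dots> \<le> cmod (cplx z - w) + cmod (w - cplx x)" using norm_triangle_ineq[of "cplx z - w" "w - cplx x"] by simp
    finally show ?thesis using that by (simp add: dist_norm)
  qed
  show ?thesis
  proof (rule stencil_sq_tendsto[of "64 * (1 / r) / r\<^sup>2" "r / 4"])
    fix s assume s: "0 < s" "s < r / 4"
    show "\<bar>stencil s (\<lambda>z. ln (norm (z - x))) z\<bar> \<le> 64 * (1 / r) / r\<^sup>2 * s^3"
    proof (rule holomorphic_gradient_estimates(2)[where q="\<lambda>w. 1 / (w - cplx x)" and r=r, OF _ _ r _ s])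
      show "(\<lambda>w. 1 / (w - cplx x)) holomorphic_on ball (cplx z) r"
        using far r by (intro holomorphic_intros) fastforce
      show "cmod (1 / (w - cplx x)) \<le> 1 / r" if "w \<in> ball (cplx z) r" for w
        using far[OF that] r by (simp add: norm_divide frac_le)
      fix y assume y: "y \<in> ball z r"
      have "cplx y \<in> ball (cplx z) r" using y norm_cplx[of "z - y"] by (simp add: dist_norm cplx_diff)
      then have "cplx y - cplx x \<noteq> 0" using far[of "cplx y"] r by auto
      then have "((\<lambda>y. ln (cmod (cplx y - cplx x))) has_derivative (\<lambda>v. Re (cplx v * (1 / (cplx y - cplx x))))) (at y)"
        by (intro has_derivative_ln_cmod[where g="\<lambda>w. w - cplx x"]) (auto intro!: derivative_eq_intros)
      moreover have "cmod (cplx y - cplx x) = norm (y - x)" for y by (simp add: cplx_diff[symmetric])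
      ultimately show "((\<lambda>z. ln (norm (z - x))) has_derivative (\<lambda>v. Re (cplx v * (1 / (cplx y - cplx x))))) (at y)" by simp
    qed
  qed (use r in auto)
qed

lemma stencil_lin: "stencil s (\<lambda>z. a * F z + b * G z) z = a * stencil s F z + b * stencil s G z"
  by (simp add: stencil_def sum.distrib sum_distrib_left algebra_simps)

context green_domain
begin

text \<open>This is \<open>stream D G \<omega> x\<close> with the measurable \<open>green_kernel\<close> in place of \<open>G\<close>; it is defined and measurable
on the whole plane, so integrals over \<open>D\<close> can be treated as integrals over the plane.\<close>

definition psi :: "(real^2 \<Rightarrow> real) \<Rightarrow> real^2 \<Rightarrow> real^2 \<Rightarrow> real" where
  "psi \<omega> x z = potential \<omega> z + green_kernel x z"

lemma psi_measurable [measurable]: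
  assumes [measurable]: "\<omega> \<in> borel_measurable borel" shows "psi \<omega> x \<in> borel_measurable borel"
  unfolding psi_def by measurable

lemma psi_nonneg: "admissible \<mu> \<omega> \<Longrightarrow> 0 \<le> psi \<omega> x z"
  unfolding psi_def using potential_nonneg green_kernel_nonneg by (intro add_nonneg_nonneg)

lemma integrable_mult_psi:
  assumes v: "admissible \<mu> v" and w: "admissible \<mu> \<omega>"
  shows "integrable lborel (\<lambda>y. v y * psi \<omega> x y)" "(LINT y|lborel. v y * psi \<omega> x y) = (LINT y|lborel. v y * potential \<omega> y) + potential v x"
proof -
  have 1: "integrable lborel (\<lambda>y. v y * potential \<omega> y)" by (rule integrable_potential_mult[OF admissibleD(1)[OF w] admissibleD(1)[OF v]])
  have 2: "integrable lborel (\<lambda>y. green_kernel x y * v y)" by (rule integrable_potential(1)[OF admissibleD(1)[OF v]])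
  have e: "(\<lambda>y. v y * psi \<omega> x y) = (\<lambda>y. v y * potential \<omega> y + green_kernel x y * v y)" by (auto simp: psi_def algebra_simps)
  show "integrable lborel (\<lambda>y. v y * psi \<omega> x y)" unfolding e by (rule Bochner_Integration.integrable_add[OF 1 2])
  show "(LINT y|lborel. v y * psi \<omega> x y) = (LINT y|lborel. v y * potential \<omega> y) + potential v x"
    unfolding e potential_def[of v x] by (rule Bochner_Integration.integral_add[OF 1 2])
qed

text \<open>Along the segment from \<open>\<omega>\<close> to \<open>v\<close> the energy is a quadratic polynomial \<open>A t + B t\<^sup>2\<close> plus its value at
\<open>\<omega>\<close>, so the linear coefficient \<open>A\<close> is not positive.\<close>

lemma first_variation:
  assumes w: "admissible \<mu> \<omega>" and x: "x \<in> D" and max: "\<And>v z. admissible \<mu> v \<Longrightarrow> z \<in> D \<Longrightarrow> energy v z \<le> energy \<omega> x"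
    and v: "admissible \<mu> v"
  shows "(LINT y|lborel. v y * psi \<omega> x y) \<le> (LINT y|lborel. \<omega> y * psi \<omega> x y)"
proof -
  define Q where "Q a b = (LINT y|lborel. a y * potential b y)" for a b :: "real^2 \<Rightarrow> real"
  have Qs: "Q v \<omega> = Q \<omega> v" unfolding Q_def by (rule potential_symmetric[OF admissibleD(1)[OF w] admissibleD(1)[OF v]])
  have ii: "integrable lborel (\<lambda>y. v y * potential v y)" "integrable lborel (\<lambda>y. v y * potential \<omega> y)" "integrable lborel (\<lambda>y. \<omega> y * potential v y)" "integrable lborel (\<lambda>y. \<omega> y * potential \<omega> y)"
    using integrable_potential_mult admissibleD(1)[OF v] admissibleD(1)[OF w] by blast+
  define A where "A = Q v \<omega> - Q \<omega> \<omega> + potential v x - potential \<omega> x"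
  define B where "B = 1 / 2 * (Q \<omega> \<omega> - 2 * Q v \<omega> + Q v v)"
  have key: "A * t + B * t\<^sup>2 \<le> 0" if t: "0 \<le> t" "t \<le> 1" for t
  proof -
    let ?u = "\<lambda>y. (1 - t) * \<omega> y + t * v y"
    have pu: "potential ?u z = (1 - t) * potential \<omega> z + t * potential v z" for z by (rule potential_linear[OF admissibleD(1)[OF w] admissibleD(1)[OF v]])
    have "(LINT y|lborel. ?u y * potential ?u y) = (LINT y|lborel. (1 - t)\<^sup>2 * (\<omega> y * potential \<omega> y) + (1 - t) * t * (\<omega> y * potential v y) + (1 - t) * t * (v y * potential \<omega> y) + t\<^sup>2 * (v y * potential v y))"
      unfolding pu by (intro Bochner_Integration.integral_cong) (auto simp: algebra_simps power2_eq_square)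
    also have "\<dots> = (1 - t)\<^sup>2 * Q \<omega> \<omega> + (1 - t) * t * Q \<omega> v + (1 - t) * t * Q v \<omega> + t\<^sup>2 * Q v v"
      unfolding Q_def using ii by simp
    finally have quad: "(LINT y|lborel. ?u y * potential ?u y) = (1 - t)\<^sup>2 * Q \<omega> \<omega> + 2 * ((1 - t) * t * Q v \<omega>) + t\<^sup>2 * Q v v"
      unfolding Qs[symmetric] by simp
    have "energy ?u x \<le> energy \<omega> x" by (rule max[OF admissible_convex[OF w v t] x])
    then have "1 / 2 * ((1 - t)\<^sup>2 * Q \<omega> \<omega> + 2 * ((1 - t) * t * Q v \<omega>) + t\<^sup>2 * Q v v) + ((1 - t) * potential \<omega> x + t * potential v x) \<le> 1 / 2 * Q \<omega> \<omega> + potential \<omega> x"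
      unfolding energy_def quad pu[of x] Q_def[of \<omega> \<omega>, symmetric] by simp
    moreover have "1 / 2 * ((1 - t)\<^sup>2 * Q \<omega> \<omega> + 2 * ((1 - t) * t * Q v \<omega>) + t\<^sup>2 * Q v v) + ((1 - t) * potential \<omega> x + t * potential v x) - (1 / 2 * Q \<omega> \<omega> + potential \<omega> x) = A * t + B * t\<^sup>2"
      by (simp add: A_def B_def power2_eq_square field_simps)
    ultimately show ?thesis by linarith
  qed
  have "A \<le> 0"
  proof (rule ccontr)
    assume "\<not> A \<le> 0"
    then have A: "A > 0" by simp
    define t where "t = min 1 (A / (2 * (\<bar>B\<bar> + 1)))"
    have t: "0 < t" "t \<le> 1" using A by (auto simp: t_def)
    have "t * (\<bar>B\<bar> + 1) \<le> A / 2"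
    proof -
      have "t \<le> A / (2 * (\<bar>B\<bar> + 1))" by (simp add: t_def)
      then have "t * (\<bar>B\<bar> + 1) \<le> A / (2 * (\<bar>B\<bar> + 1)) * (\<bar>B\<bar> + 1)" by (rule mult_right_mono) simp
      also have "\<dots> = A / 2"
      proof -
        have "a / (2 * c) * c = a / 2" if "c > 0" for a c :: real using that by simp
        from this[of "\<bar>B\<bar> + 1" A] show ?thesis by linarith
      qed
      finally show ?thesis .
    qed
    moreover have "t * (- (\<bar>B\<bar> + 1)) \<le> t * B" using t by (intro mult_left_mono) auto
    then have "- (t * (\<bar>B\<bar> + 1)) \<le> B * t" by (simp add: algebra_simps)
    ultimately have "A + B * t > 0" using A by linarith
    then have "t * (A + B * t) > 0" using t by simp
    then show False using key[of t] t by (simp add: algebra_simps power2_eq_square)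
  qed
  then show ?thesis
    unfolding integrable_mult_psi(2)[OF v w] integrable_mult_psi(2)[OF w w] A_def Q_def by linarith
qed

text \<open>Let \<open>b\<close> be the infimum of the levels whose superlevel sets carry at most unit mass. A competitor \<open>v\<close> equal
to \<open>\<mu>\<close> above \<open>b\<close>, to zero below it and to a suitable constant on \<open>{p = b}\<close> has unit mass. Since
\<open>(v - \<omega>) (p - b) \<ge> 0\<close> and its integral is not positive, \<open>\<omega> = v\<close> almost everywhere off \<open>{p = b}\<close>.\<close>

lemma bathtub:
  assumes mu: "\<mu> * areaD > 1" and w: "admissible \<mu> \<omega>" and psi [measurable]: "p \<in> borel_measurable borel" and p0: "\<And>z. p z \<ge> 0"
    and int: "\<And>v. admissible \<mu> v \<Longrightarrow> integrable lborel (\<lambda>y. v y * p y)"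
    and max: "\<And>v. admissible \<mu> v \<Longrightarrow> (LINT y|lborel. v y * p y) \<le> (LINT y|lborel. \<omega> y * p y)"
  obtains b where "b \<ge> 0" "AE y in lborel. y \<in> D \<longrightarrow> (p y > b \<longrightarrow> \<omega> y = \<mu>) \<and> (p y < b \<longrightarrow> \<omega> y = 0)"
proof -
  have mu0: "\<mu> > 0" using mu admissibleD(8)[OF w] by (cases "\<mu> = 0") auto
  define m where "m t = (LINT y|lborel. indicator {y\<in>D. p y > t} y :: real)" for t
  have meas [measurable]: "{y\<in>D. p y > t} \<in> sets borel" "{y\<in>D. p y = t} \<in> sets borel" "{y\<in>D. p y \<ge> t} \<in> sets borel" for t by measurable
  have iD: "integrable lborel (indicator X :: real^2 \<Rightarrow> real)" if "X \<subseteq> D" "X \<in> sets borel" for X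
    by (rule Bochner_Integration.integrable_bound[OF integrable_indicator_D]) (use that in \<open>auto simp: indicator_def\<close>)
  have anti: "m t \<le> m s" if "s \<le> t" for s t unfolding m_def
    by (rule integral_mono[OF iD iD]) (use that in \<open>auto simp: indicator_def\<close>)
  define T where "T = {t. \<mu> * m t \<le> 1}"
  have neg: "t \<notin> T" if "t < 0" for t
  proof -
    have "{y\<in>D. p y > t} = D" using p0 that by (auto intro: less_le_trans)
    then show ?thesis using mu by (simp add: T_def m_def areaD_def)
  qed
  have Tne: "T \<noteq> {}"
  proof -
    have "(\<lambda>n. m (real n)) \<longlonglongrightarrow> integral\<^sup>L lborel (\<lambda>y::real^2. 0::real)" unfolding m_def
    proof (rule integral_dominated_convergence[where w="indicator D"])
      show "AE y in lborel. (\<lambda>n. indicator {y\<in>D. p y > real n} y :: real) \<longlonglongrightarrow> 0"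
      proof (rule AE_I2, rule tendsto_eventually)
        fix y
        obtain n0 where n0: "p y \<le> real n0" using real_arch_simple by blast
        show "\<forall>\<^sub>F n in sequentially. indicator {y\<in>D. p y > real n} y = (0::real)"
          using eventually_ge_at_top[of n0]
        proof eventually_elim
          case (elim n)
          then have "real n0 \<le> real n" by simp
          then have "\<not> real n < p y" using n0 by linarith
          then show ?case by simp
        qed
      qed
    qed (use integrable_indicator_D openD in \<open>auto simp: indicator_def\<close>)
    then have "(\<lambda>n. m (real n)) \<longlonglongrightarrow> 0" by simp
    then have "\<forall>\<^sub>F n in sequentially. m (real n) < 1 / \<mu>" using mu0 by (intro order_tendstoD) auto
    then obtain n where "m (real n) < 1 / \<mu>" by (auto simp: eventually_sequentially)
    then have "\<mu> * m (real n) \<le> 1" using mu0 by (simp add: field_simps)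
    then show ?thesis by (auto simp: T_def)
  qed
  have Tbd: "bdd_below T" by (rule bdd_belowI[of _ 0]) (use neg in \<open>auto simp: not_less[symmetric]\<close>)
  define b where "b = Inf T"
  have b0: "b \<ge> 0" unfolding b_def by (rule cInf_greatest[OF Tne]) (use neg in \<open>auto simp: not_less[symmetric]\<close>)
  have inT: "t \<in> T" if "t > b" for t
  proof -
    have "Inf T < t" using that by (simp add: b_def)
    then obtain s where s: "s \<in> T" "s < t" using cInf_lessD[OF Tne, of t] by blast
    have "\<mu> * m t \<le> \<mu> * m s" using anti[of s t] s mu0 by simp
    then show ?thesis using s by (simp add: T_def)
  qed
  have notT: "t \<notin> T" if "t < b" for t using that cInf_lower[OF _ Tbd, of t] by (auto simp: b_def)
  have low: "\<mu> * m b \<le> 1"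
  proof -
    have "(\<lambda>n. m (b + inverse (real (Suc n)))) \<longlonglongrightarrow> m b" unfolding m_def
    proof (rule integral_dominated_convergence[where w="indicator D"])
      show "AE y in lborel. (\<lambda>n. indicator {y\<in>D. p y > b + inverse (real (Suc n))} y :: real) \<longlonglongrightarrow> indicator {y\<in>D. p y > b} y"
      proof (rule AE_I2, rule tendsto_eventually)
        fix y
        show "\<forall>\<^sub>F n in sequentially. indicator {y\<in>D. p y > b + inverse (real (Suc n))} y = (indicator {y\<in>D. p y > b} y :: real)"
        proof (cases "p y > b")
          case True
          have "\<forall>\<^sub>F n in sequentially. inverse (real (Suc n)) < p y - b"
            using True by (intro order_tendstoD[OF LIMSEQ_inverse_real_of_nat]) simp
          then show ?thesis by eventually_elim (use True in \<open>auto simp: indicator_def\<close>)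
        next
          case False
          have "\<not> b + inverse (real (Suc n)) < p y" for n
          proof -
            have "inverse (real (Suc n)) > 0" by simp
            then show ?thesis using False by linarith
          qed
          then show ?thesis using False by (simp add: indicator_def)
        qed
      qed
    qed (use integrable_indicator_D openD in \<open>auto simp: indicator_def\<close>)
    then have "(\<lambda>n. \<mu> * m (b + inverse (real (Suc n)))) \<longlonglongrightarrow> \<mu> * m b" by (intro tendsto_intros)
    moreover have "\<mu> * m (b + inverse (real (Suc n))) \<le> 1" for n using inT[of "b + inverse (real (Suc n))"] by (simp add: T_def)
    ultimately show ?thesis by (intro LIMSEQ_le_const2[of "\<lambda>n. \<mu> * m (b + inverse (real (Suc n)))"]) auto
  qed
  define mS where "mS = (LINT y|lborel. indicator {y\<in>D. p y = b} y :: real)"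
  have mge: "(LINT y|lborel. indicator {y\<in>D. p y \<ge> b} y) = m b + mS"
  proof -
    have "(LINT y|lborel. indicator {y\<in>D. p y \<ge> b} y) = (LINT y|lborel. indicator {y\<in>D. p y > b} y + indicator {y\<in>D. p y = b} y :: real)"
      by (intro Bochner_Integration.integral_cong) (auto simp: indicator_def)
    also have "\<dots> = m b + mS" unfolding m_def mS_def by (rule Bochner_Integration.integral_add[OF iD iD]) auto
    finally show ?thesis .
  qed
  have high: "1 \<le> \<mu> * (m b + mS)"
  proof -
    have "(\<lambda>n. m (b - inverse (real (Suc n)))) \<longlonglongrightarrow> (LINT y|lborel. indicator {y\<in>D. p y \<ge> b} y)" unfolding m_def
    proof (rule integral_dominated_convergence[where w="indicator D"])
      show "AE y in lborel. (\<lambda>n. indicator {y\<in>D. p y > b - inverse (real (Suc n))} y :: real) \<longlonglongrightarrow> indicator {y\<in>D. p y \<ge> b} y"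
      proof (rule AE_I2, rule tendsto_eventually)
        fix y
        show "\<forall>\<^sub>F n in sequentially. indicator {y\<in>D. p y > b - inverse (real (Suc n))} y = (indicator {y\<in>D. p y \<ge> b} y :: real)"
        proof (cases "p y \<ge> b")
          case False
          have "\<forall>\<^sub>F n in sequentially. inverse (real (Suc n)) < b - p y"
            using False by (intro order_tendstoD[OF LIMSEQ_inverse_real_of_nat]) simp
          then show ?thesis by eventually_elim (use False in \<open>auto simp: indicator_def\<close>)
        next
          case True
          have "b - inverse (real (Suc n)) < p y" for n
          proof -
            have "inverse (real (Suc n)) > 0" by simp
            then show ?thesis using True by linarith
          qed
          then show ?thesis using True by (simp add: indicator_def)
        qed
      qed
    qed (use integrable_indicator_D openD in \<open>auto simp: indicator_def\<close>)
    then have "(\<lambda>n. \<mu> * m (b - inverse (real (Suc n)))) \<longlonglongrightarrow> \<mu> * (m b + mS)" unfolding mge by (intro tendsto_intros)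
    moreover have "1 \<le> \<mu> * m (b - inverse (real (Suc n)))" for n using notT[of "b - inverse (real (Suc n))"] by (simp add: T_def)
    ultimately show ?thesis by (intro LIMSEQ_le_const[of "\<lambda>n. \<mu> * m (b - inverse (real (Suc n)))"]) auto
  qed
  have mS0: "mS \<ge> 0" unfolding mS_def by (rule Bochner_Integration.integral_nonneg) simp
  (* The mass missing above the level b, spread evenly over the level set. *)
  define \<theta> where "\<theta> = (if mS = 0 then 0 else (1 - \<mu> * m b) / mS)"
  have th: "0 \<le> \<theta>" "\<theta> \<le> \<mu>" "\<mu> * m b + \<theta> * mS = 1"
    using low high mS0 mu0 by (auto simp: \<theta>_def field_simps)
  define v where "v y = \<mu> * indicator {y\<in>D. p y > b} y + \<theta> * indicator {y\<in>D. p y = b} y" for y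
  have v: "admissible \<mu> v"
  proof -
    have "(LINT y|lborel. v y) = \<mu> * m b + \<theta> * mS"
      unfolding v_def m_def mS_def using iD[of "{y\<in>D. p y > b}"] iD[of "{y\<in>D. p y = b}"] meas by (simp add: subset_iff)
    moreover have "v \<in> borel_measurable borel" unfolding v_def by measurable
    moreover have "0 \<le> v y \<and> v y \<le> \<mu> * indicator D y" for y using th mu0 by (auto simp: v_def indicator_def)
    ultimately show ?thesis unfolding admissible_def using th by auto
  qed
  let ?F = "\<lambda>y. (v y - \<omega> y) * (p y - b)"
  have Fint: "integrable lborel ?F" "(LINT y|lborel. ?F y) = (LINT y|lborel. v y * p y) - (LINT y|lborel. \<omega> y * p y)"
  proof -
    have e: "?F = (\<lambda>y. (v y * p y - \<omega> y * p y) - b * (v y - \<omega> y))" by (auto simp: algebra_simps)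
    show "integrable lborel ?F" unfolding e using int[OF v] int[OF w] admissibleD(9)[OF v] admissibleD(9)[OF w] by simp
    show "(LINT y|lborel. ?F y) = (LINT y|lborel. v y * p y) - (LINT y|lborel. \<omega> y * p y)"
      unfolding e using int[OF v] int[OF w] admissibleD(7,9)[OF v] admissibleD(7,9)[OF w] by simp
  qed
  have Fpos: "0 \<le> ?F y" for y
  proof (cases "y \<in> D")
    case True
    show ?thesis
    proof (cases "p y" b rule: linorder_cases)
      case less
      then have "v y = 0" by (simp add: v_def)
      then show ?thesis using less admissibleD(3)[OF w, of y] by (intro mult_nonpos_nonpos) auto
    next
      case greater
      then have "v y = \<mu>" using True by (simp add: v_def)
      then show ?thesis using greater admissibleD(4)[OF w, of y] by simp
    qed simp
  qed (use admissibleD(5)[OF v] admissibleD(5)[OF w] in simp)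
  have "(LINT y|lborel. ?F y) = 0"
    using Fint(2) max[OF v] Bochner_Integration.integral_nonneg[of lborel ?F] Fpos by (intro antisym) auto
  then have "AE y in lborel. ?F y = 0"
    using integral_nonneg_eq_0_iff_AE[OF Fint(1)] Fpos by auto
  then have "AE y in lborel. y \<in> D \<longrightarrow> (p y > b \<longrightarrow> \<omega> y = \<mu>) \<and> (p y < b \<longrightarrow> \<omega> y = 0)"
    by (rule eventually_mono) (auto simp: v_def)
  then show ?thesis using that b0 by blast
qed

text \<open>Apart from the logarithmic potential of \<open>\<omega>\<close>, the stream function is harmonic off \<open>x\<close>, and the stencil
divided by the squared step tends to zero on each harmonic part.\<close>

lemma level_set_null:
  assumes w: "admissible \<mu> \<omega>" and x: "x \<in> D"
  shows "AE y in lborel. y \<in> D \<longrightarrow> psi \<omega> x y = b \<longrightarrow> \<omega> y = 0"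
proof -
  note d = admissibleD(1)[OF w] and [measurable] = admissibleD(2)[OF w]
  define S where "S = {y\<in>D. psi \<omega> x y = b \<and> y \<noteq> x}"
  have S [measurable]: "S \<in> sets borel" unfolding S_def by measurable
  define V where "V z = 1 * ((-1) * regular_potential \<omega> z + (- (1 / (2 * pi))) * ln (norm (z - x))) + (-1) * h z x" for z
  have "AE z in lborel. z \<in> S \<longrightarrow> \<omega> z = 0"
  proof (rule density_zero_on_level_set[OF domain_densityD(6)[OF d] S, where \<alpha>="- (1 / (2 * pi))" and V=V and b=b])
    have "bounded S" by (rule bounded_subset[OF bddD]) (auto simp: S_def)
    then show "emeasure lborel S < \<infinity>" by (rule emeasure_bounded_finite)
    fix z assume z: "z \<in> S"
    then have zD: "z \<in> D" and zx: "z \<noteq> x" and pz: "psi \<omega> x z = b" by (auto simp: S_def)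
    have "green_kernel x z = - (1 / (2 * pi) * ln (norm (z - x))) - h z x"
      using green_kernel_eq[OF x zD] G_eq[OF x zD] h_commute[OF x zD] zx by (simp add: ln_div norm_minus_commute)
    then show "- (1 / (2 * pi)) * log_potential \<omega> z + V z = b"
      using pz potential_eq[OF d zD] by (simp add: psi_def V_def)
    have 1: "(\<lambda>n. stencil (inverse (Suc n)) (regular_potential \<omega>) z / (inverse (Suc n))\<^sup>2) \<longlonglongrightarrow> 0"
    proof -
      obtain r L where r: "r > 0" "L \<ge> 0" "\<And>M \<omega> s. domain_density M \<omega> \<Longrightarrow> 0 < s \<Longrightarrow> s < r / 4 \<Longrightarrow> \<bar>stencil s (regular_potential \<omega>) z\<bar> \<le> M * L * s^3"
        using regular_potential_estimates[OF zD] by metis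
      show ?thesis
        by (rule stencil_sq_tendsto[of "\<mu> * L" "r / 4"]) (use r domain_densityD(1)[OF d] r(3)[OF d] in auto)
    qed
    have 2: "(\<lambda>n. stencil (inverse (Suc n)) (\<lambda>z. h z x) z / (inverse (Suc n))\<^sup>2) \<longlonglongrightarrow> 0"
    proof -
      obtain r B where r: "r > 0" "B \<ge> 0" and
        ex: "\<exists>q. q holomorphic_on ball (cplx z) r \<and> (\<forall>w\<in>ball (cplx z) r. cmod (q w) \<le> B) \<and>
         (\<forall>u\<in>ball z r. ((\<lambda>z. h z x) has_derivative (\<lambda>v. Re (cplx v * q (cplx u)))) (at u))"
        using h_local_holomorphic[OF zD] x by metis
      then obtain q where q: "q holomorphic_on ball (cplx z) r" "\<And>w. w\<in>ball (cplx z) r \<Longrightarrow> cmod (q w) \<le> B"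
        "\<And>u. u \<in> ball z r \<Longrightarrow> ((\<lambda>z. h z x) has_derivative (\<lambda>v. Re (cplx v * q (cplx u)))) (at u)" by blast
      show ?thesis
        by (rule stencil_sq_tendsto[of "64 * B / r\<^sup>2" "r / 4"])
           (use r holomorphic_gradient_estimates(2)[OF q(1,2) r(1) q(3)] in auto)
    qed
    have "(\<lambda>n. 1 * ((-1) * (stencil (inverse (Suc n)) (regular_potential \<omega>) z / (inverse (Suc n))\<^sup>2) + (- (1 / (2 * pi))) * (stencil (inverse (Suc n)) (\<lambda>z. ln (norm (z - x))) z / (inverse (Suc n))\<^sup>2)) + (-1) * (stencil (inverse (Suc n)) (\<lambda>z. h z x) z / (inverse (Suc n))\<^sup>2))
       \<longlonglongrightarrow> 1 * ((-1) * 0 + (- (1 / (2 * pi))) * 0) + (-1) * 0"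
      by (intro tendsto_intros 1 2 stencil_ln_norm[OF zx])
    moreover have "stencil s V z / s\<^sup>2 = 1 * ((-1) * (stencil s (regular_potential \<omega>) z / s\<^sup>2) + (- (1 / (2 * pi))) * (stencil s (\<lambda>z. ln (norm (z - x))) z / s\<^sup>2)) + (-1) * (stencil s (\<lambda>z. h z x) z / s\<^sup>2)" for s
      unfolding V_def stencil_lin by (simp add: add_divide_distrib diff_divide_distrib)
    ultimately show "(\<lambda>n. stencil (inverse (Suc n)) V z / (inverse (Suc n))\<^sup>2) \<longlonglongrightarrow> 0" by simp
  qed simp
  with AE_neq_point[of x] show ?thesis by eventually_elim (auto simp: S_def)
qed

text \<open>The level is positive: if it were zero, positivity of the stream function would make \<open>\<omega>\<close> equal to \<open>\<mu>\<close> on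
all of \<open>D\<close>, of mass \<open>\<mu> |D| > 1\<close>.\<close>

lemma optimal_patch:
  assumes mu: "\<mu> > 1 / areaD" and a: "areaD > 0"
  obtains \<omega> x b where "admissible \<mu> \<omega>" "x \<in> D" "b > 0"
    "AE y in lborel. \<omega> y = \<mu> * indicator {z\<in>D. psi \<omega> x z > b} y"
    "\<And>z. z \<in> D \<Longrightarrow> potential \<omega> z - kirchhoff_routh h z \<le> potential \<omega> x - kirchhoff_routh h x"
proof -
  obtain \<omega> x where w: "admissible \<mu> \<omega>" and x: "x \<in> D" and max: "\<And>v z. admissible \<mu> v \<Longrightarrow> z \<in> D \<Longrightarrow> energy v z \<le> energy \<omega> x"
    using maximizer_exists[OF mu a] by metis
  note [measurable] = admissibleD(2)[OF w]
  have mu1: "\<mu> * areaD > 1" using mu a by (simp add: divide_less_eq)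
  obtain b where b: "b \<ge> 0" and ae: "AE y in lborel. y \<in> D \<longrightarrow> (psi \<omega> x y > b \<longrightarrow> \<omega> y = \<mu>) \<and> (psi \<omega> x y < b \<longrightarrow> \<omega> y = 0)"
    by (rule bathtub[OF mu1 w, of "psi \<omega> x"])
       (use psi_nonneg[OF w] integrable_mult_psi(1)[OF _ w] first_variation[OF w x max] in auto)
  have form: "AE y in lborel. \<omega> y = \<mu> * indicator {z\<in>D. psi \<omega> x z > b} y"
    using ae level_set_null[OF w x, of b]
  proof eventually_elim
    case (elim y)
    then show ?case using admissibleD(5)[OF w, of y] by (cases "psi \<omega> x y" b rule: linorder_cases) (auto simp: indicator_def)
  qed
  have "b \<noteq> 0"
  proof
    assume "b = 0"
    have "AE y in lborel. \<omega> y = \<mu> * indicator D y"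
      using form AE_neq_point[of x]
    proof eventually_elim
      case (elim y)
      have "psi \<omega> x y > b" if "y \<in> D"
        using G_pos[OF x that] green_kernel_eq[OF x that] elim potential_nonneg[OF w, of y] \<open>b = 0\<close> by (simp add: psi_def)
      then show ?case using elim by (auto simp: indicator_def)
    qed
    then have "(LINT y|lborel. \<omega> y) = (LINT y|lborel. \<mu> * indicator D y)" by (intro integral_cong_AE) auto
    then show False using mu1 admissibleD(7)[OF w] integrable_const_D(2)[of \<mu>] by simp
  qed
  then have "b > 0" using b by simp
  moreover have "potential \<omega> z - kirchhoff_routh h z \<le> potential \<omega> x - kirchhoff_routh h x" if "z \<in> D" for z
    using max[OF w that] by (simp add: energy_def)
  ultimately show ?thesis using that w x form by blast
qed

end

section \<open>The weak vorticity equation\<close>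

text \<open>The mean value theorem, applied in direction \<open>i\<close> and then in direction \<open>j\<close>. As the second difference on
the left is symmetric in \<open>i\<close> and \<open>j\<close>, the two mixed partial derivatives agree in the limit.\<close>

lemma mixed_difference_mean_value:
  fixes \<phi> :: "'a::euclidean_space \<Rightarrow> real"
  assumes d1: "\<And>z. \<phi> differentiable (at z)" and d2: "\<And>z. partial i \<phi> differentiable (at z)" and h: "h > 0"
  shows "\<exists>s t. 0 < s \<and> s < h \<and> 0 < t \<and> t < h \<and>
    \<phi> (z + h *\<^sub>R i + h *\<^sub>R j) - \<phi> (z + h *\<^sub>R i) - \<phi> (z + h *\<^sub>R j) + \<phi> z = h * h * partial j (partial i \<phi>) (z + s *\<^sub>R i + t *\<^sub>R j)"
proof -
  define g where "g s = \<phi> ((z + h *\<^sub>R j) + s *\<^sub>R i) - \<phi> (z + s *\<^sub>R i)" for s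
  define g' where "g' s = partial i \<phi> ((z + h *\<^sub>R j) + s *\<^sub>R i) - partial i \<phi> (z + s *\<^sub>R i)" for s
  have "(g has_real_derivative g' s) (at s)" for s
    unfolding g_def g'_def by (intro DERIV_diff partial_has_real_derivative d1)
  then obtain s where s: "0 < s" "s < h" "g h - g 0 = (h - 0) * g' s" using MVT2[OF h, of g g'] by auto
  define k where "k t = partial i \<phi> ((z + s *\<^sub>R i) + t *\<^sub>R j)" for t
  have "(k has_real_derivative partial j (partial i \<phi>) ((z + s *\<^sub>R i) + t *\<^sub>R j)) (at t)" for t
    unfolding k_def by (intro partial_has_real_derivative d2)
  then obtain t where t: "0 < t" "t < h" "k h - k 0 = (h - 0) * partial j (partial i \<phi>) ((z + s *\<^sub>R i) + t *\<^sub>R j)"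
    using MVT2[OF h, of k "\<lambda>t. partial j (partial i \<phi>) ((z + s *\<^sub>R i) + t *\<^sub>R j)"] by auto
  have "g' s = k h - k 0" by (simp add: g'_def k_def add_ac)
  then have "g h - g 0 = h * h * partial j (partial i \<phi>) (z + s *\<^sub>R i + t *\<^sub>R j)" using s t by simp
  moreover have "g h - g 0 = \<phi> (z + h *\<^sub>R i + h *\<^sub>R j) - \<phi> (z + h *\<^sub>R i) - \<phi> (z + h *\<^sub>R j) + \<phi> z" by (simp add: g_def add_ac)
  ultimately show ?thesis using s t by auto
qed

lemma partial_commute:
  fixes \<phi> :: "'a::euclidean_space \<Rightarrow> real"
  assumes phi: "Ck_on 2 UNIV \<phi>" and ij: "i \<in> Basis" "j \<in> Basis"
  shows "partial j (partial i \<phi>) z = partial i (partial j \<phi>) z"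
proof -
  note P = phi[unfolded Ck_on_2]
  define h where "h n = inverse (real (Suc n))" for n
  have h: "h n > 0" "h \<longlonglongrightarrow> 0" for n unfolding h_def using LIMSEQ_inverse_real_of_nat by auto
  define \<Delta> where "\<Delta> n = \<phi> (z + h n *\<^sub>R i + h n *\<^sub>R j) - \<phi> (z + h n *\<^sub>R i) - \<phi> (z + h n *\<^sub>R j) + \<phi> z" for n
  have lim: "(\<lambda>n. \<Delta> n / (h n * h n)) \<longlonglongrightarrow> partial b (partial a \<phi>) z"
    if ab: "a \<in> Basis" "b \<in> Basis" and D: "\<And>n. \<Delta> n = \<phi> (z + h n *\<^sub>R a + h n *\<^sub>R b) - \<phi> (z + h n *\<^sub>R a) - \<phi> (z + h n *\<^sub>R b) + \<phi> z" for a b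
  proof -
    have "\<exists>s t. 0 < s \<and> s < h n \<and> 0 < t \<and> t < h n \<and> \<Delta> n = h n * h n * partial b (partial a \<phi>) (z + s *\<^sub>R a + t *\<^sub>R b)" for n
      unfolding D by (rule mixed_difference_mean_value) (use P ab h in auto)
    then obtain s t where st: "\<And>n. 0 < s n \<and> s n < h n \<and> 0 < t n \<and> t n < h n \<and> \<Delta> n = h n * h n * partial b (partial a \<phi>) (z + s n *\<^sub>R a + t n *\<^sub>R b)" by metis
    have "s \<longlonglongrightarrow> 0" "t \<longlonglongrightarrow> 0"
      by (rule tendsto_sandwich[OF _ _ tendsto_const h(2)]; use st less_imp_le in \<open>auto intro!: always_eventually\<close>)+
    then have "(\<lambda>n. z + s n *\<^sub>R a + t n *\<^sub>R b) \<longlonglongrightarrow> z + 0 *\<^sub>R a + 0 *\<^sub>R b" by (intro tendsto_intros)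
    then have pl: "(\<lambda>n. z + s n *\<^sub>R a + t n *\<^sub>R b) \<longlonglongrightarrow> z" by simp
    have "continuous_on UNIV (partial b (partial a \<phi>))" using P ab by auto
    then have "(\<lambda>n. partial b (partial a \<phi>) (z + s n *\<^sub>R a + t n *\<^sub>R b)) \<longlonglongrightarrow> partial b (partial a \<phi>) z"
      by (rule continuous_on_tendsto_compose[OF _ pl]) auto
    moreover have "\<Delta> n / (h n * h n) = partial b (partial a \<phi>) (z + s n *\<^sub>R a + t n *\<^sub>R b)" for n
      using st[of n] h(1)[of n] by simp
    ultimately show ?thesis by simp
  qed
  have "(\<lambda>n. \<Delta> n / (h n * h n)) \<longlonglongrightarrow> partial j (partial i \<phi>) z" by (rule lim[OF ij]) (simp add: \<Delta>_def)
  moreover have "(\<lambda>n. \<Delta> n / (h n * h n)) \<longlonglongrightarrow> partial i (partial j \<phi>) z" by (rule lim[OF ij(2,1)]) (simp add: \<Delta>_def add_ac)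
  ultimately show ?thesis by (rule LIMSEQ_unique)
qed

text \<open>The difference quotients integrate to zero by translation invariance and are dominated because \<open>F\<close> is
Lipschitz with bounded support.\<close>

lemma integral_gradient_eq_0:
  fixes F :: "'a::euclidean_space \<Rightarrow> real"
  assumes der: "\<And>z. (F has_derivative (\<lambda>v. g z \<bullet> v)) (at z)" and B: "\<And>z. norm (g z) \<le> B"
    and R: "\<And>z. norm z > R \<Longrightarrow> F z = 0" and i: "norm i \<le> 1"
  shows "integrable lborel (\<lambda>z. g z \<bullet> i)" "(LINT z|lborel. g z \<bullet> i) = 0"
proof -
  have B0: "B \<ge> 0" using order_trans[OF norm_ge_zero B] .
  have cont: "continuous_on UNIV F"
    using der by (meson has_derivative_continuous continuous_at_imp_continuous_on)
  have [measurable]: "F \<in> borel_measurable borel" using cont by (rule borel_measurable_continuous_onI)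
  have lip: "\<bar>F y - F z\<bar> \<le> B * norm (y - z)" for y z
    by (rule gradient_bound_imp_Lipschitz[OF convex_UNIV UNIV_I UNIV_I der B])
  have iF: "integrable lborel F"
  proof (rule Bochner_Integration.integrable_bound[OF integrable_indicator_bounded[of 0 R "\<bar>F 0\<bar> + B * \<bar>R\<bar>"]])
    show "AE z in lborel. norm (F z) \<le> norm (indicator (cball 0 R) z * (\<bar>F 0\<bar> + B * \<bar>R\<bar>))"
    proof (rule AE_I2)
      fix z
      show "norm (F z) \<le> norm (indicator (cball 0 R) z * (\<bar>F 0\<bar> + B * \<bar>R\<bar>))"
      proof (cases "norm z \<le> R")
        case True
        have "B * norm z \<le> B * \<bar>R\<bar>" using True B0 by (intro mult_left_mono) auto
        then have "\<bar>F z\<bar> \<le> \<bar>F 0\<bar> + B * \<bar>R\<bar>" using lip[of z 0] by simp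
        then show ?thesis using True by simp
      qed (use R in simp)
    qed
  qed measurable
  have shift: "(LINT y|lborel. F (y + w)) = (LINT y|lborel. F y)" "integrable lborel (\<lambda>y. F (y + w))" for w
    using integral_shift[of F w] integrable_shift_iff[of F w] iF by simp_all
  define h where "h n = inverse (real (Suc n))" for n
  have h: "h n > 0" "h \<longlonglongrightarrow> 0" "h n \<le> 1" for n unfolding h_def using LIMSEQ_inverse_real_of_nat by (auto simp: inverse_le_1_iff)
  define q where "q n z = (F (z + h n *\<^sub>R i) - F z) / h n" for n z
  have qlim: "(\<lambda>n. q n z) \<longlonglongrightarrow> g z \<bullet> i" for z
    unfolding q_def by (rule gradient_difference_quotient_tendsto[OF der h(2,1)])
  have qb: "\<bar>q n z\<bar> \<le> indicator (cball 0 (R + 1)) z * B" for n z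
  proof (cases "norm z \<le> R + 1")
    case True
    have "\<bar>F (z + h n *\<^sub>R i) - F z\<bar> \<le> B * norm (h n *\<^sub>R i)" using lip[of "z + h n *\<^sub>R i" z] by simp
    also have "\<dots> \<le> B * h n" using i h(1)[of n] B0 by (intro mult_left_mono) (auto simp: mult_left_le)
    finally show ?thesis using True h(1)[of n] by (simp add: q_def divide_le_eq)
  next
    case False
    have "norm (h n *\<^sub>R i) \<le> 1" using i h(1,3)[of n] by (simp add: mult_le_one)
    then have "norm (z + h n *\<^sub>R i) > R" using norm_diff_ineq[of z "h n *\<^sub>R i"] False by linarith
    then show ?thesis using R False by (simp add: q_def)
  qed
  have qm: "q n \<in> borel_measurable lborel" for n unfolding q_def by measurable
  have gm: "(\<lambda>z. g z \<bullet> i) \<in> borel_measurable lborel" by (rule borel_measurable_LIMSEQ_real[OF qlim qm])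
  have bd: "AE z in lborel. norm (q n z) \<le> indicator (cball 0 (R + 1)) z * B" for n using qb by simp
  have ql: "AE z in lborel. (\<lambda>n. q n z) \<longlonglongrightarrow> g z \<bullet> i" using qlim by simp
  show "integrable lborel (\<lambda>z. g z \<bullet> i)"
    by (rule integrable_dominated_convergence[OF gm qm integrable_indicator_bounded ql bd])
  have "(\<lambda>n. LINT z|lborel. q n z) \<longlonglongrightarrow> (LINT z|lborel. g z \<bullet> i)"
    by (rule integral_dominated_convergence[OF gm qm integrable_indicator_bounded ql bd])
  moreover have "(LINT z|lborel. q n z) = 0" for n
    unfolding q_def using shift[of "h n *\<^sub>R i"] iF by simp
  ultimately show "(LINT z|lborel. g z \<bullet> i) = 0" by (simp add: LIMSEQ_const_iff)
qed

lemma compact_local_bound: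
  fixes K :: "'a::metric_space set"
  assumes K: "compact K" and loc: "\<And>a. a \<in> K \<Longrightarrow> \<exists>r>0. \<exists>L. \<forall>z\<in>ball a r. P z L"
    and mono: "\<And>z L L'. P z L \<Longrightarrow> L \<le> L' \<Longrightarrow> P z (L'::real)"
  shows "\<exists>L. \<forall>z\<in>K. P z L"
proof -
  from loc obtain r L where rL: "\<And>a. a \<in> K \<Longrightarrow> r a > 0" "\<And>a z. a \<in> K \<Longrightarrow> z \<in> ball a (r a) \<Longrightarrow> P z (L a)" by metis
  obtain C where C: "C \<subseteq> K" "finite C" "K \<subseteq> (\<Union>a\<in>C. ball a (r a))"
    using compactE_image[OF K, of K "\<lambda>a. ball a (r a)"] rL(1) by (metis (no_types, lifting) UN_I centre_in_ball open_ball subsetI)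
  show ?thesis
  proof (intro exI[of _ "\<Sum>a\<in>C. \<bar>L a\<bar>"] ballI)
    fix z assume "z \<in> K"
    then obtain a where a: "a \<in> C" "z \<in> ball a (r a)" using C by blast
    have "P z (L a)" using rL(2)[of a z] a C by blast
    moreover have "L a \<le> (\<Sum>a\<in>C. \<bar>L a\<bar>)" using member_le_sum[of a C "\<lambda>a. \<bar>L a\<bar>"] a C by simp
    ultimately show "P z (\<Sum>a\<in>C. \<bar>L a\<bar>)" by (rule mono)
  qed
qed

definition ramp2 :: "real \<Rightarrow> real" where "ramp2 s = (max 0 s)\<^sup>2 / 2"

lemma ramp2_deriv: "(ramp2 has_real_derivative max 0 s) (at s)"
proof (cases s "0::real" rule: linorder_cases)
  case less
  have "((\<lambda>s. 0) has_real_derivative max 0 s) (at s)" using less by simp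
  then show ?thesis
    by (rule has_field_derivative_transform_within_open[of _ _ _ "{..<0}"]) (use less in \<open>auto simp: ramp2_def\<close>)
next
  case greater
  have "((\<lambda>s. s\<^sup>2 / 2) has_real_derivative max 0 s) (at s)" using greater by (auto intro!: derivative_eq_intros)
  then show ?thesis
    by (rule has_field_derivative_transform_within_open[of _ _ _ "{0<..}"]) (use greater in \<open>auto simp: ramp2_def\<close>)
next
  case equal
  have "((\<lambda>h. (ramp2 (0 + h) - ramp2 0) / h) \<longlongrightarrow> 0) (at 0)"
  proof (rule Lim_null_comparison)
    show "((\<lambda>h::real. \<bar>h\<bar>) \<longlongrightarrow> 0) (at 0)" using tendsto_rabs_zero[OF tendsto_ident_at[of 0 UNIV]] by simp
    show "\<forall>\<^sub>F h in at 0. norm ((ramp2 (0 + h) - ramp2 0) / h) \<le> \<bar>h\<bar>"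
    proof (rule always_eventually, rule allI)
      fix h :: real
      show "norm ((ramp2 (0 + h) - ramp2 0) / h) \<le> \<bar>h\<bar>"
        by (cases "h > 0") (auto simp: ramp2_def power2_eq_square)
    qed
  qed
  then show ?thesis using equal by (simp add: DERIV_def)
qed

text \<open>A continuous trapezoid that rises from 0 to 1 on \<open>[b, b + 1/(n+1)]\<close> and falls to 0 on
\<open>[b + n + 1, b + n + 2]\<close>.\<close>

definition plateau :: "real \<Rightarrow> nat \<Rightarrow> real \<Rightarrow> real" where
  "plateau b n s = real (Suc n) * (max 0 (s - b) - max 0 (s - b - 1 / real (Suc n))) - (max 0 (s - b - real (Suc n)) - max 0 (s - b - real (Suc (Suc n))))"

definition plateau_primitive :: "real \<Rightarrow> nat \<Rightarrow> real \<Rightarrow> real" where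
  "plateau_primitive b n s = real (Suc n) * (ramp2 (s - b) - ramp2 (s - b - 1 / real (Suc n))) - (ramp2 (s - b - real (Suc n)) - ramp2 (s - b - real (Suc (Suc n))))"

lemma plateau_primitive_deriv: "(plateau_primitive b n has_real_derivative plateau b n s) (at s)"
proof -
  have r: "((\<lambda>s. ramp2 (s - c)) has_real_derivative max 0 (s - c)) (at s)" for c
  proof -
    have "((\<lambda>s. s - c) has_real_derivative 1) (at s)" by (auto intro!: derivative_eq_intros)
    from DERIV_chain2[OF ramp2_deriv this] show ?thesis by simp
  qed
  have "((\<lambda>s. real (Suc n) * (ramp2 (s - b) - ramp2 (s - (b + 1 / real (Suc n)))) - (ramp2 (s - (b + real (Suc n))) - ramp2 (s - (b + real (Suc (Suc n)))))) has_real_derivative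
     real (Suc n) * (max 0 (s - b) - max 0 (s - (b + 1 / real (Suc n)))) - (max 0 (s - (b + real (Suc n))) - max 0 (s - (b + real (Suc (Suc n)))))) (at s)"
    by (intro DERIV_diff DERIV_cmult r)
  then show ?thesis unfolding plateau_primitive_def[abs_def] plateau_def diff_diff_eq .
qed

lemma one_div_Suc: "1 / real (Suc n) \<le> 1" "0 < 1 / real (Suc n)" by (auto simp: divide_le_eq)

lemma plateau_zero: "s \<le> b \<Longrightarrow> plateau b n s = 0" "s \<ge> b + real (Suc (Suc n)) \<Longrightarrow> plateau b n s = 0"
proof -
  show "plateau b n s = 0" if "s \<le> b"
  proof -
    have "s - b \<le> 0" "s - b - 1 / real (Suc n) \<le> 0" "s - b - real (Suc n) \<le> 0" "s - b - real (Suc (Suc n)) \<le> 0"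
      using that one_div_Suc(2)[of n] by linarith+
    then show ?thesis unfolding plateau_def by (simp only: max_absorb1) simp
  qed
  assume s: "s \<ge> b + real (Suc (Suc n))"
  have p: "s - b \<ge> 0" "s - b - 1 / real (Suc n) \<ge> 0" "s - b - real (Suc n) \<ge> 0" "s - b - real (Suc (Suc n)) \<ge> 0"
  proof -
    have e: "real (Suc (Suc n)) = real n + 2" "real (Suc n) = real n + 1" by auto
    show "s - b \<ge> 0" "s - b - 1 / real (Suc n) \<ge> 0" "s - b - real (Suc n) \<ge> 0" "s - b - real (Suc (Suc n)) \<ge> 0"
      using s one_div_Suc(1)[of n] of_nat_0_le_iff[of n, where 'a=real] e by linarith+
  qed
  have "plateau b n s = real (Suc n) * ((s - b) - (s - b - 1 / real (Suc n))) - ((s - b - real (Suc n)) - (s - b - real (Suc (Suc n))))"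
    unfolding plateau_def using p by (simp only: max_absorb2)
  also have "\<dots> = 0" by simp
  finally show "plateau b n s = 0" .
qed

lemma plateau_bound: "\<bar>plateau b n s\<bar> \<le> 2"
proof -
  have a: "0 \<le> max 0 t - max 0 (t - c) \<and> max 0 t - max 0 (t - c) \<le> c" if "c \<ge> 0" for t c :: real using that by auto
  define A where "A = max 0 (s - b) - max 0 (s - b - 1 / real (Suc n))"
  define C where "C = max 0 (s - b - real (Suc n)) - max 0 (s - b - real (Suc n) - 1)"
  have A: "0 \<le> A" "A \<le> 1 / real (Suc n)" using a[of "1 / real (Suc n)" "s - b"] by (simp_all add: A_def)
  have C: "0 \<le> C" "C \<le> 1" using a[of 1 "s - b - real (Suc n)"] by (simp_all add: C_def)
  have "real (Suc n) * A \<le> real (Suc n) * (1 / real (Suc n))" using A by (intro mult_left_mono) auto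
  then have "real (Suc n) * A \<le> 1" "0 \<le> real (Suc n) * A" using A by auto
  moreover have "plateau b n s = real (Suc n) * A - C" by (simp add: plateau_def A_def C_def algebra_simps)
  ultimately show ?thesis using C by linarith
qed

lemma plateau_tendsto: "(\<lambda>n. plateau b n s) \<longlonglongrightarrow> (if s > b then 1 else 0)"
proof (cases "s > b")
  case True
  obtain n0 where n0: "s - b \<le> real n0" using real_arch_simple by blast
  have "\<forall>\<^sub>F n in sequentially. inverse (real (Suc n)) < s - b"
    using True by (intro order_tendstoD[OF LIMSEQ_inverse_real_of_nat]) simp
  then have "\<forall>\<^sub>F n in sequentially. plateau b n s = 1"
    using eventually_ge_at_top[of n0]
  proof eventually_elim
    case (elim n)
    have p: "s - b \<ge> 0" "s - b - 1 / real (Suc n) \<ge> 0" using True elim by (auto simp: inverse_eq_divide)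
    have "real n0 \<le> real n" using elim by simp
    then have q: "s - b - real (Suc n) \<le> 0" "s - b - real (Suc (Suc n)) \<le> 0" using n0 by auto
    have "plateau b n s = real (Suc n) * ((s - b) - (s - b - 1 / real (Suc n))) - (0 - 0)"
      unfolding plateau_def using p q by (simp only: max_absorb2 max_absorb1)
    then show ?case by simp
  qed
  then show ?thesis using True by (simp add: tendsto_eventually)
next
  case False
  then show ?thesis by (simp add: plateau_zero(1))
qed

lemma plateau_primitive_const: "s \<ge> b + real (Suc (Suc n)) \<Longrightarrow> plateau_primitive b n s = plateau_primitive b n (b + real (Suc (Suc n)))"
proof (cases "s = b + real (Suc (Suc n))")
  case False
  assume "s \<ge> b + real (Suc (Suc n))"
  then have lt: "b + real (Suc (Suc n)) < s" using False by simp
  obtain t where "t > b + real (Suc (Suc n))" "plateau_primitive b n s - plateau_primitive b n (b + real (Suc (Suc n))) = (s - (b + real (Suc (Suc n)))) * plateau b n t"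
    using MVT2[OF lt, of "plateau_primitive b n" "plateau b n"] plateau_primitive_deriv by blast
  then show ?thesis using plateau_zero(2)[of b n t] by simp
qed simp

lemma differentiable_imp_gradient:
  fixes f :: "'a::euclidean_space \<Rightarrow> real"
  assumes "f differentiable (at z)"
  shows "(f has_derivative (\<lambda>v. (\<Sum>j\<in>Basis. partial j f z *\<^sub>R j) \<bullet> v)) (at z)"
proof -
  have lin: "linear (frechet_derivative f (at z))" by (rule linear_frechet_derivative[OF assms])
  have "frechet_derivative f (at z) v = (\<Sum>j\<in>Basis. partial j f z *\<^sub>R j) \<bullet> v" for v
  proof -
    have "frechet_derivative f (at z) v = frechet_derivative f (at z) (\<Sum>j\<in>Basis. (v \<bullet> j) *\<^sub>R j)" by (simp add: euclidean_representation)
    also have "\<dots> = (\<Sum>j\<in>Basis. (v \<bullet> j) * partial j f z)"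
      unfolding partial_def using lin by (simp add: linear_sum linear_scale)
    finally show ?thesis by (simp add: inner_sum_left inner_sum_right inner_commute mult.commute)
  qed
  then have "frechet_derivative f (at z) = (\<lambda>v. (\<Sum>j\<in>Basis. partial j f z *\<^sub>R j) \<bullet> v)" by (rule ext)
  then show ?thesis using assms unfolding frechet_derivative_works by simp
qed

lemma has_derivative_gradient_unique:
  assumes "(f has_derivative (\<lambda>v. g \<bullet> v)) (at z)" "(f has_derivative (\<lambda>v. g' \<bullet> v)) (at z)"
  shows "g = g'"
proof -
  have "(\<lambda>v. g \<bullet> v) = (\<lambda>v. g' \<bullet> v)" by (rule has_derivative_unique[OF assms])
  then show ?thesis by (metis vector_eq_rdot)
qed

lemma grad_eqI:
  assumes "(f has_derivative (\<lambda>v. g \<bullet> v)) (at z)" shows "grad f z = g"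
  unfolding grad_def
proof (rule the_equality)
  show "GDERIV f z :> g" using assms by (simp add: gderiv_def inner_commute)
  show "g' = g" if "GDERIV f z :> g'" for g'
    using that has_derivative_gradient_unique[OF _ assms] by (simp add: gderiv_def inner_commute)
qed

lemma inner_axis_1: "v \<bullet> axis 1 1 = v $ 1" "v \<bullet> axis 2 1 = v $ 2" for v :: "real^2"
  by (simp_all add: inner_axis)

lemma axis_in_Basis_real2: "axis 1 1 \<in> (Basis :: (real^2) set)" "axis 2 1 \<in> (Basis :: (real^2) set)"
  by (auto simp: Basis_vec_def)

lemma rotJ_inner: "rotJ g \<bullet> q = g $ 2 * q $ 1 - g $ 1 * q $ 2"
  by (simp add: rotJ_def inner_vec_def sum_2)

lemma rotJ_norm: "\<bar>rotJ g \<bullet> q\<bar> \<le> norm g * norm q"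
proof -
  have "norm (rotJ g) = norm g" by (simp add: rotJ_def norm_vec_def L2_set_def sum_2 add.commute)
  then show ?thesis using Cauchy_Schwarz_ineq2[of "rotJ g" q] by simp
qed

lemma test_function_bounds:
  fixes \<phi> :: "real^2 \<Rightarrow> real"
  assumes t: "test_function_on D \<phi>"
  defines "K \<equiv> closure {x. \<phi> x \<noteq> 0}"
  obtains B where "compact K" "K \<subseteq> D" "Ck_on 2 UNIV \<phi>" "B \<ge> 0"
    "\<And>z. \<phi> differentiable (at z)" "\<And>i z. i \<in> Basis \<Longrightarrow> partial i \<phi> differentiable (at z)"
    "\<And>i z. z \<notin> K \<Longrightarrow> partial i \<phi> z = 0"
    "\<And>i z. i \<in> Basis \<Longrightarrow> \<bar>partial i \<phi> z\<bar> \<le> B" "\<And>i j z. i \<in> Basis \<Longrightarrow> j \<in> Basis \<Longrightarrow> \<bar>partial j (partial i \<phi>) z\<bar> \<le> B"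
proof -
  have K: "compact K" "K \<subseteq> D" and C2: "Ck_on 2 UNIV \<phi>" using t by (auto simp: test_function_on_def smooth_on_def K_def)
  note P = C2[unfolded Ck_on_2]
  have oK: "open (- K)" using compact_imp_closed[OF K(1)] by blast
  have z0: "partial i f z = 0" if "\<And>y. y \<notin> K \<Longrightarrow> f y = 0" "z \<notin> K" for i z and f :: "real^2 \<Rightarrow> real"
  proof -
    have "((\<lambda>y. 0::real) has_derivative (\<lambda>v. 0)) (at z)" by simp
    then have "(f has_derivative (\<lambda>v. 0)) (at z)"
      by (rule has_derivative_transform_within_open[OF _ oK]) (use that in auto)
    then show ?thesis by (rule has_derivative_imp_partial)
  qed
  have p0: "\<phi> y = 0" if "y \<notin> K" for y using that closure_subset[of "{x. \<phi> x \<noteq> 0}"] by (auto simp: K_def)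
  have p1: "partial i \<phi> z = 0" if "z \<notin> K" for i z by (rule z0[OF p0 that])
  have p2: "partial j (partial i \<phi>) z = 0" if "z \<notin> K" for i j z by (rule z0[OF p1 that])
  have bounded: "\<exists>B. \<forall>z. \<bar>f z\<bar> \<le> B" if f: "continuous_on UNIV f" "\<And>z. z \<notin> K \<Longrightarrow> f z = 0" for f :: "real^2 \<Rightarrow> real"
  proof -
    have "bounded (f ` K)" by (intro compact_imp_bounded compact_continuous_image continuous_on_subset[OF f(1)] K) auto
    then obtain B where B: "\<And>z. z \<in> K \<Longrightarrow> \<bar>f z\<bar> \<le> B" by (auto simp: bounded_iff)
    have "\<bar>f z\<bar> \<le> \<bar>B\<bar>" for z by (cases "z \<in> K") (use B[of z] f(2) in auto)
    then show ?thesis by blast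
  qed
  have c1: "continuous_on UNIV (partial i \<phi>)" if "i \<in> Basis" for i
    using P that by (meson UNIV_I differentiable_imp_continuous_within continuous_at_imp_continuous_on)
  have "\<exists>B. \<forall>i z. i \<in> Basis \<longrightarrow> \<bar>partial i \<phi> z\<bar> \<le> B"
  proof -
    have "\<forall>i\<in>Basis. \<exists>B. \<forall>z. \<bar>partial i \<phi> z\<bar> \<le> B" using bounded[OF c1 p1] by blast
    then obtain B where B: "\<And>i z. i \<in> Basis \<Longrightarrow> \<bar>partial i \<phi> z\<bar> \<le> B i" by metis
    have "\<bar>partial i \<phi> z\<bar> \<le> (\<Sum>i\<in>Basis. \<bar>B i\<bar>)" if "i \<in> Basis" for i z
      using B[OF that, of z] member_le_sum[of i Basis "\<lambda>i. \<bar>B i\<bar>"] that by simp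
    then show ?thesis by blast
  qed
  then obtain B1 where B1: "\<And>i z. i \<in> Basis \<Longrightarrow> \<bar>partial i \<phi> z\<bar> \<le> B1" by blast
  have "\<exists>B. \<forall>i j z. i \<in> Basis \<longrightarrow> j \<in> Basis \<longrightarrow> \<bar>partial j (partial i \<phi>) z\<bar> \<le> B"
  proof -
    have "\<forall>p\<in>Basis \<times> Basis. \<exists>B. \<forall>z. \<bar>partial (snd p) (partial (fst p) \<phi>) z\<bar> \<le> B"
      using P p2 by (intro ballI bounded) auto
    then obtain B where B: "\<And>p z. p \<in> Basis \<times> Basis \<Longrightarrow> \<bar>partial (snd p) (partial (fst p) \<phi>) z\<bar> \<le> B p" by metis
    have "\<bar>partial j (partial i \<phi>) z\<bar> \<le> (\<Sum>p\<in>Basis \<times> Basis. \<bar>B p\<bar>)" if "i \<in> Basis" "j \<in> Basis" for i j z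
    proof -
      have "\<bar>partial j (partial i \<phi>) z\<bar> \<le> B (i, j)" using B[of "(i, j)" z] that by simp
      also have "\<dots> \<le> \<bar>B (i, j)\<bar>" by simp
      also have "\<dots> \<le> (\<Sum>p\<in>Basis \<times> Basis. \<bar>B p\<bar>)" using that by (intro member_le_sum) auto
      finally show ?thesis .
    qed
    then show ?thesis by blast
  qed
  then obtain B2 where B2: "\<And>i j z. i \<in> Basis \<Longrightarrow> j \<in> Basis \<Longrightarrow> \<bar>partial j (partial i \<phi>) z\<bar> \<le> B2" by blast
  show ?thesis
  proof (rule that[of "\<bar>B1\<bar> + \<bar>B2\<bar>"])
    show "\<bar>partial i \<phi> z\<bar> \<le> \<bar>B1\<bar> + \<bar>B2\<bar>" if "i \<in> Basis" for i z using B1[OF that, of z] by linarith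
    show "\<bar>partial j (partial i \<phi>) z\<bar> \<le> \<bar>B1\<bar> + \<bar>B2\<bar>" if "i \<in> Basis" "j \<in> Basis" for i j z using B2[OF that, of z] by linarith
  qed (use K C2 P p1 in auto)
qed

context green_domain
begin

lemma green_kernel_gradient:
  assumes x: "x \<in> D" and a: "a \<in> D"
  shows "\<exists>r>0. \<exists>L. ball a r \<subseteq> D \<and> (\<forall>z\<in>ball a r - {x}. \<exists>g. (green_kernel x has_derivative (\<lambda>v. g \<bullet> v)) (at z) \<and> norm g \<le> L + 1 / (2 * pi) * (1 / norm (z - x)))"
proof -
  obtain r B where r: "r > 0" "ball a r \<subseteq> D" "B \<ge> 0" and
    ex: "\<exists>q. q holomorphic_on ball (cplx a) r \<and> (\<forall>w\<in>ball (cplx a) r. cmod (q w) \<le> B) \<and>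
         (\<forall>u\<in>ball a r. ((\<lambda>z. h z x) has_derivative (\<lambda>v. Re (cplx v * q (cplx u)))) (at u))"
    using h_local_holomorphic[OF a] x by metis
  then obtain q where q: "\<And>w. w\<in>ball (cplx a) r \<Longrightarrow> cmod (q w) \<le> B"
    "\<And>u. u \<in> ball a r \<Longrightarrow> ((\<lambda>z. h z x) has_derivative (\<lambda>v. Re (cplx v * q (cplx u)))) (at u)" by blast
  have "\<exists>g. (green_kernel x has_derivative (\<lambda>v. g \<bullet> v)) (at z) \<and> norm g \<le> B + 1 / (2 * pi) * (1 / norm (z - x))" if z: "z \<in> ball a r - {x}" for z
  proof -
    have zD: "z \<in> D" and zx: "z \<noteq> x" using z r by auto
    have nz: "cplx z - cplx x \<noteq> 0" using zx by simp
    define g where "g = - (1 / (2 * pi)) *\<^sub>R plane (cnj (1 / (cplx z - cplx x))) - plane (cnj (q (cplx z)))"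
    have "((\<lambda>y. ln (cmod (cplx y - cplx x))) has_derivative (\<lambda>v. Re (cplx v * (1 / (cplx z - cplx x))))) (at z)"
      using nz by (intro has_derivative_ln_cmod[where g="\<lambda>w. w - cplx x"]) (auto intro!: derivative_eq_intros)
    then have 1: "((\<lambda>y. ln (cmod (cplx y - cplx x))) has_derivative (\<lambda>v. plane (cnj (1 / (cplx z - cplx x))) \<bullet> v)) (at z)"
      unfolding Re_mult_eq_inner .
    have 2: "((\<lambda>y. h y x) has_derivative (\<lambda>v. plane (cnj (q (cplx z))) \<bullet> v)) (at z)"
      using q(2)[of z] z unfolding Re_mult_eq_inner by blast
    have "((\<lambda>y. - (1 / (2 * pi)) * ln (cmod (cplx y - cplx x)) - h y x) has_derivative (\<lambda>v. - (1 / (2 * pi)) * (plane (cnj (1 / (cplx z - cplx x))) \<bullet> v) - plane (cnj (q (cplx z))) \<bullet> v)) (at z)"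
      by (intro has_derivative_diff has_derivative_mult_right 1 2)
    then have "((\<lambda>y. - (1 / (2 * pi)) * ln (cmod (cplx y - cplx x)) - h y x) has_derivative (\<lambda>v. g \<bullet> v)) (at z)"
      by (simp add: g_def inner_diff_left)
    then have "(green_kernel x has_derivative (\<lambda>v. g \<bullet> v)) (at z)"
    proof (rule has_derivative_transform_within_open[of _ _ _ _ "D - {x}"])
      show "open (D - {x})" using openD by (simp add: open_delete)
      show "- (1 / (2 * pi)) * ln (cmod (cplx y - cplx x)) - h y x = green_kernel x y" if "y \<in> D - {x}" for y
      proof -
        have "x \<noteq> y" "y \<in> D" using that by auto
        then show ?thesis using green_kernel_eq[OF x, of y] G_eq[OF x, of y] h_commute[OF x, of y]
          by (simp add: ln_div cplx_diff[symmetric] norm_minus_commute)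
      qed
    qed (use zD zx in auto)
    moreover have "norm g \<le> B + 1 / (2 * pi) * (1 / norm (z - x))"
    proof -
      have "cmod (q (cplx z)) \<le> B" using z norm_cplx[of "a - z"] by (intro q(1)) (simp add: dist_norm cplx_diff)
      moreover have "norm g \<le> norm (- (1 / (2 * pi)) *\<^sub>R plane (cnj (1 / (cplx z - cplx x)))) + norm (plane (cnj (q (cplx z))))"
        unfolding g_def by (rule norm_triangle_ineq4)
      moreover have "norm (- (1 / (2 * pi)) *\<^sub>R plane (cnj (1 / (cplx z - cplx x)))) = 1 / (2 * pi) * (1 / norm (z - x))"
        by (simp add: norm_divide cplx_diff[symmetric])
      ultimately show ?thesis by simp
    qed
    ultimately show ?thesis by blast
  qed
  then show ?thesis using r by blast
qed

lemma psi_gradient_local: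
  assumes w: "admissible \<mu> \<omega>" and x: "x \<in> D" and a: "a \<in> D"
  shows "\<exists>r>0. \<exists>L. \<forall>z\<in>ball a r. z \<in> D \<and> (z \<noteq> x \<longrightarrow> (\<exists>g. (psi \<omega> x has_derivative (\<lambda>v. g \<bullet> v)) (at z) \<and> norm g \<le> L + 1 / (2 * pi) * (1 / norm (z - x))))"
proof -
  obtain ra L1 where 1: "ra > 0" "ball a ra \<subseteq> D"
    "\<And>z. z \<in> ball a ra - {x} \<Longrightarrow> \<exists>g. (green_kernel x has_derivative (\<lambda>v. g \<bullet> v)) (at z) \<and> norm g \<le> L1 + 1 / (2 * pi) * (1 / norm (z - x))"
    using green_kernel_gradient[OF x a] by blast
  obtain rb L2 where 2: "rb > 0" "ball a rb \<subseteq> D"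
    "\<And>M \<omega> z. domain_density M \<omega> \<Longrightarrow> z \<in> ball a rb \<Longrightarrow> \<exists>g. (potential \<omega> has_derivative (\<lambda>v. g \<bullet> v)) (at z) \<and> norm g \<le> M * L2"
    using potential_has_derivative[OF a] by metis
  show ?thesis
  proof (rule exI[of _ "min ra rb"], intro conjI, goal_cases pos bound)
    case pos
    show "min ra rb > 0" using 1 2 by simp
  next
    case bound
    show ?case
    proof (rule exI[of _ "L1 + \<mu> * L2"], intro ballI conjI impI)
    fix z assume z: "z \<in> ball a (min ra rb)"
    show "z \<in> D" using z 1 by auto
    assume zx: "z \<noteq> x"
    obtain g1 where g1: "(green_kernel x has_derivative (\<lambda>v. g1 \<bullet> v)) (at z)" "norm g1 \<le> L1 + 1 / (2 * pi) * (1 / norm (z - x))"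
      using 1(3)[of z] z zx by auto
    obtain g2 where g2: "(potential \<omega> has_derivative (\<lambda>v. g2 \<bullet> v)) (at z)" "norm g2 \<le> \<mu> * L2"
      using 2(3)[OF admissibleD(1)[OF w], of z] z by auto
    have "((\<lambda>z. potential \<omega> z + green_kernel x z) has_derivative (\<lambda>v. g2 \<bullet> v + g1 \<bullet> v)) (at z)"
      by (rule has_derivative_add[OF g2(1) g1(1)])
    then have "(psi \<omega> x has_derivative (\<lambda>v. (g2 + g1) \<bullet> v)) (at z)"
      unfolding psi_def[abs_def] inner_add_left .
    moreover have "norm (g2 + g1) \<le> L1 + \<mu> * L2 + 1 / (2 * pi) * (1 / norm (z - x))"
      using norm_triangle_ineq[of g2 g1] g1 g2 by linarith
    ultimately show "\<exists>g. (psi \<omega> x has_derivative (\<lambda>v. g \<bullet> v)) (at z) \<and> norm g \<le> L1 + \<mu> * L2 + 1 / (2 * pi) * (1 / norm (z - x))" by blast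
    qed
  qed
qed

text \<open>Near \<open>x\<close> the singular part \<open>- 1/(2 pi) ln |x - z|\<close> exceeds every bound, while \<open>h\<close> stays bounded above and
the potential is nonnegative.\<close>

lemma psi_blowup:
  assumes w: "admissible \<mu> \<omega>" and x: "x \<in> D"
  shows "\<exists>\<delta>>0. ball x \<delta> \<subseteq> D \<and> (\<forall>z\<in>ball x \<delta> - {x}. psi \<omega> x z \<ge> N)"
proof -
  obtain r where r: "r > 0" "ball x r \<subseteq> D" using openD x open_contains_ball by blast
  define C where "C = 1 / (2 * pi) * - ln (r / 2)"
  define \<delta> where "\<delta> = min r (exp (- (2 * pi * (N + C))))"
  have d: "\<delta> > 0" using r by (simp add: \<delta>_def)
  have "psi \<omega> x z \<ge> N" if z: "z \<in> ball x \<delta> - {x}" for z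
  proof -
    have zD: "z \<in> D" using z r by (auto simp: \<delta>_def)
    have n: "0 < norm (x - z)" "norm (x - z) < exp (- (2 * pi * (N + C)))" using z by (auto simp: dist_norm \<delta>_def)
    have "ln (norm (x - z)) \<le> ln (exp (- (2 * pi * (N + C))))" using n by (intro ln_mono) auto
    then have "1 / (2 * pi) * ln (norm (x - z)) \<le> 1 / (2 * pi) * - (2 * pi * (N + C))" by (intro mult_left_mono) auto
    then have "1 / (2 * pi) * ln (norm (x - z)) \<le> - (N + C)" by simp
    moreover have "h x z \<le> C" unfolding C_def by (rule h_upper[OF x zD r])
    moreover have "green_kernel x z = - (1 / (2 * pi) * ln (norm (x - z))) - h x z"
    proof -
      have "x \<noteq> z" using z by auto
      then show ?thesis using green_kernel_eq[OF x zD] G_eq[OF x zD] by (simp add: ln_div)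
    qed
    ultimately show ?thesis using potential_nonneg[OF w, of z] by (simp add: psi_def)
  qed
  moreover have "ball x \<delta> \<subseteq> D" using r by (auto simp: \<delta>_def)
  ultimately show ?thesis using d by blast
qed

lemma psi_gradient_compact:
  assumes w: "admissible \<mu> \<omega>" and x: "x \<in> D" and K: "compact K" "K \<subseteq> D"
    and g: "\<And>z. z \<in> D - {x} \<Longrightarrow> (psi \<omega> x has_derivative (\<lambda>v. g z \<bullet> v)) (at z)"
  shows "\<exists>L. \<forall>z\<in>K. z \<noteq> x \<longrightarrow> norm (g z) \<le> L + 1 / (2 * pi) * (1 / norm (z - x))"
proof (rule compact_local_bound[OF K(1), where P="\<lambda>z L. z \<noteq> x \<longrightarrow> norm (g z) \<le> L + 1 / (2 * pi) * (1 / norm (z - x))"])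
  fix a assume "a \<in> K"
  then have "a \<in> D" using K by blast
  from psi_gradient_local[OF w x this] obtain r L where r: "r > 0"
    "\<And>z. z \<in> ball a r \<Longrightarrow> z \<in> D \<and> (z \<noteq> x \<longrightarrow> (\<exists>g. (psi \<omega> x has_derivative (\<lambda>v. g \<bullet> v)) (at z) \<and> norm g \<le> L + 1 / (2 * pi) * (1 / norm (z - x))))"
    by blast
  show "\<exists>r>0. \<exists>L. \<forall>z\<in>ball a r. z \<noteq> x \<longrightarrow> norm (g z) \<le> L + 1 / (2 * pi) * (1 / norm (z - x))"
  proof (rule exI[of _ r], intro conjI r(1), rule exI[of _ L], intro ballI impI)
    fix z assume z: "z \<in> ball a r" "z \<noteq> x"
    then obtain g' where g': "(psi \<omega> x has_derivative (\<lambda>v. g' \<bullet> v)) (at z)" "norm g' \<le> L + 1 / (2 * pi) * (1 / norm (z - x))" and zD: "z \<in> D"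
      using r(2)[of z] by blast
    have "g z = g'" by (rule has_derivative_gradient_unique[OF g g'(1)]) (use zD z in auto)
    then show "norm (g z) \<le> L + 1 / (2 * pi) * (1 / norm (z - x))" using g' by simp
  qed
qed auto

text \<open>With \<open>f = F(\<psi>)\<close> and \<open>F' = plateau b n\<close>, the gradient of \<open>f\<close> is \<open>F'(\<psi>) \<nabla>\<psi>\<close>. The functions \<open>f \<partial>\<^sub>i \<phi>\<close> are
differentiable on the whole plane with bounded gradients and bounded support, so
\<open>\<partial>\<^sub>2(f \<partial>\<^sub>1\<phi>) - \<partial>\<^sub>1(f \<partial>\<^sub>2\<phi>)\<close> has integral zero; the second derivatives of \<open>\<phi>\<close> cancel and what remains
is the integrand.\<close>

lemma plateau_integral_zero:
  assumes w: "admissible \<mu> \<omega>" and x: "x \<in> D" and t: "test_function_on D \<phi>" and b: "b > 0"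
    and g: "\<And>z. z \<in> D - {x} \<Longrightarrow> (psi \<omega> x has_derivative (\<lambda>v. g z \<bullet> v)) (at z)"
  shows "(LINT z|lborel. (if z \<in> D - {x} then plateau b n (psi \<omega> x z) * (rotJ (g z) \<bullet> (\<chi> k. partial (axis k 1) \<phi> z)) else 0)) = 0"
proof -
  define K where "K = closure {x. \<phi> x \<noteq> 0}"
  obtain B where K: "compact K" "K \<subseteq> D" and C2: "Ck_on 2 UNIV \<phi>" and B: "B \<ge> 0"
    and d1: "\<And>z. \<phi> differentiable (at z)" and d2: "\<And>i z. i \<in> Basis \<Longrightarrow> partial i \<phi> differentiable (at z)"
    and p0: "\<And>i z. z \<notin> K \<Longrightarrow> partial i \<phi> z = 0"
    and B1: "\<And>i z. i \<in> Basis \<Longrightarrow> \<bar>partial i \<phi> z\<bar> \<le> B" and B2: "\<And>i j z. i \<in> Basis \<Longrightarrow> j \<in> Basis \<Longrightarrow> \<bar>partial j (partial i \<phi>) z\<bar> \<le> B"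
    by (rule test_function_bounds[OF t, folded K_def]) (rule that, assumption+)
  have oK: "open (- K)" using compact_imp_closed[OF K(1)] by blast
  define N where "N = b + real (Suc (Suc n))"
  obtain L where L: "\<And>z. z \<in> K \<Longrightarrow> z \<noteq> x \<Longrightarrow> norm (g z) \<le> L + 1 / (2 * pi) * (1 / norm (z - x))"
    using psi_gradient_compact[OF w x K g] by blast
  obtain \<delta> where \<delta>: "\<delta> > 0" "ball x \<delta> \<subseteq> D" "\<And>z. z \<in> ball x \<delta> - {x} \<Longrightarrow> psi \<omega> x z \<ge> N"
    using psi_blowup[OF w x, of N] by blast
  (* Near x the stream function exceeds N, where the primitive is constant; this constant is also
     the value at x itself, so the pole disappears. *)
  define f where "f z = (if z = x then plateau_primitive b n N else plateau_primitive b n (psi \<omega> x z))" for z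
  define fg where "fg z = (if z \<in> D - {x} then plateau b n (psi \<omega> x z) *\<^sub>R g z else 0)" for z
  have fder: "(f has_derivative (\<lambda>v. fg z \<bullet> v)) (at z)" if z: "z \<in> D" for z
  proof (cases "z = x")
    case True
    have "((\<lambda>z. plateau_primitive b n N) has_derivative (\<lambda>v. fg z \<bullet> v)) (at z)" using True by (simp add: fg_def)
    then show ?thesis
    proof (rule has_derivative_transform_within_open[of _ _ _ _ "ball x \<delta>"])
      show "z \<in> ball x \<delta>" using True \<delta>(1) by simp
      fix y assume y: "y \<in> ball x \<delta>"
      show "plateau_primitive b n N = f y"
      proof (cases "y = x")
        case False
        then have "psi \<omega> x y \<ge> N" using \<delta>(3)[of y] y by blast
        then have "plateau_primitive b n (psi \<omega> x y) = plateau_primitive b n N" unfolding N_def by (rule plateau_primitive_const)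
        then show ?thesis using False by (simp add: f_def)
      qed (simp add: f_def)
    qed simp
  next
    case False
    have "((\<lambda>z. plateau_primitive b n (psi \<omega> x z)) has_derivative (\<lambda>v. plateau b n (psi \<omega> x z) * (g z \<bullet> v))) (at z)"
      using has_derivative_compose[OF g plateau_primitive_deriv[unfolded has_field_derivative_def]] z False by simp
    then have "((\<lambda>z. plateau_primitive b n (psi \<omega> x z)) has_derivative (\<lambda>v. fg z \<bullet> v)) (at z)"
      using z False by (simp add: fg_def)
    then show ?thesis
      by (rule has_derivative_transform_within_open[of _ _ _ _ "- {x}"]) (use False in \<open>auto simp: f_def\<close>)
  qed
  have fgb: "norm (fg z) \<le> 2 * (\<bar>L\<bar> + 1 / (2 * pi) * (1 / \<delta>))" if z: "z \<in> K" for z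
  proof (cases "z \<in> ball x \<delta>")
    case True
    then have "fg z = 0" using \<delta>(3)[of z] plateau_zero(2)[of b n "psi \<omega> x z"] by (auto simp: fg_def N_def)
    then show ?thesis using \<delta> by simp
  next
    case False
    then have zx: "z \<noteq> x" and nz: "norm (z - x) \<ge> \<delta>" using \<delta>(1) by (auto simp: dist_norm norm_minus_commute)
    have "norm (g z) \<le> L + 1 / (2 * pi) * (1 / norm (z - x))" by (rule L[OF z zx])
    also have "\<dots> \<le> \<bar>L\<bar> + 1 / (2 * pi) * (1 / \<delta>)"
    proof -
      have "norm (z - x) > 0" using nz \<delta>(1) by linarith
      then show ?thesis using nz \<delta>(1) by (intro add_mono mult_left_mono divide_left_mono) auto
    qed
    finally have "norm (g z) \<le> \<bar>L\<bar> + 1 / (2 * pi) * (1 / \<delta>)" .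
    then have "\<bar>plateau b n (psi \<omega> x z)\<bar> * norm (g z) \<le> 2 * (\<bar>L\<bar> + 1 / (2 * pi) * (1 / \<delta>))"
      using plateau_bound by (intro mult_mono) auto
    then show ?thesis using zx z K by (auto simp: fg_def)
  qed
  have "continuous_on K f" using fder K by (meson continuous_at_imp_continuous_on has_derivative_continuous subsetD)
  then have "bounded (f ` K)" by (intro compact_imp_bounded compact_continuous_image K)
  then obtain Bf where Bf: "\<And>z. z \<in> K \<Longrightarrow> \<bar>f z\<bar> \<le> Bf" by (auto simp: bounded_iff)
  obtain RK where RK: "\<And>z. z \<in> K \<Longrightarrow> norm z \<le> RK" using compact_imp_bounded[OF K(1)] by (auto simp: bounded_iff)
  define H where "H i z = (\<Sum>j\<in>Basis. partial j (partial i \<phi>) z *\<^sub>R j)" for i z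
  have Hder: "(partial i \<phi> has_derivative (\<lambda>v. H i z \<bullet> v)) (at z)" if "i \<in> Basis" for i z
    unfolding H_def by (rule differentiable_imp_gradient[OF d2[OF that]])
  have Hb: "norm (H i z) \<le> 2 * B" if i: "i \<in> Basis" for i z
  proof -
    have "norm (H i z) \<le> (\<Sum>j\<in>(Basis::(real^2) set). B)"
      unfolding H_def by (rule order_trans[OF norm_sum sum_mono]) (use B2[OF i] in auto)
    then show ?thesis by simp
  qed
  have H0: "H i z = 0" if "i \<in> Basis" "z \<notin> K" for i z
  proof -
    have "((\<lambda>y. 0::real) has_derivative (\<lambda>v. 0 \<bullet> v)) (at z)" by simp
    then have "(partial i \<phi> has_derivative (\<lambda>v. 0 \<bullet> v)) (at z)"
      by (rule has_derivative_transform_within_open[OF _ oK]) (use that p0 in auto)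
    from has_derivative_gradient_unique[OF Hder[OF that(1)] this] show ?thesis .
  qed
  define F where "F i z = (if z \<in> D then f z * partial i \<phi> z else 0)" for i z
  define FG where "FG i z = (if z \<in> D then partial i \<phi> z *\<^sub>R fg z + f z *\<^sub>R H i z else 0)" for i z
  have Fder: "(F i has_derivative (\<lambda>v. FG i z \<bullet> v)) (at z)" if i: "i \<in> Basis" for i z
  proof (cases "z \<in> D")
    case True
    have "((\<lambda>z. f z * partial i \<phi> z) has_derivative (\<lambda>v. f z * (H i z \<bullet> v) + fg z \<bullet> v * partial i \<phi> z)) (at z)"
      by (rule has_derivative_mult[OF fder[OF True] Hder[OF i]])
    then have "((\<lambda>z. f z * partial i \<phi> z) has_derivative (\<lambda>v. FG i z \<bullet> v)) (at z)"
      using True by (simp add: FG_def inner_add_left add.commute mult.commute)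
    then show ?thesis
      by (rule has_derivative_transform_within_open[OF _ openD True]) (simp add: F_def)
  next
    case False
    then have zK: "z \<in> - K" using K by auto
    have "((\<lambda>y. 0::real) has_derivative (\<lambda>v. FG i z \<bullet> v)) (at z)" using False by (simp add: FG_def)
    then show ?thesis
      by (rule has_derivative_transform_within_open[OF _ oK zK]) (use p0 in \<open>auto simp: F_def\<close>)
  qed
  define BB where "BB = B * (2 * (\<bar>L\<bar> + 1 / (2 * pi) * (1 / \<delta>))) + \<bar>Bf\<bar> * (2 * B)"
  have BB: "BB \<ge> 0" using B \<delta> by (simp add: BB_def)
  have FGb: "norm (FG i z) \<le> BB" if i: "i \<in> Basis" for i z
  proof (cases "z \<in> K")
    case True
    have "norm (FG i z) \<le> \<bar>partial i \<phi> z\<bar> * norm (fg z) + \<bar>f z\<bar> * norm (H i z)"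
      using True K norm_triangle_ineq[of "partial i \<phi> z *\<^sub>R fg z" "f z *\<^sub>R H i z"] by (auto simp: FG_def)
    also have "\<dots> \<le> BB" unfolding BB_def
      using B1[OF i, of z] fgb[OF True] Bf[OF True] Hb[OF i, of z] B by (intro add_mono mult_mono) auto
    finally show ?thesis .
  next
    case False
    then show ?thesis using p0 H0[OF i] BB by (simp add: FG_def)
  qed
  have F0: "F i z = 0" if "norm z > RK" for i z using p0 RK[of z] that by (auto simp: F_def)
  let ?e1 = "axis 1 1 :: real^2" and ?e2 = "axis 2 1 :: real^2"
  note I1 = integral_gradient_eq_0[OF Fder[OF axis_in_Basis_real2(1)] FGb[OF axis_in_Basis_real2(1)] F0, where i="?e2"]
  note I2 = integral_gradient_eq_0[OF Fder[OF axis_in_Basis_real2(2)] FGb[OF axis_in_Basis_real2(2)] F0, where i="?e1"]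
  have "(LINT z|lborel. FG ?e1 z \<bullet> ?e2 - FG ?e2 z \<bullet> ?e1) = 0"
    using I1 I2 by simp
  moreover have "FG ?e1 z \<bullet> ?e2 - FG ?e2 z \<bullet> ?e1 = (if z \<in> D - {x} then plateau b n (psi \<omega> x z) * (rotJ (g z) \<bullet> (\<chi> k. partial (axis k 1) \<phi> z)) else 0)" for z
  proof (cases "z \<in> D")
    case True
    have "H ?e1 z \<bullet> ?e2 = partial ?e2 (partial ?e1 \<phi>) z" "H ?e2 z \<bullet> ?e1 = partial ?e1 (partial ?e2 \<phi>) z"
      unfolding H_def by (simp_all add: sum_Basis_real2 inner_add_left inner_axis_axis)
    then have "H ?e1 z \<bullet> ?e2 = H ?e2 z \<bullet> ?e1" using partial_commute[OF C2 axis_in_Basis_real2, of z] by simp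
    then have "FG ?e1 z \<bullet> ?e2 - FG ?e2 z \<bullet> ?e1 = partial ?e1 \<phi> z * (fg z \<bullet> ?e2) - partial ?e2 \<phi> z * (fg z \<bullet> ?e1)"
      using True by (simp add: FG_def inner_add_left)
    also have "\<dots> = (if z \<in> D - {x} then plateau b n (psi \<omega> x z) * (rotJ (g z) \<bullet> (\<chi> k. partial (axis k 1) \<phi> z)) else 0)"
      by (simp add: fg_def rotJ_inner inner_axis_1 algebra_simps)
    finally show ?thesis .
  qed (simp add: FG_def)
  ultimately show ?thesis by simp
qed


text \<open>The limit \<open>n \<rightarrow> \<infinity>\<close> of the preceding identity. On the support of \<open>\<phi>\<close> the gradient of the stream function is
bounded by a constant plus \<open>1/(2 pi |z - x|)\<close>, which is integrable.\<close>

lemma weak_equation: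
  assumes w: "admissible \<mu> \<omega>" and x: "x \<in> D" and t: "test_function_on D \<phi>" and b: "b > 0"
    and g: "\<And>z. z \<in> D - {x} \<Longrightarrow> (psi \<omega> x has_derivative (\<lambda>v. g z \<bullet> v)) (at z)"
  shows "integrable lborel (\<lambda>z. if z \<in> D - {x} \<and> psi \<omega> x z > b then rotJ (g z) \<bullet> (\<chi> k. partial (axis k 1) \<phi> z) else 0)" (is "integrable lborel ?I")
    and "(LINT z|lborel. (if z \<in> D - {x} \<and> psi \<omega> x z > b then rotJ (g z) \<bullet> (\<chi> k. partial (axis k 1) \<phi> z) else 0)) = 0"
proof -
  note [measurable] = admissibleD(2)[OF w]
  define K where "K = closure {x. \<phi> x \<noteq> 0}"
  obtain B where K: "compact K" "K \<subseteq> D" and C2: "Ck_on 2 UNIV \<phi>" and B: "B \<ge> 0"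
    and d1: "\<And>z. \<phi> differentiable (at z)" and d2: "\<And>i z. i \<in> Basis \<Longrightarrow> partial i \<phi> differentiable (at z)"
    and p0: "\<And>i z. z \<notin> K \<Longrightarrow> partial i \<phi> z = 0"
    and B1: "\<And>i z. i \<in> Basis \<Longrightarrow> \<bar>partial i \<phi> z\<bar> \<le> B" and B2: "\<And>i j z. i \<in> Basis \<Longrightarrow> j \<in> Basis \<Longrightarrow> \<bar>partial j (partial i \<phi>) z\<bar> \<le> B"
    by (rule test_function_bounds[OF t, folded K_def]) (rule that, assumption+)
  obtain L where L: "\<And>z. z \<in> K \<Longrightarrow> z \<noteq> x \<Longrightarrow> norm (g z) \<le> L + 1 / (2 * pi) * (1 / norm (z - x))"
    using psi_gradient_compact[OF w x K g] by blast
  let ?q = "\<lambda>z. \<chi> k. partial (axis k 1) \<phi> z"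
  define J where "J n z = (if z \<in> D - {x} then plateau b n (psi \<omega> x z) * (rotJ (g z) \<bullet> ?q z) else 0)" for n z
  have pm [measurable]: "partial i \<phi> \<in> borel_measurable borel" if "i \<in> Basis" for i
  proof (rule borel_measurable_continuous_onI)
    show "continuous_on UNIV (partial i \<phi>)"
      using d2[OF that] by (meson differentiable_imp_continuous_within continuous_at_imp_continuous_on)
  qed
  define U where "U = D - {x}"
  have oU: "open U" unfolding U_def using openD by (simp add: open_delete)
  have [measurable]: "U \<in> sets borel" using oU by auto
  have gm: "(\<lambda>z. indicator U z * (g z \<bullet> i)) \<in> borel_measurable borel" for i
  proof -
    define h where "h n = inverse (real (Suc n))" for n
    have h: "h n > 0" "h \<longlonglongrightarrow> 0" for n unfolding h_def using LIMSEQ_inverse_real_of_nat by auto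
    show ?thesis
    proof (rule borel_measurable_LIMSEQ_real)
      show "(\<lambda>z. indicator U z * ((psi \<omega> x (z + h n *\<^sub>R i) - psi \<omega> x z) / h n)) \<in> borel_measurable borel" for n by measurable
      fix z :: "real^2"
      show "(\<lambda>n. indicator U z * ((psi \<omega> x (z + h n *\<^sub>R i) - psi \<omega> x z) / h n)) \<longlonglongrightarrow> indicator U z * (g z \<bullet> i)"
      proof (cases "z \<in> U")
        case True
        have "(\<lambda>n. (psi \<omega> x (z + h n *\<^sub>R i) - psi \<omega> x z) / h n) \<longlonglongrightarrow> g z \<bullet> i"
          by (rule gradient_difference_quotient_tendsto[OF g h(2,1)]) (use True in \<open>simp add: U_def\<close>)
        then show ?thesis using True by simp
      qed simp
    qed
  qed
  define T where "T z = (indicator U z * (g z \<bullet> axis 2 1)) * partial (axis 1 1) \<phi> z - (indicator U z * (g z \<bullet> axis 1 1)) * partial (axis 2 1) \<phi> z" for z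
  have Tm [measurable]: "T \<in> borel_measurable borel"
    unfolding T_def using gm pm[OF axis_in_Basis_real2(1)] pm[OF axis_in_Basis_real2(2)] by measurable
  have TU: "T z = (if z \<in> U then rotJ (g z) \<bullet> ?q z else 0)" for z
    by (simp add: T_def rotJ_inner inner_axis_1)
  have J_eq: "J n z = plateau b n (psi \<omega> x z) * T z" for n z by (simp add: J_def TU U_def)
  have I_eq: "?I z = (if psi \<omega> x z > b then 1 else 0) * T z" for z by (simp add: TU U_def)
  have platm [measurable]: "plateau b n \<in> borel_measurable borel" for n unfolding plateau_def[abs_def] by measurable
  obtain RK where RK: "\<And>z. z \<in> K \<Longrightarrow> norm z \<le> RK" using compact_imp_bounded[OF K(1)] by (auto simp: bounded_iff)
  define R where "R = \<bar>RK\<bar> + norm x"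
  define W where "W z = (2 * (2 * B)) * (indicator (cball x R) z * \<bar>L\<bar> + 1 / (2 * pi) * (indicator (cball 0 R) (z - x) * (1 / norm (z - x))))" for z
  have Wint: "integrable lborel W"
  proof -
    have "integrable lborel (\<lambda>w::real^2. indicator (cball 0 R) w * (1 / norm w))" using integrable_inverse_norm_ball[of R] by simp
    then have "integrable lborel (\<lambda>z. indicator (cball 0 R) (- x + 1 *\<^sub>R z) * (1 / norm (- x + 1 *\<^sub>R z)))"
      by (subst integrable_lborel_affine_iff) auto
    then have "integrable lborel (\<lambda>z. indicator (cball 0 R) (z - x) * (1 / norm (z - x)))" by simp
    then show ?thesis unfolding W_def
      by (intro integrable_mult_right Bochner_Integration.integrable_add integrable_indicator_bounded)
  qed
  have nq: "norm (?q z) \<le> 2 * B" for z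
  proof -
    have "norm (?q z) \<le> (\<Sum>k\<in>UNIV. \<bar>?q z $ k\<bar>)" by (rule norm_le_l1_cart)
    also have "\<dots> \<le> (\<Sum>k\<in>(UNIV :: 2 set). B)" using B1 axis_in_Basis_real2 by (intro sum_mono) (auto simp: Basis_vec_def)
    finally show ?thesis by simp
  qed
  have TW: "2 * \<bar>T z\<bar> \<le> W z" for z
  proof (cases "z \<in> K \<and> z \<noteq> x")
    case True
    have "\<bar>T z\<bar> \<le> norm (g z) * norm (?q z)" unfolding TU using rotJ_norm[of "g z" "?q z"] by auto
    also have "\<dots> \<le> (\<bar>L\<bar> + 1 / (2 * pi) * (1 / norm (z - x))) * (2 * B)"
    proof (intro mult_mono nq)
      show "norm (g z) \<le> \<bar>L\<bar> + 1 / (2 * pi) * (1 / norm (z - x))" using L[of z] True by linarith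
    qed auto
    finally have "\<bar>T z\<bar> \<le> (\<bar>L\<bar> + 1 / (2 * pi) * (1 / norm (z - x))) * (2 * B)" .
    moreover have "norm (z - x) \<le> R" using norm_triangle_ineq4[of z x] RK[of z] True unfolding R_def by linarith
    then have "W z = (2 * (2 * B)) * (\<bar>L\<bar> + 1 / (2 * pi) * (1 / norm (z - x)))"
      by (simp add: W_def dist_norm norm_minus_commute)
    moreover have "2 * a \<le> c" if "a \<le> X * (2 * B)" "c = (2 * (2 * B)) * X" for a c X :: real
      using that by (simp add: algebra_simps)
    ultimately show ?thesis by blast
  next
    case False
    then have "T z = 0" using p0[of z] by (auto simp: T_def U_def)
    then show ?thesis using B by (simp add: W_def)
  qed
  have Jb: "AE z in lborel. norm (J n z) \<le> W z" for n
  proof (rule AE_I2)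
    fix z
    have "\<bar>plateau b n (psi \<omega> x z)\<bar> * \<bar>T z\<bar> \<le> 2 * \<bar>T z\<bar>" by (intro mult_right_mono plateau_bound) simp
    then show "norm (J n z) \<le> W z" using TW[of z] by (simp add: J_eq abs_mult)
  qed
  have Jl: "AE z in lborel. (\<lambda>n. J n z) \<longlonglongrightarrow> ?I z"
    unfolding J_eq I_eq by (intro AE_I2 tendsto_intros plateau_tendsto)
  have Jm: "J n \<in> borel_measurable lborel" for n unfolding J_eq[abs_def] by measurable
  have Im: "?I \<in> borel_measurable lborel" unfolding I_eq by measurable
  show "integrable lborel ?I" by (rule integrable_dominated_convergence[OF Im Jm Wint Jl Jb])
  have "(\<lambda>n. LINT z|lborel. J n z) \<longlonglongrightarrow> (LINT z|lborel. ?I z)"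
    by (rule integral_dominated_convergence[OF Im Jm Wint Jl Jb])
  moreover have "(LINT z|lborel. J n z) = 0" for n
    unfolding J_def by (rule plateau_integral_zero[OF w x t b g])
  ultimately show "(LINT z|lborel. ?I z) = 0" by (simp add: LIMSEQ_const_iff)
qed

lemma green_potential_eq:
  assumes w: "domain_density M \<omega>" and z: "z \<in> D"
  shows "green_potential D G \<omega> z = potential \<omega> z"
proof -
  note [measurable] = domain_densityD(2)[OF w]
  define F where "F y = (if y = z then G z z * \<omega> z else green_kernel z y * \<omega> y)" for y
  have Fm: "F \<in> borel_measurable lborel" unfolding F_def by measurable
  have e: "indicator D y *\<^sub>R (G z y * \<omega> y) = F y" for y
  proof (cases "y \<in> D")
    case True
    then show ?thesis using green_kernel_eq[OF z, of y] by (cases "y = z") (auto simp: F_def)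
  next
    case False
    then show ?thesis using z domain_densityD(4)[OF w, of y] by (auto simp: F_def)
  qed
  have "green_potential D G \<omega> z = integral\<^sup>L lebesgue F"
    unfolding green_potential_def set_lebesgue_integral_def e ..
  also have "\<dots> = integral\<^sup>L lborel F" using Fm by (rule integral_completion)
  also have "\<dots> = potential \<omega> z" unfolding potential_def
  proof (rule integral_cong_AE[OF Fm])
    show "AE y in lborel. F y = green_kernel z y * \<omega> y"
      using AE_neq_point[of z] by (rule eventually_mono) (simp add: F_def)
  qed measurable
  finally show ?thesis .
qed

end

lemma AE_lborel_imp_lebesgue_on:
  assumes "AE y in lborel. P y" and "D \<in> sets lebesgue"
  shows "AE y in lebesgue_on D. P y"
proof -
  have "AE y in lebesgue. P y" using assms(1) by (rule AE_completion)
  then show ?thesis using assms(2) by (subst AE_restrict_space_iff) auto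
qed

theorem theorem2p2:
  fixes D :: "(real^2) set"
    and G h :: "real^2 \<Rightarrow> real^2 \<Rightarrow> real"
    and \<mu> :: real
  assumes "smooth_simply_connected_domain D"
    and "greens_function D G h"
    and "\<mu> > 1 / measure lebesgue D"
  shows "\<exists>\<omega>\<in>vortex_patches D \<mu>. \<exists>x\<in>D.
           weak_vortex_wave_solution D G h \<omega> x \<and>
           (\<exists>b>0. AE y in lebesgue_on D.
              \<omega> y = \<mu> * indicator {z\<in>D. green_potential D G \<omega> z + G x z > b} y)"
proof -
  have D: "open D" "bounded D" "D \<noteq> {}" "simply_connected D"
    using assms(1) by (auto simp: smooth_simply_connected_domain_def)
  obtain f where f: "f holomorphic_on cplx ` D" "inj_on f (cplx ` D)" "\<forall>z\<in>cplx ` D. cmod (f z) < 1"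
    "\<forall>z\<in>frontier D. ((\<lambda>y. cmod (f (cplx y))) \<longlongrightarrow> 1) (at z within D)"
    using Riemann_map_exists[OF D] by blast
  interpret green_domain D G h f
    by unfold_locales (use D assms(2) f in auto)
  have Dm [measurable]: "D \<in> sets borel" using D by auto
  have Dl: "D \<in> sets lebesgue" using Dm by simp
  have area: "areaD = measure lebesgue D" unfolding areaD_def using emeasure_bounded_finite[OF D(2)] by simp
  have area_pos: "areaD > 0"
  proof -
    have "\<not> negligible D" using D open_not_negligible by blast
    then have "measure lebesgue D \<noteq> 0" using negligible_iff_measure[of D] lmeasurable_open[OF D(2,1)] by auto
    then show ?thesis unfolding area using measure_nonneg[of lebesgue D] by linarith
  qed
  have mu: "\<mu> > 1 / areaD" using assms(3) area by simp
  obtain \<omega> x b where w: "admissible \<mu> \<omega>" and x: "x \<in> D" and b: "b > 0"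
    and form: "AE y in lborel. \<omega> y = \<mu> * indicator {z\<in>D. psi \<omega> x z > b} y"
    and max: "\<And>z. z \<in> D \<Longrightarrow> potential \<omega> z - kirchhoff_routh h z \<le> potential \<omega> x - kirchhoff_routh h x"
    by (rule optimal_patch[OF mu area_pos]) (rule that, assumption+)
  note [measurable] = admissibleD(2)[OF w]
  define A where "A = {z\<in>D. psi \<omega> x z > b}"
  have Ab [measurable]: "A \<in> sets borel" unfolding A_def by measurable
  have gp: "green_potential D G \<omega> z = potential \<omega> z" if "z \<in> D" for z by (rule green_potential_eq[OF admissibleD(1)[OF w] that])
  have st: "stream D G \<omega> x z = psi \<omega> x z" if "z \<in> D - {x}" for z
    using that gp[of z] green_kernel_eq[OF x, of z] by (auto simp: stream_def psi_def)
  have patch: "\<omega> \<in> vortex_patches D \<mu>"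
  proof -
    have "\<omega> \<in> borel_measurable (lebesgue_on D)"
      by (intro measurable_restrict_space1 measurable_completion) simp
    moreover have "\<bar>\<omega> y\<bar> \<le> \<mu>" for y
      using admissibleD(3)[OF w, of y] admissibleD(4)[OF w, of y] by simp
    ultimately have "\<omega> \<in> Linfty D" unfolding Linfty_def by blast
    moreover have "\<mu> * measure lebesgue A = 1"
    proof -
      have "emeasure lborel A < \<infinity>" by (rule emeasure_bounded_finite, rule bounded_subset[OF D(2)]) (auto simp: A_def)
      then have "(LINT y|lborel. \<mu> * indicator A y) = \<mu> * measure lebesgue A" by simp
      moreover have "(LINT y|lborel. \<omega> y) = (LINT y|lborel. \<mu> * indicator A y)"
        by (rule integral_cong_AE) (measurable, rule form[folded A_def])
      ultimately show ?thesis using admissibleD(7)[OF w] by simp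
    qed
    moreover have "AE y in lebesgue_on D. \<omega> y = \<mu> * indicator A y"
      using AE_lborel_imp_lebesgue_on[OF form Dl] unfolding A_def .
    moreover have "A \<in> sets lebesgue" "A \<subseteq> D" using Ab by (auto simp: A_def)
    ultimately show ?thesis unfolding vortex_patches_def by blast
  qed
  have form': "AE y in lebesgue_on D. \<omega> y = \<mu> * indicator {z\<in>D. green_potential D G \<omega> z + G x z > b} y"
  proof (rule AE_lborel_imp_lebesgue_on[OF _ Dl])
    show "AE y in lborel. \<omega> y = \<mu> * indicator {z\<in>D. green_potential D G \<omega> z + G x z > b} y"
      using form AE_neq_point[of x]
    proof eventually_elim
      case (elim y)
      show ?case
      proof (cases "y \<in> D")
        case True
        then have "green_potential D G \<omega> y + G x y = psi \<omega> x y" using st[of y] elim by (simp add: stream_def)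
        then show ?thesis using elim True by (simp add: indicator_def)
      qed (use elim in simp)
    qed
  qed
  have ex: "\<exists>g. (psi \<omega> x has_derivative (\<lambda>v. g \<bullet> v)) (at z)" if z: "z \<in> D - {x}" for z
  proof -
    have "z \<in> D" "z \<noteq> x" using z by auto
    then obtain r where "r > 0" "\<forall>y\<in>ball z r. y \<in> D \<and> (y \<noteq> x \<longrightarrow> (\<exists>g. (psi \<omega> x has_derivative (\<lambda>v. g \<bullet> v)) (at y)))"
      using psi_gradient_local[OF w x \<open>z \<in> D\<close>] by blast
    then show ?thesis using \<open>z \<noteq> x\<close> by (metis centre_in_ball)
  qed
  then obtain g where g: "\<And>z. z \<in> D - {x} \<Longrightarrow> (psi \<omega> x has_derivative (\<lambda>v. g z \<bullet> v)) (at z)" by metis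
  have oDx: "open (D - {x})" using D by (simp add: open_delete)
  have sg: "(stream D G \<omega> x has_derivative (\<lambda>v. g z \<bullet> v)) (at z)" if z: "z \<in> D - {x}" for z
    by (rule has_derivative_transform_within_open[OF g[OF z] oDx z]) (simp add: st)
  have weak: "set_integrable lebesgue D (\<lambda>y. \<omega> y * (rotJ (grad (stream D G \<omega> x) y) \<bullet> grad \<phi> y)) \<and>
     (LINT y:D|lebesgue. \<omega> y * (rotJ (grad (stream D G \<omega> x) y) \<bullet> grad \<phi> y)) = 0" if t: "test_function_on D \<phi>" for \<phi>
  proof -
    define I where "I z = (if z \<in> D - {x} \<and> psi \<omega> x z > b then rotJ (g z) \<bullet> (\<chi> k. partial (axis k 1) \<phi> z) else 0)" for z
    have I: "integrable lborel I" "(LINT z|lborel. I z) = 0"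
      unfolding I_def using weak_equation[OF w x t b g] by auto
    have gphi: "grad \<phi> z = (\<chi> k. partial (axis k 1) \<phi> z)" for z
    proof (rule grad_eqI)
      have d: "\<phi> differentiable (at z)" using t by (auto simp: test_function_on_def smooth_on_def dest: spec[of _ "Suc 0"])
      have "(\<Sum>j\<in>Basis. partial j \<phi> z *\<^sub>R j) = (\<chi> k. partial (axis k 1) \<phi> z)"
        by (simp add: sum_Basis_real2 vec_eq_iff forall_2 axis_def)
      then show "(\<phi> has_derivative (\<lambda>v. (\<chi> k. partial (axis k 1) \<phi> z) \<bullet> v)) (at z)"
        using differentiable_imp_gradient[OF d] by simp
    qed
    let ?S = "\<lambda>y. indicator D y *\<^sub>R (\<omega> y * (rotJ (grad (stream D G \<omega> x) y) \<bullet> grad \<phi> y))"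
    have Il: "integrable lebesgue (\<lambda>z. \<mu> * I z)" "integral\<^sup>L lebesgue (\<lambda>z. \<mu> * I z) = 0"
    proof -
      have m: "(\<lambda>z. \<mu> * I z) \<in> borel_measurable lborel" using I(1) by auto
      show "integrable lebesgue (\<lambda>z. \<mu> * I z)" using integrable_completion[OF m] I(1) by simp
      show "integral\<^sup>L lebesgue (\<lambda>z. \<mu> * I z) = 0" using integral_completion[OF m] I(2) by simp
    qed
    have "AE y in lborel. ?S y = \<mu> * I y"
      using form AE_neq_point[of x]
    proof eventually_elim
      case (elim y)
      show ?case
      proof (cases "y \<in> D")
        case True
        then have "grad (stream D G \<omega> x) y = g y" using elim by (intro grad_eqI sg) simp
        then show ?thesis using True elim by (simp add: I_def gphi indicator_def)
      qed (simp add: I_def)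
    qed
    then have ae: "AE y in lebesgue. \<mu> * I y = ?S y" by (intro AE_completion) (auto elim: eventually_mono)
    have Sm: "?S \<in> borel_measurable lebesgue"
      by (rule borel_measurable_AE[OF borel_measurable_integrable[OF Il(1)] ae])
    have "integrable lebesgue ?S" by (rule integrable_cong_AE_imp[OF Il(1) Sm ae])
    moreover have "integral\<^sup>L lebesgue ?S = integral\<^sup>L lebesgue (\<lambda>z. \<mu> * I z)"
      by (rule integral_cong_AE[OF Sm borel_measurable_integrable[OF Il(1)]]) (use ae in \<open>auto elim: eventually_mono\<close>)
    ultimately show ?thesis using Il(2) by (simp add: set_integrable_def set_lebesgue_integral_def)
  qed
  obtain gx where gx: "(potential \<omega> has_derivative (\<lambda>v. gx \<bullet> v)) (at x)"
    using potential_has_derivative[OF x] admissibleD(1)[OF w] by (metis centre_in_ball)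
  have gpx: "(green_potential D G \<omega> has_derivative (\<lambda>v. gx \<bullet> v)) (at x)"
    by (rule has_derivative_transform_within_open[OF gx D(1) x]) (simp add: gp)
  define kx where "kx = (\<Sum>j\<in>Basis. partial j (kirchhoff_routh h) x *\<^sub>R j)"
  have kx: "(kirchhoff_routh h has_derivative (\<lambda>v. kx \<bullet> v)) (at x)"
    unfolding kx_def by (rule differentiable_imp_gradient[OF kirchhoff_differentiable[OF x]])
  have "gx - kx = 0"
  proof -
    have "((\<lambda>z. potential \<omega> z - kirchhoff_routh h z) has_derivative (\<lambda>v. (gx - kx) \<bullet> v)) (at x)"
      using has_derivative_diff[OF gx kx] by (simp add: inner_diff_left)
    then have "(\<lambda>v. (gx - kx) \<bullet> v) = (\<lambda>v. 0)"
      by (rule differential_zero_maxmin[OF x D(1)]) (use max in auto)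
    then have "(gx - kx) \<bullet> (gx - kx) = 0" by meson
    then show ?thesis by simp
  qed
  then have stat: "grad (green_potential D G \<omega>) x - grad (kirchhoff_routh h) x = 0"
    using grad_eqI[OF gpx] grad_eqI[OF kx] by simp
  have "weak_vortex_wave_solution D G h \<omega> x"
    unfolding weak_vortex_wave_solution_def
    using sg weak gpx kirchhoff_differentiable[OF x] stat by (auto simp: differentiable_def)
  then show ?thesis using patch x form' b by blast
qed

end
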